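(* Let $\tfrac12<s<1$. For every $\varepsilon>0$ there is a constant $C>0$ (depending only on $s$ and $\varepsilon$) such that the following holds for all $\lambda\ge1$ and all dyadic $N\ge1$. Let $u$ solve $iu_t+\Delta_{\mathbb{R}\times\mathbb{T}_\lambda}u=|u|^2u$ on $\mathbb{R}\times\mathbb{T}_\lambda$ with $u(0)=u_0$, where $\|u_0\|_{L^2(\mathbb{R}\times\mathbb{T}_\lambda)}\le1$ and $E(Iu_0)\le1$, and suppose that $Iu\in C([0,\delta],H^1(\mathbb{R}\times\mathbb{T}_\lambda))$ solves $i\partial_t(Iu)+\Delta_{\mathbb{R}\times\mathbb{T}_\lambda}Iu=I(|u|^2u)$, $Iu(0)=Iu_0$, on a time interval $[0,\delta]$ of local well-posedness. Then for every $t\in[0,\delta]$, $$|E_0(u(t))-E(Iu(t))|\le C\,N^{-1+\varepsilon}\,\|Iu(t)\|_{H^1(\mathbb{R}\times\mathbb{T}_\lambda)}^4 .$$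
   Context: For $\lambda\ge1$: $\mathbb{T}_\lambda=\mathbb{R}/2\pi\lambda\mathbb{Z}$, $\mathbb{Z}_{1/\lambda}=\frac1\lambda\mathbb{Z}$, $\int_{\mathbb{R}\times\mathbb{Z}_{1/\lambda}}f(\xi)(d\xi)_\lambda:=\frac1\lambda\sum_{\eta\in\mathbb{Z}_{1/\lambda}}\int_{\mathbb{R}}f(\mu,\eta)d\mu$, and $\widehat f(\xi)=\frac1{2\pi}\int_{\mathbb{R}\times\mathbb{T}_\lambda}f(z)e^{-iz\cdot\xi}dz$. I-operator: $\widehat{Iu}(\xi)=m(\xi)\widehat u(\xi)$, where $m$ is a fixed smooth radial non-increasing (in $|\xi|$) function with $m(\xi)=1$ for $|\xi|\le N$ and $m(\xi)=(N/|\xi|)^{1-s}$ for $|\xi|\ge2N$ (with the usual symbol bounds, $m(\xi)=m_1(\xi/N)$ for a fixed $m_1$). Energy: $E(v)=\int_{\mathbb{R}\times\mathbb{T}_\lambda}\big(\frac12|\nabla v|^2+\frac14|v|^4\big)dz$. Hyperplanes: $\Sigma_k=\{(\xi_1,\dots,\xi_k)\in(\mathbb{R}\times\mathbb{Z}_{1/\lambda})^k:\xi_1+\dots+\xi_k=0\}$ with the measure obtained by pushing forward $(d\xi_1)_\lambda\cdots(d\xi_{k-1})_\lambda$ under $(\xi_1,\dots,\xi_{k-1})\mapsto(\xi_1,\dots,\xi_{k-1},-\xi_1-\dots-\xi_{k-1})$. Write $\xi_{ij}=\xi_i+\xi_j$. Set $S$: for dyadic $N_1,\dots,N_4\in2^{\mathbb{N}}$,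 $S(N_1,N_2,N_3,N_4)$ is the set of $(\xi_1,\dots,\xi_4)\in\Sigma_4$ with $|\xi_j|\sim N_j$ (with $|\xi_j|\lesssim1$ when $N_j=1$) such that either $|\cos\angle(\xi_{12},\xi_{14})|\ge\max\{N_1,N_2,N_3,N_4\}^{-1}$ or $\max_j|\xi_j|\ll N$ (i.e. $\le cN$ for a fixed small constant $c>0$); $S$ is the union of these sets over all dyadic $N_1,\dots,N_4$. Multiplier: $$\Lambda_4(\xi_1,\xi_2,\xi_3,\xi_4)=\frac{m(\xi_1)^2|\xi_1|^2-m(\xi_2)^2|\xi_2|^2+m(\xi_3)^2|\xi_3|^2-m(\xi_4)^2|\xi_4|^2}{|\xi_1|^2-|\xi_2|^2+|\xi_3|^2-|\xi_4|^2}\,1_S(\xi_1,\xi_2,\xi_3,\xi_4),$$ where the quotient is understood as $1$ when all $|\xi_j|\le N$ (measure-zero sets where quantities are undefined are ignored). Modified energy: $$E_0(u)=\frac12\int_{\Sigma_2}|\xi_1||\xi_2|m(\xi_1)m(\xi_2)\widehat u(\xi_1)\widehat{\overline u}(\xi_2)+\frac1{4(2\pi)^2}\int_{\Sigma_4}\Lambda_4(\xi_1,\xi_2,\xi_3,\xi_4)\widehat u(\xi_1)\widehat{\overline u}(\xi_2)\widehat u(\xi_3)\widehat{\overline u}(\xi_4).$$ *)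

theory Defs
  imports "HOL-Analysis.Analysis"
begin

section \<open>Physical space\<close>

text \<open>
  A function on \<open>\<real> \<times> \<real>/2\<pi>\<lambda>\<int>\<close> (with \<open>\<lambda>\<close> written \<open>lam\<close>) is a function on
  \<open>\<real> \<times> \<real>\<close> that is \<open>2\<pi>\<lambda>\<close>-periodic in its second argument; it is integrated over one period.
\<close>

definition periodic :: "real \<Rightarrow> (real \<times> real \<Rightarrow> 'b) \<Rightarrow> bool" where
  "periodic lam f \<longleftrightarrow> (\<forall>x y. f (x, y + 2 * pi * lam) = f (x, y))"

definition dz :: "real \<Rightarrow> (real \<times> real) measure" where
  "dz lam = restrict_space lborel (UNIV \<times> {0..<2 * pi * lam})"

definition sq_integrable :: "'a measure \<Rightarrow> ('a \<Rightarrow> complex) \<Rightarrow> bool" where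
  "sq_integrable M f \<longleftrightarrow> f \<in> borel_measurable M \<and> integrable M (\<lambda>x. (cmod (f x))\<^sup>2)"

definition L2_norm :: "'a measure \<Rightarrow> ('a \<Rightarrow> complex) \<Rightarrow> real" where
  "L2_norm M f = sqrt (\<integral>x. (cmod (f x))\<^sup>2 \<partial>M)"

definition L2 :: "real \<Rightarrow> (real \<times> real \<Rightarrow> complex) \<Rightarrow> bool" where
  "L2 lam f \<longleftrightarrow> periodic lam f \<and> f \<in> borel_measurable borel \<and> sq_integrable (dz lam) f"


section \<open>Frequency space\<close>

definition frequencies :: "real \<Rightarrow> (real \<times> real) set" where
  "frequencies lam = UNIV \<times> range (\<lambda>k::int. of_int k / lam)"

text \<open>
  The measure \<open>(d\<xi>)\<^sub>\<lambda>\<close>, as a Borel measure on \<open>\<real> \<times> \<real>\<close> carried by \<open>frequencies lam\<close>.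
\<close>

definition dxi :: "real \<Rightarrow> (real \<times> real) measure" where
  "dxi lam = lborel \<Otimes>\<^sub>M
     scale_measure (ennreal (1 / lam)) (distr (count_space UNIV) borel (\<lambda>k::int. of_int k / lam))"

definition Sigma2_measure :: "real \<Rightarrow> ((real \<times> real) \<times> (real \<times> real)) measure" where
  "Sigma2_measure lam = distr (dxi lam) borel (\<lambda>\<xi>. (\<xi>, - \<xi>))"

definition Sigma4 ::
  "real \<Rightarrow> ((real \<times> real) \<times> (real \<times> real) \<times> (real \<times> real) \<times> (real \<times> real)) set" where
  "Sigma4 lam = {(\<xi>\<^sub>1, \<xi>\<^sub>2, \<xi>\<^sub>3, \<xi>\<^sub>4). \<xi>\<^sub>1 \<in> frequencies lam \<and> \<xi>\<^sub>2 \<in> frequencies lam \<and>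
     \<xi>\<^sub>3 \<in> frequencies lam \<and> \<xi>\<^sub>4 \<in> frequencies lam \<and> \<xi>\<^sub>1 + \<xi>\<^sub>2 + \<xi>\<^sub>3 + \<xi>\<^sub>4 = 0}"

definition Sigma4_measure ::
  "real \<Rightarrow> ((real \<times> real) \<times> (real \<times> real) \<times> (real \<times> real) \<times> (real \<times> real)) measure" where
  "Sigma4_measure lam = distr (dxi lam \<Otimes>\<^sub>M dxi lam \<Otimes>\<^sub>M dxi lam) borel
     (\<lambda>(\<xi>\<^sub>1, \<xi>\<^sub>2, \<xi>\<^sub>3). (\<xi>\<^sub>1, \<xi>\<^sub>2, \<xi>\<^sub>3, - \<xi>\<^sub>1 - \<xi>\<^sub>2 - \<xi>\<^sub>3))"


section \<open>Fourier transform, multipliers and Sobolev norm\<close>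

definition fourier_integral ::
  "real \<Rightarrow> (real \<times> real \<Rightarrow> complex) \<Rightarrow> real \<times> real \<Rightarrow> complex" where
  "fourier_integral lam f \<xi> =
     complex_of_real (1 / (2 * pi)) * (\<integral>z. f z * exp (- \<i> * complex_of_real (z \<bullet> \<xi>)) \<partial>dz lam)"

text \<open>
  The integral formula for integrable functions, and otherwise its extension to square-integrable
  functions: the limit in \<open>L\<^sup>2((d\<xi>)\<^sub>\<lambda>)\<close> of the transforms of the truncations \<open>f 1\<^bsub>|x| \<le> n\<^esub>\<close>,
  which is determined up to a null set. On \<open>L\<^sup>1 \<inter> L\<^sup>2\<close> the two agree almost everywhere.
\<close>

definition fourier :: "real \<Rightarrow> (real \<times> real \<Rightarrow> complex) \<Rightarrow> real \<times> real \<Rightarrow> complex" where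
  "fourier lam f =
     (if integrable (dz lam) f then fourier_integral lam f
      else (SOME g. sq_integrable (dxi lam) g \<and>
        (\<lambda>n::nat. L2_norm (dxi lam)
           (\<lambda>\<xi>. fourier_integral lam (\<lambda>z. if \<bar>fst z\<bar> \<le> real n then f z else 0) \<xi> - g \<xi>))
        \<longlonglongrightarrow> 0))"

text \<open>
  The multiplier with symbol \<open>a\<close>. The result is required to be square-integrable, whereas \<open>f\<close> may also
  be merely integrable; this is needed for \<open>I(|u|\<^sup>2u)\<close>, because \<open>|u|\<^sup>2u\<close> need not be in \<open>L\<^sup>2\<close>
  when \<open>u \<in> H\<^sup>s\<close>, but is in \<open>L\<^sup>1\<close>.
\<close>

definition multiplier ::
  "real \<Rightarrow> (real \<times> real \<Rightarrow> complex) \<Rightarrow> (real \<times> real \<Rightarrow> complex) \<Rightarrow> real \<times> real \<Rightarrow> complex" where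
  "multiplier lam a f =
     (SOME g. L2 lam g \<and> (AE \<xi> in dxi lam. fourier lam g \<xi> = a \<xi> * fourier lam f \<xi>))"

definition H1 :: "real \<Rightarrow> (real \<times> real \<Rightarrow> complex) \<Rightarrow> bool" where
  "H1 lam f \<longleftrightarrow> L2 lam f \<and> integrable (dxi lam) (\<lambda>\<xi>. (1 + (norm \<xi>)\<^sup>2) * (cmod (fourier lam f \<xi>))\<^sup>2)"

definition H1_norm :: "real \<Rightarrow> (real \<times> real \<Rightarrow> complex) \<Rightarrow> real" where
  "H1_norm lam f = sqrt (\<integral>\<xi>. (1 + (norm \<xi>)\<^sup>2) * (cmod (fourier lam f \<xi>))\<^sup>2 \<partial>dxi lam)"

text \<open>The partial derivative in direction \<open>e\<close>, in the Sobolev sense.\<close>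

definition sobolev_partial ::
  "real \<Rightarrow> real \<times> real \<Rightarrow> (real \<times> real \<Rightarrow> complex) \<Rightarrow> real \<times> real \<Rightarrow> complex" where
  "sobolev_partial lam e v = multiplier lam (\<lambda>\<xi>. \<i> * complex_of_real (\<xi> \<bullet> e)) v"

text \<open>To be applied to \<open>H\<^sup>1\<close> functions only, for which the integral converges.\<close>

definition energy :: "real \<Rightarrow> (real \<times> real \<Rightarrow> complex) \<Rightarrow> real" where
  "energy lam v = (\<integral>z. 1 / 2 * (\<Sum>e\<in>Basis. (cmod (sobolev_partial lam e v z))\<^sup>2)
                       + 1 / 4 * (cmod (v z)) ^ 4 \<partial>dz lam)"


section \<open>Smooth functions and the I-operator\<close>

definition dir_deriv ::
  "real \<times> real \<Rightarrow> (real \<times> real \<Rightarrow> 'b::real_normed_vector) \<Rightarrow> real \<times> real \<Rightarrow> 'b" where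
  "dir_deriv e f z = frechet_derivative f (at z) e"

definition iter_deriv ::
  "(real \<times> real) list \<Rightarrow> (real \<times> real \<Rightarrow> 'b::real_normed_vector) \<Rightarrow> real \<times> real \<Rightarrow> 'b" where
  "iter_deriv es f = foldr dir_deriv es f"

definition smooth :: "(real \<times> real \<Rightarrow> 'b::real_normed_vector) \<Rightarrow> bool" where
  "smooth f \<longleftrightarrow> (\<forall>es z. iter_deriv es f differentiable (at z))"

text \<open>
  The symbol bounds are scale invariant, so they hold for \<open>m(\<xi>) = m\<^sub>1(\<xi>/N)\<close> with constants
  independent of \<open>N\<close>. (They follow from the remaining conditions.)
\<close>

definition I_profile :: "real \<Rightarrow> (real \<times> real \<Rightarrow> real) \<Rightarrow> bool" where
  "I_profile s m\<^sub>1 \<longleftrightarrow>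
     smooth m\<^sub>1 \<and>
     (\<exists>\<rho>. antimono_on {0..} \<rho> \<and> (\<forall>\<xi>. m\<^sub>1 \<xi> = \<rho> (norm \<xi>))) \<and>
     (\<forall>\<xi>. norm \<xi> \<le> 1 \<longrightarrow> m\<^sub>1 \<xi> = 1) \<and>
     (\<forall>\<xi>. norm \<xi> \<ge> 2 \<longrightarrow> m\<^sub>1 \<xi> = (1 / norm \<xi>) powr (1 - s)) \<and>
     (\<forall>es. set es \<subseteq> Basis \<longrightarrow>
       (\<exists>B. \<forall>\<xi>. \<xi> \<noteq> 0 \<longrightarrow> \<bar>iter_deriv es m\<^sub>1 \<xi>\<bar> \<le> B * m\<^sub>1 \<xi> / norm \<xi> ^ length es))"

definition I_symbol :: "(real \<times> real \<Rightarrow> real) \<Rightarrow> real \<Rightarrow> real \<times> real \<Rightarrow> real" where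
  "I_symbol m\<^sub>1 N \<xi> = m\<^sub>1 (\<xi> /\<^sub>R N)"

definition I_op ::
  "real \<Rightarrow> (real \<times> real \<Rightarrow> real) \<Rightarrow> (real \<times> real \<Rightarrow> complex) \<Rightarrow> real \<times> real \<Rightarrow> complex" where
  "I_op lam m f = multiplier lam (\<lambda>\<xi>. complex_of_real (m \<xi>)) f"


section \<open>Solutions of the Schroedinger equation\<close>

definition test_function :: "real \<Rightarrow> (real \<times> real \<Rightarrow> complex) \<Rightarrow> bool" where
  "test_function lam \<phi> \<longleftrightarrow>
     periodic lam \<phi> \<and> smooth \<phi> \<and> (\<exists>R. \<forall>x y. \<bar>x\<bar> \<ge> R \<longrightarrow> \<phi> (x, y) = 0)"

definition laplacian :: "(real \<times> real \<Rightarrow> complex) \<Rightarrow> real \<times> real \<Rightarrow> complex" where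
  "laplacian \<phi> z = (\<Sum>e\<in>Basis. iter_deriv [e, e] \<phi> z)"

text \<open>
  \<open>i w\<^sub>t + \<Delta>w = F\<close> on \<open>[0, \<delta>]\<close>, tested in space against smooth compactly supported functions
  on the cylinder. For \<open>w\<close> and \<open>F\<close> continuous in time this is the equation in the sense of distributions.
\<close>

definition solves_schroedinger ::
  "real \<Rightarrow> real \<Rightarrow> (real \<Rightarrow> real \<times> real \<Rightarrow> complex) \<Rightarrow> (real \<Rightarrow> real \<times> real \<Rightarrow> complex) \<Rightarrow> bool" where
  "solves_schroedinger lam \<delta> w F \<longleftrightarrow>
     (\<forall>\<phi>. test_function lam \<phi> \<longrightarrow> (\<forall>t\<in>{0..\<delta>}.
        integrable (dz lam) (\<lambda>z. F t z * \<phi> z) \<and>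
        (\<exists>D. ((\<lambda>\<tau>. \<integral>z. w \<tau> z * \<phi> z \<partial>dz lam) has_vector_derivative D) (at t within {0..\<delta>}) \<and>
             \<i> * D + (\<integral>z. w t z * laplacian \<phi> z \<partial>dz lam) = (\<integral>z. F t z * \<phi> z \<partial>dz lam))))"

definition continuous_in_H1 :: "real \<Rightarrow> real \<Rightarrow> (real \<Rightarrow> real \<times> real \<Rightarrow> complex) \<Rightarrow> bool" where
  "continuous_in_H1 lam \<delta> w \<longleftrightarrow>
     (\<forall>t\<in>{0..\<delta>}. H1 lam (w t) \<and>
        ((\<lambda>\<tau>. H1_norm lam (\<lambda>z. w \<tau> z - w t z)) \<longlongrightarrow> 0) (at t within {0..\<delta>}))"

definition cubic :: "(real \<times> real \<Rightarrow> complex) \<Rightarrow> real \<times> real \<Rightarrow> complex" where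
  "cubic f z = complex_of_real ((cmod (f z))\<^sup>2) * f z"


section \<open>The modified energy\<close>

definition dyadic :: "real set" where
  "dyadic = range (\<lambda>k::nat. 2 ^ k)"

text \<open>
  \<open>|\<xi>| \<sim> n\<close> (and \<open>|\<xi>| \<lesssim> 1\<close> for \<open>n = 1\<close>), with explicit implied constant \<open>K\<close>.
\<close>

definition freq_size :: "real \<Rightarrow> real \<times> real \<Rightarrow> real \<Rightarrow> bool" where
  "freq_size K \<xi> n \<longleftrightarrow> norm \<xi> \<le> K * n \<and> (n \<noteq> 1 \<longrightarrow> n / K \<le> norm \<xi>)"

text \<open>Zero if one of the vectors vanishes, where the angle is undefined.\<close>

definition cos_angle :: "real \<times> real \<Rightarrow> real \<times> real \<Rightarrow> real" where
  "cos_angle a b = (a \<bullet> b) / (norm a * norm b)"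

definition S_dyadic ::
  "real \<Rightarrow> real \<Rightarrow> real \<Rightarrow> real \<Rightarrow> real \<Rightarrow> real \<Rightarrow> real \<Rightarrow> real \<Rightarrow>
   ((real \<times> real) \<times> (real \<times> real) \<times> (real \<times> real) \<times> (real \<times> real)) set" where
  "S_dyadic lam K c N N\<^sub>1 N\<^sub>2 N\<^sub>3 N\<^sub>4 =
     {(\<xi>\<^sub>1, \<xi>\<^sub>2, \<xi>\<^sub>3, \<xi>\<^sub>4) \<in> Sigma4 lam.
        freq_size K \<xi>\<^sub>1 N\<^sub>1 \<and> freq_size K \<xi>\<^sub>2 N\<^sub>2 \<and> freq_size K \<xi>\<^sub>3 N\<^sub>3 \<and> freq_size K \<xi>\<^sub>4 N\<^sub>4 \<and>
        (\<bar>cos_angle (\<xi>\<^sub>1 + \<xi>\<^sub>2) (\<xi>\<^sub>1 + \<xi>\<^sub>4)\<bar> \<ge> 1 / Max {N\<^sub>1, N\<^sub>2, N\<^sub>3, N\<^sub>4} \<or>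
         Max {norm \<xi>\<^sub>1, norm \<xi>\<^sub>2, norm \<xi>\<^sub>3, norm \<xi>\<^sub>4} \<le> c * N)}"

definition S_set ::
  "real \<Rightarrow> real \<Rightarrow> real \<Rightarrow> real \<Rightarrow>
   ((real \<times> real) \<times> (real \<times> real) \<times> (real \<times> real) \<times> (real \<times> real)) set" where
  "S_set lam K c N = (\<Union>N\<^sub>1\<in>dyadic. \<Union>N\<^sub>2\<in>dyadic. \<Union>N\<^sub>3\<in>dyadic. \<Union>N\<^sub>4\<in>dyadic.
     S_dyadic lam K c N N\<^sub>1 N\<^sub>2 N\<^sub>3 N\<^sub>4)"

definition Lambda4 ::
  "real \<Rightarrow> real \<Rightarrow> real \<Rightarrow> real \<Rightarrow> (real \<times> real \<Rightarrow> real) \<Rightarrow>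
   (real \<times> real) \<times> (real \<times> real) \<times> (real \<times> real) \<times> (real \<times> real) \<Rightarrow> real" where
  "Lambda4 lam K c N m = (\<lambda>(\<xi>\<^sub>1, \<xi>\<^sub>2, \<xi>\<^sub>3, \<xi>\<^sub>4).
     (if norm \<xi>\<^sub>1 \<le> N \<and> norm \<xi>\<^sub>2 \<le> N \<and> norm \<xi>\<^sub>3 \<le> N \<and> norm \<xi>\<^sub>4 \<le> N then 1
      else ((m \<xi>\<^sub>1)\<^sup>2 * (norm \<xi>\<^sub>1)\<^sup>2 - (m \<xi>\<^sub>2)\<^sup>2 * (norm \<xi>\<^sub>2)\<^sup>2
              + (m \<xi>\<^sub>3)\<^sup>2 * (norm \<xi>\<^sub>3)\<^sup>2 - (m \<xi>\<^sub>4)\<^sup>2 * (norm \<xi>\<^sub>4)\<^sup>2)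
           / ((norm \<xi>\<^sub>1)\<^sup>2 - (norm \<xi>\<^sub>2)\<^sup>2 + (norm \<xi>\<^sub>3)\<^sup>2 - (norm \<xi>\<^sub>4)\<^sup>2))
     * indicator (S_set lam K c N) (\<xi>\<^sub>1, \<xi>\<^sub>2, \<xi>\<^sub>3, \<xi>\<^sub>4))"

definition modified_energy ::
  "real \<Rightarrow> real \<Rightarrow> real \<Rightarrow> real \<Rightarrow> (real \<times> real \<Rightarrow> real) \<Rightarrow> (real \<times> real \<Rightarrow> complex) \<Rightarrow> complex" where
  "modified_energy lam K c N m u =
     (let uh = fourier lam u; ubh = fourier lam (\<lambda>z. cnj (u z)) in
      1 / 2 * (\<integral>(\<xi>\<^sub>1, \<xi>\<^sub>2). complex_of_real (norm \<xi>\<^sub>1 * norm \<xi>\<^sub>2 * m \<xi>\<^sub>1 * m \<xi>\<^sub>2) * uh \<xi>\<^sub>1 * ubh \<xi>\<^sub>2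
                 \<partial>Sigma2_measure lam)
      + complex_of_real (1 / (4 * (2 * pi)\<^sup>2)) *
        (\<integral>(\<xi>\<^sub>1, \<xi>\<^sub>2, \<xi>\<^sub>3, \<xi>\<^sub>4). complex_of_real (Lambda4 lam K c N m (\<xi>\<^sub>1, \<xi>\<^sub>2, \<xi>\<^sub>3, \<xi>\<^sub>4))
                 * uh \<xi>\<^sub>1 * ubh \<xi>\<^sub>2 * uh \<xi>\<^sub>3 * ubh \<xi>\<^sub>4 \<partial>Sigma4_measure lam))"

end

theory Submission
  imports Defs "HOL-Probability.Characteristic_Functions"
begin

text \<open>
  The time evolution plays no role: for fixed \<open>t\<close> put \<open>v = Iu(t)\<close>. By Plancherel the quadratic parts of the
  two energies agree, and the quartic part of \<open>E(v)\<close> is the quadrilinear form with symbol \<open>\<Prod> m(\<xi>\<^sub>j)\<close>,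
  so that the difference is the quadrilinear form with symbol \<open>\<Lambda>\<^sub>4 - \<Prod> m(\<xi>\<^sub>j)\<close>. This symbol vanishes where all
  frequencies are at most \<open>cN\<close>. Elsewhere let \<open>R\<close> be the largest \<open>|\<xi>\<^sub>j|\<close>: the denominator of \<open>\<Lambda>\<^sub>4\<close> is
  \<open>2 \<xi>\<^sub>1\<^sub>2 \<bullet> \<xi>\<^sub>1\<^sub>4\<close>, which on \<open>S\<close> is at least a multiple of \<open>|\<xi>\<^sub>1\<^sub>2| |\<xi>\<^sub>1\<^sub>4| / R\<close>, while the double mean value theorem
  bounds the numerator by a multiple of \<open>m(R)\<^sup>2 |\<xi>\<^sub>1\<^sub>2| |\<xi>\<^sub>1\<^sub>4|\<close>; hence \<open>\<Lambda>\<^sub>4 = O(m(R)\<^sup>2 R)\<close>. Two of the frequencies are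
  comparable to \<open>R\<close>, so after division by \<open>\<Prod> m(\<xi>\<^sub>j) \<langle>\<xi>\<^sub>j\<rangle>\<close> there remains
  \<open>N\<^bsup>\<epsilon>-1\<^esup>\<close> times the weights \<open>\<langle>\<xi>\<rangle>\<^bsup>-1-e\<^esup>\<close> of the other two frequencies. These weights are in \<open>L\<^sup>2\<close>
  uniformly in \<open>\<lambda> \<ge> 1\<close>, and Cauchy-Schwarz in the quadrilinear form concludes.
\<close>

section \<open>Square-integrable functions\<close>

text \<open>\<open>fourier\<close> and \<open>multiplier\<close> are choices by \<open>SOME\<close>,
  fixed only up to null sets of \<open>dxi lam\<close>. Plancherel on the cylinder and a null-set
  principle on the hyperplane (\<open>AE_Sigma4\<close>) make them usable. The energy is a Bochner
  integral, which splits only once |v|^4 is known to be integrable; this comes from the frequency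
  side, where the weighted form that bounds the error also dominates the unweighted one. The
  parameters come from one balance. With two frequencies of size R, the brackets gain R^2, two
  weights cost R^(-2e), the symbol costs R, and m(R)^4 stands against m(R)^2. What must stay bounded
  below is N^(\<epsilon>-1) m(R)^2 R^(1-2e), which for R >= N is comparable to N^(\<epsilon>-2e)
  (R/N)^(2s-1-2e). Both exponents are nonnegative for e = min(s - 1/2, \<epsilon>/2), and s > 1/2
  gives e > 0, which puts weights of exponent -1-e in L^2 of the plane. K >= 2 makes the dyadic
  shells cover all frequencies, so that \<open>S_set\<close> contains every tuple with all |\<xi>_j|
  <= cN, and c < 1 gives m = 1 there.\<close>

lemma L2_norm_nonneg [simp]: "0 \<le> L2_norm M f"
  by (simp add: L2_norm_def)

lemma L2_norm_power2: "(L2_norm M f)\<^sup>2 = (\<integral>x. (cmod (f x))\<^sup>2 \<partial>M)"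
  by (simp add: L2_norm_def)

lemma L2_norm_eq_nn_integral:
  assumes "sq_integrable M f"
  shows "(\<integral>\<^sup>+x. ennreal ((cmod (f x))\<^sup>2) \<partial>M) = ennreal ((L2_norm M f)\<^sup>2)"
  using assms by (subst nn_integral_eq_integral) (auto simp: sq_integrable_def L2_norm_power2)

lemma sq_integrable_measurable [measurable_dest]: "sq_integrable M f \<Longrightarrow> f \<in> borel_measurable M"
  by (simp add: sq_integrable_def)

lemma sq_integrableI_bounded:
  assumes [measurable]: "f \<in> borel_measurable M" and "(\<integral>\<^sup>+x. ennreal ((cmod (f x))\<^sup>2) \<partial>M) \<le> ennreal B"
  shows "sq_integrable M f"
  unfolding sq_integrable_def
  using assms by (auto intro!: integrableI_bounded simp: le_less_trans[OF _ ennreal_less_top])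

lemma L2_norm_le:
  assumes "f \<in> borel_measurable M" "(\<integral>\<^sup>+x. ennreal ((cmod (f x))\<^sup>2) \<partial>M) \<le> ennreal (B\<^sup>2)" "0 \<le> B"
  shows "L2_norm M f \<le> B"
proof -
  have "ennreal ((L2_norm M f)\<^sup>2) \<le> ennreal (B\<^sup>2)"
    using L2_norm_eq_nn_integral[OF sq_integrableI_bounded[OF assms(1,2)]] assms(2) by simp
  then have "(L2_norm M f)\<^sup>2 \<le> B\<^sup>2" by simp
  then show ?thesis using assms(3) by (rule power2_le_imp_le)
qed

lemma sq_integrable_dominated:
  assumes "sq_integrable M g" and [measurable]: "f \<in> borel_measurable M"
    and "\<And>x. x \<in> space M \<Longrightarrow> cmod (f x) \<le> C * cmod (g x)"
  shows "sq_integrable M f"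
  unfolding sq_integrable_def
proof
  have "integrable M (\<lambda>x. C\<^sup>2 * (cmod (g x))\<^sup>2)"
    using assms(1) by (simp add: sq_integrable_def)
  then show "integrable M (\<lambda>x. (cmod (f x))\<^sup>2)"
  proof (rule Bochner_Integration.integrable_bound)
    show "AE x in M. norm ((cmod (f x))\<^sup>2) \<le> norm (C\<^sup>2 * (cmod (g x))\<^sup>2)"
      using power_mono[OF assms(3), of _ 2]
      by (auto simp: power_mult_distrib)
  qed measurable
qed measurable

lemma sq_integrable_mult_bounded:
  assumes "sq_integrable M f" "a \<in> borel_measurable M" "\<And>x. x \<in> space M \<Longrightarrow> cmod (a x) \<le> C"
  shows "sq_integrable M (\<lambda>x. a x * f x)"
  by (rule sq_integrable_dominated[OF assms(1), where C = C])
     (use assms in \<open>auto simp: norm_mult intro!: mult_right_mono\<close>)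

lemma sq_integrable_cmult: "sq_integrable M f \<Longrightarrow> sq_integrable M (\<lambda>x. c * f x)"
  by (rule sq_integrable_mult_bounded[where C = "cmod c"]) auto

lemma borel_measurable_cnj [measurable (raw)]:
  "f \<in> borel_measurable M \<Longrightarrow> (\<lambda>x. cnj (f x)) \<in> borel_measurable M"
  by (rule borel_measurable_continuous_on[OF continuous_on_cnj[OF continuous_on_id]])

lemma sq_integrable_cnj: "sq_integrable M f \<Longrightarrow> sq_integrable M (\<lambda>x. cnj (f x))"
  by (rule sq_integrable_dominated[where C = 1 and g = f]) (auto dest: sq_integrable_measurable)

lemma sq_integrable_add:
  assumes f: "sq_integrable M f" and g: "sq_integrable M g"
  shows "sq_integrable M (\<lambda>x. f x + g x)"
  unfolding sq_integrable_def
proof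
  have [measurable]: "f \<in> borel_measurable M" "g \<in> borel_measurable M"
    using f g by (auto simp: sq_integrable_def)
  show "(\<lambda>x. f x + g x) \<in> borel_measurable M" by measurable
  have "integrable M (\<lambda>x. 2 * (cmod (f x))\<^sup>2 + 2 * (cmod (g x))\<^sup>2)"
    using f g by (simp add: sq_integrable_def)
  then show "integrable M (\<lambda>x. (cmod (f x + g x))\<^sup>2)"
  proof (rule Bochner_Integration.integrable_bound)
    have "(cmod (f x + g x))\<^sup>2 \<le> 2 * (cmod (f x))\<^sup>2 + 2 * (cmod (g x))\<^sup>2" for x
    proof -
      have "(cmod (f x + g x))\<^sup>2 \<le> (cmod (f x) + cmod (g x))\<^sup>2"
        by (intro power_mono norm_triangle_ineq) auto
      also have "\<dots> \<le> 2 * (cmod (f x))\<^sup>2 + 2 * (cmod (g x))\<^sup>2"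
        using sum_squares_bound[of "cmod (f x)" "cmod (g x)"] by (simp add: power2_sum)
      finally show ?thesis .
    qed
    then show "AE x in M. norm ((cmod (f x + g x))\<^sup>2) \<le> norm (2 * (cmod (f x))\<^sup>2 + 2 * (cmod (g x))\<^sup>2)"
      by auto
  qed measurable
qed

lemma sq_integrable_diff:
  assumes "sq_integrable M f" "sq_integrable M g"
  shows "sq_integrable M (\<lambda>x. f x - g x)"
  using sq_integrable_add[OF assms(1) sq_integrable_cmult[OF assms(2), of "-1"]] by simp

lemma sq_integrable_zero [simp]: "sq_integrable M (\<lambda>x. 0)"
  by (simp add: sq_integrable_def)

lemma sq_integrable_sum:
  assumes "\<And>i. i \<in> I \<Longrightarrow> sq_integrable M (f i)"
  shows "sq_integrable M (\<lambda>x. \<Sum>i\<in>I. f i x)"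
  using assms by (induction I rule: infinite_finite_induct) (auto intro!: sq_integrable_add)

lemma integrable_mult_L2:
  assumes f: "sq_integrable M f" and g: "sq_integrable M g"
  shows "integrable M (\<lambda>x. f x * g x)"
proof -
  have [measurable]: "f \<in> borel_measurable M" "g \<in> borel_measurable M"
    using f g by (auto simp: sq_integrable_def)
  have "integrable M (\<lambda>x. (cmod (f x))\<^sup>2 + (cmod (g x))\<^sup>2)"
    using f g by (simp add: sq_integrable_def)
  then show ?thesis
  proof (rule Bochner_Integration.integrable_bound)
    have "cmod (f x) * cmod (g x) \<le> (cmod (f x))\<^sup>2 + (cmod (g x))\<^sup>2" for x
      using sum_squares_bound[of "cmod (f x)" "cmod (g x)"] mult_nonneg_nonneg[OF norm_ge_zero norm_ge_zero, of "f x" "g x"]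
      by linarith
    then show "AE x in M. norm (f x * g x) \<le> norm ((cmod (f x))\<^sup>2 + (cmod (g x))\<^sup>2)"
      by (auto simp: norm_mult)
  qed measurable
qed

text \<open>The moduli are kept inside the integral: the cross term of the triangle inequality needs
  this stronger form, and the bound for the complex pairing follows from it.\<close>

lemma integral_cmod_mult_le:
  assumes f: "sq_integrable M f" and g: "sq_integrable M g"
  shows "(\<integral>x. cmod (f x) * cmod (g x) \<partial>M) \<le> L2_norm M f * L2_norm M g"
proof -
  have [measurable]: "f \<in> borel_measurable M" "g \<in> borel_measurable M"
    using f g by (auto simp: sq_integrable_def)
  let ?I = "\<integral>x. cmod (f x) * cmod (g x) \<partial>M"
  have int: "integrable M (\<lambda>x. cmod (f x) * cmod (g x))"
    using integrable_norm[OF integrable_mult_L2[OF f g]] by (simp add: norm_mult)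
  have I: "(\<integral>\<^sup>+x. ennreal (cmod (f x)) * ennreal (cmod (g x)) \<partial>M) = ennreal ?I"
    using int by (subst ennreal_mult'[symmetric]) (auto intro: nn_integral_eq_integral)
  have "(ennreal ?I)\<^sup>2 \<le> ennreal ((L2_norm M f)\<^sup>2) * ennreal ((L2_norm M g)\<^sup>2)"
    using Cauchy_Schwarz_nn_integral[of "\<lambda>x. ennreal (cmod (f x))" M "\<lambda>x. ennreal (cmod (g x))"]
    by (simp add: I ennreal_power L2_norm_eq_nn_integral f g)
  also have "\<dots> = ennreal ((L2_norm M f * L2_norm M g)\<^sup>2)"
    by (simp add: ennreal_mult power_mult_distrib)
  finally have "?I\<^sup>2 \<le> (L2_norm M f * L2_norm M g)\<^sup>2"
    by (simp add: ennreal_power)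
  then show ?thesis by (rule power2_le_imp_le) simp
qed

lemma Cauchy_Schwarz_L2:
  assumes f: "sq_integrable M f" and g: "sq_integrable M g"
  shows "cmod (\<integral>x. f x * g x \<partial>M) \<le> L2_norm M f * L2_norm M g"
  using order_trans[OF integral_norm_bound integral_cmod_mult_le[OF assms, unfolded norm_mult[symmetric]]] .

lemma L2_norm_triangle:
  assumes f: "sq_integrable M f" and g: "sq_integrable M g"
  shows "L2_norm M (\<lambda>x. f x + g x) \<le> L2_norm M f + L2_norm M g"
proof (rule power2_le_imp_le)
  have [measurable]: "f \<in> borel_measurable M" "g \<in> borel_measurable M"
    using f g by (auto simp: sq_integrable_def)
  have fg: "integrable M (\<lambda>x. cmod (f x) * cmod (g x))"
    using integrable_norm[OF integrable_mult_L2[OF f g]] by (simp add: norm_mult)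
  have "(\<integral>x. (cmod (f x + g x))\<^sup>2 \<partial>M)
      \<le> (\<integral>x. (cmod (f x))\<^sup>2 + (cmod (g x))\<^sup>2 + 2 * (cmod (f x) * cmod (g x)) \<partial>M)"
  proof (rule integral_mono)
    show "integrable M (\<lambda>x. (cmod (f x + g x))\<^sup>2)"
      using sq_integrable_add[OF f g] by (simp add: sq_integrable_def)
    show "integrable M (\<lambda>x. (cmod (f x))\<^sup>2 + (cmod (g x))\<^sup>2 + 2 * (cmod (f x) * cmod (g x)))"
      using fg f g by (simp add: sq_integrable_def)
    show "(cmod (f x + g x))\<^sup>2 \<le> (cmod (f x))\<^sup>2 + (cmod (g x))\<^sup>2 + 2 * (cmod (f x) * cmod (g x))" for x
      using power_mono[OF norm_triangle_ineq[of "f x" "g x"], of 2] by (simp add: power2_sum)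
  qed
  also have "\<dots> = (L2_norm M f)\<^sup>2 + (L2_norm M g)\<^sup>2 + 2 * (\<integral>x. cmod (f x) * cmod (g x) \<partial>M)"
    using fg f g by (simp add: sq_integrable_def L2_norm_power2)
  also have "\<dots> \<le> (L2_norm M f + L2_norm M g)\<^sup>2"
    using integral_cmod_mult_le[OF f g] by (simp add: power2_sum)
  finally show "(L2_norm M (\<lambda>x. f x + g x))\<^sup>2 \<le> (L2_norm M f + L2_norm M g)\<^sup>2"
    by (simp add: L2_norm_power2)
qed simp

lemma L2_norm_cmult: "L2_norm M (\<lambda>x. c * f x) = cmod c * L2_norm M f"
  by (simp add: L2_norm_def norm_mult power_mult_distrib real_sqrt_mult)

lemma L2_norm_minus_commute: "L2_norm M (\<lambda>x. f x - g x) = L2_norm M (\<lambda>x. g x - f x)"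
  by (simp add: L2_norm_def norm_minus_commute)

lemma L2_norm_triangle_diff:
  assumes "sq_integrable M f" "sq_integrable M g" "sq_integrable M h"
  shows "L2_norm M (\<lambda>x. f x - h x) \<le> L2_norm M (\<lambda>x. f x - g x) + L2_norm M (\<lambda>x. g x - h x)"
  using L2_norm_triangle[OF sq_integrable_diff[OF assms(1,2)] sq_integrable_diff[OF assms(2,3)]]
  by simp

lemma L2_norm_diff_abs_le:
  assumes "sq_integrable M f" "sq_integrable M g"
  shows "\<bar>L2_norm M f - L2_norm M g\<bar> \<le> L2_norm M (\<lambda>x. f x - g x)"
  using L2_norm_triangle_diff[OF assms(1,2), of "\<lambda>x. 0"] L2_norm_triangle_diff[OF assms(2,1), of "\<lambda>x. 0"]
    L2_norm_minus_commute[of M f g] by simp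

lemma L2_norm_tendsto:
  assumes "\<And>n. sq_integrable M (F n)" "sq_integrable M f"
    and "(\<lambda>n::nat. L2_norm M (\<lambda>x. F n x - f x)) \<longlonglongrightarrow> 0"
  shows "(\<lambda>n. L2_norm M (F n)) \<longlonglongrightarrow> L2_norm M f"
proof -
  have "(\<lambda>n. L2_norm M (F n) - L2_norm M f) \<longlonglongrightarrow> 0"
    by (rule Lim_null_comparison[OF _ assms(3)])
       (use L2_norm_diff_abs_le[OF assms(1,2)] in auto)
  then show ?thesis by (simp add: LIM_zero_iff)
qed

lemma L2_inner_tendsto:
  assumes "\<And>n. sq_integrable M (F n)" "sq_integrable M f" "sq_integrable M h"
    and "(\<lambda>n::nat. L2_norm M (\<lambda>x. F n x - f x)) \<longlonglongrightarrow> 0"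
  shows "(\<lambda>n. \<integral>x. F n x * h x \<partial>M) \<longlonglongrightarrow> (\<integral>x. f x * h x \<partial>M)"
proof -
  have "(\<lambda>n. (\<integral>x. F n x * h x \<partial>M) - (\<integral>x. f x * h x \<partial>M)) \<longlonglongrightarrow> 0"
  proof (rule Lim_null_comparison)
    show "\<forall>\<^sub>F n in sequentially. cmod ((\<integral>x. F n x * h x \<partial>M) - (\<integral>x. f x * h x \<partial>M))
        \<le> L2_norm M (\<lambda>x. F n x - f x) * L2_norm M h"
    proof (rule always_eventually, rule allI)
      fix n
      have "(\<integral>x. F n x * h x \<partial>M) - (\<integral>x. f x * h x \<partial>M) = (\<integral>x. (F n x - f x) * h x \<partial>M)"
        by (simp add: left_diff_distrib integrable_mult_L2 assms)
      then show "cmod ((\<integral>x. F n x * h x \<partial>M) - (\<integral>x. f x * h x \<partial>M))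
        \<le> L2_norm M (\<lambda>x. F n x - f x) * L2_norm M h"
        using Cauchy_Schwarz_L2[OF sq_integrable_diff[OF assms(1,2)] assms(3)] by simp
    qed
    show "(\<lambda>n. L2_norm M (\<lambda>x. F n x - f x) * L2_norm M h) \<longlonglongrightarrow> 0"
      using tendsto_mult_left_zero[OF assms(4)] .
  qed
  then show ?thesis by (simp add: LIM_zero_iff)
qed

lemma L2_norm_cong_AE:
  assumes "f \<in> borel_measurable M" "g \<in> borel_measurable M" "AE x in M. f x = g x"
  shows "L2_norm M f = L2_norm M g"
  unfolding L2_norm_def by (rule arg_cong[where f=sqrt], rule integral_cong_AE) (use assms in auto)

lemma sq_integrable_cong_AE:
  assumes "sq_integrable M f" "g \<in> borel_measurable M" "AE x in M. f x = g x"
  shows "sq_integrable M g"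
  unfolding sq_integrable_def
proof
  have [measurable]: "f \<in> borel_measurable M" "g \<in> borel_measurable M"
    using assms by (auto simp: sq_integrable_def)
  show "g \<in> borel_measurable M" by fact
  have "integrable M (\<lambda>x. (cmod (f x))\<^sup>2)" using assms by (simp add: sq_integrable_def)
  then show "integrable M (\<lambda>x. (cmod (g x))\<^sup>2)"
    by (rule integrable_cong_AE_imp) (use assms(3) in auto)
qed

lemma L2_norm_eq_0D:
  assumes "sq_integrable M f" "L2_norm M f = 0"
  shows "AE x in M. f x = 0"
proof -
  have [measurable]: "f \<in> borel_measurable M" using assms by (auto simp: sq_integrable_def)
  have "(\<integral>\<^sup>+x. ennreal ((cmod (f x))\<^sup>2) \<partial>M) = 0"
    using assms by (simp add: L2_norm_eq_nn_integral)
  then have "AE x in M. ennreal ((cmod (f x))\<^sup>2) = 0"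
    by (subst (asm) nn_integral_0_iff_AE) auto
  then show ?thesis by (auto simp: ennreal_eq_0_iff)
qed

lemma L2_limit_unique:
  assumes "\<And>n. sq_integrable M (F n)" "sq_integrable M f" "sq_integrable M g"
    and "(\<lambda>n::nat. L2_norm M (\<lambda>x. F n x - f x)) \<longlonglongrightarrow> 0"
    and "(\<lambda>n::nat. L2_norm M (\<lambda>x. F n x - g x)) \<longlonglongrightarrow> 0"
  shows "AE x in M. f x = g x"
proof -
  have "L2_norm M (\<lambda>x. f x - g x) \<le> 0"
  proof (rule tendsto_lowerbound)
    show "(\<lambda>n. L2_norm M (\<lambda>x. F n x - f x) + L2_norm M (\<lambda>x. F n x - g x)) \<longlonglongrightarrow> 0"
      using tendsto_add[OF assms(4,5)] by simp
    show "\<forall>\<^sub>F n in sequentially. L2_norm M (\<lambda>x. f x - g x)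
        \<le> L2_norm M (\<lambda>x. F n x - f x) + L2_norm M (\<lambda>x. F n x - g x)"
      using L2_norm_triangle_diff[OF assms(2,1,3)] L2_norm_minus_commute[of M f]
      by (auto intro!: always_eventually)
  qed simp
  then have "L2_norm M (\<lambda>x. f x - g x) = 0"
    using L2_norm_nonneg[of M "\<lambda>x. f x - g x"] by linarith
  from L2_norm_eq_0D[OF sq_integrable_diff[OF assms(2,3)] this] show ?thesis by simp
qed

section \<open>Completeness of L^2\<close>

definition L2_Cauchy :: "'a measure \<Rightarrow> (nat \<Rightarrow> 'a \<Rightarrow> complex) \<Rightarrow> bool" where
  "L2_Cauchy M F \<longleftrightarrow> (\<forall>e>0. \<exists>K. \<forall>m\<ge>K. \<forall>n\<ge>K. L2_norm M (\<lambda>x. F m x - F n x) < e)"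

text \<open>Fatou along the subsequence, applied to the Cauchy estimate for \<open>F n\<close> and
  \<open>F (r j)\<close>, gives both claims at once: \<open>F n - f\<close> is square-integrable for
  one n, hence f is, and its norm is small for all large n. The a.e. limit is a premise because
  \<open>quartic_identity\<close> uses the lemma for a limit that is already known
  pointwise.\<close>

lemma L2_Cauchy_AE_limit:
  assumes F: "\<And>n. sq_integrable M (F n)" and C: "L2_Cauchy M F"
    and r: "strict_mono r" and lim: "AE x in M. (\<lambda>n. F (r n) x) \<longlonglongrightarrow> f x"
    and [measurable]: "f \<in> borel_measurable M"
  shows "sq_integrable M f" "(\<lambda>n. L2_norm M (\<lambda>x. F n x - f x)) \<longlonglongrightarrow> 0"
proof -
  have [measurable]: "F n \<in> borel_measurable M" for n using F by (auto simp: sq_integrable_def)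
  have key: "\<exists>K. \<forall>n\<ge>K. (\<integral>\<^sup>+x. ennreal ((cmod (F n x - f x))\<^sup>2) \<partial>M) \<le> ennreal (e\<^sup>2)" if e: "e > 0" for e
  proof -
    from C e obtain K where K: "\<And>m n. m \<ge> K \<Longrightarrow> n \<ge> K \<Longrightarrow> L2_norm M (\<lambda>x. F m x - F n x) < e"
      unfolding L2_Cauchy_def by blast
    show ?thesis
    proof (intro exI allI impI)
      fix n assume n: "n \<ge> K"
      have "(\<integral>\<^sup>+x. ennreal ((cmod (F n x - f x))\<^sup>2) \<partial>M)
          = (\<integral>\<^sup>+x. liminf (\<lambda>j. ennreal ((cmod (F n x - F (r j) x))\<^sup>2)) \<partial>M)"
      proof (rule nn_integral_cong_AE)
        show "AE x in M. ennreal ((cmod (F n x - f x))\<^sup>2) = liminf (\<lambda>j. ennreal ((cmod (F n x - F (r j) x))\<^sup>2))"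
          using lim
        proof eventually_elim
          case (elim x)
          have "(\<lambda>j. ennreal ((cmod (F n x - F (r j) x))\<^sup>2)) \<longlonglongrightarrow> ennreal ((cmod (F n x - f x))\<^sup>2)"
            by (intro tendsto_ennrealI tendsto_intros elim)
          from lim_imp_Liminf[OF _ this] show ?case by simp
        qed
      qed
      also have "\<dots> \<le> liminf (\<lambda>j. \<integral>\<^sup>+x. ennreal ((cmod (F n x - F (r j) x))\<^sup>2) \<partial>M)"
        by (rule nn_integral_liminf) measurable
      also have "\<dots> \<le> ennreal (e\<^sup>2)"
      proof (rule Liminf_le)
        show "\<forall>\<^sub>F j in sequentially. (\<integral>\<^sup>+x. ennreal ((cmod (F n x - F (r j) x))\<^sup>2) \<partial>M) \<le> ennreal (e\<^sup>2)"
        proof (rule eventually_sequentiallyI[of K])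
          fix j assume j: "K \<le> j"
          then have "K \<le> r j" using seq_suble[OF r, of j] by simp
          then have "L2_norm M (\<lambda>x. F n x - F (r j) x) \<le> e" using K[OF n, of "r j"] by simp
          then show "(\<integral>\<^sup>+x. ennreal ((cmod (F n x - F (r j) x))\<^sup>2) \<partial>M) \<le> ennreal (e\<^sup>2)"
            by (simp add: L2_norm_eq_nn_integral[OF sq_integrable_diff[OF F F]] power_mono)
        qed
      qed simp
      finally show "(\<integral>\<^sup>+x. ennreal ((cmod (F n x - f x))\<^sup>2) \<partial>M) \<le> ennreal (e\<^sup>2)" .
    qed
  qed
  obtain K where K: "\<forall>n\<ge>K. (\<integral>\<^sup>+x. ennreal ((cmod (F n x - f x))\<^sup>2) \<partial>M) \<le> ennreal (1\<^sup>2)"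
    using key[OF zero_less_one] by (rule exE)
  have "(\<integral>\<^sup>+x. ennreal ((cmod (F K x - f x))\<^sup>2) \<partial>M) \<le> ennreal (1\<^sup>2)"
    using K[rule_format, of K] by simp
  then have "sq_integrable M (\<lambda>x. F K x - f x)" by (intro sq_integrableI_bounded) measurable
  from sq_integrable_diff[OF F[of K] this] show f: "sq_integrable M f" by simp
  show "(\<lambda>n. L2_norm M (\<lambda>x. F n x - f x)) \<longlonglongrightarrow> 0"
  proof (rule LIMSEQ_I)
    fix e :: real assume e: "e > 0"
    obtain K where K: "\<forall>n\<ge>K. (\<integral>\<^sup>+x. ennreal ((cmod (F n x - f x))\<^sup>2) \<partial>M) \<le> ennreal ((e/2)\<^sup>2)"
      using key[OF half_gt_zero[OF e]] by (rule exE)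
    have "L2_norm M (\<lambda>x. F n x - f x) \<le> e/2" if "n \<ge> K" for n
      by (rule L2_norm_le[OF _ K[rule_format, OF that]]) (use e in auto)
    moreover have "e/2 < e" using e by simp
    ultimately have "L2_norm M (\<lambda>x. F n x - f x) < e" if "n \<ge> K" for n
      using that by (meson le_less_trans)
    then show "\<exists>no. \<forall>n\<ge>no. norm (L2_norm M (\<lambda>x. F n x - f x) - 0) < e"
      by auto
  qed
qed

text \<open>Riesz-Fischer. A subsequence with steps of norm below 4^(-j) converges a.e., and its
  limit is handed to \<open>L2_Cauchy_AE_limit\<close>. The subsequence is part of the conclusion,
  since \<open>L2_Cauchy_subseq_AE\<close> needs the a.e. convergence as well.\<close>

lemma L2_complete:
  assumes F: "\<And>n. sq_integrable M (F n)" and C: "L2_Cauchy M F"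
  obtains f r where "sq_integrable M f" "(\<lambda>n. L2_norm M (\<lambda>x. F n x - f x)) \<longlonglongrightarrow> 0"
    "strict_mono r" "AE x in M. (\<lambda>n. F (r n) x) \<longlonglongrightarrow> f x"
proof -
  have [measurable]: "F n \<in> borel_measurable M" for n using F by (auto simp: sq_integrable_def)
  have "\<forall>j. \<exists>K. \<forall>m\<ge>K. \<forall>n\<ge>K. L2_norm M (\<lambda>x. F m x - F n x) < (1/4)^j"
    using C unfolding L2_Cauchy_def by simp
  then obtain K where K: "\<And>j m n. m \<ge> K j \<Longrightarrow> n \<ge> K j \<Longrightarrow> L2_norm M (\<lambda>x. F m x - F n x) < (1/4)^j"
    by metis
  \<comment> \<open>The first argument of max makes r strictly increasing, the second puts
    \<open>r j\<close> beyond the threshold for 4^(-j).\<close>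
  define r where "r = rec_nat (K 0) (\<lambda>j p. max (Suc p) (K (Suc j)))"
  have r0: "r 0 = K 0" and rS: "r (Suc j) = max (Suc (r j)) (K (Suc j))" for j
    by (auto simp: r_def)
  have mono: "strict_mono r" by (rule strict_monoI_Suc) (simp add: rS less_max_iff_disj)
  have rK: "r j \<ge> K j" for j by (cases j) (auto simp: r0 rS)
  have rK': "r (Suc j) \<ge> K j" for j
    using rK[of j] strict_monoD[OF mono, of j "Suc j"] by simp
  \<comment> \<open>The squared steps will be weighted by 2^j. The total stays finite, as 2^j
    16^(-j) <= 2^(-j), and 2 d <= 2^j d^2 + 2^(-j) then passes from summable weighted squares to
    summable steps at almost every point.\<close>
  define d where "d j x = cmod (F (r (Suc j)) x - F (r j) x)" for j x
  have [measurable]: "d j \<in> borel_measurable M" for j by (simp add: d_def[abs_def])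
  have "(\<integral>\<^sup>+x. (\<Sum>j. ennreal (2^j * (d j x)\<^sup>2)) \<partial>M) = (\<Sum>j. \<integral>\<^sup>+x. ennreal (2^j * (d j x)\<^sup>2) \<partial>M)"
    by (rule nn_integral_suminf) measurable
  also have "\<dots> \<le> (\<Sum>j. ennreal ((1/2)^j))"
  proof (rule suminf_le)
    fix j
    have "(\<integral>\<^sup>+x. ennreal (2^j * (d j x)\<^sup>2) \<partial>M) = ennreal (2^j) * (\<integral>\<^sup>+x. ennreal ((d j x)\<^sup>2) \<partial>M)"
      by (subst nn_integral_cmult[symmetric]) (auto simp: ennreal_mult)
    also have "\<dots> = ennreal (2^j) * ennreal ((L2_norm M (\<lambda>x. F (r (Suc j)) x - F (r j) x))\<^sup>2)"
      by (simp add: d_def L2_norm_eq_nn_integral[OF sq_integrable_diff[OF F F]])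
    also have "\<dots> \<le> ennreal (2^j) * ennreal (((1/4)^j)\<^sup>2)"
      using K[OF rK' rK, of j] by (intro mult_left_mono ennreal_leI power_mono) auto
    also have "\<dots> = ennreal ((1/8)^j)"
      by (simp add: ennreal_mult[symmetric] power2_eq_square power_mult_distrib[symmetric] del: power_mult_distrib)
    also have "\<dots> \<le> ennreal ((1/2)^j)" by (intro ennreal_leI power_mono) auto
    finally show "(\<integral>\<^sup>+x. ennreal (2^j * (d j x)\<^sup>2) \<partial>M) \<le> ennreal ((1/2)^j)" .
  qed auto
  also have "\<dots> = ennreal (\<Sum>j. (1/2)^j)"
    by (rule suminf_ennreal_eq) (auto intro!: summable_sums summable_geometric)
  also have "\<dots> < \<infinity>" by simp
  finally have "(\<integral>\<^sup>+x. (\<Sum>j. ennreal (2^j * (d j x)\<^sup>2)) \<partial>M) \<noteq> \<infinity>" by simp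
  then have "AE x in M. (\<Sum>j. ennreal (2^j * (d j x)\<^sup>2)) \<noteq> \<infinity>"
    by (rule nn_integral_PInf_AE[rotated]) measurable
  then have conv: "AE x in M. convergent (\<lambda>n. F (r n) x)"
  proof eventually_elim
    case (elim x)
    then have s: "summable (\<lambda>j. 2^j * (d j x)\<^sup>2)"
      by (intro summable_suminf_not_top) auto
    have "summable (\<lambda>j. d j x)"
    proof (rule summable_comparison_test')
      show "summable (\<lambda>j. 2^j * (d j x)\<^sup>2 + (1/2)^j)"
        by (intro summable_add s summable_geometric) auto
      fix j :: nat
      have "2 * d j x \<le> 2^j * (d j x)\<^sup>2 + (1/2)^j"
      proof -
        have "0 \<le> 2^j * (d j x - (1/2)^j)\<^sup>2" by simp
        also have "\<dots> = 2^j * (d j x)\<^sup>2 - 2 * d j x * (2^j * (1/2)^j) + (2^j * (1/2)^j) * (1/2)^j"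
          by (simp add: power2_eq_square algebra_simps)
        also have "(2::real)^j * (1/2)^j = 1" by (simp add: power_mult_distrib[symmetric])
        finally show ?thesis by simp
      qed
      moreover have "0 \<le> d j x" by (simp add: d_def)
      ultimately show "norm (d j x) \<le> 2^j * (d j x)\<^sup>2 + (1/2)^j" by simp
    qed
    then have "summable (\<lambda>j. F (r (Suc j)) x - F (r j) x)"
      unfolding d_def by (rule summable_norm_cancel)
    then have "convergent (\<lambda>n. \<Sum>j<n. F (r (Suc j)) x - F (r j) x)"
      by (simp add: summable_iff_convergent)
    then have "convergent (\<lambda>n. F (r n) x - F (r 0) x)"
      by (simp only: sum_lessThan_telescope[of "\<lambda>n. F (r n) x"])
    then have "convergent (\<lambda>n. (F (r n) x - F (r 0) x) + F (r 0) x)"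
      by (intro convergent_add convergent_const)
    then show ?case by simp
  qed
  define f where "f x = lim (\<lambda>n. F (r n) x)" for x
  have [measurable]: "f \<in> borel_measurable M" unfolding f_def[abs_def] by measurable
  have lim: "AE x in M. (\<lambda>n. F (r n) x) \<longlonglongrightarrow> f x"
    using conv by eventually_elim (simp add: f_def convergent_LIMSEQ_iff)
  from L2_Cauchy_AE_limit[OF F C mono lim] that mono lim show ?thesis by simp
qed

lemma L2_convergent_imp_Cauchy:
  assumes F: "\<And>n. sq_integrable M (F n)" "sq_integrable M f"
    and lim: "(\<lambda>n. L2_norm M (\<lambda>x. F n x - f x)) \<longlonglongrightarrow> 0"
  shows "L2_Cauchy M F"
  unfolding L2_Cauchy_def
proof (intro allI impI)
  fix e :: real assume "e > 0"
  with LIMSEQ_D[OF lim, of "e/2"] obtain K where K: "\<And>n. n \<ge> K \<Longrightarrow> L2_norm M (\<lambda>x. F n x - f x) < e/2"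
    by auto
  have "L2_norm M (\<lambda>x. F m x - F n x) < e" if "m \<ge> K" "n \<ge> K" for m n
    using L2_norm_triangle_diff[OF F(1)[of m] F(2) F(1)[of n]] K[OF that(1)] K[OF that(2)]
      L2_norm_minus_commute[of M f "F n"] by simp
  then show "\<exists>K. \<forall>m\<ge>K. \<forall>n\<ge>K. L2_norm M (\<lambda>x. F m x - F n x) < e" by blast
qed

lemma L2_Cauchy_isometry:
  assumes "L2_Cauchy M F"
    and "\<And>m n. L2_norm M' (\<lambda>x. G m x - G n x) = L2_norm M (\<lambda>x. F m x - F n x)"
  shows "L2_Cauchy M' G"
  using assms by (simp add: L2_Cauchy_def)

text \<open>The majorant is for the difference \<open>F n - f\<close>: for truncations it is |f|,
  for simple approximations 3|f|.\<close>

lemma L2_dominated_convergence: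
  assumes g: "integrable M (\<lambda>x. (g x)\<^sup>2)" and [measurable]: "\<And>n. F n \<in> borel_measurable M" "f \<in> borel_measurable M"
    and lim: "AE x in M. (\<lambda>n. F n x) \<longlonglongrightarrow> f x"
    and bound: "\<And>n x. x \<in> space M \<Longrightarrow> cmod (F n x - f x) \<le> g x"
  shows "(\<lambda>n. L2_norm M (\<lambda>x. F n x - f x)) \<longlonglongrightarrow> 0"
proof -
  have "(\<lambda>n. \<integral>x. (cmod (F n x - f x))\<^sup>2 \<partial>M) \<longlonglongrightarrow> (\<integral>x. 0 \<partial>M)"
  proof (rule integral_dominated_convergence[OF _ _ g])
    show "AE x in M. (\<lambda>n. (cmod (F n x - f x))\<^sup>2) \<longlonglongrightarrow> 0"
      using lim
    proof eventually_elim
      case (elim x)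
      have "(\<lambda>n. (cmod (F n x - f x))\<^sup>2) \<longlonglongrightarrow> (cmod (f x - f x))\<^sup>2"
        by (intro tendsto_intros elim)
      then show ?case by simp
    qed
    show "AE x in M. norm ((cmod (F n x - f x))\<^sup>2) \<le> (g x)\<^sup>2" for n
      using power_mono[OF bound, of _ n 2] by auto
  qed measurable
  then have "(\<lambda>n. sqrt (\<integral>x. (cmod (F n x - f x))\<^sup>2 \<partial>M)) \<longlonglongrightarrow> sqrt 0"
    by (intro tendsto_intros) simp
  then show ?thesis by (simp add: L2_norm_def)
qed

text \<open>Used for the bands |x| <= n in space and for the balls |\<xi>| <= n in
  frequency.\<close>

lemma L2_truncation_tendsto:
  assumes f: "sq_integrable M f" and [measurable]: "\<And>n. Measurable.pred M (P n)"
    and P: "\<And>x. x \<in> space M \<Longrightarrow> \<forall>\<^sub>F n in sequentially. P n x"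
  shows "(\<lambda>n. L2_norm M (\<lambda>x. (if P n x then f x else 0) - f x)) \<longlonglongrightarrow> 0"
proof (rule L2_dominated_convergence)
  have [measurable]: "f \<in> borel_measurable M" using f by (auto simp: sq_integrable_def)
  show "integrable M (\<lambda>x. (cmod (f x))\<^sup>2)" using f by (simp add: sq_integrable_def)
  show "AE x in M. (\<lambda>n. if P n x then f x else 0) \<longlonglongrightarrow> f x"
    by (rule AE_I2, rule tendsto_eventually, drule P, erule eventually_mono) simp
  show "(\<lambda>x. if P n x then f x else 0) \<in> borel_measurable M" for n by measurable
  show "f \<in> borel_measurable M" by measurable
qed auto

lemma sq_integrable_truncation:
  assumes f: "sq_integrable M f" and [measurable]: "Measurable.pred M P"
  shows "sq_integrable M (\<lambda>x. if P x then f x else 0)"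
  by (rule sq_integrable_dominated[OF f, where C=1]) (use f in \<open>auto simp: sq_integrable_def\<close>)

section \<open>Plancherel on the real line\<close>

text \<open>Supplies the integrability premise of Fubini whenever a product f(x) g(y) is multiplied
  by a character.\<close>

lemma (in pair_sigma_finite) integrable_pair_product:
  fixes f :: "_ \<Rightarrow> complex"
  assumes f: "integrable M1 f" and g: "integrable M2 g"
    and [measurable]: "case_prod k \<in> borel_measurable (M1 \<Otimes>\<^sub>M M2)" and k: "\<And>x y. cmod (k x y) \<le> 1"
  shows "integrable (M1 \<Otimes>\<^sub>M M2) (\<lambda>(x, y). f x * g y * k x y)"
proof (rule integrableI_bounded)
  have [measurable]: "f \<in> borel_measurable M1" "g \<in> borel_measurable M2" using f g by auto
  show "(\<lambda>(x, y). f x * g y * k x y) \<in> borel_measurable (M1 \<Otimes>\<^sub>M M2)" by measurable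
  have "(\<integral>\<^sup>+z. ennreal (norm (case z of (x, y) \<Rightarrow> f x * g y * k x y)) \<partial>(M1 \<Otimes>\<^sub>M M2))
      = (\<integral>\<^sup>+x. \<integral>\<^sup>+y. ennreal (norm (f x * g y * k x y)) \<partial>M2 \<partial>M1)"
    by (subst M2.nn_integral_fst[symmetric]) auto
  also have "\<dots> \<le> (\<integral>\<^sup>+x. \<integral>\<^sup>+y. ennreal (norm (f x)) * ennreal (norm (g y)) \<partial>M2 \<partial>M1)"
    using mult_left_mono[OF k, of "norm (f _ * g _)"]
    by (intro nn_integral_mono) (simp add: norm_mult ennreal_mult[symmetric] mult_ac)
  also have "\<dots> = (\<integral>\<^sup>+x. ennreal (norm (f x)) \<partial>M1) * (\<integral>\<^sup>+y. ennreal (norm (g y)) \<partial>M2)"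
    by (simp add: nn_integral_cmult nn_integral_multc)
  also have "\<dots> < \<infinity>"
    using f g unfolding integrable_iff_bounded by (simp add: ennreal_mult_less_top)
  finally show "(\<integral>\<^sup>+z. ennreal (norm (case z of (x, y) \<Rightarrow> f x * g y * k x y)) \<partial>(M1 \<Otimes>\<^sub>M M2)) < \<infinity>" .
qed

section \<open>Continuity of translations in L^2\<close>

lemma L2_norm_translate:
  fixes f :: "real \<Rightarrow> complex"
  shows "L2_norm lborel (\<lambda>x. f (x + y)) = L2_norm lborel f"
  unfolding L2_norm_def
  using lborel_integral_real_affine[of 1 "\<lambda>x. (cmod (f x))\<^sup>2" y] by (simp add: add.commute)

lemma sq_integrable_translate:
  fixes f :: "real \<Rightarrow> complex"
  assumes "sq_integrable lborel f"
  shows "sq_integrable lborel (\<lambda>x. f (x + y))"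
proof -
  have [measurable]: "f \<in> borel_measurable borel" using assms by (simp add: sq_integrable_def)
  have "integrable lborel (\<lambda>x. (cmod (f (y + 1 * x)))\<^sup>2)"
    by (rule lborel_integrable_real_affine) (use assms in \<open>auto simp: sq_integrable_def\<close>)
  then show ?thesis by (simp add: sq_integrable_def add.commute)
qed

text \<open>Sequential, because dominated convergence is. The property is passed from open sets to
  Borel sets by regularity, to simple functions by linearity, and to all of L^2 by density.\<close>

definition L2_translation_continuous :: "(real \<Rightarrow> complex) \<Rightarrow> bool" where
  "L2_translation_continuous f \<longleftrightarrow> sq_integrable lborel f \<and>
     (\<forall>y. y \<longlonglongrightarrow> 0 \<longrightarrow> (\<lambda>n::nat. L2_norm lborel (\<lambda>x. f (x + y n) - f x)) \<longlonglongrightarrow> 0)"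

text \<open>Translation is an isometry of L^2, so an approximation of f within e/3 also approximates
  all its translates within e/3.\<close>

lemma L2_translation_continuous_closed:
  assumes f: "sq_integrable lborel f"
    and approx: "\<And>e. e > 0 \<Longrightarrow> \<exists>g. L2_translation_continuous g \<and> L2_norm lborel (\<lambda>x. f x - g x) < e"
  shows "L2_translation_continuous f"
  unfolding L2_translation_continuous_def
proof (intro conjI allI impI f LIMSEQ_I)
  fix y :: "nat \<Rightarrow> real" and e :: real assume y: "y \<longlonglongrightarrow> 0" and e: "0 < e"
  obtain g where g: "L2_translation_continuous g" and fg: "L2_norm lborel (\<lambda>x. f x - g x) < e/3"
    using approx[of "e/3"] e by auto
  have g2: "sq_integrable lborel g" using g by (simp add: L2_translation_continuous_def)
  obtain K where K: "\<And>n. n \<ge> K \<Longrightarrow> L2_norm lborel (\<lambda>x. g (x + y n) - g x) < e/3"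
    using g y e LIMSEQ_D[of "\<lambda>n. L2_norm lborel (\<lambda>x. g (x + y n) - g x)" 0 "e/3"]
    by (auto simp: L2_translation_continuous_def)
  have "L2_norm lborel (\<lambda>x. f (x + y n) - f x) < e" if "n \<ge> K" for n
  proof -
    have "L2_norm lborel (\<lambda>x. f (x + y n) - f x) \<le>
        L2_norm lborel (\<lambda>x. f (x + y n) - g (x + y n)) + L2_norm lborel (\<lambda>x. g (x + y n) - f x)"
      by (intro L2_norm_triangle_diff sq_integrable_translate f g2)
    also have "\<dots> \<le> L2_norm lborel (\<lambda>x. f (x + y n) - g (x + y n)) +
        (L2_norm lborel (\<lambda>x. g (x + y n) - g x) + L2_norm lborel (\<lambda>x. g x - f x))"
      by (intro add_left_mono L2_norm_triangle_diff sq_integrable_translate f g2)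
    also have "L2_norm lborel (\<lambda>x. f (x + y n) - g (x + y n)) = L2_norm lborel (\<lambda>x. f x - g x)"
      by (rule L2_norm_translate)
    also have "L2_norm lborel (\<lambda>x. g x - f x) = L2_norm lborel (\<lambda>x. f x - g x)"
      by (rule L2_norm_minus_commute)
    finally show ?thesis using fg K[OF that] by linarith
  qed
  then show "\<exists>no. \<forall>n\<ge>no. norm (L2_norm lborel (\<lambda>x. f (x + y n) - f x) - 0) < e" by auto
qed

lemma sq_integrable_indicator:
  assumes [measurable]: "A \<in> sets M" and "emeasure M A < \<infinity>"
  shows "sq_integrable M (indicator A)"
proof -
  have "integrable M (indicator A :: _ \<Rightarrow> real)"
    using assms by (intro integrable_real_indicator) auto
  moreover have "(cmod (indicator A x))\<^sup>2 = indicator A x" for x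
    by (simp add: indicator_def)
  ultimately show ?thesis by (simp add: sq_integrable_def)
qed

text \<open>The squared distance is 2|U| minus twice the measure of the overlap of U with its
  translate. Openness makes the overlap integrand converge at points of U; at other points the
  factor \<open>?I x\<close> is 0.\<close>

lemma L2_translation_continuous_open:
  assumes U: "open U" and fin: "emeasure lborel U < \<infinity>"
  shows "L2_translation_continuous (indicator U)"
proof -
  have [measurable]: "U \<in> sets borel" using U by simp
  have int: "integrable lborel (indicator U :: real \<Rightarrow> real)"
    using fin by (intro integrable_real_indicator) auto
  have sq: "sq_integrable lborel (indicator U)"
    using fin by (intro sq_integrable_indicator) auto
  have "(\<lambda>n. L2_norm lborel (\<lambda>x. indicator U (x + y n) - indicator U x)) \<longlonglongrightarrow> 0" if y: "y \<longlonglongrightarrow> 0" for y :: "nat \<Rightarrow> real"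
  proof -
    let ?I = "indicator U :: real \<Rightarrow> real"
    have intt: "integrable lborel (\<lambda>x. ?I (x + t))" for t
      using lborel_integrable_real_affine[OF int, of 1 t] by (simp add: add.commute)
    have intp: "integrable lborel (\<lambda>x. ?I x * ?I (x + t))" for t
      by (rule Bochner_Integration.integrable_bound[OF int]) (auto simp: indicator_def)
    have "(\<lambda>n. \<integral>x. ?I x * ?I (x + y n) \<partial>lborel) \<longlonglongrightarrow> (\<integral>x. ?I x \<partial>lborel)"
    proof (rule integral_dominated_convergence[OF _ _ int])
      show "AE x in lborel. (\<lambda>n. ?I x * ?I (x + y n)) \<longlonglongrightarrow> ?I x"
      proof (rule AE_I2)
        fix x
        show "(\<lambda>n. ?I x * ?I (x + y n)) \<longlonglongrightarrow> ?I x"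
        proof (cases "x \<in> U")
          case True
          have "(\<lambda>n. x + y n) \<longlonglongrightarrow> x" using tendsto_add[OF tendsto_const[of x] y] by simp
          from topological_tendstoD[OF this U True]
          have "\<forall>\<^sub>F n in sequentially. ?I x * ?I (x + y n) = ?I x"
            by eventually_elim (simp add: True)
          then show ?thesis by (rule tendsto_eventually)
        qed simp
      qed
    qed (auto simp: indicator_def)
    then have "(\<lambda>n. 2 * (\<integral>x. ?I x \<partial>lborel) - 2 * (\<integral>x. ?I x * ?I (x + y n) \<partial>lborel)) \<longlonglongrightarrow>
        2 * (\<integral>x. ?I x \<partial>lborel) - 2 * (\<integral>x. ?I x \<partial>lborel)"
      by (intro tendsto_intros)
    moreover have "(\<integral>x. (cmod (indicator U (x + t) - indicator U x))\<^sup>2 \<partial>lborel)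
        = 2 * (\<integral>x. ?I x \<partial>lborel) - 2 * (\<integral>x. ?I x * ?I (x + t) \<partial>lborel)" for t
    proof -
      have "(\<integral>x. (cmod (indicator U (x + t) - indicator U x))\<^sup>2 \<partial>lborel)
          = (\<integral>x. ?I (x + t) + ?I x - 2 * (?I x * ?I (x + t)) \<partial>lborel)"
        by (intro Bochner_Integration.integral_cong) (auto simp: indicator_def)
      also have "\<dots> = (\<integral>x. ?I (x + t) \<partial>lborel) + (\<integral>x. ?I x \<partial>lborel) - 2 * (\<integral>x. ?I x * ?I (x + t) \<partial>lborel)"
        using intt int intp by simp
      also have "(\<integral>x. ?I (x + t) \<partial>lborel) = (\<integral>x. ?I x \<partial>lborel)"
        using lborel_integral_real_affine[of 1 ?I t] by (simp add: add.commute)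
      finally show ?thesis by simp
    qed
    ultimately have "(\<lambda>n. \<integral>x. (cmod (indicator U (x + y n) - indicator U x))\<^sup>2 \<partial>lborel) \<longlonglongrightarrow> 0"
      by simp
    from tendsto_real_sqrt[OF this] show ?thesis by (simp add: L2_norm_def)
  qed
  with sq show ?thesis by (auto simp: L2_translation_continuous_def)
qed

lemma L2_translation_continuous_indicator:
  assumes [measurable]: "A \<in> sets borel" and fin: "emeasure lborel A < \<infinity>"
  shows "L2_translation_continuous (indicator A)"
proof (rule L2_translation_continuous_closed)
  show "sq_integrable lborel (indicator A)" using fin by (intro sq_integrable_indicator) auto
  fix e :: real assume e: "e > 0"
  \<comment> \<open>The square converts measure into L^2 norm: the indicators differ on U - A, so
    their distance is at most e/2 < e.\<close>
  obtain U where U: "open U" "A \<subseteq> U" "emeasure lborel (U - A) < ennreal ((e/2)\<^sup>2)"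
    by (rule outer_regular_lborel[of A "(e/2)\<^sup>2"]) (use e in auto)
  have [measurable]: "U \<in> sets borel" using U by simp
  have "emeasure lborel U \<le> emeasure lborel A + emeasure lborel (U - A)"
    using emeasure_subadditive[of A lborel "U - A"] U(2) by (simp add: Un_absorb1)
  also have "\<dots> < \<infinity>" using fin U(3) by (simp add: less_top[symmetric]) auto
  finally have "L2_translation_continuous (indicator U)" by (rule L2_translation_continuous_open[OF U(1)])
  moreover have "L2_norm lborel (\<lambda>x. indicator A x - indicator U x) \<le> e/2"
  proof (rule L2_norm_le)
    have "(\<integral>\<^sup>+x. ennreal ((cmod (indicator A x - indicator U x))\<^sup>2) \<partial>lborel) = (\<integral>\<^sup>+x. indicator (U - A) x \<partial>lborel)"
      using U(2) by (intro nn_integral_cong) (auto simp: indicator_def)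
    also have "\<dots> \<le> ennreal ((e/2)\<^sup>2)" using U(3) by simp
    finally show "(\<integral>\<^sup>+x. ennreal ((cmod (indicator A x - indicator U x))\<^sup>2) \<partial>lborel) \<le> ennreal ((e/2)\<^sup>2)" .
  qed (use e in auto)
  ultimately show "\<exists>g. L2_translation_continuous g \<and> L2_norm lborel (\<lambda>x. indicator A x - g x) < e"
    using e by (intro exI[of _ "indicator U"]) auto
qed

lemma L2_translation_continuous_add:
  assumes f: "L2_translation_continuous f" and g: "L2_translation_continuous g"
  shows "L2_translation_continuous (\<lambda>x. f x + g x)"
  unfolding L2_translation_continuous_def
proof (intro conjI allI impI)
  have f2: "sq_integrable lborel f" and g2: "sq_integrable lborel g"
    using f g by (auto simp: L2_translation_continuous_def)
  show "sq_integrable lborel (\<lambda>x. f x + g x)" by (intro sq_integrable_add f2 g2)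
  fix y :: "nat \<Rightarrow> real" assume y: "y \<longlonglongrightarrow> 0"
  show "(\<lambda>n. L2_norm lborel (\<lambda>x. f (x + y n) + g (x + y n) - (f x + g x))) \<longlonglongrightarrow> 0"
  proof (rule tendsto_sandwich[OF _ _ tendsto_const])
    show "(\<lambda>n. L2_norm lborel (\<lambda>x. f (x + y n) - f x) + L2_norm lborel (\<lambda>x. g (x + y n) - g x)) \<longlonglongrightarrow> 0"
      using f g y tendsto_add[of "\<lambda>n. L2_norm lborel (\<lambda>x. f (x + y n) - f x)" 0 sequentially] by (fastforce simp: L2_translation_continuous_def)
    have "L2_norm lborel (\<lambda>x. f (x + y n) + g (x + y n) - (f x + g x)) \<le>
        L2_norm lborel (\<lambda>x. f (x + y n) - f x) + L2_norm lborel (\<lambda>x. g (x + y n) - g x)" for n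
      using L2_norm_triangle[OF sq_integrable_diff[OF sq_integrable_translate[OF f2] f2] sq_integrable_diff[OF sq_integrable_translate[OF g2] g2],
        of "y n" "y n"] by (simp add: algebra_simps)
    then show "\<forall>\<^sub>F n in sequentially. L2_norm lborel (\<lambda>x. f (x + y n) + g (x + y n) - (f x + g x)) \<le>
        L2_norm lborel (\<lambda>x. f (x + y n) - f x) + L2_norm lborel (\<lambda>x. g (x + y n) - g x)" by simp
  qed simp
qed

lemma L2_translation_continuous_cmult:
  assumes f: "L2_translation_continuous f"
  shows "L2_translation_continuous (\<lambda>x. c * f x)"
proof -
  have "(\<lambda>n. cmod c * L2_norm lborel (\<lambda>x. f (x + y n) - f x)) \<longlonglongrightarrow> 0" if "y \<longlonglongrightarrow> 0" for y :: "nat \<Rightarrow> real"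
    using f that by (intro tendsto_mult_right_zero) (auto simp: L2_translation_continuous_def)
  then show ?thesis
    using f by (simp add: L2_translation_continuous_def sq_integrable_cmult right_diff_distrib[symmetric] L2_norm_cmult)
qed

lemma L2_translation_continuous_sum:
  assumes "\<And>i. i \<in> I \<Longrightarrow> L2_translation_continuous (f i)"
  shows "L2_translation_continuous (\<lambda>x. \<Sum>i\<in>I. f i x)"
  using assms
proof (induction I rule: infinite_finite_induct)
  case (insert i I)
  then show ?case by (auto intro: L2_translation_continuous_add)
qed (auto simp: L2_translation_continuous_def L2_norm_def)

lemma sq_integrable_translation_continuous:
  assumes f: "sq_integrable lborel f"
  shows "L2_translation_continuous f"
proof (rule L2_translation_continuous_closed[OF f])
  fix e :: real assume e: "e > 0"
  have [measurable]: "f \<in> borel_measurable lborel" using f by (simp add: sq_integrable_def)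
  obtain F where F: "\<And>i. simple_function lborel (F i)" "\<And>x. (\<lambda>i. F i x) \<longlonglongrightarrow> f x"
    "\<And>i x. cmod (F i x) \<le> 2 * cmod (f x)"
    using borel_measurable_implies_sequence_metric[of f lborel 0] by (auto simp: dist_norm)
  have [measurable]: "F i \<in> borel_measurable lborel" for i
    using F(1) by (rule borel_measurable_simple_function)
  have "(\<lambda>i. L2_norm lborel (\<lambda>x. F i x - f x)) \<longlonglongrightarrow> 0"
  proof (rule L2_dominated_convergence)
    show "integrable lborel (\<lambda>x. (3 * cmod (f x))\<^sup>2)"
      using f by (simp add: sq_integrable_def power_mult_distrib)
    show "cmod (F n x - f x) \<le> 3 * cmod (f x)" for n x
      using norm_triangle_ineq4[of "F n x" "f x"] F(3)[of n x] by linarith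
  qed (use F(2) in auto)
  from LIMSEQ_D[OF this e] obtain i where i: "L2_norm lborel (\<lambda>x. F i x - f x) < e" by auto
  have "L2_translation_continuous (\<lambda>x. \<Sum>c\<in>range (F i). c * indicator (F i -` {c}) x)"
  proof (rule L2_translation_continuous_sum)
    fix c assume "c \<in> range (F i)"
    have [measurable]: "F i -` {c} \<in> sets borel"
      using simple_functionD(2)[OF F(1), of i "{c}"] by simp
    show "L2_translation_continuous (\<lambda>x. c * indicator (F i -` {c}) x)"
    proof (cases "c = 0")
      case False
      \<comment> \<open>Chebyshev: on the level set of c the bound |F i| <= 2|f| gives |c|^2 <=
        4|f|^2, so the level set has finite measure. For c = 0 the term vanishes, whatever the
        measure of its level set.\<close>
      have "integrable lborel (\<lambda>x. (4 / (cmod c)\<^sup>2) * (cmod (f x))\<^sup>2)"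
        using f by (simp add: sq_integrable_def)
      then have "integrable lborel (indicator (F i -` {c}) :: real \<Rightarrow> real)"
      proof (rule Bochner_Integration.integrable_bound)
        have "(cmod c)\<^sup>2 \<le> 4 * (cmod (f x))\<^sup>2" if "F i x = c" for x
          using power_mono[OF F(3)[of i x], of 2] that by (simp add: power_mult_distrib)
        then show "AE x in lborel. norm (indicator (F i -` {c}) x :: real) \<le> norm ((4 / (cmod c)\<^sup>2) * (cmod (f x))\<^sup>2)"
          using False by (auto simp: indicator_def field_simps)
      qed auto
      then have "emeasure lborel (F i -` {c}) < \<infinity>"
        by (subst (asm) integrable_indicator_iff) auto
      then show ?thesis
        by (intro L2_translation_continuous_cmult L2_translation_continuous_indicator) auto
    qed (auto simp: L2_translation_continuous_def L2_norm_def)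
  qed
  also have "(\<lambda>x. \<Sum>c\<in>range (F i). c * indicator (F i -` {c}) x) = F i"
  proof (rule ext)
    fix x
    have "F i x = (\<Sum>c\<in>range (F i). indicator (F i -` {c}) x *\<^sub>R c)"
      by (rule simple_function_indicator_representation_banach[OF F(1)[of i], of x, unfolded space_lborel space_borel Int_UNIV_right, OF UNIV_I])
    also have "\<dots> = (\<Sum>c\<in>range (F i). c * indicator (F i -` {c}) x)"
      by (intro sum.cong) (auto simp: indicator_def)
    finally show "(\<Sum>c\<in>range (F i). c * indicator (F i -` {c}) x) = F i x" ..
  qed
  finally show "\<exists>g. L2_translation_continuous g \<and> L2_norm lborel (\<lambda>x. f x - g x) < e"
    using i L2_norm_minus_commute[of lborel f "F i"] by auto
qed

text \<open>Without normalising factor, so that one function serves the line, with Plancherel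
  constant 2 pi, and, sampled at k/\<lambda>, the circle, with Parseval constant 2 pi
  \<lambda>.\<close>

definition ft :: "(real \<Rightarrow> complex) \<Rightarrow> real \<Rightarrow> complex" where
  "ft f \<mu> = (\<integral>x. f x * exp (- \<i> * complex_of_real (x * \<mu>)) \<partial>lborel)"

text \<open>Stated for families, as the transform in x of a function of (x, y) must be jointly
  measurable.\<close>

lemma measurable_ft [measurable (raw)]:
  assumes "case_prod f \<in> borel_measurable (M \<Otimes>\<^sub>M borel)" "g \<in> borel_measurable M"
  shows "(\<lambda>x. ft (f x) (g x)) \<in> borel_measurable M"
proof -
  have [measurable]: "case_prod f \<in> borel_measurable (M \<Otimes>\<^sub>M lborel)" "g \<in> borel_measurable M" using assms by auto
  show ?thesis unfolding ft_def by measurable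
qed

lemma ft_integrable:
  assumes "integrable lborel f"
  shows "integrable lborel (\<lambda>x. f x * exp (- \<i> * complex_of_real (x * \<mu>)))"
  by (rule Bochner_Integration.integrable_bound[OF assms]) (use assms in \<open>auto simp: norm_mult\<close>)

lemma cmod_ft_le:
  assumes "integrable lborel f"
  shows "cmod (ft f \<mu>) \<le> (\<integral>x. cmod (f x) \<partial>lborel)"
  using integral_norm_bound[of lborel "\<lambda>x. f x * exp (- \<i> * complex_of_real (x * \<mu>))"]
  by (simp add: ft_def norm_mult)

text \<open>Both sides are the double integral of f(x) g(\<mu>) exp(-i x \<mu>).\<close>

lemma ft_mult_formula:
  assumes f: "integrable lborel f" and g: "integrable lborel g"
  shows "(\<integral>\<mu>. ft f \<mu> * g \<mu> \<partial>lborel) = (\<integral>x. f x * ft g x \<partial>lborel)"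
proof -
  have [measurable]: "f \<in> borel_measurable borel" "g \<in> borel_measurable borel" using f g by auto
  have "integrable (lborel \<Otimes>\<^sub>M lborel) (\<lambda>(x, \<mu>). f x * g \<mu> * exp (- \<i> * complex_of_real (x * \<mu>)))"
    by (intro lborel_pair.integrable_pair_product f g) auto
  from lborel_pair.Fubini_integral[OF this]
  have "(\<integral>\<mu>. \<integral>x. f x * g \<mu> * exp (- \<i> * complex_of_real (x * \<mu>)) \<partial>lborel \<partial>lborel)
      = (\<integral>x. \<integral>\<mu>. f x * g \<mu> * exp (- \<i> * complex_of_real (x * \<mu>)) \<partial>lborel \<partial>lborel)" .
  also have "(\<lambda>\<mu>. \<integral>x. f x * g \<mu> * exp (- \<i> * complex_of_real (x * \<mu>)) \<partial>lborel) = (\<lambda>\<mu>. ft f \<mu> * g \<mu>)"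
    unfolding ft_def by (intro ext, subst integral_mult_left_zero[symmetric]) (simp add: mult_ac)
  also have "(\<lambda>x. \<integral>\<mu>. f x * g \<mu> * exp (- \<i> * complex_of_real (x * \<mu>)) \<partial>lborel) = (\<lambda>x. f x * ft g x)"
    unfolding ft_def by (intro ext, subst integral_mult_right_zero[symmetric]) (simp add: mult_ac)
  finally show ?thesis .
qed

text \<open>Convolution of f with its reflected conjugate: its transform is |ft f|^2 and its value
  at 0 is the squared norm of f, so Plancherel is the inversion formula for it at the single point
  0.\<close>

definition autocorrelation :: "(real \<Rightarrow> complex) \<Rightarrow> real \<Rightarrow> complex" where
  "autocorrelation f y = (\<integral>x. f (x + y) * cnj (f x) \<partial>lborel)"

lemma autocorrelation_integrable_pair:
  fixes f :: "real \<Rightarrow> complex"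
  assumes f: "integrable lborel f"
  shows "integrable (lborel \<Otimes>\<^sub>M lborel) (\<lambda>(y, x). f (x + y) * cnj (f x))"
proof (rule integrableI_bounded)
  have [measurable]: "f \<in> borel_measurable borel" using f by auto
  show "(\<lambda>(y, x). f (x + y) * cnj (f x)) \<in> borel_measurable (lborel \<Otimes>\<^sub>M lborel)" by measurable
  have "(\<integral>\<^sup>+z. ennreal (norm (case z of (y, x) \<Rightarrow> f (x + y) * cnj (f x))) \<partial>(lborel \<Otimes>\<^sub>M lborel))
      = (\<integral>\<^sup>+x. \<integral>\<^sup>+y. ennreal (norm (f (x + y) * cnj (f x))) \<partial>lborel \<partial>lborel)"
    by (subst lborel_pair.nn_integral_snd[symmetric]) (auto simp: split_beta')
  also have "\<dots> = (\<integral>\<^sup>+x. (\<integral>\<^sup>+y. ennreal (norm (f y)) \<partial>lborel) * ennreal (norm (f x)) \<partial>lborel)"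
  proof (rule nn_integral_cong)
    fix x
    have "(\<integral>\<^sup>+y. ennreal (norm (f (x + y) * cnj (f x))) \<partial>lborel) = (\<integral>\<^sup>+y. ennreal (norm (f (x + y))) \<partial>lborel) * ennreal (norm (f x))"
      by (subst nn_integral_multc[symmetric]) (auto simp: norm_mult ennreal_mult)
    also have "(\<integral>\<^sup>+y. ennreal (norm (f (x + y))) \<partial>lborel) = (\<integral>\<^sup>+y. ennreal (norm (f y)) \<partial>lborel)"
      using nn_integral_real_affine[of "\<lambda>x. ennreal (norm (f x))" 1 x] by simp
    finally show "(\<integral>\<^sup>+y. ennreal (norm (f (x + y) * cnj (f x))) \<partial>lborel) = (\<integral>\<^sup>+y. ennreal (norm (f y)) \<partial>lborel) * ennreal (norm (f x))" .
  qed
  also have "\<dots> = (\<integral>\<^sup>+y. ennreal (norm (f y)) \<partial>lborel) * (\<integral>\<^sup>+y. ennreal (norm (f y)) \<partial>lborel)"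
    by (rule nn_integral_cmult) auto
  also have "\<dots> < \<infinity>"
    using f unfolding integrable_iff_bounded by (simp add: ennreal_mult_less_top)
  finally show "(\<integral>\<^sup>+z. ennreal (norm (case z of (y, x) \<Rightarrow> f (x + y) * cnj (f x))) \<partial>(lborel \<Otimes>\<^sub>M lborel)) < \<infinity>" .
qed

lemma autocorrelation_integrable:
  assumes f: "integrable lborel f"
  shows "integrable lborel (autocorrelation f)"
  unfolding autocorrelation_def[abs_def]
  by (rule lborel_pair.integrable_fst) (rule autocorrelation_integrable_pair[OF f])

text \<open>Fubini and the substitution x + y: the exponential at y is the one at x + y times the
  conjugate of the one at x, and the two integrals separate.\<close>

lemma ft_autocorrelation:
  assumes f: "integrable lborel f"
  shows "ft (autocorrelation f) \<mu> = complex_of_real ((cmod (ft f \<mu>))\<^sup>2)"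
proof -
  have [measurable]: "f \<in> borel_measurable borel" using f by auto
  let ?e = "\<lambda>t. exp (- \<i> * complex_of_real (t * \<mu>))"
  have int: "integrable (lborel \<Otimes>\<^sub>M lborel) (\<lambda>(y, x). f (x + y) * cnj (f x) * ?e y)"
    by (rule Bochner_Integration.integrable_bound[OF autocorrelation_integrable_pair[OF f]])
       (auto simp: norm_mult)
  have "ft (autocorrelation f) \<mu> = (\<integral>y. \<integral>x. f (x + y) * cnj (f x) * ?e y \<partial>lborel \<partial>lborel)"
    unfolding ft_def autocorrelation_def by simp
  also have "\<dots> = (\<integral>x. \<integral>y. f (x + y) * cnj (f x) * ?e y \<partial>lborel \<partial>lborel)"
    using lborel_pair.Fubini_integral[OF int] by simp
  also have "\<dots> = (\<integral>x. ft f \<mu> * cnj (f x * ?e x) \<partial>lborel)"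
  proof (rule Bochner_Integration.integral_cong[OF refl])
    fix x
    have "(\<integral>y. f (x + y) * cnj (f x) * ?e y \<partial>lborel) = (\<integral>y. f (x + y) * ?e (x + y) * cnj (f x * ?e x) \<partial>lborel)"
      by (intro Bochner_Integration.integral_cong refl)
         (simp add: exp_cnj mult_ac exp_add[symmetric], simp add: algebra_simps)
    also have "\<dots> = (\<integral>y. f (x + y) * ?e (x + y) \<partial>lborel) * cnj (f x * ?e x)"
      by (rule integral_mult_left_zero)
    also have "(\<integral>y. f (x + y) * ?e (x + y) \<partial>lborel) = ft f \<mu>"
      unfolding ft_def by (subst lborel_integral_real_affine[of 1 _ x]) auto
    finally show "(\<integral>y. f (x + y) * cnj (f x) * ?e y \<partial>lborel) = ft f \<mu> * cnj (f x * ?e x)" .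
  qed
  also have "\<dots> = ft f \<mu> * cnj (ft f \<mu>)"
    unfolding ft_def Bochner_Integration.integral_cnj[symmetric] by (rule integral_mult_right_zero)
  finally show ?thesis by (simp add: complex_norm_square del: of_real_power)
qed

text \<open>Continuity at 0 comes from continuity of translations, and it is all that the Gaussian
  means require in the limit.\<close>

lemma autocorrelation_tendsto:
  assumes f: "sq_integrable lborel f" and y: "y \<longlonglongrightarrow> 0"
  shows "(\<lambda>n. autocorrelation f (y n)) \<longlonglongrightarrow> autocorrelation f 0"
proof -
  have "(\<lambda>n. L2_norm lborel (\<lambda>x. f (x + y n) - f x)) \<longlonglongrightarrow> 0"
    using sq_integrable_translation_continuous[OF f] y by (simp add: L2_translation_continuous_def)
  from L2_inner_tendsto[OF sq_integrable_translate[OF f] f sq_integrable_cnj[OF f] this]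
  show ?thesis by (simp add: autocorrelation_def)
qed

lemma cmod_autocorrelation_le:
  assumes f: "sq_integrable lborel f"
  shows "cmod (autocorrelation f y) \<le> (L2_norm lborel f)\<^sup>2"
proof -
  have "cmod (autocorrelation f y) \<le> L2_norm lborel (\<lambda>x. f (x + y)) * L2_norm lborel (\<lambda>x. cnj (f x))"
    unfolding autocorrelation_def by (intro Cauchy_Schwarz_L2 sq_integrable_translate sq_integrable_cnj f)
  then show ?thesis by (simp add: L2_norm_translate power2_eq_square) (simp add: L2_norm_def)
qed

lemma autocorrelation_0: "autocorrelation f 0 = complex_of_real ((L2_norm lborel f)\<^sup>2)"
proof -
  have "autocorrelation f 0 = (\<integral>x. complex_of_real ((cmod (f x))\<^sup>2) \<partial>lborel)"
    unfolding autocorrelation_def by (simp add: complex_norm_square del: of_real_power)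
  then show ?thesis by (simp only: integral_complex_of_real L2_norm_power2)
qed

text \<open>The integral is the characteristic function of the standard normal law at -y/d,
  rescaled.\<close>

lemma ft_std_normal_density:
  assumes d: "d > 0"
  shows "ft (\<lambda>\<mu>. complex_of_real (std_normal_density (d * \<mu>))) y = complex_of_real (exp (- (y / d)\<^sup>2 / 2) / d)"
proof -
  let ?g = "\<lambda>t. complex_of_real (std_normal_density t) * exp (- \<i> * complex_of_real (t * (y / d)))"
  have "complex_of_real (exp (- (- (y/d))\<^sup>2 / 2)) = char std_normal_distribution (- (y / d))"
    by (simp add: char_std_normal_distribution)
  also have "\<dots> = (\<integral>t. ?g t \<partial>lborel)"
    unfolding char_def
    by (subst integral_density) (auto simp: scaleR_conv_of_real mult_ac intro!: Bochner_Integration.integral_cong)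
  also have "\<dots> = d * (\<integral>\<mu>. ?g (d * \<mu>) \<partial>lborel)"
    using lborel_integral_real_affine[of d ?g 0] d by (simp add: scaleR_conv_of_real)
  also have "(\<integral>\<mu>. ?g (d * \<mu>) \<partial>lborel) = ft (\<lambda>\<mu>. complex_of_real (std_normal_density (d * \<mu>))) y"
    unfolding ft_def using d by (intro Bochner_Integration.integral_cong) (auto simp: field_simps)
  finally show ?thesis using d by (simp add: field_simps)
qed

text \<open>The multiplication formula moves the transform onto the Gaussian; the substitution y = d
  t then puts the parameter into the argument of the autocorrelation, where the limit d -> 0 can be
  taken under the integral.\<close>

lemma ft_gaussian_mean:
  assumes f: "integrable lborel f" and d: "d > 0"
  shows "(\<integral>\<mu>. complex_of_real ((cmod (ft f \<mu>))\<^sup>2 * std_normal_density (d * \<mu>)) \<partial>lborel)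
    = sqrt (2 * pi) * (\<integral>t. autocorrelation f (d * t) * complex_of_real (std_normal_density t) \<partial>lborel)"
proof -
  have [measurable]: "f \<in> borel_measurable borel" using f by auto
  have int: "integrable lborel (\<lambda>\<mu>. complex_of_real (std_normal_density (d * \<mu>)))"
    using lborel_integrable_real_affine[OF integrable_normal_density[of 1 0], of d 0] d by simp
  have "(\<integral>\<mu>. complex_of_real ((cmod (ft f \<mu>))\<^sup>2 * std_normal_density (d * \<mu>)) \<partial>lborel)
      = (\<integral>\<mu>. ft (autocorrelation f) \<mu> * complex_of_real (std_normal_density (d * \<mu>)) \<partial>lborel)"
    by (simp add: ft_autocorrelation[OF f])
  also have "\<dots> = (\<integral>y. autocorrelation f y * complex_of_real (exp (- (y / d)\<^sup>2 / 2) / d) \<partial>lborel)"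
    by (subst ft_mult_formula[OF autocorrelation_integrable[OF f] int]) (simp add: ft_std_normal_density[OF d])
  also have "\<dots> = d * (\<integral>t. autocorrelation f (d * t) * complex_of_real (exp (- t\<^sup>2 / 2) / d) \<partial>lborel)"
    by (subst lborel_integral_real_affine[of d _ 0]) (use d in \<open>auto simp: scaleR_conv_of_real\<close>)
  also have "\<dots> = (\<integral>t. sqrt (2 * pi) * (autocorrelation f (d * t) * complex_of_real (std_normal_density t)) \<partial>lborel)"
    by (subst integral_mult_right_zero[symmetric], intro Bochner_Integration.integral_cong)
       (use d in \<open>auto simp: std_normal_density_def\<close>)
  finally show ?thesis by simp
qed

text \<open>Gaussian regularisation: let \<open>d\<close> tend to \<open>0\<close> on both sides of \<open>ft_gaussian_mean\<close>.\<close>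

theorem plancherel_real:
  assumes f: "integrable lborel f" and f2: "sq_integrable lborel f"
  shows "(\<integral>\<^sup>+\<mu>. ennreal ((cmod (ft f \<mu>))\<^sup>2) \<partial>lborel) = ennreal (2 * pi * (L2_norm lborel f)\<^sup>2)"
proof -
  have [measurable]: "f \<in> borel_measurable borel" using f by auto
  have A [measurable]: "autocorrelation f \<in> borel_measurable borel" using autocorrelation_integrable[OF f] by auto
  define d where "d n = 1 / real (Suc n)" for n
  have d: "d n > 0" for n by (simp add: d_def)
  have d0: "d \<longlonglongrightarrow> 0" unfolding d_def[abs_def] by (rule LIMSEQ_Suc[OF lim_1_over_n])
  have dmono: "d (Suc n) \<le> d n" for n by (simp add: d_def frac_le)
  define B where "B = (\<integral>x. cmod (f x) \<partial>lborel)"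
  \<comment> \<open>The factor sqrt (2 pi) compensates the value of the density at 0, so that
    \<open>g n\<close> increases to |ft f|^2. Monotone convergence then works without prior
    integrability of |ft f|^2.\<close>
  define g where "g n \<mu> = sqrt (2 * pi) * ((cmod (ft f \<mu>))\<^sup>2 * std_normal_density (d n * \<mu>))" for n \<mu>
  have [measurable]: "ft f \<in> borel_measurable borel" by measurable
  have [measurable]: "g n \<in> borel_measurable borel" for n unfolding g_def[abs_def] by measurable
  have g0: "0 \<le> g n \<mu>" for n \<mu> by (simp add: g_def)
  have "incseq (\<lambda>n \<mu>. ennreal (g n \<mu>))"
  proof (rule incseq_SucI, rule le_funI, rule ennreal_leI)
    fix n \<mu>
    have "(d (Suc n) * \<mu>)\<^sup>2 \<le> (d n * \<mu>)\<^sup>2"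
      unfolding power_mult_distrib using dmono[of n] d[of "Suc n"] by (intro mult_right_mono power_mono) auto
    then have "std_normal_density (d n * \<mu>) \<le> std_normal_density (d (Suc n) * \<mu>)"
      by (simp add: std_normal_density_def divide_right_mono)
    then show "g n \<mu> \<le> g (Suc n) \<mu>" unfolding g_def by (intro mult_left_mono) auto
  qed
  moreover have "(\<lambda>n. ennreal (g n \<mu>)) \<longlonglongrightarrow> ennreal ((cmod (ft f \<mu>))\<^sup>2)" for \<mu>
  proof (rule tendsto_ennrealI)
    have "(\<lambda>n. (cmod (ft f \<mu>))\<^sup>2 * exp (- (d n * \<mu>)\<^sup>2 / 2)) \<longlonglongrightarrow> (cmod (ft f \<mu>))\<^sup>2 * exp (- (0 * \<mu>)\<^sup>2 / 2)"
      by (intro tendsto_intros d0) simp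
    then show "(\<lambda>n. g n \<mu>) \<longlonglongrightarrow> (cmod (ft f \<mu>))\<^sup>2" by (simp add: g_def std_normal_density_def)
  qed
  ultimately have lim1: "(\<lambda>n. \<integral>\<^sup>+\<mu>. ennreal (g n \<mu>) \<partial>lborel) \<longlonglongrightarrow> (\<integral>\<^sup>+\<mu>. ennreal ((cmod (ft f \<mu>))\<^sup>2) \<partial>lborel)"
    by (intro nn_integral_LIMSEQ) auto
  have gint: "integrable lborel (g n)" for n
  proof -
    have "integrable lborel (\<lambda>\<mu>. sqrt (2 * pi) * B\<^sup>2 * std_normal_density (d n * \<mu>))"
      using lborel_integrable_real_affine[OF integrable_normal_density[of 1 0], of "d n" 0] d[of n] by simp
    then show ?thesis
    proof (rule Bochner_Integration.integrable_bound)
      have "(cmod (ft f \<mu>))\<^sup>2 \<le> B\<^sup>2" for \<mu>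
        using cmod_ft_le[OF f] unfolding B_def by (intro power_mono) auto
      then have "norm (g n \<mu>) \<le> norm (sqrt (2 * pi) * B\<^sup>2 * std_normal_density (d n * \<mu>))" for \<mu>
        unfolding g_def by (simp add: abs_mult mult.assoc mult_right_mono)
      then show "AE \<mu> in lborel. norm (g n \<mu>) \<le> norm (sqrt (2 * pi) * B\<^sup>2 * std_normal_density (d n * \<mu>))"
        by simp
    qed measurable
  qed
  let ?h = "\<lambda>n. (2 * pi) * (\<integral>t. autocorrelation f (d n * t) * complex_of_real (std_normal_density t) \<partial>lborel)"
  have eq: "complex_of_real (\<integral>\<mu>. g n \<mu> \<partial>lborel) = ?h n" for n
  proof -
    have "complex_of_real (\<integral>\<mu>. g n \<mu> \<partial>lborel) = (\<integral>\<mu>. complex_of_real (g n \<mu>) \<partial>lborel)"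
      by (simp only: integral_complex_of_real)
    also have "\<dots> = sqrt (2 * pi) * (\<integral>\<mu>. complex_of_real ((cmod (ft f \<mu>))\<^sup>2 * std_normal_density (d n * \<mu>)) \<partial>lborel)"
      unfolding g_def by (subst of_real_mult) (rule integral_mult_right_zero)
    also have "\<dots> = (complex_of_real (sqrt (2 * pi)) * complex_of_real (sqrt (2 * pi))) * (\<integral>t. autocorrelation f (d n * t) * complex_of_real (std_normal_density t) \<partial>lborel)"
      by (subst ft_gaussian_mean[OF f d]) (simp only: mult_ac)
    also have "complex_of_real (sqrt (2 * pi)) * complex_of_real (sqrt (2 * pi)) = of_real (2 * pi)"
      unfolding of_real_mult[symmetric] by simp
    finally show ?thesis by simp
  qed
  \<comment> \<open>On this side Cauchy-Schwarz bounds the autocorrelation by the squared norm of f,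
    a majorant independent of n.\<close>
  have "(\<lambda>n. \<integral>t. autocorrelation f (d n * t) * complex_of_real (std_normal_density t) \<partial>lborel)
      \<longlonglongrightarrow> (\<integral>t. autocorrelation f 0 * complex_of_real (std_normal_density t) \<partial>lborel)"
  proof (rule integral_dominated_convergence)
    show "integrable lborel (\<lambda>t. (L2_norm lborel f)\<^sup>2 * std_normal_density t)" by simp
    show "AE t in lborel. (\<lambda>n. autocorrelation f (d n * t) * complex_of_real (std_normal_density t)) \<longlonglongrightarrow>
        autocorrelation f 0 * complex_of_real (std_normal_density t)"
      by (intro AE_I2 tendsto_intros autocorrelation_tendsto f2) (use tendsto_mult_left_zero[OF d0] in auto)
    show "AE t in lborel. norm (autocorrelation f (d n * t) * complex_of_real (std_normal_density t)) \<le> (L2_norm lborel f)\<^sup>2 * std_normal_density t" for n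
      using cmod_autocorrelation_le[OF f2] by (auto simp: norm_mult intro!: mult_right_mono)
  qed measurable
  then have "?h \<longlonglongrightarrow> (2 * pi) * (\<integral>t. autocorrelation f 0 * complex_of_real (std_normal_density t) \<partial>lborel)"
    by (intro tendsto_intros)
  also have "(\<integral>t. autocorrelation f 0 * complex_of_real (std_normal_density t) \<partial>lborel) = autocorrelation f 0"
    by simp
  also have "(2 * pi) * autocorrelation f 0 = complex_of_real (2 * pi * (L2_norm lborel f)\<^sup>2)"
    by (simp add: autocorrelation_0)
  finally have "(\<lambda>n. \<integral>\<mu>. g n \<mu> \<partial>lborel) \<longlonglongrightarrow> 2 * pi * (L2_norm lborel f)\<^sup>2"
    unfolding eq[symmetric] tendsto_of_real_iff .
  then have "(\<lambda>n. \<integral>\<^sup>+\<mu>. ennreal (g n \<mu>) \<partial>lborel) \<longlonglongrightarrow> ennreal (2 * pi * (L2_norm lborel f)\<^sup>2)"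
    using nn_integral_eq_integral[OF gint] g0 by (simp add: tendsto_ennrealI)
  from LIMSEQ_unique[OF lim1 this] show ?thesis .
qed

section \<open>Parseval on the circle\<close>

lemma integral_exp_period:
  assumes lam: "lam > 0"
  shows "has_bochner_integral lborel
    (\<lambda>y. indicator {0..<2 * pi * lam} y *\<^sub>R exp (\<i> * complex_of_real (y * (of_int k / lam))))
    (if k = 0 then complex_of_real (2 * pi * lam) else 0)"
proof -
  let ?L = "2 * pi * lam"
  have L: "0 \<le> ?L" using lam by simp
  define F where "F y = (if k = 0 then complex_of_real y
    else exp (\<i> * complex_of_real (y * (of_int k / lam))) / (\<i> * complex_of_real (of_int k / lam)))" for y
  have "has_bochner_integral lborel
      (\<lambda>y. indicator {0..?L} y *\<^sub>R exp (\<i> * complex_of_real (y * (of_int k / lam)))) (F ?L - F 0)"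
  proof (rule has_bochner_integral_FTC_Icc[OF L])
    fix x :: real
    show "(F has_vector_derivative exp (\<i> * complex_of_real (x * (of_int k / lam)))) (at x within {0..?L})"
    proof (cases "k = 0")
      case True
      have "(complex_of_real has_vector_derivative complex_of_real 1) (at x within {0..?L})"
        by (intro has_vector_derivative_of_real) (rule DERIV_ident)
      then show ?thesis using True by (simp add: F_def[abs_def] exp_eq_1)
    next
      case False
      let ?c = "\<i> * complex_of_real (of_int k / lam)"
      have "((\<lambda>z. exp (?c * z) / ?c) has_field_derivative exp (?c * complex_of_real x)) (at (complex_of_real x))"
        using False lam by (auto intro!: derivative_eq_intros)
      from has_vector_derivative_real_field[OF this]
      show ?thesis using False lam by (simp add: F_def[abs_def] mult_ac)
    qed
  qed (use lam in \<open>auto intro!: continuous_intros\<close>)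
  moreover have "F ?L - F 0 = (if k = 0 then complex_of_real ?L else 0)"
  proof (cases "k = 0")
    case False
    have "exp (\<i> * complex_of_real (?L * (of_int k / lam))) = 1"
      unfolding exp_eq_1 using lam by (auto intro!: exI[of _ k])
    then show ?thesis using False by (simp add: F_def)
  qed (simp add: F_def)
  \<comment> \<open>The fundamental theorem gives the closed interval; the half-open one, whose
    translates tile the line, differs by a null set.\<close>
  moreover have "AE y in lborel. indicator {0..?L} y = (indicator {0..<?L} y :: real)"
    using AE_lborel_singleton[of ?L] by eventually_elim (auto simp: indicator_def)
  ultimately show ?thesis
    by (subst has_bochner_integral_cong_AE[where g = "\<lambda>y. indicator {0..?L} y *\<^sub>R exp (\<i> * complex_of_real (y * (of_int k / lam)))"])
       auto
qed

text \<open>Expanding the square leaves the diagonal, by orthogonality. The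
  \<open>has_bochner_integral\<close> form carries integrability along, which
  \<open>fourier_inverse_isometry\<close> needs to pass to \<open>nn_integral\<close>.\<close>

lemma integral_trig_sum:
  fixes a :: "int \<Rightarrow> complex"
  assumes lam: "lam > 0" and K: "finite K"
  shows "has_bochner_integral lborel (\<lambda>y. indicator {0..<2 * pi * lam} y *
      (cmod (\<Sum>k\<in>K. a k * exp (\<i> * complex_of_real (y * (of_int k / lam)))))\<^sup>2)
    (2 * pi * lam * (\<Sum>k\<in>K. (cmod (a k))\<^sup>2))"
proof -
  let ?e = "\<lambda>k y. exp (\<i> * complex_of_real (y * (of_int k / lam)))"
  have ee: "?e j y * cnj (?e k y) = ?e (j - k) y" for j k y
  proof -
    have "\<i> * complex_of_real (y * (of_int j / lam)) + - (\<i> * complex_of_real (y * (of_int k / lam)))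
        = \<i> * complex_of_real (y * (of_int (j - k) / lam))"
      by (simp add: algebra_simps diff_divide_distrib)
    then show ?thesis by (simp add: exp_cnj exp_add[symmetric])
  qed
  have "has_bochner_integral lborel
      (\<lambda>y. \<Sum>j\<in>K. \<Sum>k\<in>K. (a j * cnj (a k)) * (indicator {0..<2 * pi * lam} y *\<^sub>R ?e (j - k) y))
      (\<Sum>j\<in>K. \<Sum>k\<in>K. (a j * cnj (a k)) * (if j - k = 0 then complex_of_real (2 * pi * lam) else 0))"
    by (intro has_bochner_integral_sum has_bochner_integral_mult_right integral_exp_period lam)
  also have "(\<lambda>y. \<Sum>j\<in>K. \<Sum>k\<in>K. (a j * cnj (a k)) * (indicator {0..<2 * pi * lam} y *\<^sub>R ?e (j - k) y))
      = (\<lambda>y. complex_of_real (indicator {0..<2 * pi * lam} y * (cmod (\<Sum>k\<in>K. a k * ?e k y))\<^sup>2))"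
  proof
    fix y
    have "complex_of_real ((cmod (\<Sum>k\<in>K. a k * ?e k y))\<^sup>2)
        = (\<Sum>j\<in>K. a j * ?e j y) * (\<Sum>k\<in>K. cnj (a k) * cnj (?e k y))"
      by (simp only: complex_norm_square cnj_sum complex_cnj_mult)
    also have "\<dots> = (\<Sum>j\<in>K. \<Sum>k\<in>K. (a j * cnj (a k)) * (?e j y * cnj (?e k y)))"
      by (simp only: sum_product mult_ac)
    finally have "complex_of_real ((cmod (\<Sum>k\<in>K. a k * ?e k y))\<^sup>2)
        = (\<Sum>j\<in>K. \<Sum>k\<in>K. (a j * cnj (a k)) * ?e (j - k) y)" by (simp only: ee)
    then show "(\<Sum>j\<in>K. \<Sum>k\<in>K. (a j * cnj (a k)) * (indicator {0..<2 * pi * lam} y *\<^sub>R ?e (j - k) y))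
        = complex_of_real (indicator {0..<2 * pi * lam} y * (cmod (\<Sum>k\<in>K. a k * ?e k y))\<^sup>2)"
      by (simp add: indicator_def del: of_real_power)
  qed
  also have "(\<Sum>j\<in>K. \<Sum>k\<in>K. (a j * cnj (a k)) * (if j - k = 0 then complex_of_real (2 * pi * lam) else 0))
      = complex_of_real (2 * pi * lam * (\<Sum>k\<in>K. (cmod (a k))\<^sup>2))"
    using K by (simp add: if_distrib[of "\<lambda>x. _ * x"] sum.delta complex_norm_square sum_distrib_left sum_distrib_right mult_ac
        del: of_real_power cong: if_cong)
  finally show ?thesis
    using has_bochner_integral_Re by fastforce
qed

lemma nn_integral_count_space_int_le:
  fixes g :: "int \<Rightarrow> ennreal"
  assumes "\<And>n::nat. (\<Sum>k\<in>{- int n..int n}. g k) \<le> B"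
  shows "(\<integral>\<^sup>+k. g k \<partial>count_space UNIV) \<le> B"
proof -
  have "(\<lambda>n::nat. \<integral>\<^sup>+k. g k * indicator {- int n..int n} k \<partial>count_space UNIV) \<longlonglongrightarrow> (\<integral>\<^sup>+k. g k \<partial>count_space UNIV)"
  proof (rule nn_integral_LIMSEQ)
    show "incseq (\<lambda>n k. g k * indicator {- int n..int n} k)"
      by (auto simp: incseq_def le_fun_def indicator_def)
    fix k :: int
    have "\<forall>\<^sub>F n in sequentially. g k * indicator {- int n..int n} k = g k"
      by (rule eventually_sequentiallyI[of "nat \<bar>k\<bar>"]) (auto simp: indicator_def)
    then show "(\<lambda>n. g k * indicator {- int n..int n} k) \<longlonglongrightarrow> g k" by (rule tendsto_eventually)
  qed auto
  moreover have "(\<integral>\<^sup>+k. g k * indicator {- int n..int n} k \<partial>count_space UNIV) \<le> B" for n :: nat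
    using assms[of n] by (subst nn_integral_count_space'[of "{- int n..int n}"]) (auto simp: indicator_def)
  ultimately show ?thesis by (intro LIMSEQ_le_const2) auto
qed

text \<open>Pair f with its own partial sum p. The pairing equals the sum T of the |c k|^2 over K,
  and the squared norm of p is 2 pi \<lambda> T, so Cauchy-Schwarz reads T^2 <= 2 pi \<lambda>
  ||f||^2 T, and T can be cancelled.\<close>

lemma bessel_circle:
  assumes lam: "lam > 0" and f: "sq_integrable lborel f" and supp: "\<And>x. x \<notin> {0..<2 * pi * lam} \<Longrightarrow> f x = 0"
  shows "sq_integrable (count_space UNIV) (\<lambda>k::int. ft f (of_int k / lam))"
    and "L2_norm (count_space UNIV) (\<lambda>k::int. ft f (of_int k / lam)) \<le> sqrt (2 * pi * lam) * L2_norm lborel f"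
proof -
  let ?L = "2 * pi * lam"
  let ?I = "indicator {0..<?L} :: real \<Rightarrow> complex"
  let ?e = "\<lambda>k y. exp (\<i> * complex_of_real (y * (of_int k / lam)))"
  define c where "c k = ft f (of_int k / lam)" for k :: int
  have I: "sq_integrable lborel ?I" by (rule sq_integrable_indicator) (use lam in auto)
  have fI: "f x * ?I x = f x" for x using supp[of x] by (auto simp: indicator_def)
  have fin: "(\<Sum>k\<in>K. (cmod (c k))\<^sup>2) \<le> ?L * (L2_norm lborel f)\<^sup>2" if K: "finite K" for K :: "int set"
  proof -
    define p where "p y = (\<Sum>k\<in>K. (c k * ?e k y) * ?I y)" for y
    have p: "sq_integrable lborel p" unfolding p_def[abs_def]
      by (intro sq_integrable_sum sq_integrable_mult_bounded[OF I]) (auto simp: norm_mult)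
    have "(\<integral>y. (cmod (p y))\<^sup>2 \<partial>lborel) = (\<integral>y. indicator {0..<?L} y * (cmod (\<Sum>k\<in>K. c k * ?e k y))\<^sup>2 \<partial>lborel)"
      unfolding p_def by (intro Bochner_Integration.integral_cong) (auto simp: indicator_def)
    also have "\<dots> = ?L * (\<Sum>k\<in>K. (cmod (c k))\<^sup>2)"
      by (rule has_bochner_integral_integral_eq[OF integral_trig_sum[OF lam K]])
    finally have np: "(L2_norm lborel p)\<^sup>2 = ?L * (\<Sum>k\<in>K. (cmod (c k))\<^sup>2)"
      by (simp add: L2_norm_power2)
    have int: "integrable lborel f" using integrable_mult_L2[OF f I] by (simp add: fI)
    have "(\<integral>y. f y * cnj (p y) \<partial>lborel) = (\<integral>y. (\<Sum>k\<in>K. cnj (c k) * (f y * exp (- \<i> * complex_of_real (y * (of_int k / lam))))) \<partial>lborel)"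
    proof (rule Bochner_Integration.integral_cong[OF refl])
      fix y
      have "f y * cnj (p y) = (\<Sum>k\<in>K. cnj (c k) * (f y * exp (- \<i> * complex_of_real (y * (of_int k / lam))))) * ?I y"
        unfolding p_def cnj_sum sum_distrib_left sum_distrib_right
        by (intro sum.cong) (auto simp: exp_cnj indicator_def mult_ac)
      also have "\<dots> = (\<Sum>k\<in>K. cnj (c k) * ((f y * ?I y) * exp (- \<i> * complex_of_real (y * (of_int k / lam)))))"
        by (simp only: sum_distrib_left sum_distrib_right mult_ac)
      finally show "f y * cnj (p y) = (\<Sum>k\<in>K. cnj (c k) * (f y * exp (- \<i> * complex_of_real (y * (of_int k / lam)))))"
        by (simp only: fI)
    qed
    also have "\<dots> = (\<Sum>k\<in>K. cnj (c k) * c k)"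
      unfolding c_def ft_def
      by (subst Bochner_Integration.integral_sum, rule integrable_mult_right, rule ft_integrable[OF int])
         (simp only: integral_mult_right_zero)
    also have "\<dots> = complex_of_real (\<Sum>k\<in>K. (cmod (c k))\<^sup>2)"
      by (simp add: complex_norm_square mult.commute del: of_real_power)
    finally have "(\<Sum>k\<in>K. (cmod (c k))\<^sup>2) = cmod (\<integral>y. f y * cnj (p y) \<partial>lborel)"
      by (simp add: sum_nonneg del: of_real_sum)
    also have "\<dots> \<le> L2_norm lborel f * L2_norm lborel (\<lambda>y. cnj (p y))"
      by (intro Cauchy_Schwarz_L2 f sq_integrable_cnj p)
    also have "L2_norm lborel (\<lambda>y. cnj (p y)) = L2_norm lborel p" by (simp add: L2_norm_def)
    finally have "(\<Sum>k\<in>K. (cmod (c k))\<^sup>2)\<^sup>2 \<le> (L2_norm lborel f * L2_norm lborel p)\<^sup>2"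
      by (intro power_mono sum_nonneg) auto
    also have "\<dots> = ((L2_norm lborel f)\<^sup>2 * ?L) * (\<Sum>k\<in>K. (cmod (c k))\<^sup>2)"
      by (simp add: power_mult_distrib np)
    finally have "(\<Sum>k\<in>K. (cmod (c k))\<^sup>2) * (\<Sum>k\<in>K. (cmod (c k))\<^sup>2) \<le> ((L2_norm lborel f)\<^sup>2 * ?L) * (\<Sum>k\<in>K. (cmod (c k))\<^sup>2)"
      by (simp add: power2_eq_square)
    moreover have "0 \<le> (\<Sum>k\<in>K. (cmod (c k))\<^sup>2)" by (intro sum_nonneg) auto
    ultimately show ?thesis
      using lam by (cases "(\<Sum>k\<in>K. (cmod (c k))\<^sup>2) = 0") (auto simp: mult_le_cancel_right mult.commute)
  qed
  have "(\<integral>\<^sup>+k. ennreal ((cmod (c k))\<^sup>2) \<partial>count_space UNIV) \<le> ennreal (?L * (L2_norm lborel f)\<^sup>2)"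
    by (rule nn_integral_count_space_int_le) (subst sum_ennreal, simp, rule ennreal_leI, rule fin, simp)
  also have "?L * (L2_norm lborel f)\<^sup>2 = (sqrt ?L * L2_norm lborel f)\<^sup>2" using lam by (simp add: power_mult_distrib)
  finally have *: "(\<integral>\<^sup>+k. ennreal ((cmod (c k))\<^sup>2) \<partial>count_space UNIV) \<le> ennreal ((sqrt ?L * L2_norm lborel f)\<^sup>2)" .
  show "sq_integrable (count_space UNIV) (\<lambda>k::int. ft f (of_int k / lam))"
    by (rule sq_integrableI_bounded[OF _ *[unfolded c_def]]) auto
  show "L2_norm (count_space UNIV) (\<lambda>k::int. ft f (of_int k / lam)) \<le> sqrt ?L * L2_norm lborel f"
    by (rule L2_norm_le[OF _ *[unfolded c_def]]) (use lam in auto)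
qed

section \<open>Sums over the integers as integrals, and periodisation\<close>

lemma sigma_finite_count_space_int: "sigma_finite_measure (count_space (UNIV :: int set))"
  by (rule sigma_finite_measure_count_space_countable) auto

lemma measurable_pair_count_space_int [measurable (raw)]:
  assumes "\<And>k::int. (\<lambda>x. f x k) \<in> measurable M N"
  shows "(\<lambda>z. f (fst z) (snd z)) \<in> measurable (M \<Otimes>\<^sub>M count_space UNIV) N"
proof -
  have "(\<lambda>z. f (snd z) (fst z)) \<in> measurable (count_space (UNIV :: int set) \<Otimes>\<^sub>M M) N"
    by (rule measurable_pair_measure_countable1) (use assms in auto)
  from measurable_comp[OF measurable_pair_swap' this] show ?thesis
    by (simp add: comp_def split_beta')
qed

lemma nn_integral_count_space_int_swap:
  assumes M: "sigma_finite_measure M" and [measurable]: "\<And>k::int. g k \<in> borel_measurable M"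
  shows "(\<integral>\<^sup>+k. \<integral>\<^sup>+x. g k x \<partial>M \<partial>count_space UNIV) = (\<integral>\<^sup>+x. \<integral>\<^sup>+k. g k x \<partial>count_space UNIV \<partial>M)"
proof -
  interpret M: sigma_finite_measure M by fact
  interpret C: sigma_finite_measure "count_space (UNIV :: int set)" by (rule sigma_finite_count_space_int)
  interpret pair_sigma_finite M "count_space (UNIV :: int set)" ..
  show ?thesis
    by (rule Fubini') (use measurable_pair_count_space_int[of "\<lambda>x k. g k x" M borel] in \<open>simp add: split_beta'\<close>)
qed

text \<open>The translates of [0, h) tile the line, the tile of x having index floor (x / h).
  Parseval uses this to average over the shifts of the frequency grid, and
  \<open>riemann_sum_bracket_le\<close> to compare a grid sum with an integral.\<close>

lemma nn_integral_periodize: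
  fixes g :: "real \<Rightarrow> ennreal" and h :: real
  assumes [measurable]: "g \<in> borel_measurable borel" and h: "h > 0"
  shows "(\<integral>\<^sup>+x. g x \<partial>lborel) = (\<integral>\<^sup>+\<theta>. (\<integral>\<^sup>+k. g (\<theta> + of_int k * h) \<partial>count_space (UNIV :: int set)) * indicator {0..<h} \<theta> \<partial>lborel)"
proof -
  have one: "(\<integral>\<^sup>+k. indicator {of_int k * h..<of_int k * h + h} x \<partial>count_space (UNIV :: int set)) = 1" for x
  proof -
    have "indicator {of_int k * h..<of_int k * h + h} x = (indicator {\<lfloor>x / h\<rfloor>} k :: ennreal)" for k :: int
    proof -
      have "(of_int k * h \<le> x \<and> x < of_int k * h + h) \<longleftrightarrow> (of_int k \<le> x / h \<and> x / h < of_int k + 1)"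
        using h by (simp add: field_simps)
      also have "\<dots> \<longleftrightarrow> k = \<lfloor>x / h\<rfloor>" by (simp add: eq_commute[of k] floor_eq_iff)
      finally show ?thesis by (simp add: indicator_def)
    qed
    then show ?thesis by simp
  qed
  have "(\<integral>\<^sup>+x. g x \<partial>lborel) = (\<integral>\<^sup>+x. \<integral>\<^sup>+k. g x * indicator {of_int k * h..<of_int k * h + h} x \<partial>count_space (UNIV :: int set) \<partial>lborel)"
    by (simp add: nn_integral_cmult one)
  also have "\<dots> = (\<integral>\<^sup>+k. \<integral>\<^sup>+x. g x * indicator {of_int k * h..<of_int k * h + h} x \<partial>lborel \<partial>count_space (UNIV :: int set))"
    by (rule nn_integral_count_space_int_swap[symmetric]) (auto intro: lborel.sigma_finite_measure_axioms)
  also have "\<dots> = (\<integral>\<^sup>+k. \<integral>\<^sup>+\<theta>. g (\<theta> + of_int k * h) * indicator {0..<h} \<theta> \<partial>lborel \<partial>count_space (UNIV :: int set))"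
  proof (rule nn_integral_cong)
    fix k :: int
    have "(\<integral>\<^sup>+x. g x * indicator {of_int k * h..<of_int k * h + h} x \<partial>lborel)
        = (\<integral>\<^sup>+\<theta>. g (of_int k * h + 1 * \<theta>) * indicator {of_int k * h..<of_int k * h + h} (of_int k * h + 1 * \<theta>) \<partial>lborel)"
      by (subst nn_integral_real_affine[of _ 1 "of_int k * h"]) auto
    also have "\<dots> = (\<integral>\<^sup>+\<theta>. g (\<theta> + of_int k * h) * indicator {0..<h} \<theta> \<partial>lborel)"
      by (intro nn_integral_cong) (auto simp: indicator_def add.commute)
    finally show "(\<integral>\<^sup>+x. g x * indicator {of_int k * h..<of_int k * h + h} x \<partial>lborel)
        = (\<integral>\<^sup>+\<theta>. g (\<theta> + of_int k * h) * indicator {0..<h} \<theta> \<partial>lborel)" .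
  qed
  also have "\<dots> = (\<integral>\<^sup>+\<theta>. \<integral>\<^sup>+k. g (\<theta> + of_int k * h) * indicator {0..<h} \<theta> \<partial>count_space (UNIV :: int set) \<partial>lborel)"
    by (rule nn_integral_count_space_int_swap) (auto intro: lborel.sigma_finite_measure_axioms)
  finally show ?thesis by (simp add: nn_integral_multc)
qed

text \<open>
  Bessel's inequality holds on every shift of the frequency grid. The average over the shifts is the
  Plancherel identity on the line, so equality holds for almost every shift, and by continuity for the shift \<open>0\<close>.
\<close>

theorem parseval_circle:
  assumes lam: "lam > 0" and f: "sq_integrable lborel f" and supp: "\<And>x. x \<notin> {0..<2 * pi * lam} \<Longrightarrow> f x = 0"
  shows "(\<integral>\<^sup>+k. ennreal ((cmod (ft f (of_int k / lam)))\<^sup>2) \<partial>count_space (UNIV :: int set))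
    = ennreal (2 * pi * lam * (L2_norm lborel f)\<^sup>2)"
proof -
  let ?L = "2 * pi * lam" and ?C = "count_space (UNIV :: int set)"
  let ?N = "\<lambda>\<theta>. L2_norm ?C (\<lambda>k. ft f (\<theta> + of_int k * (1 / lam)))"
  have [measurable]: "f \<in> borel_measurable borel" using f by (simp add: sq_integrable_def)
  have int: "integrable lborel f"
  proof -
    have "sq_integrable lborel (indicator {0..<?L})" by (rule sq_integrable_indicator) (use lam in auto)
    moreover have "(\<lambda>x. f x * indicator {0..<?L} x) = f"
    proof
      show "f x * indicator {0..<?L} x = f x" for x using supp[of x] by (cases "x \<in> {0..<?L}") auto
    qed
    ultimately show ?thesis using integrable_mult_L2[OF f, of "indicator {0..<?L}"] by simp
  qed
  \<comment> \<open>Modulation by \<theta> shifts the transform by \<theta> and keeps norm and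
    support; Bessel for \<open>F \<theta>\<close> is Bessel for f on the shifted grid.\<close>
  define F where "F \<theta> x = exp (- \<i> * complex_of_real (x * \<theta>)) * f x" for \<theta> x
  have F2: "sq_integrable lborel (F \<theta>)" for \<theta>
    unfolding F_def[abs_def] by (rule sq_integrable_mult_bounded[OF f, where C = 1]) auto
  have [measurable]: "F \<theta> \<in> borel_measurable borel" for \<theta>
    using F2[of \<theta>] by (simp add: sq_integrable_def)
  have Fsupp: "x \<notin> {0..<?L} \<Longrightarrow> F \<theta> x = 0" for \<theta> x using supp by (simp add: F_def)
  have ftF: "ft (F \<theta>) \<mu> = ft f (\<theta> + \<mu>)" for \<theta> \<mu>
    unfolding ft_def F_def
    by (intro Bochner_Integration.integral_cong refl) (simp add: exp_add[symmetric] algebra_simps)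
  have nF: "L2_norm lborel (F \<theta>) = L2_norm lborel f" for \<theta>
    by (simp add: L2_norm_def F_def norm_mult)
  have sq: "sq_integrable ?C (\<lambda>k. ft f (\<theta> + of_int k * (1 / lam)))" for \<theta>
    using bessel_circle(1)[OF lam F2 Fsupp, of \<theta>] by (simp add: ftF)
  have le: "?N \<theta> \<le> sqrt ?L * L2_norm lborel f" for \<theta>
    using bessel_circle(2)[OF lam F2 Fsupp, of \<theta>] by (simp add: ftF nF)
  define S where "S \<theta> = (\<integral>\<^sup>+k. ennreal ((cmod (ft f (\<theta> + of_int k * (1 / lam))))\<^sup>2) \<partial>?C)" for \<theta>
  have S_eq: "S \<theta> = ennreal ((?N \<theta>)\<^sup>2)" for \<theta>
    unfolding S_def by (rule L2_norm_eq_nn_integral[OF sq])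
  define B where "B = ?L * (L2_norm lborel f)\<^sup>2"
  have B0: "0 \<le> B" using lam by (simp add: B_def)
  have S_le: "S \<theta> \<le> ennreal B" for \<theta>
    unfolding S_eq using power_mono[OF le, of \<theta> 2] lam by (intro ennreal_leI) (simp add: B_def power_mult_distrib)
  have [measurable]: "S \<in> borel_measurable borel"
  proof -
    interpret sigma_finite_measure ?C by (rule sigma_finite_count_space_int)
    show ?thesis unfolding S_def[abs_def]
      by (rule borel_measurable_nn_integral)
         (use measurable_pair_count_space_int[of "\<lambda>\<theta> k. ennreal ((cmod (ft f (\<theta> + of_int k * (1 / lam))))\<^sup>2)" borel borel] in \<open>simp add: split_beta'\<close>)
  qed
  let ?I = "indicator {0..<1 / lam} :: real \<Rightarrow> ennreal"
  have tot: "(\<integral>\<^sup>+\<theta>. S \<theta> * ?I \<theta> \<partial>lborel) = (\<integral>\<^sup>+\<theta>. ennreal B * ?I \<theta> \<partial>lborel)"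
  proof -
    have "(\<integral>\<^sup>+\<theta>. S \<theta> * ?I \<theta> \<partial>lborel) = (\<integral>\<^sup>+\<mu>. ennreal ((cmod (ft f \<mu>))\<^sup>2) \<partial>lborel)"
      unfolding S_def by (rule nn_integral_periodize[symmetric]) (use lam in auto)
    also have "\<dots> = ennreal (2 * pi * (L2_norm lborel f)\<^sup>2)" by (rule plancherel_real[OF int f])
    also have "\<dots> = ennreal B * ennreal (1 / lam)"
      using lam by (simp add: B_def ennreal_mult[symmetric] field_simps)
    also have "\<dots> = (\<integral>\<^sup>+\<theta>. ennreal B * ?I \<theta> \<partial>lborel)"
      using lam by (simp add: nn_integral_cmult)
    finally show ?thesis .
  qed
  \<comment> \<open>Two functions with the same finite integral, one below the other, agree
    a.e.\<close>
  have AE: "AE \<theta> in lborel. \<theta> \<in> {0..<1 / lam} \<longrightarrow> S \<theta> = ennreal B"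
  proof -
    have fin: "(\<integral>\<^sup>+\<theta>. S \<theta> * ?I \<theta> \<partial>lborel) \<noteq> \<infinity>"
      unfolding tot using lam by (simp add: nn_integral_cmult ennreal_mult_eq_top_iff)
    have "(\<integral>\<^sup>+\<theta>. ennreal B * ?I \<theta> - S \<theta> * ?I \<theta> \<partial>lborel) = (\<integral>\<^sup>+\<theta>. ennreal B * ?I \<theta> \<partial>lborel) - (\<integral>\<^sup>+\<theta>. S \<theta> * ?I \<theta> \<partial>lborel)"
      by (rule nn_integral_diff) (use S_le fin in \<open>auto intro!: mult_right_mono\<close>)
    also have "\<dots> = 0" using fin by (simp add: tot)
    finally have "AE \<theta> in lborel. ennreal B * ?I \<theta> - S \<theta> * ?I \<theta> = 0"
      by (subst (asm) nn_integral_0_iff_AE) auto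
    then show ?thesis
    proof eventually_elim
      case (elim \<theta>)
      show ?case
      proof
        assume "\<theta> \<in> {0..<1 / lam}"
        then have "ennreal B - S \<theta> = 0" using elim by simp
        then have "ennreal B \<le> S \<theta>" by (simp add: diff_eq_0_iff_ennreal S_eq)
        with S_le[of \<theta>] show "S \<theta> = ennreal B" by simp
      qed
    qed
  qed
  \<comment> \<open>A set of full measure in [0, 1/\<lambda>) meets every interval (0, d).\<close>
  have ex: "\<exists>\<theta>. 0 < \<theta> \<and> \<theta> < e \<and> S \<theta> = ennreal B" if e: "e > 0" for e
  proof (rule ccontr)
    assume no: "\<not> ?thesis"
    obtain d where d: "0 < d" "d \<le> e" "d \<le> 1 / lam"
      using e lam that[of "min e (1 / lam)"] by auto
    let ?A = "{0<..<d}"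
    have "AE \<theta> in lborel. \<theta> \<notin> ?A" using AE by eventually_elim (use no d in auto)
    then have "?A \<in> null_sets lborel" by (subst AE_iff_null_sets) auto
    then have "emeasure lborel ?A = 0" by (rule null_setsD1)
    then show False using d by simp
  qed
  \<comment> \<open>The samples of \<open>F \<theta>\<close> and f differ by the samples of
    \<open>F \<theta> - f\<close>, which has the same support, so Bessel bounds their distance. On
    that support |exp(-i x \<theta>) - 1| <= 2 pi \<lambda> e.\<close>
  have close: "sqrt ?L * L2_norm lborel f \<le> ?N 0 + sqrt ?L * (e * ?L * L2_norm lborel f)" if e: "e > 0" for e
  proof -
    obtain \<theta> where \<theta>: "0 < \<theta>" "\<theta> < e" "S \<theta> = ennreal B" using ex[OF e] by blast
    have "(?N \<theta>)\<^sup>2 = (sqrt ?L * L2_norm lborel f)\<^sup>2"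
      using \<theta>(3) B0 lam by (simp add: S_eq B_def power_mult_distrib)
    then have "sqrt ?L * L2_norm lborel f = ?N \<theta>"
      using lam by (subst (asm) power2_eq_iff_nonneg) auto
    also have "\<dots> \<le> ?N 0 + L2_norm ?C (\<lambda>k. ft f (\<theta> + of_int k * (1 / lam)) - ft f (0 + of_int k * (1 / lam)))"
      using L2_norm_triangle[OF sq[of 0] sq_integrable_diff[OF sq[of \<theta>] sq[of 0]]] by simp
    also have "(\<lambda>k::int. ft f (\<theta> + of_int k * (1 / lam)) - ft f (0 + of_int k * (1 / lam))) = (\<lambda>k. ft (\<lambda>x. F \<theta> x - f x) (of_int k / lam))"
    proof
      fix k :: int
      have iF: "integrable lborel (F \<theta>)"
        by (rule Bochner_Integration.integrable_bound[OF int]) (auto simp: F_def norm_mult)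
      have "ft (\<lambda>x. F \<theta> x - f x) (of_int k / lam) = ft (F \<theta>) (of_int k / lam) - ft f (of_int k / lam)"
        unfolding ft_def left_diff_distrib
        by (rule Bochner_Integration.integral_diff[OF ft_integrable[OF iF] ft_integrable[OF int]])
      then show "ft f (\<theta> + of_int k * (1 / lam)) - ft f (0 + of_int k * (1 / lam)) = ft (\<lambda>x. F \<theta> x - f x) (of_int k / lam)"
        by (simp add: ftF)
    qed
    also have "L2_norm ?C (\<lambda>k. ft (\<lambda>x. F \<theta> x - f x) (of_int k / lam)) \<le> sqrt ?L * L2_norm lborel (\<lambda>x. F \<theta> x - f x)"
      by (rule bessel_circle(2)[OF lam sq_integrable_diff[OF F2 f]]) (use Fsupp supp in auto)
    also have "L2_norm lborel (\<lambda>x. F \<theta> x - f x) \<le> e * ?L * L2_norm lborel f"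
    proof (rule L2_norm_le)
      have pt: "(cmod (F \<theta> x - f x))\<^sup>2 \<le> (e * ?L)\<^sup>2 * (cmod (f x))\<^sup>2" for x
      proof (cases "x \<in> {0..<?L}")
        case True
        have "cmod (F \<theta> x - f x) = cmod (exp (\<i> * complex_of_real (- (x * \<theta>))) - 1) * cmod (f x)"
          by (simp add: F_def norm_mult[symmetric] left_diff_distrib)
        also have "cmod (exp (\<i> * complex_of_real (- (x * \<theta>))) - 1) \<le> \<bar>- (x * \<theta>)\<bar>"
          using iexp_approx1[of "- (x * \<theta>)" 0] by simp
        also have "\<dots> \<le> e * ?L" using True \<theta> lam by (auto simp: abs_mult mult.commute[of e] intro!: mult_mono)
        finally have "cmod (F \<theta> x - f x) \<le> e * ?L * cmod (f x)" by (simp add: mult_right_mono)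
        from power_mono[OF this, of 2] show ?thesis by (simp add: power_mult_distrib)
      qed (simp add: supp Fsupp)
      have "(\<integral>\<^sup>+x. ennreal ((cmod (F \<theta> x - f x))\<^sup>2) \<partial>lborel) \<le> (\<integral>\<^sup>+x. ennreal ((e * ?L)\<^sup>2) * ennreal ((cmod (f x))\<^sup>2) \<partial>lborel)"
        using pt by (intro nn_integral_mono) (simp add: ennreal_mult[symmetric])
      also have "\<dots> = ennreal ((e * ?L * L2_norm lborel f)\<^sup>2)"
        by (subst nn_integral_cmult) (auto simp: L2_norm_eq_nn_integral[OF f] ennreal_mult[symmetric] power_mult_distrib)
      finally show "(\<integral>\<^sup>+x. ennreal ((cmod (F \<theta> x - f x))\<^sup>2) \<partial>lborel) \<le> ennreal ((e * ?L * L2_norm lborel f)\<^sup>2)" .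
    qed (use e lam F2[of \<theta>] in \<open>auto simp: sq_integrable_def\<close>)
    finally show ?thesis using lam by simp
  qed
  have "sqrt ?L * L2_norm lborel f \<le> ?N 0"
  proof (rule tendsto_lowerbound)
    have "((\<lambda>e. ?N 0 + sqrt ?L * (e * ?L * L2_norm lborel f)) \<longlongrightarrow> ?N 0 + sqrt ?L * (0 * ?L * L2_norm lborel f)) (at_right 0)"
      by (intro tendsto_intros)
    then show "((\<lambda>e. ?N 0 + sqrt ?L * (e * ?L * L2_norm lborel f)) \<longlongrightarrow> ?N 0) (at_right 0)" by simp
    show "\<forall>\<^sub>F e in at_right 0. sqrt ?L * L2_norm lborel f \<le> ?N 0 + sqrt ?L * (e * ?L * L2_norm lborel f)"
      using close by (auto simp: eventually_at_filter)
  qed simp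
  with le[of 0] have "?N 0 = sqrt ?L * L2_norm lborel f" by simp
  then have "S 0 = ennreal B" using lam by (simp add: S_eq B_def power_mult_distrib)
  then show ?thesis by (simp add: S_def B_def)
qed

section \<open>The frequency measure\<close>

lemma frequencies_borel [measurable]: "frequencies lam \<in> sets borel"
proof -
  have "range (\<lambda>k::int. of_int k / lam) \<in> sets borel" by (rule sets.countable) auto
  then show ?thesis unfolding frequencies_def borel_prod[symmetric] by measurable
qed

locale cylinder =
  fixes lam :: real
  assumes lam_pos: "0 < lam"
begin

abbreviation "freq_param \<equiv> (\<lambda>(\<mu>, k::int). (\<mu>, real_of_int k / lam))"
abbreviation "param_measure \<equiv> (lborel :: real measure) \<Otimes>\<^sub>M count_space (UNIV :: int set)"

text \<open>The grid is countable with finite point masses, because k/\<lambda> determines k, and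
  its complement is null.\<close>

lemma sigma_finite_grid:
  "sigma_finite_measure (scale_measure (ennreal (1 / lam)) (distr (count_space UNIV) borel (\<lambda>k::int. of_int k / lam)))"
    (is "sigma_finite_measure ?G")
proof
  let ?R = "range (\<lambda>k::int. of_int k / lam)"
  have cR: "countable ?R" by simp
  have R: "?R \<in> sets borel" using cR by (rule sets.countable[rotated]) simp
  have fin: "emeasure ?G {x} \<noteq> \<infinity>" for x
  proof -
    have "(\<lambda>k::int. of_int k / lam) -` {x} \<subseteq> {\<lfloor>x * lam\<rfloor>}" using lam_pos by auto
    then have "finite ((\<lambda>k::int. of_int k / lam) -` {x})" by (rule finite_subset) simp
    then show ?thesis by (simp add: emeasure_distr ennreal_mult_eq_top_iff)
  qed
  have "emeasure ?G (- ?R) = 0"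
  proof -
    have "(\<lambda>k::int. of_int k / lam) -` (- ?R) = {}" by auto
    then show ?thesis using R by (simp add: emeasure_distr)
  qed
  then show "\<exists>A. countable A \<and> A \<subseteq> sets ?G \<and> \<Union> A = space ?G \<and> (\<forall>a\<in>A. emeasure ?G a \<noteq> \<infinity>)"
    using cR R fin by (intro exI[of _ "insert (- ?R) ((\<lambda>x. {x}) ` ?R)"]) (auto simp: space_scale_measure)
qed

lemma sigma_finite_dxi: "sigma_finite_measure (dxi lam)"
proof -
  interpret G: sigma_finite_measure "scale_measure (ennreal (1 / lam)) (distr (count_space UNIV) borel (\<lambda>k::int. of_int k / lam))"
    by (rule sigma_finite_grid)
  show ?thesis unfolding dxi_def by (rule sigma_finite_pair_measure) (rule lborel.sigma_finite_measure_axioms, rule G.sigma_finite_measure_axioms)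
qed

lemma sets_dxi [measurable_cong, simp]: "sets (dxi lam) = sets borel"
  unfolding dxi_def by (subst borel_prod[symmetric]) (intro sets_pair_measure_cong, auto)

lemma space_dxi [simp]: "space (dxi lam) = UNIV"
  using sets_eq_imp_space_eq[OF sets_dxi] by simp

lemma nn_integral_dxi:
  assumes [measurable]: "g \<in> borel_measurable borel"
  shows "(\<integral>\<^sup>+\<xi>. g \<xi> \<partial>dxi lam) = (\<integral>\<^sup>+\<mu>. ennreal (1 / lam) * (\<integral>\<^sup>+k. g (\<mu>, of_int k / lam) \<partial>count_space (UNIV :: int set)) \<partial>lborel)"
proof -
  let ?G = "scale_measure (ennreal (1 / lam)) (distr (count_space UNIV) borel (\<lambda>k::int. of_int k / lam))"
  interpret G: sigma_finite_measure ?G by (rule sigma_finite_grid)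
  have g: "g \<in> borel_measurable (lborel \<Otimes>\<^sub>M ?G)"
    using assms sets_dxi unfolding dxi_def by (simp cong: measurable_cong_sets)
  show ?thesis unfolding dxi_def
    by (subst G.nn_integral_fst[OF g, symmetric]) (simp add: nn_integral_scale_measure nn_integral_distr)
qed

lemma nn_integral_dxi_snd:
  assumes [measurable]: "g \<in> borel_measurable borel"
  shows "(\<integral>\<^sup>+\<xi>. g \<xi> \<partial>dxi lam) = ennreal (1 / lam) * (\<integral>\<^sup>+k. \<integral>\<^sup>+\<mu>. g (\<mu>, of_int k / lam) \<partial>lborel \<partial>count_space (UNIV :: int set))"
proof -
  interpret C: sigma_finite_measure "count_space (UNIV :: int set)" by (rule sigma_finite_count_space_int)
  have [measurable]: "(\<lambda>\<mu>. \<integral>\<^sup>+k. g (\<mu>, of_int k / lam) \<partial>count_space (UNIV :: int set)) \<in> borel_measurable lborel"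
    by (rule C.borel_measurable_nn_integral)
       (use measurable_pair_count_space_int[of "\<lambda>\<mu> k. g (\<mu>, of_int k / lam)" lborel borel] in \<open>simp add: split_beta'\<close>)
  have "(\<integral>\<^sup>+\<xi>. g \<xi> \<partial>dxi lam) = ennreal (1 / lam) * (\<integral>\<^sup>+\<mu>. (\<integral>\<^sup>+k. g (\<mu>, of_int k / lam) \<partial>count_space (UNIV :: int set)) \<partial>lborel)"
    by (subst nn_integral_dxi) (auto intro: nn_integral_cmult)
  also have "(\<integral>\<^sup>+\<mu>. (\<integral>\<^sup>+k. g (\<mu>, of_int k / lam) \<partial>count_space (UNIV :: int set)) \<partial>lborel)
      = (\<integral>\<^sup>+k. \<integral>\<^sup>+\<mu>. g (\<mu>, of_int k / lam) \<partial>lborel \<partial>count_space (UNIV :: int set))"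
    by (rule nn_integral_count_space_int_swap[symmetric]) (auto intro: lborel.sigma_finite_measure_axioms)
  finally show ?thesis .
qed

text \<open>\<open>dxi\<close> is a product with a scaled image measure. As a constant density over
  a single image measure it falls under the transfer rules for Bochner integrals.\<close>

lemma dxi_eq_density:
  "dxi lam = density (distr param_measure borel freq_param) (\<lambda>_. ennreal (1 / lam))"
proof (rule measure_eqI)
  fix A assume A: "A \<in> sets (dxi lam)"
  then have [measurable]: "A \<in> sets borel" by simp
  interpret C: sigma_finite_measure "count_space (UNIV :: int set)" by (rule sigma_finite_count_space_int)
  interpret pair_sigma_finite "lborel :: real measure" "count_space (UNIV :: int set)" ..
  have m: "(\<lambda>x. indicator A (freq_param x) :: ennreal) \<in> borel_measurable param_measure" by measurable
  have "emeasure (density (distr param_measure borel freq_param) (\<lambda>_. ennreal (1 / lam))) A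
      = (\<integral>\<^sup>+x. ennreal (1 / lam) * indicator A x \<partial>distr param_measure borel freq_param)"
    by (rule emeasure_density) auto
  also have "\<dots> = (\<integral>\<^sup>+x. ennreal (1 / lam) * indicator A (freq_param x) \<partial>param_measure)"
    by (rule nn_integral_distr) auto
  also have "\<dots> = ennreal (1 / lam) * (\<integral>\<^sup>+x. indicator A (freq_param x) \<partial>param_measure)"
    by (rule nn_integral_cmult) measurable
  also have "(\<integral>\<^sup>+x. indicator A (freq_param x) \<partial>param_measure)
      = (\<integral>\<^sup>+k. \<integral>\<^sup>+\<mu>. indicator A (\<mu>, of_int k / lam) \<partial>lborel \<partial>count_space (UNIV :: int set))"
    by (subst nn_integral_snd[symmetric]) (use m in \<open>auto simp: split_beta'\<close>)
  also have "ennreal (1 / lam) * \<dots> = emeasure (dxi lam) A"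
    by (subst nn_integral_dxi_snd[symmetric]) auto
  finally show "emeasure (dxi lam) A = emeasure (density (distr param_measure borel freq_param) (\<lambda>_. ennreal (1 / lam))) A" ..
qed simp

lemma integrable_dxi_iff:
  fixes h :: "real \<times> real \<Rightarrow> complex"
  assumes [measurable]: "h \<in> borel_measurable borel"
  shows "integrable (dxi lam) h \<longleftrightarrow> integrable param_measure (\<lambda>x. h (freq_param x))"
proof -
  have "integrable (dxi lam) h \<longleftrightarrow> integrable param_measure (\<lambda>x. (1 / lam) *\<^sub>R h (freq_param x))"
    unfolding dxi_eq_density using lam_pos
    by (subst integrable_density) (auto simp: integrable_distr_eq)
  also have "\<dots> \<longleftrightarrow> integrable param_measure (\<lambda>x. h (freq_param x))"
    using integrable_scaleR_right[of lam param_measure "\<lambda>x. (1 / lam) *\<^sub>R h (freq_param x)"] lam_pos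
    by (auto intro: integrable_scaleR_right)
  finally show ?thesis .
qed

lemma integral_dxi:
  fixes h :: "real \<times> real \<Rightarrow> complex"
  assumes [measurable]: "h \<in> borel_measurable borel"
  shows "(\<integral>\<xi>. h \<xi> \<partial>dxi lam) = (1 / lam) *\<^sub>R (\<integral>x. h (freq_param x) \<partial>param_measure)"
  unfolding dxi_eq_density using lam_pos
  by (subst integral_density) (auto simp: integral_distr)

text \<open>For functions living on finitely many rows the sum over rows is finite, so the Bochner
  integral splits without a convergence question.\<close>

lemma integral_dxi_finite:
  fixes h :: "real \<times> real \<Rightarrow> complex"
  assumes h: "integrable (dxi lam) h" and K: "finite K"
    and 0: "\<And>\<mu> k. k \<notin> K \<Longrightarrow> h (\<mu>, of_int k / lam) = 0"
  shows "(\<integral>\<xi>. h \<xi> \<partial>dxi lam) = (1 / lam) *\<^sub>R (\<Sum>k\<in>K. \<integral>\<mu>. h (\<mu>, of_int k / lam) \<partial>lborel)"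
proof -
  have [measurable]: "h \<in> borel_measurable borel" using borel_measurable_integrable[OF h] by simp
  interpret C: sigma_finite_measure "count_space (UNIV :: int set)" by (rule sigma_finite_count_space_int)
  interpret pair_sigma_finite "lborel :: real measure" "count_space (UNIV :: int set)" ..
  have "integrable param_measure (case_prod (\<lambda>\<mu> k. h (\<mu>, of_int k / lam)))"
    using h unfolding integrable_dxi_iff[OF \<open>h \<in> borel_measurable borel\<close>] by (simp add: split_beta')
  from integral_snd[OF this]
  have "(\<integral>x. h (freq_param x) \<partial>param_measure) = (\<integral>k. \<integral>\<mu>. h (\<mu>, of_int k / lam) \<partial>lborel \<partial>count_space UNIV)"
    by (simp add: split_beta')
  also have "\<dots> = (\<Sum>k\<in>K. \<integral>\<mu>. h (\<mu>, of_int k / lam) \<partial>lborel)"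
  proof (subst lebesgue_integral_count_space_finite_support)
    have *: "{k \<in> UNIV. (\<integral>\<mu>. h (\<mu>, of_int k / lam) \<partial>lborel) \<noteq> 0} \<subseteq> K"
    proof (rule subsetI, rule ccontr)
      fix k assume "k \<in> {k \<in> UNIV. (\<integral>\<mu>. h (\<mu>, of_int k / lam) \<partial>lborel) \<noteq> 0}" "k \<notin> K"
      then show False using 0[of k] by simp
    qed
    show "finite {k \<in> UNIV. (\<integral>\<mu>. h (\<mu>, of_int k / lam) \<partial>lborel) \<noteq> 0}" by (rule finite_subset[OF * K])
    show "(\<Sum>k | k \<in> UNIV \<and> (\<integral>\<mu>. h (\<mu>, of_int k / lam) \<partial>lborel) \<noteq> 0. \<integral>\<mu>. h (\<mu>, of_int k / lam) \<partial>lborel)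
        = (\<Sum>k\<in>K. \<integral>\<mu>. h (\<mu>, of_int k / lam) \<partial>lborel)"
      by (rule sum.mono_neutral_left[OF K *]) auto
  qed
  finally show ?thesis by (simp add: integral_dxi)
qed

text \<open>\<open>dxi lam\<close> is a measure on the whole plane but invariant only under shifts
  from the grid; this recovers grid points inside integrals.\<close>

lemma AE_dxi_frequencies: "AE \<xi> in dxi lam. \<xi> \<in> frequencies lam"
proof -
  have "AE x in param_measure. freq_param x \<in> frequencies lam"
    by (rule AE_I2) (auto simp: frequencies_def)
  then have "AE \<xi> in distr param_measure borel freq_param. \<xi> \<in> frequencies lam"
    by (subst AE_distr_iff) auto
  then show ?thesis unfolding dxi_eq_density by (subst AE_density) auto
qed

text \<open>One reflection covers all symmetries in use: \<zeta> = 0 gives \<xi> -> -\<xi>, two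
  reflections compose to a translation, and \<zeta> = -\<xi>_1 - \<xi>_2 exchanges the last two
  variables of the hyperplane.\<close>

lemma nn_integral_dxi_reflect:
  assumes [measurable]: "g \<in> borel_measurable borel" and \<zeta>: "\<zeta> \<in> frequencies lam"
  shows "(\<integral>\<^sup>+\<xi>. g (\<zeta> - \<xi>) \<partial>dxi lam) = (\<integral>\<^sup>+\<xi>. g \<xi> \<partial>dxi lam)"
proof -
  obtain a j where z: "\<zeta> = (a, of_int j / lam)" using \<zeta> by (auto simp: frequencies_def)
  have bij: "bij_betw (\<lambda>k::int. j - k) UNIV UNIV"
    by (rule bij_betw_byWitness[where f' = "\<lambda>k. j - k"]) auto
  have "(\<integral>\<^sup>+\<xi>. g (\<zeta> - \<xi>) \<partial>dxi lam) = ennreal (1 / lam) *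
      (\<integral>\<^sup>+k. \<integral>\<^sup>+\<mu>. g (a - \<mu>, of_int (j - k) / lam) \<partial>lborel \<partial>count_space (UNIV :: int set))"
    by (subst nn_integral_dxi_snd) (auto simp: z diff_divide_distrib)
  also have "\<dots> = ennreal (1 / lam) * (\<integral>\<^sup>+k. \<integral>\<^sup>+\<mu>. g (a - \<mu>, of_int k / lam) \<partial>lborel \<partial>count_space (UNIV :: int set))"
    using nn_integral_bij_count_space[OF bij, of "\<lambda>k. \<integral>\<^sup>+\<mu>. g (a - \<mu>, of_int k / lam) \<partial>lborel"] by simp
  also have "\<dots> = ennreal (1 / lam) * (\<integral>\<^sup>+k. \<integral>\<^sup>+\<mu>. g (\<mu>, of_int k / lam) \<partial>lborel \<partial>count_space (UNIV :: int set))"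
  proof -
    have "(\<integral>\<^sup>+\<mu>. g (\<mu>, of_int k / lam) \<partial>lborel) = (\<integral>\<^sup>+\<mu>. g (a - \<mu>, of_int k / lam) \<partial>lborel)" for k :: int
      by (subst nn_integral_real_affine[of _ "-1" a]) auto
    then show ?thesis by simp
  qed
  also have "\<dots> = (\<integral>\<^sup>+\<xi>. g \<xi> \<partial>dxi lam)" by (simp add: nn_integral_dxi_snd)
  finally show ?thesis .
qed

lemma zero_frequency: "0 \<in> frequencies lam"
  by (auto simp: frequencies_def zero_prod_def intro!: image_eqI[of _ _ 0])

lemma frequencies_diff:
  assumes "\<xi> \<in> frequencies lam" "\<zeta> \<in> frequencies lam"
  shows "\<xi> - \<zeta> \<in> frequencies lam"
proof -
  obtain a j b k where "\<xi> = (a, of_int j / lam)" "\<zeta> = (b, of_int k / lam)" using assms by (auto simp: frequencies_def)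
  then show ?thesis by (auto simp: frequencies_def intro!: image_eqI[of _ _ "j - k"] simp: diff_divide_distrib)
qed

lemma frequencies_uminus: "\<xi> \<in> frequencies lam \<Longrightarrow> - \<xi> \<in> frequencies lam"
  using frequencies_diff[OF zero_frequency, of \<xi>] by simp

lemma frequencies_add: "\<xi> \<in> frequencies lam \<Longrightarrow> \<zeta> \<in> frequencies lam \<Longrightarrow> \<xi> + \<zeta> \<in> frequencies lam"
  using frequencies_diff[OF _ frequencies_uminus, of \<xi> \<zeta>] by simp

lemma distr_dxi_reflect:
  assumes "\<zeta> \<in> frequencies lam"
  shows "distr (dxi lam) borel (\<lambda>\<xi>. \<zeta> - \<xi>) = dxi lam"
proof (rule measure_eqI)
  fix A assume "A \<in> sets (distr (dxi lam) borel (\<lambda>\<xi>. \<zeta> - \<xi>))"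
  then have [measurable]: "A \<in> sets borel" by simp
  have "emeasure (distr (dxi lam) borel (\<lambda>\<xi>. \<zeta> - \<xi>)) A = (\<integral>\<^sup>+\<xi>. indicator A \<xi> \<partial>distr (dxi lam) borel (\<lambda>\<xi>. \<zeta> - \<xi>))"
    by simp
  also have "\<dots> = (\<integral>\<^sup>+\<xi>. indicator A (\<zeta> - \<xi>) \<partial>dxi lam)" by (rule nn_integral_distr) measurable
  also have "\<dots> = emeasure (dxi lam) A" by (subst nn_integral_dxi_reflect[OF _ assms]) auto
  finally show "emeasure (distr (dxi lam) borel (\<lambda>\<xi>. \<zeta> - \<xi>)) A = emeasure (dxi lam) A" .
qed simp

lemma integral_dxi_reflect:
  fixes h :: "real \<times> real \<Rightarrow> complex"
  assumes [measurable]: "h \<in> borel_measurable borel" and "\<zeta> \<in> frequencies lam"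
  shows "(\<integral>\<xi>. h (\<zeta> - \<xi>) \<partial>dxi lam) = (\<integral>\<xi>. h \<xi> \<partial>dxi lam)"
  by (subst (2) distr_dxi_reflect[OF assms(2), symmetric]) (simp add: integral_distr)

lemma integral_dxi_translate:
  fixes h :: "real \<times> real \<Rightarrow> complex"
  assumes [measurable]: "h \<in> borel_measurable borel" and "\<zeta> \<in> frequencies lam"
  shows "(\<integral>\<xi>. h (\<xi> + \<zeta>) \<partial>dxi lam) = (\<integral>\<xi>. h \<xi> \<partial>dxi lam)"
  using integral_dxi_reflect[of "\<lambda>\<xi>. h (- \<xi>)" "- \<zeta>"] integral_dxi_reflect[of h 0] assms(2)
  by (simp add: frequencies_uminus zero_frequency add.commute)

lemma AE_dxi_reflect:
  assumes "\<zeta> \<in> frequencies lam" and P: "AE \<xi> in dxi lam. P \<xi>"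
  shows "AE \<xi> in dxi lam. P (\<zeta> - \<xi>)"
proof -
  have "AE \<xi> in distr (dxi lam) borel (\<lambda>\<xi>. \<zeta> - \<xi>). P \<xi>" unfolding distr_dxi_reflect[OF assms(1)] by (rule P)
  then show ?thesis by (rule AE_distrD[rotated]) measurable
qed

end

text \<open>Lets measurability proofs project from \<open>borel\<close> on a product space, which
  equals the product sigma-algebra without having its form.\<close>

lemma borel_measurable_fst_comp [measurable (raw)]:
  fixes f :: "'a \<Rightarrow> 'b::second_countable_topology \<times> 'c::second_countable_topology"
  shows "f \<in> borel_measurable M \<Longrightarrow> (\<lambda>x. fst (f x)) \<in> borel_measurable M"
  by (rule measurable_compose[OF _ measurable_fst, of f M borel borel]) (simp add: borel_prod)

lemma borel_measurable_snd_comp [measurable (raw)]: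
  fixes f :: "'a \<Rightarrow> 'b::second_countable_topology \<times> 'c::second_countable_topology"
  shows "f \<in> borel_measurable M \<Longrightarrow> (\<lambda>x. snd (f x)) \<in> borel_measurable M"
  by (rule measurable_compose[OF _ measurable_snd, of f M borel borel]) (simp add: borel_prod)

section \<open>Integration over the strip, and the transform of integrable functions\<close>

context cylinder
begin

abbreviation "period \<equiv> 2 * pi * lam"
abbreviation "strip \<equiv> UNIV \<times> {0..<period} :: (real \<times> real) set"

lemma period_pos: "0 < period" using lam_pos by simp

lemma strip_borel [measurable]: "strip \<in> sets borel"
  unfolding borel_prod[symmetric] by measurable

lemma space_dz: "space (dz lam) = strip"
  by (simp add: dz_def space_restrict_space)

lemma measurable_dz: "f \<in> measurable borel N \<Longrightarrow> f \<in> measurable (dz lam) N"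
  unfolding dz_def by (rule measurable_restrict_space1) simp

lemma measurable_dz_iff:
  fixes f :: "real \<times> real \<Rightarrow> complex"
  shows "f \<in> borel_measurable (dz lam) \<longleftrightarrow> (\<lambda>z. indicator strip z *\<^sub>R f z) \<in> borel_measurable borel"
  unfolding dz_def by (subst borel_measurable_restrict_space_iff) auto

lemma sigma_finite_dz: "sigma_finite_measure (dz lam)"
  unfolding dz_def by (rule sigma_finite_measure_restrict_space) (auto intro: lborel.sigma_finite_measure_axioms)

lemma nn_integral_dz:
  assumes [measurable]: "g \<in> borel_measurable borel"
  shows "(\<integral>\<^sup>+z. g z \<partial>dz lam) = (\<integral>\<^sup>+y. \<integral>\<^sup>+x. g (x, y) * indicator {0..<period} y \<partial>lborel \<partial>lborel)"
proof -
  have [measurable]: "g \<in> borel_measurable (lborel \<Otimes>\<^sub>M lborel)" unfolding lborel_prod by simp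
  have "(\<integral>\<^sup>+z. g z \<partial>dz lam) = (\<integral>\<^sup>+z. g z * indicator strip z \<partial>(lborel \<Otimes>\<^sub>M lborel))"
    unfolding dz_def lborel_prod by (rule nn_integral_restrict_space) simp
  also have "\<dots> = (\<integral>\<^sup>+y. \<integral>\<^sup>+x. g (x, y) * indicator strip (x, y) \<partial>lborel \<partial>lborel)"
    by (subst lborel_pair.nn_integral_snd[symmetric]) (auto simp: split_beta' lborel_prod)
  finally show ?thesis by (simp add: indicator_times)
qed

text \<open>Finite measure of the bands makes the truncations in \<open>fourier\<close>
  integrable.\<close>

lemma finite_measure_band: "emeasure (dz lam) {z \<in> space (dz lam). \<bar>fst z\<bar> \<le> r} < \<infinity>"
proof -
  have [measurable]: "{z. \<bar>fst z\<bar> \<le> r} \<in> sets (borel :: (real \<times> real) measure)" by measurable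
  have "emeasure (dz lam) {z \<in> space (dz lam). \<bar>fst z\<bar> \<le> r} = (\<integral>\<^sup>+z. indicator {z. \<bar>fst z\<bar> \<le> r} z \<partial>dz lam)"
  proof -
    have "{z. \<bar>fst z\<bar> \<le> r} \<inter> strip \<in> sets (dz lam)" unfolding dz_def by (subst sets_restrict_space_iff) auto
    then have "emeasure (dz lam) ({z. \<bar>fst z\<bar> \<le> r} \<inter> strip) = (\<integral>\<^sup>+z. indicator ({z. \<bar>fst z\<bar> \<le> r} \<inter> strip) z \<partial>dz lam)" by simp
    also have "\<dots> = (\<integral>\<^sup>+z. indicator {z. \<bar>fst z\<bar> \<le> r} z \<partial>dz lam)"
      by (intro nn_integral_cong) (auto simp: space_dz indicator_def)
    also have "{z. \<bar>fst z\<bar> \<le> r} \<inter> strip = {z \<in> space (dz lam). \<bar>fst z\<bar> \<le> r}" by (auto simp: space_dz)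
    finally show ?thesis .
  qed
  also have "\<dots> = (\<integral>\<^sup>+y. \<integral>\<^sup>+x. indicator {- r..r} x * indicator {0..<period} y \<partial>lborel \<partial>lborel)"
    by (subst nn_integral_dz) (auto intro!: nn_integral_cong simp: indicator_def)
  also have "\<dots> = emeasure lborel {- r..r} * ennreal period"
    using lam_pos by (simp add: nn_integral_multc nn_integral_cmult)
  also have "\<dots> < \<infinity>" by (simp add: ennreal_mult_less_top emeasure_lborel_Icc_eq)
  finally show ?thesis .
qed

text \<open>A plain integral, convergent for band-limited h; general data are reached by frequency
  cutoffs followed by L^2 limits.\<close>

definition fourier_inverse :: "(real \<times> real \<Rightarrow> complex) \<Rightarrow> real \<times> real \<Rightarrow> complex" where
  "fourier_inverse h z = complex_of_real (1 / (2 * pi)) * (\<integral>\<xi>. h \<xi> * exp (\<i> * complex_of_real (z \<bullet> \<xi>)) \<partial>dxi lam)"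

lemma measurable_character:
  fixes c :: complex
  assumes 1: "(\<lambda>x. x) \<in> measurable M1 (borel :: (real \<times> real) measure)" and 2: "(\<lambda>x. x) \<in> measurable M2 borel"
  shows "(\<lambda>p. exp (c * complex_of_real (fst p \<bullet> snd p))) \<in> borel_measurable (M1 \<Otimes>\<^sub>M M2)"
    "(\<lambda>p. exp (c * complex_of_real (snd p \<bullet> fst p))) \<in> borel_measurable (M1 \<Otimes>\<^sub>M M2)"
proof -
  have f: "fst \<in> borel_measurable (M1 \<Otimes>\<^sub>M M2)" by (rule measurable_compose[OF measurable_fst 1])
  have s: "snd \<in> borel_measurable (M1 \<Otimes>\<^sub>M M2)" by (rule measurable_compose[OF measurable_snd 2])
  have "(\<lambda>p. fst p \<bullet> snd p) \<in> borel_measurable (M1 \<Otimes>\<^sub>M M2)" by (rule borel_measurable_inner[OF f s])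
  from measurable_compose[OF this, of "\<lambda>t. exp (c * complex_of_real t)"]
  show "(\<lambda>p. exp (c * complex_of_real (fst p \<bullet> snd p))) \<in> borel_measurable (M1 \<Otimes>\<^sub>M M2)" by simp
  then show "(\<lambda>p. exp (c * complex_of_real (snd p \<bullet> fst p))) \<in> borel_measurable (M1 \<Otimes>\<^sub>M M2)"
    by (simp add: inner_commute)
qed

lemma measurable_id_dz: "(\<lambda>z. z) \<in> measurable (dz lam) borel"
  by (rule measurable_dz) simp

lemma measurable_id_dxi: "(\<lambda>z. z) \<in> measurable (dxi lam) borel"
  by (rule measurable_ident_sets) simp

lemma borel_measurable_fourier_integral:
  assumes "f \<in> borel_measurable (dz lam)"
  shows "fourier_integral lam f \<in> borel_measurable borel"
proof -
  interpret sigma_finite_measure "dz lam" by (rule sigma_finite_dz)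
  have "(\<lambda>p. f (snd p) * exp (- \<i> * complex_of_real (snd p \<bullet> fst p))) \<in> borel_measurable (borel \<Otimes>\<^sub>M dz lam)"
    by (intro borel_measurable_times measurable_compose[OF measurable_snd assms] measurable_character measurable_id_dz measurable_ident_sets[OF refl])
  then have "(\<lambda>\<xi>. \<integral>z. f z * exp (- \<i> * complex_of_real (z \<bullet> \<xi>)) \<partial>dz lam) \<in> borel_measurable borel"
    by (intro borel_measurable_lebesgue_integral) (simp add: split_beta')
  then show ?thesis unfolding fourier_integral_def[abs_def] by (intro borel_measurable_times borel_measurable_const)
qed

lemma borel_measurable_fourier_inverse:
  assumes "h \<in> borel_measurable borel"
  shows "fourier_inverse h \<in> borel_measurable borel"
proof -
  interpret sigma_finite_measure "dxi lam" by (rule sigma_finite_dxi)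
  have h: "h \<in> borel_measurable (dxi lam)" using assms by simp
  have "(\<lambda>p. h (snd p) * exp (\<i> * complex_of_real (fst p \<bullet> snd p))) \<in> borel_measurable (borel \<Otimes>\<^sub>M dxi lam)"
    by (intro borel_measurable_times measurable_compose[OF measurable_snd h] measurable_character measurable_id_dxi measurable_ident_sets[OF refl])
  then have "(\<lambda>z. \<integral>\<xi>. h \<xi> * exp (\<i> * complex_of_real (z \<bullet> \<xi>)) \<partial>dxi lam) \<in> borel_measurable borel"
    by (intro borel_measurable_lebesgue_integral) (simp add: split_beta')
  then show ?thesis unfolding fourier_inverse_def[abs_def] by (intro borel_measurable_times borel_measurable_const)
qed

text \<open>Extended to L^2, this pairing with inverse transforms determines the transform
  (\<open>fourier_eqI\<close>).\<close>

lemma fourier_adjoint: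
  assumes f: "integrable (dz lam) f" and h: "integrable (dxi lam) h"
  shows "(\<integral>\<xi>. fourier_integral lam f \<xi> * cnj (h \<xi>) \<partial>dxi lam) = (\<integral>z. f z * cnj (fourier_inverse h z) \<partial>dz lam)"
proof -
  interpret Z: sigma_finite_measure "dz lam" by (rule sigma_finite_dz)
  interpret X: sigma_finite_measure "dxi lam" by (rule sigma_finite_dxi)
  interpret pair_sigma_finite "dz lam" "dxi lam" ..
  let ?e = "\<lambda>z \<xi>. exp (- \<i> * complex_of_real (z \<bullet> \<xi>))"
  have "integrable (dz lam \<Otimes>\<^sub>M dxi lam) (\<lambda>(z, \<xi>). f z * cnj (h \<xi>) * ?e z \<xi>)"
  proof (intro integrable_pair_product f integrable_cnj h)
    show "(\<lambda>(z, \<xi>). ?e z \<xi>) \<in> borel_measurable (dz lam \<Otimes>\<^sub>M dxi lam)"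
      using measurable_character(1)[OF measurable_id_dz measurable_id_dxi, of "- \<i>"] by (simp add: split_beta')
  qed auto
  from Fubini_integral[OF this]
  have eq: "(\<integral>\<xi>. \<integral>z. f z * cnj (h \<xi>) * ?e z \<xi> \<partial>dz lam \<partial>dxi lam) = (\<integral>z. \<integral>\<xi>. f z * cnj (h \<xi>) * ?e z \<xi> \<partial>dxi lam \<partial>dz lam)" .
  have "(\<integral>\<xi>. fourier_integral lam f \<xi> * cnj (h \<xi>) \<partial>dxi lam)
      = (\<integral>\<xi>. complex_of_real (1 / (2 * pi)) * (\<integral>z. f z * cnj (h \<xi>) * ?e z \<xi> \<partial>dz lam) \<partial>dxi lam)"
  proof (rule Bochner_Integration.integral_cong[OF refl])
    fix \<xi>
    have "(\<integral>z. f z * ?e z \<xi> \<partial>dz lam) * cnj (h \<xi>) = (\<integral>z. f z * ?e z \<xi> * cnj (h \<xi>) \<partial>dz lam)"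
      by (rule integral_mult_left_zero[symmetric])
    also have "\<dots> = (\<integral>z. f z * cnj (h \<xi>) * ?e z \<xi> \<partial>dz lam)" by (simp only: mult_ac)
    finally show "fourier_integral lam f \<xi> * cnj (h \<xi>) = complex_of_real (1 / (2 * pi)) * (\<integral>z. f z * cnj (h \<xi>) * ?e z \<xi> \<partial>dz lam)"
      unfolding fourier_integral_def by (simp only: mult.assoc)
  qed
  also have "\<dots> = complex_of_real (1 / (2 * pi)) * (\<integral>z. \<integral>\<xi>. f z * cnj (h \<xi>) * ?e z \<xi> \<partial>dxi lam \<partial>dz lam)"
    unfolding eq[symmetric] by (rule integral_mult_right_zero)
  also have "\<dots> = (\<integral>z. complex_of_real (1 / (2 * pi)) * (\<integral>\<xi>. f z * cnj (h \<xi>) * ?e z \<xi> \<partial>dxi lam) \<partial>dz lam)"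
    by (rule integral_mult_right_zero[symmetric])
  also have "\<dots> = (\<integral>z. f z * cnj (fourier_inverse h z) \<partial>dz lam)"
  proof (rule Bochner_Integration.integral_cong[OF refl])
    fix z
    have "f z * cnj (\<integral>\<xi>. h \<xi> * exp (\<i> * complex_of_real (z \<bullet> \<xi>)) \<partial>dxi lam) = (\<integral>\<xi>. f z * cnj (h \<xi> * exp (\<i> * complex_of_real (z \<bullet> \<xi>))) \<partial>dxi lam)"
      unfolding Bochner_Integration.integral_cnj[symmetric] by (rule integral_mult_right_zero[symmetric])
    also have "\<dots> = (\<integral>\<xi>. f z * cnj (h \<xi>) * ?e z \<xi> \<partial>dxi lam)"
      by (intro Bochner_Integration.integral_cong refl) (simp add: exp_cnj)
    finally have eq: "f z * cnj (\<integral>\<xi>. h \<xi> * exp (\<i> * complex_of_real (z \<bullet> \<xi>)) \<partial>dxi lam) = (\<integral>\<xi>. f z * cnj (h \<xi>) * ?e z \<xi> \<partial>dxi lam)" .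
    show "complex_of_real (1 / (2 * pi)) * (\<integral>\<xi>. f z * cnj (h \<xi>) * ?e z \<xi> \<partial>dxi lam) = f z * cnj (fourier_inverse h z)"
      unfolding fourier_inverse_def complex_cnj_mult complex_cnj_complex_of_real eq[symmetric] by (rule mult.left_commute)
  qed
  finally show ?thesis .
qed

text \<open>The ball meets finitely many rows of the grid, each in a bounded interval.\<close>

lemma emeasure_dxi_ball: "emeasure (dxi lam) {\<xi>. norm \<xi> \<le> R} < \<infinity>"
proof -
  let ?K = "{k::int. of_int k / lam \<in> {-R..R}}"
  have K: "finite ?K"
  proof (rule finite_subset)
    show "?K \<subseteq> {- \<lceil>R * lam\<rceil>..\<lceil>R * lam\<rceil>}"
    proof
      fix k assume "k \<in> ?K"
      then have "\<bar>of_int k\<bar> \<le> R * lam" using lam_pos by (auto simp: field_simps abs_le_iff)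
      then have "\<bar>of_int k\<bar> \<le> real_of_int \<lceil>R * lam\<rceil>" by linarith
      then show "k \<in> {- \<lceil>R * lam\<rceil>..\<lceil>R * lam\<rceil>}" by (simp add: abs_le_iff)
    qed
  qed simp
  have "emeasure (dxi lam) {\<xi>. norm \<xi> \<le> R} = (\<integral>\<^sup>+\<xi>. indicator {\<xi>. norm \<xi> \<le> R} \<xi> \<partial>dxi lam)" by simp
  also have "\<dots> \<le> (\<integral>\<^sup>+\<xi>. indicator {-R..R} (fst \<xi>) * indicator {-R..R} (snd \<xi>) \<partial>dxi lam)"
  proof (rule nn_integral_mono)
    fix \<xi> :: "real \<times> real"
    show "indicator {\<xi>. norm \<xi> \<le> R} \<xi> \<le> (indicator {-R..R} (fst \<xi>) * indicator {-R..R} (snd \<xi>) :: ennreal)"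
      using norm_fst_le[of "fst \<xi>" "snd \<xi>"] norm_snd_le[of "snd \<xi>" "fst \<xi>"]
      by (cases \<xi>) (auto simp: indicator_def abs_le_iff)
  qed
  also have "\<dots> = ennreal (1 / lam) * (\<integral>\<^sup>+k. emeasure lborel {-R..R} * indicator ?K k \<partial>count_space (UNIV :: int set))"
  proof (subst nn_integral_dxi_snd)
    have "(\<integral>\<^sup>+\<mu>. indicator {-R..R} \<mu> * indicator {-R..R} (of_int k / lam) \<partial>lborel) = emeasure lborel {-R..R} * indicator ?K k" for k :: int
      by (subst nn_integral_multc) (auto simp: indicator_def[of ?K] indicator_def[of _ "of_int k / lam"])
    then show "ennreal (1 / lam) * (\<integral>\<^sup>+k. \<integral>\<^sup>+\<mu>. indicator {-R..R} (fst (\<mu>, of_int k / lam)) * indicator {-R..R} (snd (\<mu>, real_of_int k / lam)) \<partial>lborel \<partial>count_space UNIV)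
      = ennreal (1 / lam) * (\<integral>\<^sup>+k. emeasure lborel {-R..R} * indicator ?K k \<partial>count_space UNIV)"
      by simp
  qed measurable
  also have "\<dots> = ennreal (1 / lam) * (emeasure lborel {-R..R} * emeasure (count_space UNIV) ?K)"
    by (subst nn_integral_cmult) auto
  also have "\<dots> < \<infinity>"
  proof -
    have "emeasure (count_space UNIV) ?K \<noteq> top" "emeasure lborel {-R..R} \<noteq> top"
      using K by (auto simp: emeasure_lborel_Icc_eq)
    then show ?thesis
      by (auto simp only: less_top[symmetric] infinity_ennreal_def ennreal_mult_eq_top_iff ennreal_neq_top)
  qed
  finally show ?thesis .
qed

text \<open>A dense class with bounded frequency support: its members are integrable and occupy
  finitely many rows, so \<open>fourier_inverse\<close> is a finite sum of one-dimensional
  transforms.\<close>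

definition band_limited :: "(real \<times> real \<Rightarrow> complex) \<Rightarrow> bool" where
  "band_limited h \<longleftrightarrow> sq_integrable (dxi lam) h \<and> (\<exists>R. \<forall>\<xi>. norm \<xi> > R \<longrightarrow> h \<xi> = 0)"

lemma band_limited_sq: "band_limited h \<Longrightarrow> sq_integrable (dxi lam) h"
  by (simp add: band_limited_def)

lemma band_limited_measurable [measurable_dest]: "band_limited h \<Longrightarrow> h \<in> borel_measurable borel"
  using sq_integrable_measurable[of "dxi lam" h] by (simp add: band_limited_def)

lemma band_limited_integrable:
  assumes "band_limited h"
  shows "integrable (dxi lam) h"
proof -
  obtain R where R: "\<And>\<xi>. norm \<xi> > R \<Longrightarrow> h \<xi> = 0" using assms by (auto simp: band_limited_def)
  have "integrable (dxi lam) (\<lambda>\<xi>. h \<xi> * indicator {\<xi>. norm \<xi> \<le> R} \<xi>)"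
    using assms emeasure_dxi_ball[of R] by (intro integrable_mult_L2 sq_integrable_indicator) (auto simp: band_limited_def)
  also have "(\<lambda>\<xi>. h \<xi> * indicator {\<xi>. norm \<xi> \<le> R} \<xi>) = h"
  proof
    show "h \<xi> * indicator {\<xi>. norm \<xi> \<le> R} \<xi> = h \<xi>" for \<xi> using R[of \<xi>] by (cases "norm \<xi> \<le> R") auto
  qed
  finally show ?thesis .
qed

lemma band_limited_truncate:
  assumes "sq_integrable (dxi lam) h"
  shows "band_limited (\<lambda>\<xi>. if norm \<xi> \<le> R then h \<xi> else 0)"
proof -
  have "Measurable.pred (dxi lam) (\<lambda>\<xi>. norm \<xi> \<le> R)" by measurable
  from sq_integrable_truncation[OF assms this] show ?thesis
    by (auto simp: band_limited_def intro!: exI[of _ R])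
qed

lemma band_limited_diff:
  assumes "band_limited g" "band_limited h"
  shows "band_limited (\<lambda>\<xi>. g \<xi> - h \<xi>)"
proof -
  obtain R1 R2 where "\<And>\<xi>. norm \<xi> > R1 \<Longrightarrow> g \<xi> = 0" "\<And>\<xi>. norm \<xi> > R2 \<Longrightarrow> h \<xi> = 0"
    using assms by (auto simp: band_limited_def)
  then show ?thesis using assms unfolding band_limited_def
    by (intro conjI sq_integrable_diff exI[of _ "max R1 R2"]) auto
qed

text \<open>Each row \<open>H k\<close> is transformed on the line by Plancherel, and the rows are
  orthogonal over one period. The constants combine as 2 pi \<lambda> c^2 2 pi = 1/\<lambda>, the
  weight of a row in \<open>dxi\<close>.\<close>

lemma fourier_inverse_isometry:
  assumes h: "band_limited h"
  shows "(\<integral>\<^sup>+z. ennreal ((cmod (fourier_inverse h z))\<^sup>2) \<partial>dz lam) = (\<integral>\<^sup>+\<xi>. ennreal ((cmod (h \<xi>))\<^sup>2) \<partial>dxi lam)"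
proof -
  have [measurable]: "h \<in> borel_measurable borel" using h by (rule band_limited_measurable)
  have [measurable]: "fourier_inverse h \<in> borel_measurable borel" by (rule borel_measurable_fourier_inverse) measurable
  obtain R where R: "\<And>\<xi>. norm \<xi> > R \<Longrightarrow> h \<xi> = 0" using h by (auto simp: band_limited_def)
  \<comment> \<open>The row of index k lies at height k/\<lambda>; rows outside \<open>?K\<close>
    miss the support of h.\<close>
  let ?K = "{- \<lceil>R * lam\<rceil>..\<lceil>R * lam\<rceil>}"
  have supp: "h (\<mu>, of_int k / lam) = 0" if "k \<notin> ?K" for \<mu> k
  proof (rule R)
    have "\<bar>real_of_int k\<bar> > R * lam" using that by (simp add: abs_le_iff) linarith
    then have "R < \<bar>of_int k / lam\<bar>" using lam_pos by (simp add: field_simps)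
    also have "\<dots> \<le> norm (\<mu>, of_int k / lam)" using norm_snd_le[of "of_int k / lam" \<mu>] by simp
    finally show "R < norm (\<mu>, of_int k / lam)" .
  qed
  define H where "H k = (\<lambda>\<mu>. h (\<mu>, of_int k / lam))" for k :: int
  have [measurable]: "H k \<in> borel_measurable borel" for k unfolding H_def by measurable
  have fin: "(\<integral>\<^sup>+\<xi>. ennreal ((cmod (h \<xi>))\<^sup>2) \<partial>dxi lam) < \<infinity>"
    using L2_norm_eq_nn_integral[OF band_limited_sq[OF h]] by simp
  have sum: "(\<integral>\<^sup>+\<xi>. ennreal ((cmod (h \<xi>))\<^sup>2) \<partial>dxi lam) = ennreal (1 / lam) * (\<Sum>k\<in>?K. \<integral>\<^sup>+\<mu>. ennreal ((cmod (H k \<mu>))\<^sup>2) \<partial>lborel)"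
    unfolding H_def by (subst nn_integral_dxi_snd, simp, subst nn_integral_count_space'[of ?K]) (auto simp: supp)
  have Hfin: "(\<integral>\<^sup>+\<mu>. ennreal ((cmod (H k \<mu>))\<^sup>2) \<partial>lborel) < \<infinity>" for k
  proof (cases "k \<in> ?K")
    case True
    have "(\<Sum>k\<in>?K. \<integral>\<^sup>+\<mu>. ennreal ((cmod (H k \<mu>))\<^sup>2) \<partial>lborel) < \<infinity>"
      using fin lam_pos unfolding sum by (auto simp: ennreal_mult_less_top)
    then show ?thesis
      by (rule le_less_trans[rotated]) (rule member_le_sum[OF True], auto)
  qed (simp add: H_def supp)
  have H2: "sq_integrable lborel (H k)" for k
    using Hfin[of k] by (auto simp: sq_integrable_def integrable_iff_bounded)
  have H1: "integrable lborel (H k)" for k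
  proof -
    have "integrable lborel (\<lambda>\<mu>. H k \<mu> * indicator {-R..R} \<mu>)"
      by (intro integrable_mult_L2 H2 sq_integrable_indicator) (auto simp: emeasure_lborel_Icc_eq)
    also have "(\<lambda>\<mu>. H k \<mu> * indicator {-R..R} \<mu>) = H k"
    proof
      fix \<mu>
      show "H k \<mu> * indicator {-R..R} \<mu> = H k \<mu>"
        using R[of "(\<mu>, of_int k / lam)"] norm_fst_le[of \<mu> "of_int k / lam"]
        by (cases "\<mu> \<in> {-R..R}") (auto simp: H_def abs_le_iff)
    qed
    finally show ?thesis .
  qed
  define c where "c = 1 / (2 * pi * lam)"
  have inv: "fourier_inverse h (x, y) = (\<Sum>k\<in>?K. (complex_of_real c * ft (H k) (- x)) * exp (\<i> * complex_of_real (y * (of_int k / lam))))" for x y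
  proof -
    let ?g = "\<lambda>\<xi>. h \<xi> * exp (\<i> * complex_of_real ((x, y) \<bullet> \<xi>))"
    have "integrable (dxi lam) ?g"
      by (rule Bochner_Integration.integrable_bound[OF band_limited_integrable[OF h]]) (auto simp: norm_mult)
    then have "(\<integral>\<xi>. ?g \<xi> \<partial>dxi lam) = (1 / lam) *\<^sub>R (\<Sum>k\<in>?K. \<integral>\<mu>. ?g (\<mu>, of_int k / lam) \<partial>lborel)"
      by (rule integral_dxi_finite) (auto simp: supp)
    also have "(\<lambda>k. \<integral>\<mu>. ?g (\<mu>, of_int k / lam) \<partial>lborel) = (\<lambda>k. ft (H k) (- x) * exp (\<i> * complex_of_real (y * (of_int k / lam))))"
    proof
      fix k
      have "?g (\<mu>, of_int k / lam) = H k \<mu> * exp (- \<i> * complex_of_real (\<mu> * (- x))) * exp (\<i> * complex_of_real (y * (of_int k / lam)))" for \<mu>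
        by (simp add: H_def exp_add[symmetric] algebra_simps)
      then show "(\<integral>\<mu>. ?g (\<mu>, of_int k / lam) \<partial>lborel) = ft (H k) (- x) * exp (\<i> * complex_of_real (y * (of_int k / lam)))"
        unfolding ft_def by (simp only: integral_mult_left_zero)
    qed
    finally show ?thesis unfolding fourier_inverse_def c_def
      by (simp add: sum_distrib_left scaleR_conv_of_real mult_ac)
  qed
  have inner: "(\<integral>\<^sup>+y. ennreal ((cmod (fourier_inverse h (x, y)))\<^sup>2) * indicator {0..<period} y \<partial>lborel)
      = (\<Sum>k\<in>?K. ennreal (period * c\<^sup>2) * ennreal ((cmod (ft (H k) (- x)))\<^sup>2))" for x
  proof -
    have hb: "has_bochner_integral lborel (\<lambda>y. indicator {0..<period} y * (cmod (fourier_inverse h (x, y)))\<^sup>2)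
        (period * (\<Sum>k\<in>?K. (cmod (complex_of_real c * ft (H k) (- x)))\<^sup>2))"
      unfolding inv by (rule integral_trig_sum[OF lam_pos]) simp
    have "(\<integral>\<^sup>+y. ennreal ((cmod (fourier_inverse h (x, y)))\<^sup>2) * indicator {0..<period} y \<partial>lborel)
        = (\<integral>\<^sup>+y. ennreal (indicator {0..<period} y * (cmod (fourier_inverse h (x, y)))\<^sup>2) \<partial>lborel)"
      by (intro nn_integral_cong) (auto simp: indicator_def)
    also have "\<dots> = ennreal (period * (\<Sum>k\<in>?K. (cmod (complex_of_real c * ft (H k) (- x)))\<^sup>2))"
      using hb by (subst nn_integral_eq_integral) (auto simp: has_bochner_integral_iff)
    also have "\<dots> = (\<Sum>k\<in>?K. ennreal (period * c\<^sup>2) * ennreal ((cmod (ft (H k) (- x)))\<^sup>2))"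
      using lam_pos
      by (simp add: norm_mult power_mult_distrib sum_distrib_left sum_ennreal[symmetric] ennreal_mult[symmetric] mult_ac del: sum_ennreal)
    finally show ?thesis .
  qed
  have [measurable]: "ft (H k) \<in> borel_measurable borel" for k by measurable
  have "(\<integral>\<^sup>+z. ennreal ((cmod (fourier_inverse h z))\<^sup>2) \<partial>dz lam)
      = (\<integral>\<^sup>+y. \<integral>\<^sup>+x. ennreal ((cmod (fourier_inverse h (x, y)))\<^sup>2) * indicator {0..<period} y \<partial>lborel \<partial>lborel)"
    by (rule nn_integral_dz) measurable
  also have "\<dots> = (\<integral>\<^sup>+x. \<integral>\<^sup>+y. ennreal ((cmod (fourier_inverse h (x, y)))\<^sup>2) * indicator {0..<period} y \<partial>lborel \<partial>lborel)"
  proof (rule lborel_pair.Fubini')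
    have "(\<lambda>z. ennreal ((cmod (fourier_inverse h z))\<^sup>2) * indicator {0..<period} (snd z)) \<in> borel_measurable borel" by measurable
    then show "(\<lambda>(x, y). ennreal ((cmod (fourier_inverse h (x, y)))\<^sup>2) * indicator {0..<period} y) \<in> borel_measurable (lborel \<Otimes>\<^sub>M lborel)"
      by (simp add: lborel_prod split_beta')
  qed
  also have "\<dots> = (\<Sum>k\<in>?K. ennreal (period * c\<^sup>2) * (\<integral>\<^sup>+x. ennreal ((cmod (ft (H k) (- x)))\<^sup>2) \<partial>lborel))"
    unfolding inner by (subst nn_integral_sum) (auto simp: nn_integral_cmult)
  also have "(\<lambda>k. \<integral>\<^sup>+x. ennreal ((cmod (ft (H k) (- x)))\<^sup>2) \<partial>lborel) = (\<lambda>k. ennreal (2 * pi) * (\<integral>\<^sup>+\<mu>. ennreal ((cmod (H k \<mu>))\<^sup>2) \<partial>lborel))"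
  proof
    fix k
    have "(\<integral>\<^sup>+x. ennreal ((cmod (ft (H k) (- x)))\<^sup>2) \<partial>lborel) = (\<integral>\<^sup>+x. ennreal ((cmod (ft (H k) x))\<^sup>2) \<partial>lborel)"
      using nn_integral_real_affine[of "\<lambda>x. ennreal ((cmod (ft (H k) x))\<^sup>2)" "-1" 0] by simp
    then show "(\<integral>\<^sup>+x. ennreal ((cmod (ft (H k) (- x)))\<^sup>2) \<partial>lborel) = ennreal (2 * pi) * (\<integral>\<^sup>+\<mu>. ennreal ((cmod (H k \<mu>))\<^sup>2) \<partial>lborel)"
      by (simp add: plancherel_real[OF H1 H2] L2_norm_eq_nn_integral[OF H2] ennreal_mult)
  qed
  also have "(\<Sum>k\<in>?K. ennreal (period * c\<^sup>2) * (ennreal (2 * pi) * (\<integral>\<^sup>+\<mu>. ennreal ((cmod (H k \<mu>))\<^sup>2) \<partial>lborel)))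
      = ennreal (1 / lam) * (\<Sum>k\<in>?K. \<integral>\<^sup>+\<mu>. ennreal ((cmod (H k \<mu>))\<^sup>2) \<partial>lborel)"
  proof -
    have "ennreal (period * c\<^sup>2) * ennreal (2 * pi) = ennreal (1 / lam)"
      using lam_pos by (simp add: ennreal_mult[symmetric] c_def power2_eq_square field_simps)
    then show ?thesis by (simp add: sum_distrib_left mult.assoc[symmetric])
  qed
  finally show ?thesis by (simp only: sum)
qed

text \<open>In x, Plancherel applies on almost every line y = const. In y, Parseval applies for
  almost every \<mu>, because Tonelli shows the partial transform to be square-integrable there. The
  constants 1/\<lambda>, 1/(2 pi)^2, 2 pi \<lambda> and 2 pi cancel.\<close>

lemma plancherel_L1_L2:
  assumes [measurable]: "f \<in> borel_measurable borel" and f1: "integrable (dz lam) f" and f2: "sq_integrable (dz lam) f"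
  shows "(\<integral>\<^sup>+\<xi>. ennreal ((cmod (fourier_integral lam f \<xi>))\<^sup>2) \<partial>dxi lam) = (\<integral>\<^sup>+z. ennreal ((cmod (f z))\<^sup>2) \<partial>dz lam)"
proof -
  \<comment> \<open>Cut to one period in y: the integral over the strip becomes one over the plane,
    and the support condition of \<open>parseval_circle\<close> holds.\<close>
  define f0 where "f0 = (\<lambda>x y. f (x, y) * indicator {0..<period} y)"
  have [measurable]: "case_prod f0 \<in> borel_measurable (lborel \<Otimes>\<^sub>M lborel)"
    unfolding f0_def lborel_prod split_beta' by measurable
  have m0 [measurable]: "(\<lambda>x. f0 x y) \<in> borel_measurable borel" for y unfolding f0_def by measurable
  define g where "g = (\<lambda>\<mu> y. ft (\<lambda>x. f0 x y) \<mu>)"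
  have gm: "case_prod g \<in> borel_measurable (lborel \<Otimes>\<^sub>M lborel)"
  proof -
    have "(\<lambda>z. ft (\<lambda>x. f0 x (snd z)) (fst z)) \<in> borel_measurable (borel :: (real \<times> real) measure)"
    proof (rule measurable_ft)
      have "(\<lambda>w. f (snd w, snd (fst w)) * indicator {0..<period} (snd (fst w))) \<in> borel_measurable ((borel :: (real \<times> real) measure) \<Otimes>\<^sub>M (borel :: real measure))" by measurable
      then show "(\<lambda>(z, x). f0 x (snd z)) \<in> borel_measurable ((borel :: (real \<times> real) measure) \<Otimes>\<^sub>M borel)"
        by (simp add: f0_def split_beta')
    qed simp
    then show ?thesis by (simp add: lborel_prod g_def split_beta')
  qed
  have [measurable]: "g \<mu> \<in> borel_measurable borel" for \<mu>
    using measurable_compose[OF measurable_Pair1' gm, of \<mu>] by simp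
  have int0: "integrable (lborel \<Otimes>\<^sub>M lborel) (case_prod f0)"
  proof -
    have "integrable lborel (\<lambda>z. indicator strip z *\<^sub>R f z)"
      using f1 unfolding dz_def by (subst (asm) integrable_restrict_space) auto
    also have "(\<lambda>z. indicator strip z *\<^sub>R f z) = case_prod f0" by (auto simp: f0_def indicator_def)
    finally show ?thesis by (simp add: lborel_prod)
  qed
  have fi: "fourier_integral lam f (\<mu>, \<eta>) = complex_of_real (1 / (2 * pi)) * ft (g \<mu>) \<eta>" for \<mu> \<eta>
  proof -
    let ?e = "\<lambda>x y. exp (- \<i> * complex_of_real ((x, y) \<bullet> (\<mu>, \<eta>)))"
    have i: "integrable (lborel \<Otimes>\<^sub>M lborel) (\<lambda>(x, y). f0 x y * ?e x y)"
    proof (rule Bochner_Integration.integrable_bound[OF int0])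
      have "(\<lambda>z. case_prod f0 z * exp (- \<i> * complex_of_real (z \<bullet> (\<mu>, \<eta>)))) \<in> borel_measurable (lborel \<Otimes>\<^sub>M lborel)"
      proof (intro borel_measurable_times)
        show "(\<lambda>z. exp (- \<i> * complex_of_real (z \<bullet> (\<mu>, \<eta>)))) \<in> borel_measurable (lborel \<Otimes>\<^sub>M lborel)"
          unfolding lborel_prod by measurable
      qed measurable
      then show "(\<lambda>(x, y). f0 x y * ?e x y) \<in> borel_measurable (lborel \<Otimes>\<^sub>M lborel)" by (simp add: split_beta')
    qed (auto simp: norm_mult)
    have "(\<integral>z. f z * exp (- \<i> * complex_of_real (z \<bullet> (\<mu>, \<eta>))) \<partial>dz lam) = (\<integral>z. indicator strip z *\<^sub>R (f z * exp (- \<i> * complex_of_real (z \<bullet> (\<mu>, \<eta>)))) \<partial>lborel)"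
      unfolding dz_def by (rule integral_restrict_space) simp
    also have "\<dots> = integral\<^sup>L (lborel \<Otimes>\<^sub>M lborel) (\<lambda>(x, y). f0 x y * ?e x y)"
      unfolding lborel_prod by (intro Bochner_Integration.integral_cong refl) (auto simp: f0_def indicator_def)
    also have "\<dots> = (\<integral>y. \<integral>x. f0 x y * ?e x y \<partial>lborel \<partial>lborel)"
      by (rule lborel_pair.integral_snd[symmetric]) (use i in simp)
    also have "(\<lambda>y. \<integral>x. f0 x y * ?e x y \<partial>lborel) = (\<lambda>y. g \<mu> y * exp (- \<i> * complex_of_real (y * \<eta>)))"
    proof
      fix y
      have "f0 x y * ?e x y = f0 x y * exp (- \<i> * complex_of_real (x * \<mu>)) * exp (- \<i> * complex_of_real (y * \<eta>))" for x
        by (simp add: exp_add[symmetric] algebra_simps)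
      then show "(\<integral>x. f0 x y * ?e x y \<partial>lborel) = g \<mu> y * exp (- \<i> * complex_of_real (y * \<eta>))"
        unfolding g_def ft_def by (simp only: integral_mult_left_zero)
    qed
    finally show ?thesis unfolding fourier_integral_def ft_def by simp
  qed
  let ?N = "(\<integral>\<^sup>+z. ennreal ((cmod (f z))\<^sup>2) \<partial>dz lam)"
  have N: "?N = (\<integral>\<^sup>+y. \<integral>\<^sup>+x. ennreal ((cmod (f0 x y))\<^sup>2) \<partial>lborel \<partial>lborel)"
    by (subst nn_integral_dz) (auto intro!: nn_integral_cong simp: f0_def indicator_def)
  have Nfin: "?N < \<infinity>" using L2_norm_eq_nn_integral[OF f2] by simp
  have m2: "(\<lambda>y. \<integral>\<^sup>+x. ennreal ((cmod (f0 x y))\<^sup>2) \<partial>lborel) \<in> borel_measurable lborel"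
  proof -
    have "(\<lambda>(y, x). ennreal ((cmod (f0 x y))\<^sup>2)) \<in> borel_measurable (lborel \<Otimes>\<^sub>M lborel)" by measurable
    from lborel.borel_measurable_nn_integral[OF this] show ?thesis .
  qed
  have AE2: "AE y in lborel. sq_integrable lborel (\<lambda>x. f0 x y)"
  proof -
    have "AE y in lborel. (\<integral>\<^sup>+x. ennreal ((cmod (f0 x y))\<^sup>2) \<partial>lborel) \<noteq> \<infinity>"
      by (rule nn_integral_PInf_AE[OF m2]) (use Nfin N in auto)
    then show ?thesis
      by eventually_elim (auto simp: sq_integrable_def integrable_iff_bounded less_top)
  qed
  have AE1: "AE y in lborel. integrable lborel (\<lambda>x. f0 x y)"
    by (rule lborel_pair.AE_integrable_snd[OF int0])
  have gy: "AE y in lborel. (\<integral>\<^sup>+\<mu>. ennreal ((cmod (g \<mu> y))\<^sup>2) \<partial>lborel) = ennreal (2 * pi) * (\<integral>\<^sup>+x. ennreal ((cmod (f0 x y))\<^sup>2) \<partial>lborel)"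
    using AE1 AE2
    by eventually_elim (simp add: g_def plancherel_real L2_norm_eq_nn_integral ennreal_mult)
  have gm2: "(\<lambda>(\<mu>, y). ennreal ((cmod (g \<mu> y))\<^sup>2)) \<in> borel_measurable (lborel \<Otimes>\<^sub>M lborel)" using gm by measurable
  have tot: "(\<integral>\<^sup>+\<mu>. \<integral>\<^sup>+y. ennreal ((cmod (g \<mu> y))\<^sup>2) \<partial>lborel \<partial>lborel) = ennreal (2 * pi) * ?N"
  proof -
    have "(\<integral>\<^sup>+\<mu>. \<integral>\<^sup>+y. ennreal ((cmod (g \<mu> y))\<^sup>2) \<partial>lborel \<partial>lborel) = (\<integral>\<^sup>+y. \<integral>\<^sup>+\<mu>. ennreal ((cmod (g \<mu> y))\<^sup>2) \<partial>lborel \<partial>lborel)"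
      by (rule lborel_pair.Fubini'[OF gm2, symmetric])
    also have "\<dots> = (\<integral>\<^sup>+y. ennreal (2 * pi) * (\<integral>\<^sup>+x. ennreal ((cmod (f0 x y))\<^sup>2) \<partial>lborel) \<partial>lborel)"
      by (rule nn_integral_cong_AE[OF gy])
    also have "\<dots> = ennreal (2 * pi) * ?N" unfolding N by (rule nn_integral_cmult[OF m2])
    finally show ?thesis .
  qed
  \<comment> \<open>The total mass \<open>tot\<close> is finite, so almost every slice is in L^2 and
    Parseval applies to it.\<close>
  have AEg: "AE \<mu> in lborel. sq_integrable lborel (g \<mu>)"
  proof -
    have "AE \<mu> in lborel. (\<integral>\<^sup>+y. ennreal ((cmod (g \<mu> y))\<^sup>2) \<partial>lborel) \<noteq> \<infinity>"
      by (rule nn_integral_PInf_AE[OF lborel.borel_measurable_nn_integral[OF gm2]]) (use Nfin tot in \<open>auto simp: ennreal_mult_eq_top_iff\<close>)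
    then show ?thesis
      by eventually_elim (auto simp: sq_integrable_def integrable_iff_bounded less_top)
  qed
  have "(\<integral>\<^sup>+\<xi>. ennreal ((cmod (fourier_integral lam f \<xi>))\<^sup>2) \<partial>dxi lam)
     = (\<integral>\<^sup>+\<mu>. ennreal (1 / lam) * (\<integral>\<^sup>+k. ennreal ((cmod (fourier_integral lam f (\<mu>, of_int k / lam)))\<^sup>2) \<partial>count_space (UNIV :: int set)) \<partial>lborel)"
    by (rule nn_integral_dxi) (use borel_measurable_fourier_integral[OF measurable_dz[OF assms(1)]] in measurable)
  also have "\<dots> = (\<integral>\<^sup>+\<mu>. ennreal (1 / (2 * pi)) * (\<integral>\<^sup>+y. ennreal ((cmod (g \<mu> y))\<^sup>2) \<partial>lborel) \<partial>lborel)"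
  proof (rule nn_integral_cong_AE)
    show "AE \<mu> in lborel. ennreal (1 / lam) * (\<integral>\<^sup>+k. ennreal ((cmod (fourier_integral lam f (\<mu>, of_int k / lam)))\<^sup>2) \<partial>count_space (UNIV :: int set))
        = ennreal (1 / (2 * pi)) * (\<integral>\<^sup>+y. ennreal ((cmod (g \<mu> y))\<^sup>2) \<partial>lborel)"
      using AEg
    proof eventually_elim
      case (elim \<mu>)
      have "g \<mu> y = 0" if "y \<notin> {0..<period}" for y
        using that by (simp add: g_def ft_def f0_def)
      from parseval_circle[OF lam_pos elim this]
      have *: "(\<integral>\<^sup>+k. ennreal ((cmod (ft (g \<mu>) (of_int k / lam)))\<^sup>2) \<partial>count_space (UNIV :: int set)) = ennreal (period * (L2_norm lborel (g \<mu>))\<^sup>2)" .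
      have "(\<integral>\<^sup>+k. ennreal ((cmod (fourier_integral lam f (\<mu>, of_int k / lam)))\<^sup>2) \<partial>count_space (UNIV :: int set))
          = ennreal ((1 / (2 * pi))\<^sup>2) * ennreal (period * (L2_norm lborel (g \<mu>))\<^sup>2)"
      proof -
        have "ennreal ((cmod (complex_of_real (1 / (2 * pi)) * X))\<^sup>2) = ennreal ((1 / (2 * pi))\<^sup>2) * ennreal ((cmod X)\<^sup>2)" for X
          by (simp only: norm_mult power_mult_distrib norm_of_real power2_abs ennreal_mult zero_le_power2)
        then show ?thesis unfolding fi *[symmetric] by (simp only: nn_integral_cmult borel_measurable_count_space)
      qed
      moreover have "ennreal (1 / lam) * (ennreal ((1 / (2 * pi))\<^sup>2) * ennreal (period * n)) = ennreal (1 / (2 * pi)) * ennreal n" if "0 \<le> n" for n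
        using lam_pos that by (simp add: ennreal_mult[symmetric] power2_eq_square field_simps)
      ultimately show ?case by (simp only: L2_norm_eq_nn_integral[OF elim] zero_le_power2)
    qed
  qed
  also have "\<dots> = ennreal (1 / (2 * pi)) * (ennreal (2 * pi) * ?N)"
    unfolding tot[symmetric] by (rule nn_integral_cmult[OF lborel.borel_measurable_nn_integral[OF gm2]])
  also have "\<dots> = ?N" by (simp add: mult.assoc[symmetric] ennreal_mult[symmetric])
  finally show ?thesis .
qed

end

section \<open>The Fourier transform on the cylinder\<close>

text \<open>Expansion needed for the polarisation in \<open>fourier_inverse_inner\<close>.\<close>

lemma L2_norm_add_power2:
  assumes f: "sq_integrable M f" and g: "sq_integrable M g"
  shows "(L2_norm M (\<lambda>x. f x + g x))\<^sup>2 = (L2_norm M f)\<^sup>2 + (L2_norm M g)\<^sup>2 + 2 * Re (\<integral>x. f x * cnj (g x) \<partial>M)"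
proof -
  have i: "integrable M (\<lambda>x. f x * cnj (g x))" by (intro integrable_mult_L2 f sq_integrable_cnj g)
  have "(\<integral>x. (cmod (f x + g x))\<^sup>2 \<partial>M) = (\<integral>x. (cmod (f x))\<^sup>2 + (cmod (g x))\<^sup>2 + 2 * Re (f x * cnj (g x)) \<partial>M)"
    by (intro Bochner_Integration.integral_cong refl)
       (simp add: cmod_power2, simp add: power2_eq_square algebra_simps)
  also have "\<dots> = (\<integral>x. (cmod (f x))\<^sup>2 \<partial>M) + (\<integral>x. (cmod (g x))\<^sup>2 \<partial>M) + 2 * (\<integral>x. Re (f x * cnj (g x)) \<partial>M)"
  proof -
    have "integrable M (\<lambda>x. (cmod (f x))\<^sup>2)" "integrable M (\<lambda>x. (cmod (g x))\<^sup>2)"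
      using f g by (simp_all add: sq_integrable_def)
    then show ?thesis using integrable_Re[OF i]
      by (simp only: Bochner_Integration.integral_add Bochner_Integration.integrable_add integral_mult_right_zero integrable_mult_right)
  qed
  also have "(\<integral>x. Re (f x * cnj (g x)) \<partial>M) = Re (\<integral>x. f x * cnj (g x) \<partial>M)" by (rule integral_Re[OF i])
  finally show ?thesis by (simp add: L2_norm_power2)
qed

context cylinder
begin

abbreviation dz' where "dz' \<equiv> dz lam"
abbreviation dxi' where "dxi' \<equiv> dxi lam"

text \<open>\<open>L2\<close> without periodicity: the integrals see one strip, and closure under
  truncation, difference and \<open>fourier_inverse\<close> is immediate.\<close>

definition L2z :: "(real \<times> real \<Rightarrow> complex) \<Rightarrow> bool" where
  "L2z f \<longleftrightarrow> f \<in> borel_measurable borel \<and> sq_integrable dz' f"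

lemma L2_imp_L2z: "L2 lam f \<Longrightarrow> L2z f"
  by (simp add: L2_def L2z_def)

lemma L2z_sq: "L2z f \<Longrightarrow> sq_integrable dz' f"
  and L2z_measurable [measurable_dest]: "L2z f \<Longrightarrow> f \<in> borel_measurable borel"
  by (simp_all add: L2z_def)

lemma L2z_diff: "L2z f \<Longrightarrow> L2z g \<Longrightarrow> L2z (\<lambda>z. f z - g z)"
  by (auto simp: L2z_def intro: sq_integrable_diff)

lemma L2z_cnj: "L2z f \<Longrightarrow> L2z (\<lambda>z. cnj (f z))"
  by (auto simp: L2z_def intro: sq_integrable_cnj)

section \<open>Extension of the transform to L^2 by truncation\<close>

abbreviation trunc :: "(real \<times> real \<Rightarrow> complex) \<Rightarrow> nat \<Rightarrow> real \<times> real \<Rightarrow> complex" where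
  "trunc f n \<equiv> (\<lambda>z. if \<bar>fst z\<bar> \<le> real n then f z else 0)"

lemma pred_band: "Measurable.pred dz' (\<lambda>z. \<bar>fst z\<bar> \<le> r)"
  by (rule measurable_dz) measurable

lemma L2z_trunc: "L2z f \<Longrightarrow> L2z (trunc f n)"
  using sq_integrable_truncation[OF _ pred_band] by (auto simp: L2z_def)

lemma trunc_integrable:
  assumes "L2z f" shows "integrable dz' (trunc f n)"
proof -
  have m: "{z \<in> space dz'. \<bar>fst z\<bar> \<le> real n} \<in> sets dz'" using pred_band by (simp add: pred_def)
  have "integrable dz' (\<lambda>z. f z * indicator {z \<in> space dz'. \<bar>fst z\<bar> \<le> real n} z)"
    by (intro integrable_mult_L2 L2z_sq assms sq_integrable_indicator m finite_measure_band)
  then show ?thesis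
    by (rule Bochner_Integration.integrable_cong[THEN iffD1, rotated 2]) auto
qed

lemma trunc_tendsto: "L2z f \<Longrightarrow> (\<lambda>n. L2_norm dz' (\<lambda>z. trunc f n z - f z)) \<longlonglongrightarrow> 0"
proof (rule L2_truncation_tendsto[OF L2z_sq pred_band])
  fix z :: "real \<times> real"
  show "\<forall>\<^sub>F n in sequentially. \<bar>fst z\<bar> \<le> real n"
    by (rule eventually_sequentiallyI[of "nat \<lceil>\<bar>fst z\<bar>\<rceil>"]) linarith
qed

lemma fourier_integral_L2:
  assumes f: "L2z f" and f1: "integrable dz' f"
  shows "sq_integrable dxi' (fourier_integral lam f)" "L2_norm dxi' (fourier_integral lam f) = L2_norm dz' f"
proof -
  have eq: "(\<integral>\<^sup>+\<xi>. ennreal ((cmod (fourier_integral lam f \<xi>))\<^sup>2) \<partial>dxi') = ennreal ((L2_norm dz' f)\<^sup>2)"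
    using plancherel_L1_L2[OF L2z_measurable[OF f] f1 L2z_sq[OF f]] L2_norm_eq_nn_integral[OF L2z_sq[OF f]] by simp
  have m: "fourier_integral lam f \<in> borel_measurable dxi'"
    using borel_measurable_fourier_integral[OF measurable_dz[OF L2z_measurable[OF f]]] by simp
  show sq: "sq_integrable dxi' (fourier_integral lam f)"
    using eq by (intro sq_integrableI_bounded[OF m]) auto
  show "L2_norm dxi' (fourier_integral lam f) = L2_norm dz' f"
    using eq unfolding L2_norm_eq_nn_integral[OF sq] by (simp add: power2_eq_iff_nonneg)
qed

lemma integrable_fourier_kernel:
  assumes "integrable dz' f" shows "integrable dz' (\<lambda>z. f z * exp (- \<i> * complex_of_real (z \<bullet> \<xi>)))"
  by (rule Bochner_Integration.integrable_bound[OF assms])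
     (intro borel_measurable_times borel_measurable_integrable[OF assms] measurable_dz, auto simp: norm_mult)

lemma fourier_integral_diff:
  assumes "integrable dz' f" "integrable dz' g"
  shows "fourier_integral lam (\<lambda>z. f z - g z) \<xi> = fourier_integral lam f \<xi> - fourier_integral lam g \<xi>"
  unfolding fourier_integral_def left_diff_distrib
  by (subst Bochner_Integration.integral_diff[OF integrable_fourier_kernel[OF assms(1)] integrable_fourier_kernel[OF assms(2)]])
     (rule right_diff_distrib)

text \<open>Both branches of \<open>fourier\<close> meet one characterisation. For integrable f the
  truncated integrals converge by Plancherel; otherwise they form a Cauchy sequence by the same
  isometry, and completeness provides the witness that \<open>SOME\<close> requires.\<close>

lemma fourier_limit:
  assumes f: "L2z f"
  shows "sq_integrable dxi' (fourier lam f) \<and> (\<lambda>n. L2_norm dxi' (\<lambda>\<xi>. fourier_integral lam (trunc f n) \<xi> - fourier lam f \<xi>)) \<longlonglongrightarrow> 0"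
proof (cases "integrable dz' f")
  case True
  have "(\<lambda>\<xi>. fourier_integral lam (trunc f n) \<xi> - fourier lam f \<xi>) = fourier_integral lam (\<lambda>z. trunc f n z - f z)" for n
    using True by (intro ext, subst fourier_integral_diff[OF trunc_integrable[OF f] True]) (simp add: fourier_def)
  then have "L2_norm dxi' (\<lambda>\<xi>. fourier_integral lam (trunc f n) \<xi> - fourier lam f \<xi>) = L2_norm dz' (\<lambda>z. trunc f n z - f z)" for n
    using fourier_integral_L2(2)[OF L2z_diff[OF L2z_trunc[OF f] f] Bochner_Integration.integrable_diff[OF trunc_integrable[OF f] True], of n] by simp
  then show ?thesis using trunc_tendsto[OF f] fourier_integral_L2(1)[OF f True] True by (simp add: fourier_def)
next
  case False
  let ?F = "\<lambda>n. fourier_integral lam (trunc f n)"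
  have sq: "sq_integrable dxi' (?F n)" for n by (rule fourier_integral_L2[OF L2z_trunc[OF f] trunc_integrable[OF f]])
  have "L2_Cauchy dz' (trunc f)"
    by (rule L2_convergent_imp_Cauchy[OF L2z_sq[OF L2z_trunc[OF f]] L2z_sq[OF f] trunc_tendsto[OF f]])
  moreover have "L2_norm dxi' (\<lambda>\<xi>. ?F m \<xi> - ?F n \<xi>) = L2_norm dz' (\<lambda>z. trunc f m z - trunc f n z)" for m n
    unfolding fourier_integral_diff[OF trunc_integrable[OF f] trunc_integrable[OF f], symmetric]
    by (rule fourier_integral_L2(2)[OF L2z_diff[OF L2z_trunc[OF f] L2z_trunc[OF f]]
        Bochner_Integration.integrable_diff[OF trunc_integrable[OF f] trunc_integrable[OF f]]])
  ultimately have "L2_Cauchy dxi' ?F" by (rule L2_Cauchy_isometry)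
  then obtain g where "sq_integrable dxi' g" "(\<lambda>n. L2_norm dxi' (\<lambda>\<xi>. ?F n \<xi> - g \<xi>)) \<longlonglongrightarrow> 0"
    by (rule L2_complete[OF sq])
  then have "\<exists>g. sq_integrable dxi' g \<and> (\<lambda>n. L2_norm dxi' (\<lambda>\<xi>. ?F n \<xi> - g \<xi>)) \<longlonglongrightarrow> 0" by blast
  from someI_ex[OF this] show ?thesis using False by (simp add: fourier_def)
qed

lemma fourier_sq: "L2z f \<Longrightarrow> sq_integrable dxi' (fourier lam f)"
  using fourier_limit by blast

lemma fourier_measurable [measurable_dest]: "L2z f \<Longrightarrow> fourier lam f \<in> borel_measurable borel"
  using sq_integrable_measurable[OF fourier_sq, of f] by simp

lemma L2_norm_fourier:
  assumes f: "L2z f"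
  shows "L2_norm dxi' (fourier lam f) = L2_norm dz' f"
proof (rule LIMSEQ_unique)
  have sq: "sq_integrable dxi' (fourier_integral lam (trunc f n))" for n
    by (rule fourier_integral_L2[OF L2z_trunc[OF f] trunc_integrable[OF f]])
  show "(\<lambda>n. L2_norm dz' (trunc f n)) \<longlonglongrightarrow> L2_norm dz' f"
    by (rule L2_norm_tendsto[OF L2z_sq[OF L2z_trunc[OF f]] L2z_sq[OF f] trunc_tendsto[OF f]])
  show "(\<lambda>n. L2_norm dz' (trunc f n)) \<longlonglongrightarrow> L2_norm dxi' (fourier lam f)"
    using L2_norm_tendsto[OF sq fourier_sq[OF f] conjunct2[OF fourier_limit[OF f]]]
    by (simp only: fourier_integral_L2(2)[OF L2z_trunc[OF f] trunc_integrable[OF f]])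
qed

lemma fourier_inverse_L2z: "band_limited h \<Longrightarrow> L2z (fourier_inverse h)"
  unfolding L2z_def
proof
  assume h: "band_limited h"
  show m: "fourier_inverse h \<in> borel_measurable borel"
    by (rule borel_measurable_fourier_inverse[OF band_limited_measurable[OF h]])
  show "sq_integrable dz' (fourier_inverse h)"
    by (rule sq_integrableI_bounded[OF measurable_dz[OF m], where B = "(L2_norm dxi' h)\<^sup>2"])
       (simp add: fourier_inverse_isometry[OF h] L2_norm_eq_nn_integral[OF band_limited_sq[OF h]])
qed

lemma L2_norm_fourier_inverse: "band_limited h \<Longrightarrow> L2_norm dz' (fourier_inverse h) = L2_norm dxi' h"
  using fourier_inverse_isometry[of h] L2_norm_eq_nn_integral[OF L2z_sq[OF fourier_inverse_L2z], of h]
    L2_norm_eq_nn_integral[OF band_limited_sq, of h] by (simp add: power2_eq_iff_nonneg)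

lemma integrable_inverse_kernel:
  assumes "integrable dxi' h" shows "integrable dxi' (\<lambda>\<xi>. h \<xi> * exp (\<i> * complex_of_real (z \<bullet> \<xi>)))"
  by (rule Bochner_Integration.integrable_bound[OF assms]) (use assms in \<open>auto simp: norm_mult\<close>)

lemma fourier_inverse_add:
  assumes "band_limited g" "band_limited h"
  shows "fourier_inverse (\<lambda>\<xi>. g \<xi> + h \<xi>) z = fourier_inverse g z + fourier_inverse h z"
  unfolding fourier_inverse_def distrib_right
  by (subst Bochner_Integration.integral_add[OF integrable_inverse_kernel integrable_inverse_kernel])
     (auto intro: assms band_limited_integrable simp: distrib_left)

lemma fourier_inverse_cmult: "fourier_inverse (\<lambda>\<xi>. c * h \<xi>) z = c * fourier_inverse h z"
  unfolding fourier_inverse_def by (simp add: mult.assoc)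

lemma band_limited_cmult: "band_limited h \<Longrightarrow> band_limited (\<lambda>\<xi>. c * h \<xi>)"
  by (auto simp: band_limited_def intro: sq_integrable_cmult)

lemma band_limited_add:
  assumes "band_limited g" "band_limited h"
  shows "band_limited (\<lambda>\<xi>. g \<xi> + h \<xi>)"
  using band_limited_diff[OF assms(1) band_limited_cmult[OF assms(2), of "-1"]] by simp

lemma fourier_inverse_diff:
  assumes "band_limited g" "band_limited h"
  shows "fourier_inverse (\<lambda>\<xi>. g \<xi> - h \<xi>) z = fourier_inverse g z - fourier_inverse h z"
  using fourier_inverse_add[OF assms(1) band_limited_cmult[OF assms(2), of "-1"], of z] fourier_inverse_cmult[of "-1" h z] by simp

text \<open>Polarisation: equality of norms for g + h gives the real parts, and i h in place of h
  gives the imaginary parts.\<close>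

lemma fourier_inverse_inner:
  assumes g: "band_limited g" and h: "band_limited h"
  shows "(\<integral>z. fourier_inverse g z * cnj (fourier_inverse h z) \<partial>dz') = (\<integral>\<xi>. g \<xi> * cnj (h \<xi>) \<partial>dxi')"
proof -
  note sq = L2z_sq[OF fourier_inverse_L2z] band_limited_sq
  have Re: "Re (\<integral>z. fourier_inverse g z * cnj (fourier_inverse h z) \<partial>dz') = Re (\<integral>\<xi>. g \<xi> * cnj (h \<xi>) \<partial>dxi')" if h: "band_limited h" for h
  proof -
    have "fourier_inverse (\<lambda>\<xi>. g \<xi> + h \<xi>) = (\<lambda>z. fourier_inverse g z + fourier_inverse h z)"
      by (intro ext fourier_inverse_add g h)
    then have "L2_norm dz' (\<lambda>z. fourier_inverse g z + fourier_inverse h z) = L2_norm dxi' (\<lambda>\<xi>. g \<xi> + h \<xi>)"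
      using L2_norm_fourier_inverse[OF band_limited_add[OF g h]] by simp
    then show ?thesis
      using L2_norm_add_power2[OF sq(1)[OF g] sq(1)[OF h]] L2_norm_add_power2[OF sq(2)[OF g] sq(2)[OF h]]
      by (simp add: L2_norm_fourier_inverse g h)
  qed
  have "Re (\<integral>z. fourier_inverse g z * cnj (fourier_inverse (\<lambda>\<xi>. \<i> * h \<xi>) z) \<partial>dz') = Re (\<integral>\<xi>. g \<xi> * cnj (\<i> * h \<xi>) \<partial>dxi')"
    by (rule Re[OF band_limited_cmult[OF h]])
  moreover have "(\<integral>z. fourier_inverse g z * cnj (fourier_inverse (\<lambda>\<xi>. \<i> * h \<xi>) z) \<partial>dz') = - \<i> * (\<integral>z. fourier_inverse g z * cnj (fourier_inverse h z) \<partial>dz')"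
    by (subst integral_mult_right_zero[symmetric]) (simp add: fourier_inverse_cmult mult_ac)
  moreover have "(\<integral>\<xi>. g \<xi> * cnj (\<i> * h \<xi>) \<partial>dxi') = - \<i> * (\<integral>\<xi>. g \<xi> * cnj (h \<xi>) \<partial>dxi')"
    by (subst integral_mult_right_zero[symmetric]) (simp add: mult_ac)
  ultimately show ?thesis using Re[OF h] by (simp add: complex_eq_iff)
qed

text \<open>Passage to the limit in \<open>fourier_adjoint\<close> along the truncations of
  f.\<close>

lemma fourier_inner:
  assumes f: "L2z f" and h: "band_limited h"
  shows "(\<integral>\<xi>. fourier lam f \<xi> * cnj (h \<xi>) \<partial>dxi') = (\<integral>z. f z * cnj (fourier_inverse h z) \<partial>dz')"
proof (rule LIMSEQ_unique)
  have sq: "sq_integrable dxi' (fourier_integral lam (trunc f n))" for n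
    by (rule fourier_integral_L2[OF L2z_trunc[OF f] trunc_integrable[OF f]])
  show "(\<lambda>n. \<integral>\<xi>. fourier_integral lam (trunc f n) \<xi> * cnj (h \<xi>) \<partial>dxi') \<longlonglongrightarrow> (\<integral>\<xi>. fourier lam f \<xi> * cnj (h \<xi>) \<partial>dxi')"
    by (rule L2_inner_tendsto[OF sq fourier_sq[OF f] sq_integrable_cnj[OF band_limited_sq[OF h]] conjunct2[OF fourier_limit[OF f]]])
  show "(\<lambda>n. \<integral>\<xi>. fourier_integral lam (trunc f n) \<xi> * cnj (h \<xi>) \<partial>dxi') \<longlonglongrightarrow> (\<integral>z. f z * cnj (fourier_inverse h z) \<partial>dz')"
    using L2_inner_tendsto[OF L2z_sq[OF L2z_trunc[OF f]] L2z_sq[OF f] sq_integrable_cnj[OF L2z_sq[OF fourier_inverse_L2z[OF h]]] trunc_tendsto[OF f]]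
    by (simp only: fourier_adjoint[OF trunc_integrable[OF f] band_limited_integrable[OF h]])
qed

lemma eventually_norm_le: "\<forall>\<^sub>F n in sequentially. norm (\<xi> :: real \<times> real) \<le> real n"
  by (rule eventually_sequentiallyI[of "nat \<lceil>norm \<xi>\<rceil>"]) linarith

abbreviation cutoff :: "(real \<times> real \<Rightarrow> complex) \<Rightarrow> nat \<Rightarrow> real \<times> real \<Rightarrow> complex" where
  "cutoff a n \<equiv> (\<lambda>\<xi>. if norm \<xi> \<le> real n then a \<xi> else 0)"

lemma cutoff_tendsto:
  assumes a: "sq_integrable dxi' a"
  shows "(\<lambda>n. L2_norm dxi' (\<lambda>\<xi>. cutoff a n \<xi> - a \<xi>)) \<longlonglongrightarrow> 0"
  by (rule L2_truncation_tendsto[OF a _ eventually_norm_le]) measurable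

text \<open>Testing against the cutoffs of a itself makes every cutoff vanish a.e.\<close>

lemma band_limited_dense:
  assumes a: "sq_integrable dxi' a" and 0: "\<And>h. band_limited h \<Longrightarrow> (\<integral>\<xi>. a \<xi> * cnj (h \<xi>) \<partial>dxi') = 0"
  shows "AE \<xi> in dxi'. a \<xi> = 0"
proof -
  have "AE \<xi> in dxi'. cutoff a n \<xi> = 0" for n
  proof (rule L2_norm_eq_0D)
    show "sq_integrable dxi' (cutoff a n)" by (rule band_limited_sq[OF band_limited_truncate[OF a]])
    have "(\<integral>\<xi>. complex_of_real ((cmod (cutoff a n \<xi>))\<^sup>2) \<partial>dxi') = (\<integral>\<xi>. a \<xi> * cnj (cutoff a n \<xi>) \<partial>dxi')"
      by (intro Bochner_Integration.integral_cong refl) (simp add: complex_norm_square del: of_real_power)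
    also have "\<dots> = 0" by (rule 0[OF band_limited_truncate[OF a]])
    finally have "(\<integral>\<xi>. (cmod (cutoff a n \<xi>))\<^sup>2 \<partial>dxi') = 0"
      by (simp only: integral_complex_of_real of_real_eq_0_iff)
    then show "L2_norm dxi' (cutoff a n) = 0" by (simp add: L2_norm_def)
  qed
  then have "AE \<xi> in dxi'. \<forall>n. cutoff a n \<xi> = 0" unfolding AE_all_countable by (rule allI)
  then show ?thesis
  proof eventually_elim
    case (elim \<xi>)
    obtain n where "norm \<xi> \<le> real n" using real_arch_simple by blast
    then show ?case using elim[rule_format, of n] by simp
  qed
qed

text \<open>Weak characterisation of the transform. Differences, conjugation, inversion and
  surjectivity are all obtained by checking pairings, without touching the limit in the
  definition.\<close>

lemma fourier_eqI:
  assumes f: "L2z f" and a: "sq_integrable dxi' a"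
    and eq: "\<And>h. band_limited h \<Longrightarrow> (\<integral>\<xi>. a \<xi> * cnj (h \<xi>) \<partial>dxi') = (\<integral>z. f z * cnj (fourier_inverse h z) \<partial>dz')"
  shows "AE \<xi> in dxi'. fourier lam f \<xi> = a \<xi>"
proof -
  have "AE \<xi> in dxi'. fourier lam f \<xi> - a \<xi> = 0"
  proof (rule band_limited_dense)
    show "sq_integrable dxi' (\<lambda>\<xi>. fourier lam f \<xi> - a \<xi>)" by (intro sq_integrable_diff fourier_sq f a)
    fix h assume h: "band_limited h"
    note ch = sq_integrable_cnj[OF band_limited_sq[OF h]]
    have "(\<integral>\<xi>. (fourier lam f \<xi> - a \<xi>) * cnj (h \<xi>) \<partial>dxi') = (\<integral>\<xi>. fourier lam f \<xi> * cnj (h \<xi>) \<partial>dxi') - (\<integral>\<xi>. a \<xi> * cnj (h \<xi>) \<partial>dxi')"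
      unfolding left_diff_distrib
      by (rule Bochner_Integration.integral_diff[OF integrable_mult_L2[OF fourier_sq[OF f] ch] integrable_mult_L2[OF a ch]])
    then show "(\<integral>\<xi>. (fourier lam f \<xi> - a \<xi>) * cnj (h \<xi>) \<partial>dxi') = 0" by (simp add: fourier_inner[OF f h] eq[OF h])
  qed
  then show ?thesis by simp
qed

lemma fourier_diff:
  assumes f: "L2z f" and g: "L2z g"
  shows "AE \<xi> in dxi'. fourier lam (\<lambda>z. f z - g z) \<xi> = fourier lam f \<xi> - fourier lam g \<xi>"
proof (rule fourier_eqI[OF L2z_diff[OF f g] sq_integrable_diff[OF fourier_sq[OF f] fourier_sq[OF g]]])
  fix h assume h: "band_limited h"
  note ch = sq_integrable_cnj[OF band_limited_sq[OF h]] and ci = sq_integrable_cnj[OF L2z_sq[OF fourier_inverse_L2z[OF h]]]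
  show "(\<integral>\<xi>. (fourier lam f \<xi> - fourier lam g \<xi>) * cnj (h \<xi>) \<partial>dxi') = (\<integral>z. (f z - g z) * cnj (fourier_inverse h z) \<partial>dz')"
    unfolding left_diff_distrib
    by (subst Bochner_Integration.integral_diff[OF integrable_mult_L2[OF fourier_sq[OF f] ch] integrable_mult_L2[OF fourier_sq[OF g] ch]],
        subst Bochner_Integration.integral_diff[OF integrable_mult_L2[OF L2z_sq[OF f] ci] integrable_mult_L2[OF L2z_sq[OF g] ci]])
       (simp add: fourier_inner f g h)
qed

lemma L2_norm_fourier_diff:
  assumes f: "L2z f" and g: "L2z g"
  shows "L2_norm dz' (\<lambda>z. f z - g z) = L2_norm dxi' (\<lambda>\<xi>. fourier lam f \<xi> - fourier lam g \<xi>)"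
  using L2_norm_cong_AE[OF _ _ fourier_diff[OF f g]] L2_norm_fourier[OF L2z_diff[OF f g]]
    sq_integrable_measurable[OF fourier_sq[OF L2z_diff[OF f g]]]
    sq_integrable_measurable[OF sq_integrable_diff[OF fourier_sq[OF f] fourier_sq[OF g]]] by simp

section \<open>Conjugation, inversion and surjectivity\<close>

lemma sq_integrable_reflect:
  assumes a: "sq_integrable dxi' a" and \<zeta>: "\<zeta> \<in> frequencies lam"
  shows "sq_integrable dxi' (\<lambda>\<xi>. a (\<zeta> - \<xi>))"
proof -
  have [measurable]: "a \<in> borel_measurable borel" using sq_integrable_measurable[OF a] by simp
  have "integrable (distr dxi' borel (\<lambda>\<xi>. \<zeta> - \<xi>)) (\<lambda>\<xi>. (cmod (a \<xi>))\<^sup>2)"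
    using a unfolding distr_dxi_reflect[OF \<zeta>] by (simp add: sq_integrable_def)
  then show ?thesis unfolding sq_integrable_def by (subst (asm) integrable_distr_eq) auto
qed

lemma sq_integrable_uminus: "sq_integrable dxi' a \<Longrightarrow> sq_integrable dxi' (\<lambda>\<xi>. a (- \<xi>))"
  using sq_integrable_reflect[OF _ zero_frequency, of a] by simp

lemma band_limited_uminus_cnj:
  assumes h: "band_limited h"
  shows "band_limited (\<lambda>\<xi>. cnj (h (- \<xi>)))"
proof -
  obtain R where R: "\<And>\<xi>. norm \<xi> > R \<Longrightarrow> h \<xi> = 0" using h by (auto simp: band_limited_def)
  have "norm \<xi> > R \<longrightarrow> cnj (h (- \<xi>)) = 0" for \<xi> using R[of "- \<xi>"] by simp
  moreover have "sq_integrable dxi' (\<lambda>\<xi>. cnj (h (- \<xi>)))"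
    by (intro sq_integrable_cnj sq_integrable_uminus band_limited_sq h)
  ultimately show ?thesis unfolding band_limited_def by blast
qed

lemma fourier_inverse_cnj:
  assumes h: "band_limited h"
  shows "fourier_inverse (\<lambda>\<xi>. cnj (h (- \<xi>))) z = cnj (fourier_inverse h z)"
proof -
  have [measurable]: "h \<in> borel_measurable borel" using h by measurable
  have "(\<integral>\<xi>. cnj (h (- \<xi>)) * exp (\<i> * complex_of_real (z \<bullet> \<xi>)) \<partial>dxi') = (\<integral>\<xi>. cnj (h (0 - \<xi>) * exp (\<i> * complex_of_real (z \<bullet> (0 - \<xi>)))) \<partial>dxi')"
    by (intro Bochner_Integration.integral_cong refl) (simp add: exp_cnj)
  also have "\<dots> = (\<integral>\<xi>. cnj (h \<xi> * exp (\<i> * complex_of_real (z \<bullet> \<xi>))) \<partial>dxi')"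
    by (rule integral_dxi_reflect[OF _ zero_frequency]) measurable
  also have "\<dots> = cnj (\<integral>\<xi>. h \<xi> * exp (\<i> * complex_of_real (z \<bullet> \<xi>)) \<partial>dxi')"
    by (rule Bochner_Integration.integral_cnj)
  finally show ?thesis unfolding fourier_inverse_def by (simp only: complex_cnj_mult complex_cnj_complex_of_real)
qed

lemma fourier_cnj:
  assumes f: "L2z f"
  shows "AE \<xi> in dxi'. fourier lam (\<lambda>z. cnj (f z)) \<xi> = cnj (fourier lam f (- \<xi>))"
proof (rule fourier_eqI[OF L2z_cnj[OF f] sq_integrable_cnj[OF sq_integrable_uminus[OF fourier_sq[OF f]]]])
  fix h assume h: "band_limited h"
  define h' where "h' \<xi> = cnj (h (- \<xi>))" for \<xi>
  have [measurable]: "h \<in> borel_measurable borel" "fourier lam f \<in> borel_measurable borel"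
    using h f by measurable
  have h': "band_limited h'"
    unfolding h'_def[abs_def] by (rule band_limited_uminus_cnj[OF h])
  have inv: "fourier_inverse h' z = cnj (fourier_inverse h z)" for z
    unfolding h'_def[abs_def] by (rule fourier_inverse_cnj[OF h])
  have "(\<integral>\<xi>. cnj (fourier lam f (- \<xi>)) * cnj (h \<xi>) \<partial>dxi') = (\<integral>\<xi>. cnj (fourier lam f (0 - \<xi>) * cnj (h' (0 - \<xi>))) \<partial>dxi')"
    by (simp add: h'_def)
  also have "\<dots> = (\<integral>\<xi>. cnj (fourier lam f \<xi> * cnj (h' \<xi>)) \<partial>dxi')"
    by (rule integral_dxi_reflect[OF _ zero_frequency]) (use band_limited_measurable[OF h'] in measurable)
  also have "\<dots> = cnj (\<integral>z. f z * cnj (fourier_inverse h' z) \<partial>dz')"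
    by (simp only: Bochner_Integration.integral_cnj fourier_inner[OF f h'])
  also have "\<dots> = (\<integral>z. cnj (f z) * cnj (fourier_inverse h z) \<partial>dz')"
    unfolding Bochner_Integration.integral_cnj[symmetric] by (simp add: inv)
  finally show "(\<integral>\<xi>. cnj (fourier lam f (- \<xi>)) * cnj (h \<xi>) \<partial>dxi') = (\<integral>z. cnj (f z) * cnj (fourier_inverse h z) \<partial>dz')" .
qed

lemma fourier_fourier_inverse:
  assumes h: "band_limited h"
  shows "AE \<xi> in dxi'. fourier lam (fourier_inverse h) \<xi> = h \<xi>"
  by (rule fourier_eqI[OF fourier_inverse_L2z[OF h] band_limited_sq[OF h]]) (simp add: fourier_inverse_inner[OF h])

text \<open>Supplies approximations of f in physical space whose transforms have bounded support;
  for these the convolution theorem is a matter of Fubini.\<close>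

lemma fourier_inversion:
  assumes f: "L2z f"
  shows "(\<lambda>n. L2_norm dz' (\<lambda>z. fourier_inverse (cutoff (fourier lam f) n) z - f z)) \<longlonglongrightarrow> 0"
proof -
  let ?h = "cutoff (fourier lam f)"
  have h: "band_limited (?h n)" for n by (rule band_limited_truncate[OF fourier_sq[OF f]])
  have "L2_norm dz' (\<lambda>z. fourier_inverse (?h n) z - f z) = L2_norm dxi' (\<lambda>\<xi>. ?h n \<xi> - fourier lam f \<xi>)" for n
  proof -
    have "L2_norm dz' (\<lambda>z. fourier_inverse (?h n) z - f z) = L2_norm dxi' (\<lambda>\<xi>. fourier lam (fourier_inverse (?h n)) \<xi> - fourier lam f \<xi>)"
      by (rule L2_norm_fourier_diff[OF fourier_inverse_L2z[OF h] f])
    also have "\<dots> = L2_norm dxi' (\<lambda>\<xi>. ?h n \<xi> - fourier lam f \<xi>)"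
    proof (rule L2_norm_cong_AE)
      show "AE \<xi> in dxi'. fourier lam (fourier_inverse (?h n)) \<xi> - fourier lam f \<xi> = ?h n \<xi> - fourier lam f \<xi>"
        using fourier_fourier_inverse[OF h[of n]] by eventually_elim simp
    qed (use fourier_sq[OF fourier_inverse_L2z[OF h]] fourier_sq[OF f] band_limited_sq[OF h] in
        \<open>auto intro!: sq_integrable_measurable sq_integrable_diff\<close>)
    finally show ?thesis .
  qed
  then show ?thesis using cutoff_tendsto[OF fourier_sq[OF f]] by simp
qed

text \<open>Shows that the choice in \<open>multiplier\<close> has a candidate. The inverse
  transforms of the cutoffs are Cauchy by isometry; their limit is determined on one strip and is
  continued periodically.\<close>

lemma fourier_surj:
  assumes a: "sq_integrable dxi' a"
  obtains f where "L2 lam f" "AE \<xi> in dxi'. fourier lam f \<xi> = a \<xi>"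
proof -
  let ?h = "cutoff a" and ?F = "\<lambda>n. fourier_inverse (cutoff a n)"
  have h: "band_limited (?h n)" for n by (rule band_limited_truncate[OF a])
  have sq: "sq_integrable dz' (?F n)" for n by (rule L2z_sq[OF fourier_inverse_L2z[OF h]])
  have "L2_Cauchy dxi' ?h" by (rule L2_convergent_imp_Cauchy[OF band_limited_sq[OF h] a cutoff_tendsto[OF a]])
  moreover have "L2_norm dz' (\<lambda>z. ?F m z - ?F n z) = L2_norm dxi' (\<lambda>\<xi>. ?h m \<xi> - ?h n \<xi>)" for m n
    unfolding fourier_inverse_diff[OF h h, symmetric] by (rule L2_norm_fourier_inverse[OF band_limited_diff[OF h h]])
  ultimately have "L2_Cauchy dz' ?F" by (rule L2_Cauchy_isometry)
  then obtain g where g: "sq_integrable dz' g" and lim: "(\<lambda>n. L2_norm dz' (\<lambda>z. ?F n z - g z)) \<longlonglongrightarrow> 0"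
    by (rule L2_complete[OF sq])
  define g0 where "g0 z = indicator strip z *\<^sub>R g z" for z
  have [measurable]: "g0 \<in> borel_measurable borel"
    using g measurable_dz_iff[of g] by (simp add: sq_integrable_def g0_def[abs_def])
  \<comment> \<open>Reduction of y modulo the period; on the strip the floor is 0, so f and g agree
    there.\<close>
  define f where "f = (\<lambda>(x, y). g0 (x, y - period * of_int \<lfloor>y / period\<rfloor>))"
  have fg: "f z = g z" if "z \<in> strip" for z
  proof -
    obtain x y where z: "z = (x, y)" "0 \<le> y" "y < period" using \<open>z \<in> strip\<close> by (cases z) auto
    then have "\<lfloor>y / period\<rfloor> = 0" using period_pos by (simp add: floor_eq_iff)
    then show ?thesis using z by (simp add: f_def g0_def)
  qed
  have m: "f \<in> borel_measurable borel"
    unfolding f_def split_beta' by measurable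
  have per: "periodic lam f"
  proof -
    have "\<lfloor>(y + period) / period\<rfloor> = \<lfloor>y / period\<rfloor> + 1" for y
      using lam_pos by (simp add: add_divide_distrib)
    then show ?thesis by (simp add: periodic_def f_def algebra_simps)
  qed
  have sqf: "sq_integrable dz' f"
    by (rule sq_integrable_cong_AE[OF g measurable_dz[OF m]]) (auto intro!: AE_I2 simp: space_dz fg)
  have L2: "L2 lam f" using per m sqf by (simp add: L2_def)
  have "(\<integral>\<xi>. a \<xi> * cnj (h \<xi>) \<partial>dxi') = (\<integral>z. f z * cnj (fourier_inverse h z) \<partial>dz')" if b: "band_limited h" for h
  proof (rule LIMSEQ_unique)
    show "(\<lambda>n. \<integral>\<xi>. ?h n \<xi> * cnj (h \<xi>) \<partial>dxi') \<longlonglongrightarrow> (\<integral>\<xi>. a \<xi> * cnj (h \<xi>) \<partial>dxi')"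
      by (rule L2_inner_tendsto[OF band_limited_sq[OF h] a sq_integrable_cnj[OF band_limited_sq[OF b]] cutoff_tendsto[OF a]])
    have "(\<lambda>n. \<integral>z. ?F n z * cnj (fourier_inverse h z) \<partial>dz') \<longlonglongrightarrow> (\<integral>z. g z * cnj (fourier_inverse h z) \<partial>dz')"
      by (rule L2_inner_tendsto[OF sq g sq_integrable_cnj[OF L2z_sq[OF fourier_inverse_L2z[OF b]]] lim])
    also have "(\<integral>z. g z * cnj (fourier_inverse h z) \<partial>dz') = (\<integral>z. f z * cnj (fourier_inverse h z) \<partial>dz')"
      by (rule Bochner_Integration.integral_cong) (auto simp: space_dz fg)
    finally show "(\<lambda>n. \<integral>\<xi>. ?h n \<xi> * cnj (h \<xi>) \<partial>dxi') \<longlonglongrightarrow> (\<integral>z. f z * cnj (fourier_inverse h z) \<partial>dz')"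
      by (simp only: fourier_inverse_inner[OF h b])
  qed
  from that[OF L2 fourier_eqI[OF L2_imp_L2z[OF L2] a this]] show ?thesis .
qed

text \<open>The premise concerns the product, hence it serves the unbounded symbols of
  \<open>sobolev_partial\<close> as well as the bounded one of \<open>I_op\<close>.\<close>

lemma multiplier_L2:
  assumes "sq_integrable dxi' (\<lambda>\<xi>. a \<xi> * fourier lam f \<xi>)"
  shows "L2 lam (multiplier lam a f)"
    and "AE \<xi> in dxi'. fourier lam (multiplier lam a f) \<xi> = a \<xi> * fourier lam f \<xi>"
proof -
  have "\<exists>g. L2 lam g \<and> (AE \<xi> in dxi'. fourier lam g \<xi> = a \<xi> * fourier lam f \<xi>)"
    using fourier_surj[OF assms] by metis
  from someI_ex[OF this] show "L2 lam (multiplier lam a f)"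
    "AE \<xi> in dxi'. fourier lam (multiplier lam a f) \<xi> = a \<xi> * fourier lam f \<xi>"
    by (auto simp: multiplier_def)
qed

end

section \<open>Quadrilinear forms\<close>

lemma ennreal_power2_le_imp:
  assumes "x\<^sup>2 \<le> (ennreal c)\<^sup>2" "0 \<le> c"
  shows "x \<le> ennreal c"
proof (cases x)
  case (real r)
  then have "r\<^sup>2 \<le> c\<^sup>2" using assms by (simp add: ennreal_power)
  then have "r \<le> c" using assms(2) by (rule power2_le_imp_le)
  then show ?thesis using real by (simp add: ennreal_leI)
qed (use assms in \<open>simp add: ennreal_power top_unique\<close>)

lemma minus_diff_commute: "- x - y = - y - (x :: 'a :: ab_group_add)"
  by simp

type_synonym freq4 = "(real \<times> real) \<times> (real \<times> real) \<times> (real \<times> real) \<times> (real \<times> real)"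

context cylinder
begin

lemma pair_dxi: "pair_sigma_finite dxi' dxi'"
  using sigma_finite_dxi by (simp add: pair_sigma_finite_def)

lemma sets_dxi2: "sets (dxi' \<Otimes>\<^sub>M dxi') = sets borel"
  by (subst borel_prod[symmetric]) (intro sets_pair_measure_cong, auto)

lemma sets_dxi3: "sets (dxi' \<Otimes>\<^sub>M dxi' \<Otimes>\<^sub>M dxi') = sets borel"
  by (subst borel_prod[symmetric]) (intro sets_pair_measure_cong sets_dxi2 sets_dxi)

lemma sigma_finite_dxi2: "sigma_finite_measure (dxi' \<Otimes>\<^sub>M dxi')"
  by (intro sigma_finite_pair_measure sigma_finite_dxi)

definition param4 :: "(real \<times> real) \<times> (real \<times> real) \<times> (real \<times> real) \<Rightarrow> freq4" where
  "param4 = (\<lambda>(\<xi>\<^sub>1, \<xi>\<^sub>2, \<xi>\<^sub>3). (\<xi>\<^sub>1, \<xi>\<^sub>2, \<xi>\<^sub>3, - \<xi>\<^sub>1 - \<xi>\<^sub>2 - \<xi>\<^sub>3))"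

lemma param4_borel: "param4 \<in> borel_measurable borel"
  unfolding param4_def split_beta'
  by (intro borel_measurable_Pair borel_measurable_diff borel_measurable_uminus borel_measurable_fst_comp borel_measurable_snd_comp) auto

lemma param4_measurable: "param4 \<in> measurable (dxi' \<Otimes>\<^sub>M dxi' \<Otimes>\<^sub>M dxi') borel"
  using param4_borel measurable_cong_sets[OF sets_dxi3 refl] by blast

lemma Sigma4_measure_eq: "Sigma4_measure lam = distr (dxi' \<Otimes>\<^sub>M dxi' \<Otimes>\<^sub>M dxi') borel param4"
  by (simp add: Sigma4_measure_def param4_def)

lemma sets_Sigma4_measure [simp, measurable_cong]: "sets (Sigma4_measure lam) = sets borel"
  by (simp add: Sigma4_measure_def)

lemma space_Sigma4_measure [simp]: "space (Sigma4_measure lam) = UNIV"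
  by (simp add: Sigma4_measure_def)

lemma nn_integral_dxi3:
  assumes g: "g \<in> borel_measurable borel"
  shows "(\<integral>\<^sup>+x. g x \<partial>(dxi' \<Otimes>\<^sub>M dxi' \<Otimes>\<^sub>M dxi')) = (\<integral>\<^sup>+\<xi>\<^sub>1. \<integral>\<^sup>+\<xi>\<^sub>2. \<integral>\<^sup>+\<xi>\<^sub>3. g (\<xi>\<^sub>1, \<xi>\<^sub>2, \<xi>\<^sub>3) \<partial>dxi' \<partial>dxi' \<partial>dxi')"
proof -
  interpret X: sigma_finite_measure dxi' by (rule sigma_finite_dxi)
  interpret X2: sigma_finite_measure "dxi' \<Otimes>\<^sub>M dxi'" by (rule sigma_finite_dxi2)
  have "g \<in> borel_measurable (dxi' \<Otimes>\<^sub>M dxi' \<Otimes>\<^sub>M dxi')"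
    using g measurable_cong_sets[OF sets_dxi3 refl] by blast
  then have "(\<integral>\<^sup>+x. g x \<partial>(dxi' \<Otimes>\<^sub>M dxi' \<Otimes>\<^sub>M dxi')) = (\<integral>\<^sup>+\<xi>\<^sub>1. \<integral>\<^sup>+y. g (\<xi>\<^sub>1, y) \<partial>(dxi' \<Otimes>\<^sub>M dxi') \<partial>dxi')"
    by (rule X2.nn_integral_fst[symmetric])
  also have "\<dots> = (\<integral>\<^sup>+\<xi>\<^sub>1. \<integral>\<^sup>+\<xi>\<^sub>2. \<integral>\<^sup>+\<xi>\<^sub>3. g (\<xi>\<^sub>1, \<xi>\<^sub>2, \<xi>\<^sub>3) \<partial>dxi' \<partial>dxi' \<partial>dxi')"
  proof (rule nn_integral_cong)
    fix \<xi>\<^sub>1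
    have "(\<lambda>y. g (\<xi>\<^sub>1, y)) \<in> borel_measurable borel"
      by (rule measurable_compose[OF _ g]) measurable
    then have "(\<lambda>y. g (\<xi>\<^sub>1, y)) \<in> borel_measurable (dxi' \<Otimes>\<^sub>M dxi')"
      using measurable_cong_sets[OF sets_dxi2 refl] by blast
    from X.nn_integral_fst[OF this]
    show "(\<integral>\<^sup>+y. g (\<xi>\<^sub>1, y) \<partial>(dxi' \<Otimes>\<^sub>M dxi')) = (\<integral>\<^sup>+\<xi>\<^sub>2. \<integral>\<^sup>+\<xi>\<^sub>3. g (\<xi>\<^sub>1, \<xi>\<^sub>2, \<xi>\<^sub>3) \<partial>dxi' \<partial>dxi')" by simp
  qed
  finally show ?thesis .
qed

lemma nn_integral_Sigma4:
  assumes g: "g \<in> borel_measurable borel"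
  shows "(\<integral>\<^sup>+x. g x \<partial>Sigma4_measure lam) = (\<integral>\<^sup>+\<xi>\<^sub>1. \<integral>\<^sup>+\<xi>\<^sub>2. \<integral>\<^sup>+\<xi>\<^sub>3. g (\<xi>\<^sub>1, \<xi>\<^sub>2, \<xi>\<^sub>3, - \<xi>\<^sub>1 - \<xi>\<^sub>2 - \<xi>\<^sub>3) \<partial>dxi' \<partial>dxi' \<partial>dxi')"
proof -
  have "(\<integral>\<^sup>+x. g x \<partial>Sigma4_measure lam) = (\<integral>\<^sup>+x. g (param4 x) \<partial>(dxi' \<Otimes>\<^sub>M dxi' \<Otimes>\<^sub>M dxi'))"
    unfolding Sigma4_measure_eq by (rule nn_integral_distr[OF param4_measurable]) (use g in simp)
  also have "\<dots> = (\<integral>\<^sup>+\<xi>\<^sub>1. \<integral>\<^sup>+\<xi>\<^sub>2. \<integral>\<^sup>+\<xi>\<^sub>3. g (param4 (\<xi>\<^sub>1, \<xi>\<^sub>2, \<xi>\<^sub>3)) \<partial>dxi' \<partial>dxi' \<partial>dxi')"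
    by (rule nn_integral_dxi3) (rule measurable_compose[OF param4_borel g])
  finally show ?thesis by (simp add: param4_def)
qed

text \<open>With values in \<open>ennreal\<close>, so that Tonelli permutes the integrals without
  integrability premises.\<close>

definition form4 :: "(real \<times> real \<Rightarrow> ennreal) \<Rightarrow> (real \<times> real \<Rightarrow> ennreal) \<Rightarrow> (real \<times> real \<Rightarrow> ennreal) \<Rightarrow> (real \<times> real \<Rightarrow> ennreal) \<Rightarrow> ennreal" where
  "form4 f1 f2 f3 f4 = (\<integral>\<^sup>+(\<xi>\<^sub>1, \<xi>\<^sub>2, \<xi>\<^sub>3, \<xi>\<^sub>4). f1 \<xi>\<^sub>1 * f2 \<xi>\<^sub>2 * f3 \<xi>\<^sub>3 * f4 \<xi>\<^sub>4 \<partial>Sigma4_measure lam)"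

lemma form4_integrand_measurable:
  assumes [measurable]: "f1 \<in> borel_measurable borel" "f2 \<in> borel_measurable borel" "f3 \<in> borel_measurable borel" "f4 \<in> borel_measurable borel"
  shows "(\<lambda>(\<xi>\<^sub>1, \<xi>\<^sub>2, \<xi>\<^sub>3, \<xi>\<^sub>4). f1 \<xi>\<^sub>1 * f2 \<xi>\<^sub>2 * f3 \<xi>\<^sub>3 * f4 \<xi>\<^sub>4 :: ennreal) \<in> borel_measurable (borel :: freq4 measure)"
  unfolding split_beta' by measurable

lemma form4_iterated:
  assumes "f1 \<in> borel_measurable borel" "f2 \<in> borel_measurable borel" "f3 \<in> borel_measurable borel" "f4 \<in> borel_measurable borel"
  shows "form4 f1 f2 f3 f4 = (\<integral>\<^sup>+\<xi>\<^sub>1. \<integral>\<^sup>+\<xi>\<^sub>2. \<integral>\<^sup>+\<xi>\<^sub>3. f1 \<xi>\<^sub>1 * f2 \<xi>\<^sub>2 * f3 \<xi>\<^sub>3 * f4 (- \<xi>\<^sub>1 - \<xi>\<^sub>2 - \<xi>\<^sub>3) \<partial>dxi' \<partial>dxi' \<partial>dxi')"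
  unfolding form4_def by (subst nn_integral_Sigma4[OF form4_integrand_measurable[OF assms]]) simp

text \<open>\<open>Sigma4_measure\<close> treats the fourth variable as dependent, so invariance
  under permutations needs proof; three adjacent transpositions generate them all. This one is
  Tonelli.\<close>

lemma form4_swap12:
  assumes [measurable]: "f1 \<in> borel_measurable borel" "f2 \<in> borel_measurable borel" "f3 \<in> borel_measurable borel" "f4 \<in> borel_measurable borel"
  shows "form4 f1 f2 f3 f4 = form4 f2 f1 f3 f4"
proof -
  interpret X: sigma_finite_measure dxi' by (rule sigma_finite_dxi)
  interpret P: pair_sigma_finite dxi' dxi' by (rule pair_dxi)
  define G where "G \<xi>\<^sub>1 \<xi>\<^sub>2 = (\<integral>\<^sup>+\<xi>\<^sub>3. f1 \<xi>\<^sub>1 * f2 \<xi>\<^sub>2 * f3 \<xi>\<^sub>3 * f4 (- \<xi>\<^sub>1 - \<xi>\<^sub>2 - \<xi>\<^sub>3) \<partial>dxi')" for \<xi>\<^sub>1 \<xi>\<^sub>2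
  have "(\<lambda>x. f1 (fst (fst x)) * f2 (snd (fst x)) * f3 (snd x) * f4 (- fst (fst x) - snd (fst x) - snd x)) \<in> borel_measurable ((dxi' \<Otimes>\<^sub>M dxi') \<Otimes>\<^sub>M dxi')"
  proof -
    have s: "sets ((dxi' \<Otimes>\<^sub>M dxi') \<Otimes>\<^sub>M dxi') = sets borel"
      by (subst borel_prod[symmetric]) (intro sets_pair_measure_cong sets_dxi2 sets_dxi)
    have "(\<lambda>x. f1 (fst (fst x)) * f2 (snd (fst x)) * f3 (snd x) * f4 (- fst (fst x) - snd (fst x) - snd x))
        \<in> borel_measurable (borel :: (((real \<times> real) \<times> (real \<times> real)) \<times> (real \<times> real)) measure)"
      by measurable
    then show ?thesis using measurable_cong_sets[OF s refl] by blast
  qed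
  then have "case_prod G \<in> borel_measurable (dxi' \<Otimes>\<^sub>M dxi')"
    unfolding G_def split_beta' by (intro X.borel_measurable_nn_integral) (simp add: split_beta')
  from P.Fubini'[OF this] have "(\<integral>\<^sup>+\<xi>\<^sub>2. \<integral>\<^sup>+\<xi>\<^sub>1. G \<xi>\<^sub>1 \<xi>\<^sub>2 \<partial>dxi' \<partial>dxi') = (\<integral>\<^sup>+\<xi>\<^sub>1. \<integral>\<^sup>+\<xi>\<^sub>2. G \<xi>\<^sub>1 \<xi>\<^sub>2 \<partial>dxi' \<partial>dxi')" .
  moreover have "G \<xi>\<^sub>1 \<xi>\<^sub>2 = (\<integral>\<^sup>+\<xi>\<^sub>3. f2 \<xi>\<^sub>2 * f1 \<xi>\<^sub>1 * f3 \<xi>\<^sub>3 * f4 (- \<xi>\<^sub>2 - \<xi>\<^sub>1 - \<xi>\<^sub>3) \<partial>dxi')" for \<xi>\<^sub>1 \<xi>\<^sub>2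
    unfolding G_def
    by (simp only: mult.commute[of "f1 \<xi>\<^sub>1"] minus_diff_commute[of \<xi>\<^sub>1 \<xi>\<^sub>2])
  ultimately show ?thesis
    by (simp only: form4_iterated[OF assms] form4_iterated[OF assms(2,1,3,4)] G_def)
qed

lemma form4_swap23:
  assumes [measurable]: "f1 \<in> borel_measurable borel" "f2 \<in> borel_measurable borel" "f3 \<in> borel_measurable borel" "f4 \<in> borel_measurable borel"
  shows "form4 f1 f2 f3 f4 = form4 f1 f3 f2 f4"
proof -
  interpret P: pair_sigma_finite dxi' dxi' by (rule pair_dxi)
  have "(\<integral>\<^sup>+\<xi>\<^sub>2. \<integral>\<^sup>+\<xi>\<^sub>3. f1 \<xi>\<^sub>1 * f2 \<xi>\<^sub>2 * f3 \<xi>\<^sub>3 * f4 (- \<xi>\<^sub>1 - \<xi>\<^sub>2 - \<xi>\<^sub>3) \<partial>dxi' \<partial>dxi')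
      = (\<integral>\<^sup>+\<xi>\<^sub>2. \<integral>\<^sup>+\<xi>\<^sub>3. f1 \<xi>\<^sub>1 * f3 \<xi>\<^sub>2 * f2 \<xi>\<^sub>3 * f4 (- \<xi>\<^sub>1 - \<xi>\<^sub>2 - \<xi>\<^sub>3) \<partial>dxi' \<partial>dxi')" for \<xi>\<^sub>1
  proof -
    have "(\<lambda>(\<xi>\<^sub>3, \<xi>\<^sub>2). f1 \<xi>\<^sub>1 * f2 \<xi>\<^sub>2 * f3 \<xi>\<^sub>3 * f4 (- \<xi>\<^sub>1 - \<xi>\<^sub>2 - \<xi>\<^sub>3)) \<in> borel_measurable (borel :: ((real \<times> real) \<times> (real \<times> real)) measure)"
      unfolding split_beta' by measurable
    then have "(\<lambda>(\<xi>\<^sub>3, \<xi>\<^sub>2). f1 \<xi>\<^sub>1 * f2 \<xi>\<^sub>2 * f3 \<xi>\<^sub>3 * f4 (- \<xi>\<^sub>1 - \<xi>\<^sub>2 - \<xi>\<^sub>3)) \<in> borel_measurable (dxi' \<Otimes>\<^sub>M dxi')"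
      using measurable_cong_sets[OF sets_dxi2 refl] by blast
    from P.Fubini'[OF this]
    have "(\<integral>\<^sup>+\<xi>\<^sub>2. \<integral>\<^sup>+\<xi>\<^sub>3. f1 \<xi>\<^sub>1 * f2 \<xi>\<^sub>2 * f3 \<xi>\<^sub>3 * f4 (- \<xi>\<^sub>1 - \<xi>\<^sub>2 - \<xi>\<^sub>3) \<partial>dxi' \<partial>dxi')
        = (\<integral>\<^sup>+\<xi>\<^sub>3. \<integral>\<^sup>+\<xi>\<^sub>2. f1 \<xi>\<^sub>1 * f2 \<xi>\<^sub>2 * f3 \<xi>\<^sub>3 * f4 (- \<xi>\<^sub>1 - \<xi>\<^sub>2 - \<xi>\<^sub>3) \<partial>dxi' \<partial>dxi')" .
    also have "\<dots> = (\<integral>\<^sup>+\<xi>\<^sub>2. \<integral>\<^sup>+\<xi>\<^sub>3. f1 \<xi>\<^sub>1 * f3 \<xi>\<^sub>2 * f2 \<xi>\<^sub>3 * f4 (- \<xi>\<^sub>1 - \<xi>\<^sub>2 - \<xi>\<^sub>3) \<partial>dxi' \<partial>dxi')"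
      by (intro nn_integral_cong) (simp add: mult_ac algebra_simps)
    finally show ?thesis .
  qed
  then show ?thesis
    by (simp only: form4_iterated[OF assms] form4_iterated[OF assms(1,3,2,4)])
qed

text \<open>Reflection in \<xi>_3 with \<zeta> = -\<xi>_1 - \<xi>_2 interchanges the independent and
  the dependent variable. This \<zeta> has to be a grid point, hence the two nested a.e.
  arguments.\<close>

lemma form4_swap34:
  assumes [measurable]: "f1 \<in> borel_measurable borel" "f2 \<in> borel_measurable borel" "f3 \<in> borel_measurable borel" "f4 \<in> borel_measurable borel"
  shows "form4 f1 f2 f3 f4 = form4 f1 f2 f4 f3"
proof -
  have "AE \<xi>\<^sub>1 in dxi'. (\<integral>\<^sup>+\<xi>\<^sub>2. \<integral>\<^sup>+\<xi>\<^sub>3. f1 \<xi>\<^sub>1 * f2 \<xi>\<^sub>2 * f3 \<xi>\<^sub>3 * f4 (- \<xi>\<^sub>1 - \<xi>\<^sub>2 - \<xi>\<^sub>3) \<partial>dxi' \<partial>dxi')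
      = (\<integral>\<^sup>+\<xi>\<^sub>2. \<integral>\<^sup>+\<xi>\<^sub>3. f1 \<xi>\<^sub>1 * f2 \<xi>\<^sub>2 * f4 \<xi>\<^sub>3 * f3 (- \<xi>\<^sub>1 - \<xi>\<^sub>2 - \<xi>\<^sub>3) \<partial>dxi' \<partial>dxi')"
    using AE_dxi_frequencies
  proof eventually_elim
    case (elim \<xi>\<^sub>1)
    show ?case
    proof (rule nn_integral_cong_AE)
      show "AE \<xi>\<^sub>2 in dxi'. (\<integral>\<^sup>+\<xi>\<^sub>3. f1 \<xi>\<^sub>1 * f2 \<xi>\<^sub>2 * f3 \<xi>\<^sub>3 * f4 (- \<xi>\<^sub>1 - \<xi>\<^sub>2 - \<xi>\<^sub>3) \<partial>dxi')
          = (\<integral>\<^sup>+\<xi>\<^sub>3. f1 \<xi>\<^sub>1 * f2 \<xi>\<^sub>2 * f4 \<xi>\<^sub>3 * f3 (- \<xi>\<^sub>1 - \<xi>\<^sub>2 - \<xi>\<^sub>3) \<partial>dxi')"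
        using AE_dxi_frequencies
      proof eventually_elim
        case (elim \<xi>\<^sub>2)
        then have z: "- \<xi>\<^sub>1 - \<xi>\<^sub>2 \<in> frequencies lam"
          using \<open>\<xi>\<^sub>1 \<in> frequencies lam\<close> by (intro frequencies_diff frequencies_uminus)
        have "(\<integral>\<^sup>+\<xi>\<^sub>3. f1 \<xi>\<^sub>1 * f2 \<xi>\<^sub>2 * f4 \<xi>\<^sub>3 * f3 (- \<xi>\<^sub>1 - \<xi>\<^sub>2 - \<xi>\<^sub>3) \<partial>dxi')
            = (\<integral>\<^sup>+\<xi>\<^sub>3. f1 \<xi>\<^sub>1 * f2 \<xi>\<^sub>2 * f4 (- \<xi>\<^sub>1 - \<xi>\<^sub>2 - \<xi>\<^sub>3) * f3 (- \<xi>\<^sub>1 - \<xi>\<^sub>2 - (- \<xi>\<^sub>1 - \<xi>\<^sub>2 - \<xi>\<^sub>3)) \<partial>dxi')"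
          by (rule nn_integral_dxi_reflect[OF _ z, symmetric]) measurable
        then show ?case by (simp add: mult_ac)
      qed
    qed
  qed
  then show ?thesis
    by (simp only: form4_iterated[OF assms] form4_iterated[OF assms(1,2,4,3)] nn_integral_cong_AE)
qed

lemma convolution_bound:
  assumes [measurable]: "f \<in> borel_measurable borel" "g \<in> borel_measurable borel"
    and f: "(\<integral>\<^sup>+\<xi>. (f \<xi>)\<^sup>2 \<partial>dxi') \<le> ennreal (a\<^sup>2)" and g: "(\<integral>\<^sup>+\<xi>. (g \<xi>)\<^sup>2 \<partial>dxi') \<le> ennreal (b\<^sup>2)"
    and "0 \<le> a" "0 \<le> b" and \<zeta>: "\<zeta> \<in> frequencies lam"
  shows "(\<integral>\<^sup>+\<xi>. f \<xi> * g (\<zeta> - \<xi>) \<partial>dxi') \<le> ennreal (a * b)"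
proof -
  have "(\<integral>\<^sup>+\<xi>. f \<xi> * g (\<zeta> - \<xi>) \<partial>dxi')\<^sup>2 \<le> (\<integral>\<^sup>+\<xi>. (f \<xi>)\<^sup>2 \<partial>dxi') * (\<integral>\<^sup>+\<xi>. (g (\<zeta> - \<xi>))\<^sup>2 \<partial>dxi')"
    by (rule Cauchy_Schwarz_nn_integral) measurable
  also have "(\<integral>\<^sup>+\<xi>. (g (\<zeta> - \<xi>))\<^sup>2 \<partial>dxi') = (\<integral>\<^sup>+\<xi>. (g \<xi>)\<^sup>2 \<partial>dxi')"
    by (rule nn_integral_dxi_reflect[OF _ \<zeta>]) measurable
  also have "(\<integral>\<^sup>+\<xi>. (f \<xi>)\<^sup>2 \<partial>dxi') * (\<integral>\<^sup>+\<xi>. (g \<xi>)\<^sup>2 \<partial>dxi') \<le> ennreal (a\<^sup>2) * ennreal (b\<^sup>2)"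
    by (intro mult_mono f g) auto
  also have "\<dots> = (ennreal (a * b))\<^sup>2"
    using assms(5,6) by (simp add: ennreal_mult[symmetric] ennreal_power power_mult_distrib)
  finally show ?thesis using assms(5,6) by (intro ennreal_power2_le_imp) auto
qed

text \<open>Two factors are integrated, the other two are convolved, and the convolution of two L^2
  functions is bounded at every grid point.\<close>

lemma form4_bound:
  assumes [measurable]: "f1 \<in> borel_measurable borel" "f2 \<in> borel_measurable borel" "f3 \<in> borel_measurable borel" "f4 \<in> borel_measurable borel"
    and f1: "(\<integral>\<^sup>+\<xi>. f1 \<xi> \<partial>dxi') \<le> A1" and f2: "(\<integral>\<^sup>+\<xi>. f2 \<xi> \<partial>dxi') \<le> A2"
    and f3: "(\<integral>\<^sup>+\<xi>. (f3 \<xi>)\<^sup>2 \<partial>dxi') \<le> ennreal (a3\<^sup>2)" and f4: "(\<integral>\<^sup>+\<xi>. (f4 \<xi>)\<^sup>2 \<partial>dxi') \<le> ennreal (a4\<^sup>2)"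
    and "0 \<le> a3" "0 \<le> a4"
  shows "form4 f1 f2 f3 f4 \<le> A1 * A2 * ennreal (a3 * a4)"
proof -
  have "form4 f1 f2 f3 f4 = (\<integral>\<^sup>+\<xi>\<^sub>1. \<integral>\<^sup>+\<xi>\<^sub>2. \<integral>\<^sup>+\<xi>\<^sub>3. f1 \<xi>\<^sub>1 * f2 \<xi>\<^sub>2 * f3 \<xi>\<^sub>3 * f4 (- \<xi>\<^sub>1 - \<xi>\<^sub>2 - \<xi>\<^sub>3) \<partial>dxi' \<partial>dxi' \<partial>dxi')"
    by (rule form4_iterated) measurable
  also have "\<dots> \<le> (\<integral>\<^sup>+\<xi>\<^sub>1. \<integral>\<^sup>+\<xi>\<^sub>2. f1 \<xi>\<^sub>1 * f2 \<xi>\<^sub>2 * ennreal (a3 * a4) \<partial>dxi' \<partial>dxi')"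
  proof (rule nn_integral_mono_AE)
    show "AE \<xi>\<^sub>1 in dxi'. (\<integral>\<^sup>+\<xi>\<^sub>2. \<integral>\<^sup>+\<xi>\<^sub>3. f1 \<xi>\<^sub>1 * f2 \<xi>\<^sub>2 * f3 \<xi>\<^sub>3 * f4 (- \<xi>\<^sub>1 - \<xi>\<^sub>2 - \<xi>\<^sub>3) \<partial>dxi' \<partial>dxi')
        \<le> (\<integral>\<^sup>+\<xi>\<^sub>2. f1 \<xi>\<^sub>1 * f2 \<xi>\<^sub>2 * ennreal (a3 * a4) \<partial>dxi')"
      using AE_dxi_frequencies
    proof eventually_elim
      case (elim \<xi>\<^sub>1)
      show ?case
      proof (rule nn_integral_mono_AE)
        show "AE \<xi>\<^sub>2 in dxi'. (\<integral>\<^sup>+\<xi>\<^sub>3. f1 \<xi>\<^sub>1 * f2 \<xi>\<^sub>2 * f3 \<xi>\<^sub>3 * f4 (- \<xi>\<^sub>1 - \<xi>\<^sub>2 - \<xi>\<^sub>3) \<partial>dxi') \<le> f1 \<xi>\<^sub>1 * f2 \<xi>\<^sub>2 * ennreal (a3 * a4)"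
          using AE_dxi_frequencies
        proof eventually_elim
          case (elim \<xi>\<^sub>2)
          then have z: "- \<xi>\<^sub>1 - \<xi>\<^sub>2 \<in> frequencies lam"
            using \<open>\<xi>\<^sub>1 \<in> frequencies lam\<close> by (intro frequencies_diff frequencies_uminus)
          have "(\<integral>\<^sup>+\<xi>\<^sub>3. f1 \<xi>\<^sub>1 * f2 \<xi>\<^sub>2 * f3 \<xi>\<^sub>3 * f4 (- \<xi>\<^sub>1 - \<xi>\<^sub>2 - \<xi>\<^sub>3) \<partial>dxi')
              = f1 \<xi>\<^sub>1 * f2 \<xi>\<^sub>2 * (\<integral>\<^sup>+\<xi>\<^sub>3. f3 \<xi>\<^sub>3 * f4 (- \<xi>\<^sub>1 - \<xi>\<^sub>2 - \<xi>\<^sub>3) \<partial>dxi')"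
            by (subst nn_integral_cmult[symmetric]) (auto simp: mult_ac)
          also have "\<dots> \<le> f1 \<xi>\<^sub>1 * f2 \<xi>\<^sub>2 * ennreal (a3 * a4)"
            by (intro mult_left_mono convolution_bound f3 f4 z) (use assms in auto)
          finally show ?case .
        qed
      qed
    qed
  qed
  also have "\<dots> = (\<integral>\<^sup>+\<xi>. f1 \<xi> \<partial>dxi') * (\<integral>\<^sup>+\<xi>. f2 \<xi> \<partial>dxi') * ennreal (a3 * a4)"
    by (simp add: nn_integral_cmult nn_integral_multc mult.assoc)
  also have "\<dots> \<le> A1 * A2 * ennreal (a3 * a4)"
    by (intro mult_mono f1 f2) auto
  finally show ?thesis .
qed

end

section \<open>The quartic integral in frequency space\<close>

context cylinder
begin

text \<open>The reflections are due to \<open>\<F>(cnj b)(\<xi>) = cnj (\<F>b(-\<xi>))\<close>.\<close>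

definition quad :: "(real \<times> real \<Rightarrow> complex) \<Rightarrow> (real \<times> real \<Rightarrow> complex) \<Rightarrow> (real \<times> real \<Rightarrow> complex) \<Rightarrow> (real \<times> real \<Rightarrow> complex) \<Rightarrow> freq4 \<Rightarrow> complex" where
  "quad a b c d = (\<lambda>(\<xi>\<^sub>1, \<xi>\<^sub>2, \<xi>\<^sub>3, \<xi>\<^sub>4). a \<xi>\<^sub>1 * cnj (b (- \<xi>\<^sub>2)) * c \<xi>\<^sub>3 * cnj (d (- \<xi>\<^sub>4)))"

lemma quad_measurable:
  assumes [measurable]: "a \<in> borel_measurable borel" "b \<in> borel_measurable borel" "c \<in> borel_measurable borel" "d \<in> borel_measurable borel"
  shows "quad a b c d \<in> borel_measurable borel"
  unfolding quad_def split_beta' by measurable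

lemma cmod_quad:
  "ennreal (cmod (quad a b c d x)) = (case x of (\<xi>\<^sub>1, \<xi>\<^sub>2, \<xi>\<^sub>3, \<xi>\<^sub>4) \<Rightarrow>
     ennreal (cmod (a \<xi>\<^sub>1)) * ennreal (cmod (b (- \<xi>\<^sub>2))) * ennreal (cmod (c \<xi>\<^sub>3)) * ennreal (cmod (d (- \<xi>\<^sub>4))))"
  by (cases x) (simp add: quad_def norm_mult ennreal_mult)

lemma integrable_Sigma4_iff:
  fixes g :: "freq4 \<Rightarrow> complex"
  assumes g: "g \<in> borel_measurable borel"
  shows "integrable (Sigma4_measure lam) g \<longleftrightarrow> (\<integral>\<^sup>+x. ennreal (cmod (g x)) \<partial>Sigma4_measure lam) < \<infinity>"
  using g by (simp add: integrable_iff_bounded)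

lemma integral_Sigma4:
  fixes g :: "freq4 \<Rightarrow> complex"
  assumes int: "integrable (Sigma4_measure lam) g"
  shows "(\<integral>x. g x \<partial>Sigma4_measure lam) = (\<integral>\<xi>\<^sub>1. \<integral>\<xi>\<^sub>2. \<integral>\<xi>\<^sub>3. g (\<xi>\<^sub>1, \<xi>\<^sub>2, \<xi>\<^sub>3, - \<xi>\<^sub>1 - \<xi>\<^sub>2 - \<xi>\<^sub>3) \<partial>dxi' \<partial>dxi' \<partial>dxi')"
proof -
  interpret X: sigma_finite_measure dxi' by (rule sigma_finite_dxi)
  interpret X2: sigma_finite_measure "dxi' \<Otimes>\<^sub>M dxi'" by (rule sigma_finite_dxi2)
  interpret P: pair_sigma_finite dxi' dxi' by (rule pair_dxi)
  interpret P3: pair_sigma_finite dxi' "dxi' \<Otimes>\<^sub>M dxi'" ..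
  have g: "g \<in> borel_measurable borel" using borel_measurable_integrable[OF int] by simp
  have i3: "integrable (dxi' \<Otimes>\<^sub>M dxi' \<Otimes>\<^sub>M dxi') (\<lambda>x. g (param4 x))"
    using int unfolding Sigma4_measure_eq by (subst (asm) integrable_distr_eq[OF param4_measurable g])
  have "(\<integral>x. g x \<partial>Sigma4_measure lam) = (\<integral>x. g (param4 x) \<partial>(dxi' \<Otimes>\<^sub>M dxi' \<Otimes>\<^sub>M dxi'))"
    unfolding Sigma4_measure_eq by (rule integral_distr[OF param4_measurable g])
  also have "\<dots> = (\<integral>\<xi>\<^sub>1. \<integral>y. g (param4 (\<xi>\<^sub>1, y)) \<partial>(dxi' \<Otimes>\<^sub>M dxi') \<partial>dxi')"
    by (rule P3.integral_fst'[OF i3, symmetric])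
  also have "\<dots> = (\<integral>\<xi>\<^sub>1. \<integral>\<xi>\<^sub>2. \<integral>\<xi>\<^sub>3. g (param4 (\<xi>\<^sub>1, \<xi>\<^sub>2, \<xi>\<^sub>3)) \<partial>dxi' \<partial>dxi' \<partial>dxi')"
  proof (rule integral_cong_AE)
    have m3: "(\<lambda>x. g (param4 x)) \<in> borel_measurable (dxi' \<Otimes>\<^sub>M dxi' \<Otimes>\<^sub>M dxi')" using i3 by (rule borel_measurable_integrable)
    then show "(\<lambda>\<xi>\<^sub>1. \<integral>y. g (param4 (\<xi>\<^sub>1, y)) \<partial>(dxi' \<Otimes>\<^sub>M dxi')) \<in> borel_measurable dxi'"
      by (intro X2.borel_measurable_lebesgue_integral) simp
    have "(\<lambda>w. g (param4 (fst (fst w), snd (fst w), snd w))) \<in> borel_measurable ((dxi' \<Otimes>\<^sub>M dxi') \<Otimes>\<^sub>M dxi')"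
      by (rule measurable_compose[OF _ m3, of "\<lambda>w. (fst (fst w), snd (fst w), snd w)"]) measurable
    then have "(\<lambda>y. \<integral>\<xi>\<^sub>3. g (param4 (fst y, snd y, \<xi>\<^sub>3)) \<partial>dxi') \<in> borel_measurable (dxi' \<Otimes>\<^sub>M dxi')"
      by (intro X.borel_measurable_lebesgue_integral) (simp add: split_beta')
    then show "(\<lambda>\<xi>\<^sub>1. \<integral>\<xi>\<^sub>2. \<integral>\<xi>\<^sub>3. g (param4 (\<xi>\<^sub>1, \<xi>\<^sub>2, \<xi>\<^sub>3)) \<partial>dxi' \<partial>dxi') \<in> borel_measurable dxi'"
      by (intro X.borel_measurable_lebesgue_integral) (simp add: split_beta')
    show "AE \<xi>\<^sub>1 in dxi'. (\<integral>y. g (param4 (\<xi>\<^sub>1, y)) \<partial>(dxi' \<Otimes>\<^sub>M dxi')) = (\<integral>\<xi>\<^sub>2. \<integral>\<xi>\<^sub>3. g (param4 (\<xi>\<^sub>1, \<xi>\<^sub>2, \<xi>\<^sub>3)) \<partial>dxi' \<partial>dxi')"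
      using P3.AE_integrable_fst'[OF i3]
    proof eventually_elim
      case (elim \<xi>\<^sub>1)
      show ?case by (rule P.integral_fst'[OF elim, symmetric])
    qed
  qed
  finally show ?thesis by (simp add: param4_def)
qed

text \<open>Carries a.e. statements about transforms to the hyperplane. A null set in coordinate j
  contributes \<open>form4\<close> with its indicator in slot j and 1 elsewhere; for slot 4 this
  vanishes by reflection, for the others by permuting.\<close>

lemma AE_Sigma4:
  assumes P: "AE \<xi> in dxi'. P \<xi>"
  shows "AE x in Sigma4_measure lam. case x of (\<xi>\<^sub>1, \<xi>\<^sub>2, \<xi>\<^sub>3, \<xi>\<^sub>4) \<Rightarrow> P \<xi>\<^sub>1 \<and> P \<xi>\<^sub>2 \<and> P \<xi>\<^sub>3 \<and> P \<xi>\<^sub>4"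
proof -
  obtain N where N: "{\<xi> \<in> space dxi'. \<not> P \<xi>} \<subseteq> N" "emeasure dxi' N = 0" "N \<in> sets dxi'"
    using P by (rule AE_E)
  then have [measurable]: "N \<in> sets borel" by simp
  let ?N = "indicator N :: real \<times> real \<Rightarrow> ennreal" and ?U = "\<lambda>_ :: real \<times> real. 1 :: ennreal"
  have N0: "(\<integral>\<^sup>+\<xi>. ?N \<xi> \<partial>dxi') = 0" using N by simp
  have 4: "form4 ?U ?U ?U ?N = 0"
  proof -
    have "AE \<xi>\<^sub>1 in dxi'. (\<integral>\<^sup>+\<xi>\<^sub>2. \<integral>\<^sup>+\<xi>\<^sub>3. ?N (- \<xi>\<^sub>1 - \<xi>\<^sub>2 - \<xi>\<^sub>3) \<partial>dxi' \<partial>dxi') = 0"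
      using AE_dxi_frequencies
    proof eventually_elim
      case (elim \<xi>\<^sub>1)
      have "AE \<xi>\<^sub>2 in dxi'. (\<integral>\<^sup>+\<xi>\<^sub>3. ?N (- \<xi>\<^sub>1 - \<xi>\<^sub>2 - \<xi>\<^sub>3) \<partial>dxi') = 0"
        using AE_dxi_frequencies
      proof eventually_elim
        case (elim \<xi>\<^sub>2)
        then have z: "- \<xi>\<^sub>1 - \<xi>\<^sub>2 \<in> frequencies lam"
          using \<open>\<xi>\<^sub>1 \<in> frequencies lam\<close> by (intro frequencies_diff frequencies_uminus)
        show ?case using nn_integral_dxi_reflect[OF _ z, of ?N] N0 by simp
      qed
      then show ?case by (subst nn_integral_cong_AE[where v = "\<lambda>_. 0"]) auto
    qed
    then show ?thesis
      by (subst form4_iterated) (auto simp: nn_integral_cong_AE[where v = "\<lambda>_. 0"])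
  qed
  have 3: "form4 ?U ?U ?N ?U = 0" using 4 by (subst form4_swap34) auto
  have 2: "form4 ?U ?N ?U ?U = 0" using 3 by (subst form4_swap23) auto
  have 1: "form4 ?N ?U ?U ?U = 0" using 2 by (subst form4_swap12) auto
  have ae: "AE x in Sigma4_measure lam. (case x of (\<xi>\<^sub>1, \<xi>\<^sub>2, \<xi>\<^sub>3, \<xi>\<^sub>4) \<Rightarrow> f1 \<xi>\<^sub>1 * f2 \<xi>\<^sub>2 * f3 \<xi>\<^sub>3 * f4 \<xi>\<^sub>4) = 0"
    if "form4 f1 f2 f3 f4 = 0" "f1 \<in> borel_measurable borel" "f2 \<in> borel_measurable borel" "f3 \<in> borel_measurable borel" "f4 \<in> borel_measurable borel" for f1 f2 f3 f4
    using that(1) unfolding form4_def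
    by (subst (asm) nn_integral_0_iff_AE) (use form4_integrand_measurable[OF that(2-)] in auto)
  have "AE x in Sigma4_measure lam. case x of (\<xi>\<^sub>1, \<xi>\<^sub>2, \<xi>\<^sub>3, \<xi>\<^sub>4) \<Rightarrow> \<xi>\<^sub>1 \<notin> N \<and> \<xi>\<^sub>2 \<notin> N \<and> \<xi>\<^sub>3 \<notin> N \<and> \<xi>\<^sub>4 \<notin> N"
    using ae[OF 1] ae[OF 2] ae[OF 3] ae[OF 4]
    by (auto simp: split_beta' indicator_eq_0_iff elim!: AE_mp[OF _ AE_I2, rotated -1])
  then show ?thesis
    by eventually_elim (use N(1) in auto)
qed

lemma cmod_fourier_inverse_le:
  assumes "integrable dxi' h"
  shows "cmod (fourier_inverse h z) \<le> (1 / (2 * pi)) * (\<integral>\<xi>. cmod (h \<xi>) \<partial>dxi')"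
  using integral_norm_bound[of dxi' "\<lambda>\<xi>. h \<xi> * exp (\<i> * complex_of_real (z \<bullet> \<xi>))"]
  by (simp add: fourier_inverse_def norm_mult norm_divide divide_right_mono)

lemma integral_mult_fourier_inverse:
  assumes V: "integrable dz' V" and h: "integrable dxi' h"
  shows "(\<integral>z. V z * fourier_inverse h z \<partial>dz') = complex_of_real (1 / (2 * pi)) * (\<integral>\<xi>. h \<xi> * (\<integral>z. V z * exp (\<i> * complex_of_real (z \<bullet> \<xi>)) \<partial>dz') \<partial>dxi')"
proof -
  interpret Z: sigma_finite_measure dz' by (rule sigma_finite_dz)
  interpret X: sigma_finite_measure dxi' by (rule sigma_finite_dxi)
  interpret pair_sigma_finite dz' dxi' ..
  let ?e = "\<lambda>z \<xi>. exp (\<i> * complex_of_real (z \<bullet> \<xi>))"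
  have "integrable (dz' \<Otimes>\<^sub>M dxi') (\<lambda>(z, \<xi>). V z * h \<xi> * ?e z \<xi>)"
  proof (intro integrable_pair_product V h)
    show "(\<lambda>(z, \<xi>). ?e z \<xi>) \<in> borel_measurable (dz' \<Otimes>\<^sub>M dxi')"
      using measurable_character(1)[OF measurable_id_dz measurable_id_dxi, of "\<i>"] by (simp add: split_beta')
  qed auto
  from Fubini_integral[OF this]
  have eq: "(\<integral>\<xi>. \<integral>z. V z * h \<xi> * ?e z \<xi> \<partial>dz' \<partial>dxi') = (\<integral>z. \<integral>\<xi>. V z * h \<xi> * ?e z \<xi> \<partial>dxi' \<partial>dz')" .
  have 1: "(\<lambda>\<xi>. \<integral>z. V z * h \<xi> * ?e z \<xi> \<partial>dz') = (\<lambda>\<xi>. h \<xi> * (\<integral>z. V z * ?e z \<xi> \<partial>dz'))"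
    by (subst integral_mult_right_zero[symmetric]) (simp only: mult_ac)
  have 2: "(\<lambda>z. \<integral>\<xi>. V z * h \<xi> * ?e z \<xi> \<partial>dxi') = (\<lambda>z. V z * (\<integral>\<xi>. h \<xi> * ?e z \<xi> \<partial>dxi'))"
    by (subst integral_mult_right_zero[symmetric]) (simp only: mult_ac)
  have "(\<integral>z. V z * fourier_inverse h z \<partial>dz') = (\<integral>z. complex_of_real (1 / (2 * pi)) * (V z * (\<integral>\<xi>. h \<xi> * ?e z \<xi> \<partial>dxi')) \<partial>dz')"
    unfolding fourier_inverse_def by (simp only: mult.left_commute)
  also have "\<dots> = complex_of_real (1 / (2 * pi)) * (\<integral>z. V z * (\<integral>\<xi>. h \<xi> * ?e z \<xi> \<partial>dxi') \<partial>dz')"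
    by (rule integral_mult_right_zero)
  finally show ?thesis using eq unfolding 1 2 by simp
qed

lemma band_limited_translate:
  assumes h: "band_limited h" and \<zeta>: "\<zeta> \<in> frequencies lam"
  shows "band_limited (\<lambda>\<xi>. h (\<xi> - \<zeta>))"
proof -
  obtain R where R: "\<And>\<xi>. norm \<xi> > R \<Longrightarrow> h \<xi> = 0" using h by (auto simp: band_limited_def)
  have "norm \<xi> > R + norm \<zeta> \<longrightarrow> h (\<xi> - \<zeta>) = 0" for \<xi>
    using norm_triangle_ineq2[of \<xi> \<zeta>] by (auto intro!: R)
  moreover have "sq_integrable dxi' (\<lambda>\<xi>. h (\<xi> - \<zeta>))"
    using sq_integrable_reflect[OF sq_integrable_uminus[OF band_limited_sq[OF h]] \<zeta>] by simp
  ultimately show ?thesis unfolding band_limited_def by blast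
qed

text \<open>A grid shift in frequency is a character in space; this absorbs the characters that
  Fubini leaves in \<open>quartic_band_limited\<close>.\<close>

lemma fourier_inverse_translate:
  assumes h: "band_limited h" and \<zeta>: "\<zeta> \<in> frequencies lam"
  shows "fourier_inverse (\<lambda>\<xi>. h (\<xi> - \<zeta>)) z = exp (\<i> * complex_of_real (z \<bullet> \<zeta>)) * fourier_inverse h z"
proof -
  have [measurable]: "h \<in> borel_measurable borel" using h by measurable
  have "(\<integral>\<xi>. h (\<xi> - \<zeta>) * exp (\<i> * complex_of_real (z \<bullet> \<xi>)) \<partial>dxi') = (\<integral>\<xi>. h (\<xi> + \<zeta> - \<zeta>) * exp (\<i> * complex_of_real (z \<bullet> (\<xi> + \<zeta>))) \<partial>dxi')"
    by (rule integral_dxi_translate[OF _ \<zeta>, symmetric]) measurable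
  also have "\<dots> = (\<integral>\<xi>. exp (\<i> * complex_of_real (z \<bullet> \<zeta>)) * (h \<xi> * exp (\<i> * complex_of_real (z \<bullet> \<xi>))) \<partial>dxi')"
    by (intro Bochner_Integration.integral_cong refl) (simp add: inner_add_right exp_add distrib_left mult_ac)
  also have "\<dots> = exp (\<i> * complex_of_real (z \<bullet> \<zeta>)) * (\<integral>\<xi>. h \<xi> * exp (\<i> * complex_of_real (z \<bullet> \<xi>)) \<partial>dxi')"
    by (rule integral_mult_right_zero)
  finally show ?thesis unfolding fourier_inverse_def by (simp only: mult.left_commute)
qed

text \<open>Band-limited functions are in L^1 and in L^2, so \<open>form4_bound\<close> applies with
  a, b in L^1 and c, d in L^2.\<close>

lemma quad_integrable:
  assumes a: "band_limited a" and b: "band_limited b" and c: "band_limited c" and d: "band_limited d"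
  shows "integrable (Sigma4_measure lam) (quad a b c d)"
proof -
  have m: "h \<in> borel_measurable borel" if "band_limited h" for h using that by measurable
  note [measurable] = m[OF a] m[OF b] m[OF c] m[OF d]
  have L1: "(\<integral>\<^sup>+\<xi>. ennreal (cmod (h \<xi>)) \<partial>dxi') < \<infinity>" if "band_limited h" for h
    using band_limited_integrable[OF that] by (simp add: integrable_iff_bounded)
  have L2: "(\<integral>\<^sup>+\<xi>. (ennreal (cmod (h \<xi>)))\<^sup>2 \<partial>dxi') \<le> ennreal ((L2_norm dxi' h)\<^sup>2)" if "band_limited h" for h
    using L2_norm_eq_nn_integral[OF band_limited_sq[OF that]] by (simp add: ennreal_power)
  have refl: "(\<integral>\<^sup>+\<xi>. g (- \<xi>) \<partial>dxi') = (\<integral>\<^sup>+\<xi>. g \<xi> \<partial>dxi')" if "g \<in> borel_measurable borel" for g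
    using nn_integral_dxi_reflect[OF that zero_frequency] by simp
  have "(\<integral>\<^sup>+x. ennreal (cmod (quad a b c d x)) \<partial>Sigma4_measure lam)
      = form4 (\<lambda>\<xi>. ennreal (cmod (a \<xi>))) (\<lambda>\<xi>. ennreal (cmod (b (- \<xi>)))) (\<lambda>\<xi>. ennreal (cmod (c \<xi>))) (\<lambda>\<xi>. ennreal (cmod (d (- \<xi>))))"
    unfolding form4_def cmod_quad ..
  also have "\<dots> \<le> (\<integral>\<^sup>+\<xi>. ennreal (cmod (a \<xi>)) \<partial>dxi') * (\<integral>\<^sup>+\<xi>. ennreal (cmod (b \<xi>)) \<partial>dxi') * ennreal (L2_norm dxi' c * L2_norm dxi' d)"
  proof (rule form4_bound)
    show "(\<integral>\<^sup>+\<xi>. ennreal (cmod (b (- \<xi>))) \<partial>dxi') \<le> (\<integral>\<^sup>+\<xi>. ennreal (cmod (b \<xi>)) \<partial>dxi')"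
      using refl[of "\<lambda>\<xi>. ennreal (cmod (b \<xi>))"] by simp
    show "(\<integral>\<^sup>+\<xi>. (ennreal (cmod (d (- \<xi>))))\<^sup>2 \<partial>dxi') \<le> ennreal ((L2_norm dxi' d)\<^sup>2)"
      using refl[of "\<lambda>\<xi>. (ennreal (cmod (d \<xi>)))\<^sup>2"] L2[OF d] by simp
  qed (use L2[OF c] in auto)
  also have "\<dots> < \<infinity>" using L1[OF a] L1[OF b] by (simp add: ennreal_mult_less_top)
  finally show ?thesis by (subst integrable_Sigma4_iff) (auto intro!: quad_measurable)
qed

text \<open>The inverse transforms of a and of the reflected conjugate of b are unfolded by Fubini,
  each leaving a factor 1/(2 pi) and a character. What remains is a Plancherel pairing of c, shifted
  by \<xi>_1 + \<xi>_2, with d; it produces \<xi>_3 and the constraint on \<xi>_4.\<close>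

lemma quartic_band_limited:
  assumes a: "band_limited a" and b: "band_limited b" and c: "band_limited c" and d: "band_limited d"
  shows "(\<integral>z. fourier_inverse a z * cnj (fourier_inverse b z) * fourier_inverse c z * cnj (fourier_inverse d z) \<partial>dz')
    = complex_of_real (1 / (2 * pi)\<^sup>2) * (\<integral>x. quad a b c d x \<partial>Sigma4_measure lam)"
proof -
  define A B W where "A = fourier_inverse a" "B = fourier_inverse (\<lambda>\<xi>. cnj (b (- \<xi>)))"
    "W z = fourier_inverse c z * cnj (fourier_inverse d z)" for z
  let ?e = "\<lambda>z \<xi>. exp (\<i> * complex_of_real (z \<bullet> \<xi>))"
  have W: "integrable dz' W"
    unfolding A_B_W_def by (intro integrable_mult_L2 sq_integrable_cnj L2z_sq fourier_inverse_L2z c d)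
  have b': "band_limited (\<lambda>\<xi>. cnj (b (- \<xi>)))" by (rule band_limited_uminus_cnj[OF b])
  have Bm: "B \<in> borel_measurable dz'"
    unfolding A_B_W_def by (rule measurable_dz[OF L2z_measurable[OF fourier_inverse_L2z[OF b']]])
  have em: "(\<lambda>z. ?e z \<xi>) \<in> borel_measurable dz'" for \<xi> by (rule measurable_dz) measurable
  \<comment> \<open>Unfolding a needs W B integrable: W is a product of two L^2 functions, and B is
    bounded as the inverse transform of an integrable function.\<close>
  have WB: "integrable dz' (\<lambda>z. W z * B z)"
  proof (rule Bochner_Integration.integrable_bound)
    define C where "C = (1 / (2 * pi)) * (\<integral>\<xi>. cmod (cnj (b (- \<xi>))) \<partial>dxi')"
    show "integrable dz' (\<lambda>z. C * cmod (W z))" using W by simp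
    have "cmod (B z) \<le> C" for z
      unfolding C_def A_B_W_def by (rule cmod_fourier_inverse_le[OF band_limited_integrable[OF b']])
    then have "norm (W z * B z) \<le> C * cmod (W z)" for z
      by (simp add: norm_mult mult.commute[of "cmod (W z)"] mult_right_mono)
    then show "AE z in dz'. norm (W z * B z) \<le> norm (C * cmod (W z))"
      by (intro AE_I2) (metis abs_ge_self order_trans real_norm_def)
    show "(\<lambda>z. W z * B z) \<in> borel_measurable dz'" using W Bm by (intro borel_measurable_times) auto
  qed
  have We: "integrable dz' (\<lambda>z. W z * ?e z \<xi>)" for \<xi>
    by (rule Bochner_Integration.integrable_bound[OF W]) (use W em in \<open>auto simp: norm_mult\<close>)
  have inner: "(\<integral>z. W z * ?e z \<zeta> \<partial>dz') = (\<integral>\<xi>. c \<xi> * cnj (d (\<xi> + \<zeta>)) \<partial>dxi')" if \<zeta>: "\<zeta> \<in> frequencies lam" for \<zeta>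
  proof -
    have [measurable]: "c \<in> borel_measurable borel" "d \<in> borel_measurable borel" using c d by measurable
    have "(\<integral>z. W z * ?e z \<zeta> \<partial>dz') = (\<integral>z. fourier_inverse (\<lambda>\<xi>. c (\<xi> - \<zeta>)) z * cnj (fourier_inverse d z) \<partial>dz')"
      by (simp only: fourier_inverse_translate[OF c \<zeta>] A_B_W_def mult_ac)
    also have "\<dots> = (\<integral>\<xi>. c (\<xi> - \<zeta>) * cnj (d \<xi>) \<partial>dxi')"
      by (rule fourier_inverse_inner[OF band_limited_translate[OF c \<zeta>] d])
    also have "\<dots> = (\<integral>\<xi>. c (\<xi> + \<zeta> - \<zeta>) * cnj (d (\<xi> + \<zeta>)) \<partial>dxi')"
      by (rule integral_dxi_translate[OF _ \<zeta>, symmetric]) measurable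
    finally show ?thesis by simp
  qed
  let ?p = "complex_of_real (1 / (2 * pi))"
  have pull: "(\<integral>\<xi>. f \<xi> * (p * g \<xi>) \<partial>dxi') = p * (\<integral>\<xi>. f \<xi> * g \<xi> \<partial>dxi')" for f g :: "real \<times> real \<Rightarrow> complex" and p
    by (subst integral_mult_right_zero[symmetric]) (simp only: mult.left_commute)
  have "(\<integral>z. fourier_inverse a z * cnj (fourier_inverse b z) * fourier_inverse c z * cnj (fourier_inverse d z) \<partial>dz')
      = (\<integral>z. (W z * B z) * fourier_inverse a z \<partial>dz')"
    by (simp only: A_B_W_def fourier_inverse_cnj[OF b] mult_ac)
  also have "\<dots> = ?p * (\<integral>\<xi>\<^sub>1. a \<xi>\<^sub>1 * (\<integral>z. (W z * B z) * ?e z \<xi>\<^sub>1 \<partial>dz') \<partial>dxi')"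
    by (rule integral_mult_fourier_inverse[OF WB band_limited_integrable[OF a]])
  also have "(\<lambda>\<xi>\<^sub>1. \<integral>z. (W z * B z) * ?e z \<xi>\<^sub>1 \<partial>dz') = (\<lambda>\<xi>\<^sub>1. ?p * (\<integral>\<xi>\<^sub>2. cnj (b (- \<xi>\<^sub>2)) * (\<integral>z. W z * ?e z (\<xi>\<^sub>1 + \<xi>\<^sub>2) \<partial>dz') \<partial>dxi'))"
  proof
    fix \<xi>\<^sub>1
    have "(\<integral>z. (W z * B z) * ?e z \<xi>\<^sub>1 \<partial>dz') = (\<integral>z. (W z * ?e z \<xi>\<^sub>1) * fourier_inverse (\<lambda>\<xi>. cnj (b (- \<xi>))) z \<partial>dz')"
      by (simp only: A_B_W_def mult_ac)
    also have "\<dots> = ?p * (\<integral>\<xi>\<^sub>2. cnj (b (- \<xi>\<^sub>2)) * (\<integral>z. (W z * ?e z \<xi>\<^sub>1) * ?e z \<xi>\<^sub>2 \<partial>dz') \<partial>dxi')"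
      by (rule integral_mult_fourier_inverse[OF We band_limited_integrable[OF b']])
    also have "(\<lambda>\<xi>\<^sub>2. \<integral>z. (W z * ?e z \<xi>\<^sub>1) * ?e z \<xi>\<^sub>2 \<partial>dz') = (\<lambda>\<xi>\<^sub>2. \<integral>z. W z * ?e z (\<xi>\<^sub>1 + \<xi>\<^sub>2) \<partial>dz')"
      by (simp add: inner_add_right distrib_left exp_add mult_ac)
    finally show "(\<integral>z. (W z * B z) * ?e z \<xi>\<^sub>1 \<partial>dz') = ?p * (\<integral>\<xi>\<^sub>2. cnj (b (- \<xi>\<^sub>2)) * (\<integral>z. W z * ?e z (\<xi>\<^sub>1 + \<xi>\<^sub>2) \<partial>dz') \<partial>dxi')" .
  qed
  also have "?p * (\<integral>\<xi>\<^sub>1. a \<xi>\<^sub>1 * (?p * (\<integral>\<xi>\<^sub>2. cnj (b (- \<xi>\<^sub>2)) * (\<integral>z. W z * ?e z (\<xi>\<^sub>1 + \<xi>\<^sub>2) \<partial>dz') \<partial>dxi')) \<partial>dxi')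
      = ?p * ?p * (\<integral>\<xi>\<^sub>1. a \<xi>\<^sub>1 * (\<integral>\<xi>\<^sub>2. cnj (b (- \<xi>\<^sub>2)) * (\<integral>z. W z * ?e z (\<xi>\<^sub>1 + \<xi>\<^sub>2) \<partial>dz') \<partial>dxi') \<partial>dxi')"
    by (subst pull) (simp only: mult.assoc)
  also have "(\<integral>\<xi>\<^sub>1. a \<xi>\<^sub>1 * (\<integral>\<xi>\<^sub>2. cnj (b (- \<xi>\<^sub>2)) * (\<integral>z. W z * ?e z (\<xi>\<^sub>1 + \<xi>\<^sub>2) \<partial>dz') \<partial>dxi') \<partial>dxi')
      = (\<integral>x. quad a b c d x \<partial>Sigma4_measure lam)"
  proof -
    have Sm: "(\<lambda>\<zeta>. \<integral>z. W z * ?e z \<zeta> \<partial>dz') \<in> borel_measurable borel"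
    proof -
      interpret sigma_finite_measure dz' by (rule sigma_finite_dz)
      have "(\<lambda>p. W (snd p) * exp (\<i> * complex_of_real (snd p \<bullet> fst p))) \<in> borel_measurable (borel \<Otimes>\<^sub>M dz')"
        by (intro borel_measurable_times measurable_compose[OF measurable_snd borel_measurable_integrable[OF W]] measurable_character measurable_id_dz measurable_ident_sets[OF refl])
      then show ?thesis by (intro borel_measurable_lebesgue_integral) (simp add: split_beta')
    qed
    have [measurable]: "a \<in> borel_measurable borel" "b \<in> borel_measurable borel" "c \<in> borel_measurable borel" "d \<in> borel_measurable borel"
      using a b c d by measurable
    interpret X: sigma_finite_measure dxi' by (rule sigma_finite_dxi)
    have mS: "(\<lambda>x. \<integral>z. W z * ?e z (fst x + snd x) \<partial>dz') \<in> borel_measurable (borel :: ((real \<times> real) \<times> (real \<times> real)) measure)"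
      by (rule measurable_compose[OF _ Sm]) measurable
    have mc: "(\<lambda>x. c (snd x) * cnj (d (snd x + fst x))) \<in> borel_measurable (borel :: ((real \<times> real) \<times> (real \<times> real)) measure)" by measurable
    have s2: "f \<in> borel_measurable borel \<Longrightarrow> f \<in> borel_measurable (dxi' \<Otimes>\<^sub>M dxi')" for f :: "(real \<times> real) \<times> (real \<times> real) \<Rightarrow> complex"
      using measurable_cong_sets[OF sets_dxi2 refl] by blast
    have mQ: "(\<lambda>\<zeta>. \<integral>\<xi>. c \<xi> * cnj (d (\<xi> + \<zeta>)) \<partial>dxi') \<in> borel_measurable borel"
      using X.borel_measurable_lebesgue_integral[of "\<lambda>\<zeta> \<xi>. c \<xi> * cnj (d (\<xi> + \<zeta>))" dxi'] s2[OF mc] by (simp add: split_beta')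
    have mQ2: "(\<lambda>x. \<integral>\<xi>. c \<xi> * cnj (d (\<xi> + (fst x + snd x))) \<partial>dxi') \<in> borel_measurable (borel :: ((real \<times> real) \<times> (real \<times> real)) measure)"
      by (rule measurable_compose[OF _ mQ]) measurable
    have "(\<integral>\<xi>\<^sub>1. a \<xi>\<^sub>1 * (\<integral>\<xi>\<^sub>2. cnj (b (- \<xi>\<^sub>2)) * (\<integral>z. W z * ?e z (\<xi>\<^sub>1 + \<xi>\<^sub>2) \<partial>dz') \<partial>dxi') \<partial>dxi')
        = (\<integral>\<xi>\<^sub>1. a \<xi>\<^sub>1 * (\<integral>\<xi>\<^sub>2. cnj (b (- \<xi>\<^sub>2)) * (\<integral>\<xi>. c \<xi> * cnj (d (\<xi> + (\<xi>\<^sub>1 + \<xi>\<^sub>2))) \<partial>dxi') \<partial>dxi') \<partial>dxi')"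
    \<comment> \<open>\<open>inner\<close> is available at grid points, so the integrands are
      compared a.e., and this asks for the measurability of both.\<close>
    proof (rule integral_cong_AE)
      have "(\<lambda>x. cnj (b (- snd x)) * (\<integral>z. W z * ?e z (fst x + snd x) \<partial>dz')) \<in> borel_measurable (borel :: ((real \<times> real) \<times> (real \<times> real)) measure)"
        by (intro borel_measurable_times mS) measurable
      from X.borel_measurable_lebesgue_integral[of "\<lambda>\<xi>\<^sub>1 \<xi>\<^sub>2. cnj (b (- \<xi>\<^sub>2)) * (\<integral>z. W z * ?e z (\<xi>\<^sub>1 + \<xi>\<^sub>2) \<partial>dz')" dxi'] s2[OF this]
      show "(\<lambda>\<xi>\<^sub>1. a \<xi>\<^sub>1 * (\<integral>\<xi>\<^sub>2. cnj (b (- \<xi>\<^sub>2)) * (\<integral>z. W z * ?e z (\<xi>\<^sub>1 + \<xi>\<^sub>2) \<partial>dz') \<partial>dxi')) \<in> borel_measurable dxi'"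
        by (intro borel_measurable_times) (auto simp: split_beta')
      have "(\<lambda>x. cnj (b (- snd x)) * (\<integral>\<xi>. c \<xi> * cnj (d (\<xi> + (fst x + snd x))) \<partial>dxi')) \<in> borel_measurable (borel :: ((real \<times> real) \<times> (real \<times> real)) measure)"
        by (intro borel_measurable_times mQ2) measurable
      from X.borel_measurable_lebesgue_integral[of "\<lambda>\<xi>\<^sub>1 \<xi>\<^sub>2. cnj (b (- \<xi>\<^sub>2)) * (\<integral>\<xi>. c \<xi> * cnj (d (\<xi> + (\<xi>\<^sub>1 + \<xi>\<^sub>2))) \<partial>dxi')" dxi'] s2[OF this]
      show "(\<lambda>\<xi>\<^sub>1. a \<xi>\<^sub>1 * (\<integral>\<xi>\<^sub>2. cnj (b (- \<xi>\<^sub>2)) * (\<integral>\<xi>. c \<xi> * cnj (d (\<xi> + (\<xi>\<^sub>1 + \<xi>\<^sub>2))) \<partial>dxi') \<partial>dxi')) \<in> borel_measurable dxi'"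
        by (intro borel_measurable_times) (auto simp: split_beta')
      show "AE \<xi>\<^sub>1 in dxi'. a \<xi>\<^sub>1 * (\<integral>\<xi>\<^sub>2. cnj (b (- \<xi>\<^sub>2)) * (\<integral>z. W z * ?e z (\<xi>\<^sub>1 + \<xi>\<^sub>2) \<partial>dz') \<partial>dxi')
          = a \<xi>\<^sub>1 * (\<integral>\<xi>\<^sub>2. cnj (b (- \<xi>\<^sub>2)) * (\<integral>\<xi>. c \<xi> * cnj (d (\<xi> + (\<xi>\<^sub>1 + \<xi>\<^sub>2))) \<partial>dxi') \<partial>dxi')"
        using AE_dxi_frequencies
      proof eventually_elim
        case (elim \<xi>\<^sub>1)
        have "(\<integral>\<xi>\<^sub>2. cnj (b (- \<xi>\<^sub>2)) * (\<integral>z. W z * ?e z (\<xi>\<^sub>1 + \<xi>\<^sub>2) \<partial>dz') \<partial>dxi')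
            = (\<integral>\<xi>\<^sub>2. cnj (b (- \<xi>\<^sub>2)) * (\<integral>\<xi>. c \<xi> * cnj (d (\<xi> + (\<xi>\<^sub>1 + \<xi>\<^sub>2))) \<partial>dxi') \<partial>dxi')"
        proof (rule integral_cong_AE)
          show "AE \<xi>\<^sub>2 in dxi'. cnj (b (- \<xi>\<^sub>2)) * (\<integral>z. W z * ?e z (\<xi>\<^sub>1 + \<xi>\<^sub>2) \<partial>dz') = cnj (b (- \<xi>\<^sub>2)) * (\<integral>\<xi>. c \<xi> * cnj (d (\<xi> + (\<xi>\<^sub>1 + \<xi>\<^sub>2))) \<partial>dxi')"
            using AE_dxi_frequencies by eventually_elim (simp add: inner[OF frequencies_add[OF elim]])
          show "(\<lambda>\<xi>\<^sub>2. cnj (b (- \<xi>\<^sub>2)) * (\<integral>z. W z * ?e z (\<xi>\<^sub>1 + \<xi>\<^sub>2) \<partial>dz')) \<in> borel_measurable dxi'"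
            using measurable_compose[OF _ mS, of "\<lambda>\<xi>\<^sub>2. (\<xi>\<^sub>1, \<xi>\<^sub>2)" dxi'] by (intro borel_measurable_times) auto
          show "(\<lambda>\<xi>\<^sub>2. cnj (b (- \<xi>\<^sub>2)) * (\<integral>\<xi>. c \<xi> * cnj (d (\<xi> + (\<xi>\<^sub>1 + \<xi>\<^sub>2))) \<partial>dxi')) \<in> borel_measurable dxi'"
            using measurable_compose[OF _ mQ2, of "\<lambda>\<xi>\<^sub>2. (\<xi>\<^sub>1, \<xi>\<^sub>2)" dxi'] by (intro borel_measurable_times) auto
        qed
        then show ?case by simp
      qed
    qed
    also have "\<dots> = (\<integral>x. quad a b c d x \<partial>Sigma4_measure lam)"
      unfolding integral_Sigma4[OF quad_integrable[OF a b c d]] integral_mult_right_zero[symmetric]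
      by (simp add: quad_def algebra_simps)
    finally show ?thesis .
  qed
  finally show ?thesis by (simp add: power2_eq_square)
qed

lemma L2_Cauchy_subseq_AE:
  assumes F: "\<And>n. sq_integrable M (F n)" and f: "sq_integrable M f"
    and lim: "(\<lambda>n. L2_norm M (\<lambda>x. F n x - f x)) \<longlonglongrightarrow> 0"
  obtains r where "strict_mono r" "AE x in M. (\<lambda>n. F (r n) x) \<longlonglongrightarrow> f x"
proof -
  have "L2_Cauchy M F" by (rule L2_convergent_imp_Cauchy[OF F f lim])
  then obtain g r where g: "sq_integrable M g" "(\<lambda>n. L2_norm M (\<lambda>x. F n x - g x)) \<longlonglongrightarrow> 0"
    and r: "strict_mono r" "AE x in M. (\<lambda>n. F (r n) x) \<longlonglongrightarrow> g x"
    by (rule L2_complete[OF F])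
  have "AE x in M. f x = g x" by (rule L2_limit_unique[OF F f g(1) lim g(2)])
  with r(2) have "AE x in M. (\<lambda>n. F (r n) x) \<longlonglongrightarrow> f x" by eventually_elim simp
  with r(1) show ?thesis by (rule that)
qed

text \<open>
  For the frequency truncations \<open>v\<^sub>n\<close> the identity is the convolution theorem. Polarised, it shows by dominated
  convergence on the frequency side that \<open>|v\<^sub>n|\<^sup>2\<close> is a Cauchy sequence in \<open>L\<^sup>2\<close>.
\<close>

theorem quartic_identity:
  fixes v :: "real \<times> real \<Rightarrow> complex"
  defines "V \<equiv> fourier lam v"
  assumes v: "L2z v" and fin: "integrable (Sigma4_measure lam) (quad V V V V)"
  shows "integrable dz' (\<lambda>z. cmod (v z) ^ 4)"
    and "complex_of_real (\<integral>z. cmod (v z) ^ 4 \<partial>dz') = complex_of_real (1 / (2 * pi)\<^sup>2) * (\<integral>x. quad V V V V x \<partial>Sigma4_measure lam)"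
proof -
  have V2: "sq_integrable dxi' V" unfolding V_def by (rule fourier_sq[OF v])
  have [measurable]: "V \<in> borel_measurable borel" using sq_integrable_measurable[OF V2] by simp
  have [measurable]: "v \<in> borel_measurable dz'" using L2z_sq[OF v] by (rule sq_integrable_measurable)
  let ?h = "cutoff V" and ?v = "\<lambda>n. fourier_inverse (cutoff V n)" and ?S = "Sigma4_measure lam"
  have h: "band_limited (?h n)" for n by (rule band_limited_truncate[OF V2])
  have vn: "sq_integrable dz' (?v n)" for n by (rule L2z_sq[OF fourier_inverse_L2z[OF h]])
  have [measurable]: "?v n \<in> borel_measurable dz'" for n by (rule sq_integrable_measurable[OF vn])
  \<comment> \<open>Two indices, because the integrals of |v_n|^2 |v_m|^2 decide whether the |v_n|^2
    form a Cauchy sequence.\<close>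
  define q where "q n m = quad (?h n) (?h n) (?h m) (?h m)" for n m
  define J where "J n m = (\<integral>x. q n m x \<partial>?S)" for n m
  define J0 where "J0 = (\<integral>x. quad V V V V x \<partial>?S)"
  have qm [measurable]: "q n m \<in> borel_measurable borel" for n m
    unfolding q_def by (rule quad_measurable) measurable
  have q0m [measurable]: "quad V V V V \<in> borel_measurable borel" by (rule quad_measurable) measurable
  have prod: "(\<integral>z. complex_of_real ((cmod (?v n z))\<^sup>2 * (cmod (?v m z))\<^sup>2) \<partial>dz') = complex_of_real (1 / (2 * pi)\<^sup>2) * J n m" for n m
    unfolding J_def q_def quartic_band_limited[OF h h h h, symmetric]
    by (simp only: of_real_mult complex_norm_square mult.assoc)
  have bounded: "\<exists>C. \<forall>z. cmod (?v n z) \<le> C" for n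
    using cmod_fourier_inverse_le[OF band_limited_integrable[OF h]] by blast
  \<comment> \<open>Each v_n is bounded and in L^2, hence |v_n|^2 is in L^2, with a norm that may
    depend on n so far.\<close>
  have vv: "sq_integrable dz' (\<lambda>z. complex_of_real ((cmod (?v n z))\<^sup>2))" for n
  proof -
    obtain C where C: "\<And>z. cmod (?v n z) \<le> C" using bounded by blast
    have "sq_integrable dz' (\<lambda>z. cnj (?v n z) * ?v n z)"
      by (rule sq_integrable_mult_bounded[OF vn, where C = C]) (use C in auto)
    then show ?thesis by (simp only: complex_norm_square mult.commute)
  qed
  have ii: "integrable dz' (\<lambda>z. (cmod (?v n z))\<^sup>2 * (cmod (?v m z))\<^sup>2)" for n m
    using integrable_Re[OF integrable_mult_L2[OF vv vv, of n m]] by simp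
  have prodR: "complex_of_real (\<integral>z. (cmod (?v n z))\<^sup>2 * (cmod (?v m z))\<^sup>2 \<partial>dz') = complex_of_real (1 / (2 * pi)\<^sup>2) * J n m" for n m
    unfolding prod[symmetric] by (simp only: integral_complex_of_real)
  \<comment> \<open>Joint convergence in n and m: the cutoffs change the integrand only where some
    frequency exceeds the smaller index, so one tail \<open>R K\<close> bounds every
    difference.\<close>
  have conv: "\<exists>K. \<forall>n\<ge>K. \<forall>m\<ge>K. cmod (J n m - J0) < e" if e: "e > 0" for e
  proof -
    define R where "R k x = (case x of (\<xi>\<^sub>1, \<xi>\<^sub>2, \<xi>\<^sub>3, \<xi>\<^sub>4) \<Rightarrow>
      if norm \<xi>\<^sub>1 \<le> real k \<and> norm \<xi>\<^sub>2 \<le> real k \<and> norm \<xi>\<^sub>3 \<le> real k \<and> norm \<xi>\<^sub>4 \<le> real k then 0 else cmod (quad V V V V x))" for k :: nat and x :: freq4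
    have Rm [measurable]: "R k \<in> borel_measurable borel" for k
    proof -
      have "R k = (\<lambda>x. if norm (fst x) \<le> real k \<and> norm (fst (snd x)) \<le> real k \<and> norm (fst (snd (snd x))) \<le> real k \<and> norm (snd (snd (snd x))) \<le> real k then 0 else cmod (quad V V V V x))"
        by (auto simp: R_def)
      then show ?thesis by simp
    qed
    have Rint: "integrable ?S (R k)" for k
      by (rule Bochner_Integration.integrable_bound[OF integrable_norm[OF fin]]) (auto simp: R_def)
    have "(\<lambda>k. \<integral>x. R k x \<partial>?S) \<longlonglongrightarrow> (\<integral>x. 0 \<partial>?S)"
    proof (rule integral_dominated_convergence[OF _ _ integrable_norm[OF fin]])
      show "AE x in ?S. (\<lambda>k. R k x) \<longlonglongrightarrow> 0"
      proof (rule AE_I2)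
        fix x :: freq4
        obtain \<xi>\<^sub>1 \<xi>\<^sub>2 \<xi>\<^sub>3 \<xi>\<^sub>4 where x: "x = (\<xi>\<^sub>1, \<xi>\<^sub>2, \<xi>\<^sub>3, \<xi>\<^sub>4)" by (cases x)
        have "\<forall>\<^sub>F k in sequentially. R k x = 0"
          using eventually_norm_le[of \<xi>\<^sub>1] eventually_norm_le[of \<xi>\<^sub>2] eventually_norm_le[of \<xi>\<^sub>3] eventually_norm_le[of \<xi>\<^sub>4]
          by eventually_elim (simp add: x R_def)
        then show "(\<lambda>k. R k x) \<longlonglongrightarrow> 0" by (rule tendsto_eventually)
      qed
    qed (auto simp: R_def)
    then have "(\<lambda>k. \<integral>x. R k x \<partial>?S) \<longlonglongrightarrow> 0" by simp
    from LIMSEQ_D[OF this e] obtain K where "\<forall>k\<ge>K. norm ((\<integral>x. R k x \<partial>?S) - 0) < e" by (rule exE)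
    from this[rule_format, of K] have K: "(\<integral>x. R K x \<partial>?S) < e" by simp
    show ?thesis
    proof (intro exI allI impI)
      fix n m assume nm: "K \<le> n" "K \<le> m"
      have pt: "cmod (q n m x - quad V V V V x) \<le> R K x" for x
        using nm by (cases x) (auto simp: R_def q_def quad_def)
      have qi: "integrable ?S (q n m)" unfolding q_def by (rule quad_integrable[OF h h h h])
      have "cmod (J n m - J0) = cmod (\<integral>x. q n m x - quad V V V V x \<partial>?S)"
        unfolding J_def J0_def by (simp add: Bochner_Integration.integral_diff[OF qi fin])
      also have "\<dots> \<le> (\<integral>x. cmod (q n m x - quad V V V V x) \<partial>?S)" by (rule integral_norm_bound)
      also have "\<dots> \<le> (\<integral>x. R K x \<partial>?S)"
        by (rule integral_mono[OF integrable_norm[OF Bochner_Integration.integrable_diff[OF qi fin]] Rint pt])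
      also have "\<dots> < e" by (rule K)
      finally show "cmod (J n m - J0) < e" .
    qed
  qed
  let ?w = "\<lambda>n z. complex_of_real ((cmod (?v n z))\<^sup>2)"
  have Cauchy: "L2_Cauchy dz' ?w"
    unfolding L2_Cauchy_def
  proof (intro allI impI)
    fix e :: real assume e: "e > 0"
    have "0 < e\<^sup>2 / 4" using e by simp
    from conv[OF this] obtain K where K: "\<forall>n\<ge>K. \<forall>m\<ge>K. cmod (J n m - J0) < e\<^sup>2 / 4" by (rule exE)
    have "L2_norm dz' (\<lambda>z. ?w m z - ?w n z) < e" if mn: "K \<le> m" "K \<le> n" for m n
    proof (rule power2_less_imp_less)
      \<comment> \<open>The square expands into the integrals behind \<open>J m m\<close>,
        \<open>J m n\<close>, \<open>J n n\<close>, which share the limit \<open>J0\<close>; the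
        coefficients 1, -2, 1 sum to zero, so \<open>J0\<close> cancels.\<close>
      have "(L2_norm dz' (\<lambda>z. ?w m z - ?w n z))\<^sup>2 = (\<integral>z. ((cmod (?v m z))\<^sup>2 * (cmod (?v m z))\<^sup>2 - 2 * ((cmod (?v m z))\<^sup>2 * (cmod (?v n z))\<^sup>2)) + (cmod (?v n z))\<^sup>2 * (cmod (?v n z))\<^sup>2 \<partial>dz')"
        unfolding L2_norm_power2 of_real_diff[symmetric] norm_of_real power2_abs
        by (intro Bochner_Integration.integral_cong refl) (simp add: power2_eq_square algebra_simps)
      also have "\<dots> = (\<integral>z. (cmod (?v m z))\<^sup>2 * (cmod (?v m z))\<^sup>2 \<partial>dz') - 2 * (\<integral>z. (cmod (?v m z))\<^sup>2 * (cmod (?v n z))\<^sup>2 \<partial>dz') + (\<integral>z. (cmod (?v n z))\<^sup>2 * (cmod (?v n z))\<^sup>2 \<partial>dz')"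
        by (simp only: Bochner_Integration.integral_add Bochner_Integration.integral_diff Bochner_Integration.integrable_add
            Bochner_Integration.integrable_diff integrable_mult_right ii integral_mult_right_zero)
      finally have "complex_of_real ((L2_norm dz' (\<lambda>z. ?w m z - ?w n z))\<^sup>2)
          = complex_of_real (1 / (2 * pi)\<^sup>2) * (J m m - 2 * J m n + J n n)"
        by (simp only: of_real_add of_real_diff of_real_mult[of 2] prodR of_real_numeral) (simp only: algebra_simps)
      also have "J m m - 2 * J m n + J n n = (J m m - J0) - (J m n - J0) - (J m n - J0) + (J n n - J0)" by simp
      finally have "cmod (complex_of_real ((L2_norm dz' (\<lambda>z. ?w m z - ?w n z))\<^sup>2))
          = (1 / (2 * pi)\<^sup>2) * cmod ((J m m - J0) - (J m n - J0) - (J m n - J0) + (J n n - J0))"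
        by (simp only: norm_mult norm_of_real) simp
      also have "\<dots> \<le> 1 * cmod ((J m m - J0) - (J m n - J0) - (J m n - J0) + (J n n - J0))"
      proof (rule mult_right_mono)
        have "1 \<le> (2 * pi)\<^sup>2" using pi_ge_two by (intro one_le_power) simp
        then show "1 / (2 * pi)\<^sup>2 \<le> 1" by simp
      qed simp
      also have "\<dots> \<le> cmod (J m m - J0) + cmod (J m n - J0) + cmod (J m n - J0) + cmod (J n n - J0)"
        using norm_triangle_ineq[of "(J m m - J0) - (J m n - J0) - (J m n - J0)" "J n n - J0"]
          norm_triangle_ineq4[of "(J m m - J0) - (J m n - J0)" "J m n - J0"] norm_triangle_ineq4[of "J m m - J0" "J m n - J0"] by linarith
      also have "\<dots> < e\<^sup>2 / 4 + e\<^sup>2 / 4 + e\<^sup>2 / 4 + e\<^sup>2 / 4"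
        using K mn by (intro add_strict_mono) blast+
      finally show "(L2_norm dz' (\<lambda>z. ?w m z - ?w n z))\<^sup>2 < e\<^sup>2"
        unfolding norm_of_real abs_power2 by linarith
    qed (use e in simp)
    then show "\<exists>K. \<forall>m\<ge>K. \<forall>n\<ge>K. L2_norm dz' (\<lambda>z. ?w m z - ?w n z) < e" by blast
  qed
  \<comment> \<open>A subsequence of the truncations converges to v a.e.; this identifies the L^2
    limit of their squared moduli as |v|^2.\<close>
  obtain r where r: "strict_mono r" "AE z in dz'. (\<lambda>n. ?v (r n) z) \<longlonglongrightarrow> v z"
    by (rule L2_Cauchy_subseq_AE[OF vn L2z_sq[OF v] fourier_inversion[OF v, folded V_def]])
  have lim: "AE z in dz'. (\<lambda>n. ?w (r n) z) \<longlonglongrightarrow> complex_of_real ((cmod (v z))\<^sup>2)"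
    using r(2) by eventually_elim (intro tendsto_intros)
  have wm: "(\<lambda>z. complex_of_real ((cmod (v z))\<^sup>2)) \<in> borel_measurable dz'" by measurable
  have w2: "sq_integrable dz' (\<lambda>z. complex_of_real ((cmod (v z))\<^sup>2))"
    and wlim: "(\<lambda>n. L2_norm dz' (\<lambda>z. ?w n z - complex_of_real ((cmod (v z))\<^sup>2))) \<longlonglongrightarrow> 0"
    using L2_Cauchy_AE_limit[OF vv Cauchy r(1) lim wm] by blast+
  have p4: "(cmod (complex_of_real ((cmod x)\<^sup>2)))\<^sup>2 = cmod x ^ 4" for x
    by (simp add: norm_power)
  show "integrable dz' (\<lambda>z. cmod (v z) ^ 4)"
    using w2 unfolding sq_integrable_def p4 by simp
  have "(\<lambda>n. (L2_norm dz' (?w n))\<^sup>2) \<longlonglongrightarrow> (L2_norm dz' (\<lambda>z. complex_of_real ((cmod (v z))\<^sup>2)))\<^sup>2"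
    by (intro tendsto_intros L2_norm_tendsto[OF vv w2 wlim])
  then have "(\<lambda>n. \<integral>z. (cmod (?v n z))\<^sup>2 * (cmod (?v n z))\<^sup>2 \<partial>dz') \<longlonglongrightarrow> (\<integral>z. cmod (v z) ^ 4 \<partial>dz')"
    unfolding L2_norm_power2 p4 by (simp add: power2_eq_square power4_eq_xxxx mult.assoc)
  then have l1: "(\<lambda>n. complex_of_real (1 / (2 * pi)\<^sup>2) * J n n) \<longlonglongrightarrow> complex_of_real (\<integral>z. cmod (v z) ^ 4 \<partial>dz')"
    unfolding prodR[symmetric] by (rule tendsto_of_real)
  have "(\<lambda>n. J n n) \<longlonglongrightarrow> J0"
  proof (rule LIMSEQ_I)
    fix e :: real assume "e > 0"
    from conv[OF this] obtain K where "\<forall>n\<ge>K. \<forall>m\<ge>K. cmod (J n m - J0) < e" by (rule exE)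
    then show "\<exists>no. \<forall>n\<ge>no. norm (J n n - J0) < e" by blast
  qed
  then have "(\<lambda>n. complex_of_real (1 / (2 * pi)\<^sup>2) * J n n) \<longlonglongrightarrow> complex_of_real (1 / (2 * pi)\<^sup>2) * J0"
    by (intro tendsto_intros)
  from LIMSEQ_unique[OF l1 this] show "complex_of_real (\<integral>z. cmod (v z) ^ 4 \<partial>dz') = complex_of_real (1 / (2 * pi)\<^sup>2) * (\<integral>x. quad V V V V x \<partial>?S)"
    by (simp add: J0_def)
qed

end

section \<open>Symbol estimates\<close>

text \<open>Directional derivative expanded in the partial derivatives, since these are what
  \<open>I_profile\<close> bounds.\<close>

definition line_deriv :: "(real \<times> real \<Rightarrow> real) \<Rightarrow> real \<times> real \<Rightarrow> real \<times> real \<Rightarrow> real" where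
  "line_deriv f z h = fst h * dir_deriv (1, 0) f z + snd h * dir_deriv (0, 1) f z"

lemma line_deriv_has_derivative:
  assumes f: "\<And>z. f differentiable (at z)"
  shows "((\<lambda>t. f (a + t *\<^sub>R h)) has_real_derivative line_deriv f (a + t *\<^sub>R h) h) (at t)"
proof -
  let ?f' = "frechet_derivative f (at (a + t *\<^sub>R h))"
  have f': "(f has_derivative ?f') (at (a + t *\<^sub>R h))" using f by (simp add: frechet_derivative_works)
  then interpret bounded_linear ?f' by (rule has_derivative_bounded_linear)
  have "h = fst h *\<^sub>R (1, 0) + snd h *\<^sub>R (0, 1)" by (cases h) simp
  then have "?f' h = ?f' (fst h *\<^sub>R (1, 0) + snd h *\<^sub>R (0, 1))" by simp
  also have "\<dots> = line_deriv f (a + t *\<^sub>R h) h" by (simp only: add scaleR) (simp add: line_deriv_def dir_deriv_def)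
  finally have eq: "?f' h = line_deriv f (a + t *\<^sub>R h) h" .
  have "((\<lambda>t. a + t *\<^sub>R h) has_derivative (\<lambda>t. t *\<^sub>R h)) (at t)"
    by (auto intro!: derivative_eq_intros)
  from has_derivative_compose[OF this f'] have "((\<lambda>t. f (a + t *\<^sub>R h)) has_derivative (\<lambda>x. ?f' (x *\<^sub>R h))) (at t)" .
  also have "(\<lambda>x. ?f' (x *\<^sub>R h)) = (*) (line_deriv f (a + t *\<^sub>R h) h)" by (auto simp: scaleR eq)
  finally show ?thesis by (simp add: has_field_derivative_def)
qed

lemma inner_line_derivatives:
  fixes a h w :: "real \<times> real"
  shows "((\<lambda>t. (a + t *\<^sub>R h) \<bullet> (a + t *\<^sub>R h)) has_real_derivative 2 * ((a + t *\<^sub>R h) \<bullet> h)) (at t)"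
    and "((\<lambda>t. (a + t *\<^sub>R h) \<bullet> w) has_real_derivative (h \<bullet> w)) (at t)"
proof -
  have "(\<lambda>t. (a + t *\<^sub>R h) \<bullet> (a + t *\<^sub>R h)) = (\<lambda>t. a \<bullet> a + 2 * t * (a \<bullet> h) + t\<^sup>2 * (h \<bullet> h))"
    by (auto simp: inner_add_left inner_add_right inner_commute power2_eq_square)
  then show "((\<lambda>t. (a + t *\<^sub>R h) \<bullet> (a + t *\<^sub>R h)) has_real_derivative 2 * ((a + t *\<^sub>R h) \<bullet> h)) (at t)"
    by (auto intro!: derivative_eq_intros simp: inner_add_left)
  show "((\<lambda>t. (a + t *\<^sub>R h) \<bullet> w) has_real_derivative (h \<bullet> w)) (at t)"
    unfolding inner_add_left inner_scaleR_left by (auto intro!: derivative_eq_intros)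
qed

lemma abs_coord_le: "\<bar>fst h\<bar> \<le> norm (h :: real \<times> real)" "\<bar>snd h\<bar> \<le> norm h"
  using norm_fst_le[of "fst h" "snd h"] norm_snd_le[of "snd h" "fst h"] by auto

section \<open>The profile and its scale-invariant bounds\<close>

locale profile =
  fixes s :: real and m1 :: "real \<times> real \<Rightarrow> real"
  assumes s_gt: "1 / 2 < s" and s_lt: "s < 1" and profile: "I_profile s m1"
begin

lemma m1_antimono: "norm \<xi> \<le> norm \<eta> \<Longrightarrow> m1 \<eta> \<le> m1 \<xi>"
proof -
  assume le: "norm \<xi> \<le> norm \<eta>"
  obtain \<rho> where "antimono_on {0..} \<rho>" "\<And>\<xi>. m1 \<xi> = \<rho> (norm \<xi>)" using profile by (auto simp: I_profile_def)
  then show ?thesis using le by (auto simp: monotone_on_def)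
qed

lemma m1_cong: "norm \<xi> = norm \<eta> \<Longrightarrow> m1 \<xi> = m1 \<eta>"
  using m1_antimono[of \<xi> \<eta>] m1_antimono[of \<eta> \<xi>] by simp

lemma m1_small: "norm \<xi> \<le> 1 \<Longrightarrow> m1 \<xi> = 1"
  using profile unfolding I_profile_def by blast

lemma m1_large: "2 \<le> norm \<xi> \<Longrightarrow> m1 \<xi> = norm \<xi> powr (s - 1)"
proof -
  assume "2 \<le> norm \<xi>"
  then have "m1 \<xi> = (1 / norm \<xi>) powr (1 - s)" using profile unfolding I_profile_def by blast
  also have "\<dots> = norm \<xi> powr (s - 1)" by (simp add: powr_divide powr_minus_divide[symmetric])
  finally show ?thesis .
qed

lemma m1_le_1: "m1 \<xi> \<le> 1"
  using m1_antimono[of 0 \<xi>] m1_small[of 0] by simp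

text \<open>\<open>m\<^sub>1(\<xi>)\<close> and \<open>M |\<xi>|\<close> agree up to a factor \<open>2\<close>.\<close>

definition M :: "real \<Rightarrow> real" where "M r = max 1 r powr (s - 1)"

lemma M_pos: "0 < M r" by (simp add: M_def)

lemma M_le_1: "M r \<le> 1"
  unfolding M_def using s_lt powr_mono2'[of "s - 1" 1 "max 1 r"] by simp

lemma M_antimono: "r \<le> r' \<Longrightarrow> M r' \<le> M r"
  unfolding M_def using s_lt by (intro powr_mono2') auto

text \<open>Doubling property: \<open>M\<close> decays more slowly than 1/r, because s - 1 >
  -1.\<close>

lemma M_divide:
  assumes "1 \<le> k" shows "M (r / k) \<le> k * M r"
proof -
  have "max 1 r \<le> k * max 1 (r / k)" using assms by (auto simp: max_def)
  then have "(k * max 1 (r / k)) powr (s - 1) \<le> max 1 r powr (s - 1)"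
    using s_lt by (intro powr_mono2') auto
  then have "k powr (s - 1) * M (r / k) \<le> M r"
    using assms by (simp add: M_def powr_mult)
  moreover have "1 / k \<le> k powr (s - 1)"
    using assms s_gt powr_mono[of "-1" "s - 1" k] by (simp add: powr_minus_divide)
  ultimately have "1 / k * M (r / k) \<le> M r"
    using M_pos[of "r / k"] by (meson less_imp_le mult_right_mono order_trans)
  then show ?thesis using assms by (simp add: field_simps)
qed

lemma M_2: "1 / 2 \<le> M 2"
  using s_gt powr_mono[of "-1" "s - 1" 2] by (simp add: M_def powr_minus_divide)

text \<open>On |\<xi>| <= 2, where the profile is not explicit, both functions take values in
  [1/2, 1]; beyond, they coincide.\<close>

lemma m1_le_M: "m1 \<xi> \<le> 2 * M (norm \<xi>)"
proof (cases "norm \<xi> \<le> 2")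
  case True
  then have "1 / 2 \<le> M (norm \<xi>)" using M_antimono[OF True] M_2 by linarith
  then show ?thesis using m1_le_1[of \<xi>] by linarith
next
  case False
  then show ?thesis using m1_large[of \<xi>] M_pos[of "norm \<xi>"] by (simp add: M_def)
qed

lemma M_le_m1: "M (norm \<xi>) \<le> 2 * m1 \<xi>"
proof (cases "norm \<xi> \<le> 2")
  case True
  have "m1 (2, 0) = M 2" using m1_large[of "(2, 0)"] by (simp add: M_def norm_Pair)
  then have "1 / 2 \<le> m1 \<xi>" using m1_antimono[of \<xi> "(2, 0)"] True M_2 by (simp add: norm_Pair)
  then show ?thesis using M_le_1[of "norm \<xi>"] by linarith
next
  case False
  then show ?thesis using m1_large[of \<xi>] M_pos[of "norm \<xi>"] by (simp add: M_def)
qed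

lemma m1_pos: "0 < m1 \<xi>"
  using M_le_m1[of \<xi>] M_pos[of "norm \<xi>"] by linarith

text \<open>Beyond 1 the function is r^(2s-1), and s > 1/2 makes it increasing. It bounds the
  gradient of \<open>G\<close> along a segment by the value at the largest norm.\<close>

lemma mult_M_mono:
  assumes "0 \<le> r" "r \<le> r'" shows "r * (M r)\<^sup>2 \<le> r' * (M r')\<^sup>2"
proof (cases "r' \<le> 1")
  case True
  then have "max 1 r = 1" "max 1 r' = 1" using assms by auto
  then show ?thesis using assms by (simp only: M_def) simp
next
  case False
  have eq: "x * (x powr (s - 1))\<^sup>2 = x powr (2 * s - 1)" if "x > 0" for x
  proof -
    have "x * (x powr (s - 1))\<^sup>2 = x powr 1 * (x powr (s - 1) * x powr (s - 1))"
      using that by (simp add: power2_eq_square)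
    also have "\<dots> = x powr (2 * s - 1)" by (simp only: powr_add[symmetric]) simp
    finally show ?thesis .
  qed
  have "r * (M r)\<^sup>2 \<le> max 1 r * (max 1 r powr (s - 1))\<^sup>2"
    unfolding M_def by (intro mult_right_mono) auto
  also have "\<dots> = max 1 r powr (2 * s - 1)" by (rule eq) simp
  also have "\<dots> \<le> r' powr (2 * s - 1)"
    using False assms s_gt by (intro powr_mono2) auto
  also have "\<dots> = r' * (M r')\<^sup>2" using False by (subst eq[symmetric]) (auto simp: M_def max_def)
  finally show ?thesis .
qed

lemma m1_differentiable: "m1 differentiable (at z)"
  and dm1_differentiable: "e \<in> Basis \<Longrightarrow> dir_deriv e m1 differentiable (at z)"
proof -
  have sm: "iter_deriv es m1 differentiable (at z)" for es using profile unfolding I_profile_def smooth_def by blast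
  show "m1 differentiable (at z)" using sm[of "[]"] by (simp add: iter_deriv_def)
  show "dir_deriv e m1 differentiable (at z)" using sm[of "[e]"] by (simp add: iter_deriv_def)
qed

lemma m1_continuous: "continuous_on UNIV m1"
  using differentiable_imp_continuous_within[OF m1_differentiable] by (simp add: continuous_on_eq_continuous_within)

lemma m1_borel [measurable]: "m1 \<in> borel_measurable borel"
  by (rule borel_measurable_continuous_onI[OF m1_continuous])

lemma Basis_2: "(1, 0) \<in> (Basis :: (real \<times> real) set)" "(0, 1) \<in> (Basis :: (real \<times> real) set)"
  by (auto simp: Basis_prod_def)

lemma symbol_bounds:
  obtains B where "0 \<le> B"
    "\<And>z h. z \<noteq> 0 \<Longrightarrow> \<bar>line_deriv m1 z h\<bar> \<le> B * m1 z / norm z * norm h"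
    "\<And>z h k. z \<noteq> 0 \<Longrightarrow> \<bar>fst h * line_deriv (dir_deriv (1, 0) m1) z k + snd h * line_deriv (dir_deriv (0, 1) m1) z k\<bar>
        \<le> B * m1 z / (norm z)\<^sup>2 * norm h * norm k"
proof -
  have bd: "\<exists>B. \<forall>\<xi>. \<xi> \<noteq> 0 \<longrightarrow> \<bar>iter_deriv es m1 \<xi>\<bar> \<le> B * m1 \<xi> / norm \<xi> ^ length es" if "set es \<subseteq> Basis" for es
    using profile that unfolding I_profile_def by blast
  let ?x = "(1, 0) :: real \<times> real" and ?y = "(0, 1) :: real \<times> real"
  have b1: "\<exists>B. \<forall>\<xi>. \<xi> \<noteq> 0 \<longrightarrow> \<bar>dir_deriv e m1 \<xi>\<bar> \<le> B * m1 \<xi> / norm \<xi>" if "e \<in> Basis" for e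
    using bd[of "[e]"] that by (simp add: iter_deriv_def)
  have b2: "\<exists>B. \<forall>\<xi>. \<xi> \<noteq> 0 \<longrightarrow> \<bar>dir_deriv e' (dir_deriv e m1) \<xi>\<bar> \<le> B * m1 \<xi> / (norm \<xi>)\<^sup>2" if "e \<in> Basis" "e' \<in> Basis" for e e'
    using bd[of "[e', e]"] that by (simp add: iter_deriv_def power2_eq_square)
  obtain X where X: "\<And>\<xi>. \<xi> \<noteq> 0 \<Longrightarrow> \<bar>dir_deriv ?x m1 \<xi>\<bar> \<le> X * m1 \<xi> / norm \<xi>" using b1[OF Basis_2(1)] by blast
  obtain Y where Y: "\<And>\<xi>. \<xi> \<noteq> 0 \<Longrightarrow> \<bar>dir_deriv ?y m1 \<xi>\<bar> \<le> Y * m1 \<xi> / norm \<xi>" using b1[OF Basis_2(2)] by blast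
  obtain XX where XX: "\<And>\<xi>. \<xi> \<noteq> 0 \<Longrightarrow> \<bar>dir_deriv ?x (dir_deriv ?x m1) \<xi>\<bar> \<le> XX * m1 \<xi> / (norm \<xi>)\<^sup>2" using b2[OF Basis_2(1,1)] by blast
  obtain XY where XY: "\<And>\<xi>. \<xi> \<noteq> 0 \<Longrightarrow> \<bar>dir_deriv ?y (dir_deriv ?x m1) \<xi>\<bar> \<le> XY * m1 \<xi> / (norm \<xi>)\<^sup>2" using b2[OF Basis_2(1,2)] by blast
  obtain YX where YX: "\<And>\<xi>. \<xi> \<noteq> 0 \<Longrightarrow> \<bar>dir_deriv ?x (dir_deriv ?y m1) \<xi>\<bar> \<le> YX * m1 \<xi> / (norm \<xi>)\<^sup>2" using b2[OF Basis_2(2,1)] by blast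
  obtain YY where YY: "\<And>\<xi>. \<xi> \<noteq> 0 \<Longrightarrow> \<bar>dir_deriv ?y (dir_deriv ?y m1) \<xi>\<bar> \<le> YY * m1 \<xi> / (norm \<xi>)\<^sup>2" using b2[OF Basis_2(2,2)] by blast
  define B0 where "B0 = \<bar>X\<bar> + \<bar>Y\<bar> + \<bar>XX\<bar> + \<bar>XY\<bar> + \<bar>YX\<bar> + \<bar>YY\<bar>"
  have B0: "0 \<le> B0" "X \<le> B0" "Y \<le> B0" "XX \<le> B0" "XY \<le> B0" "YX \<le> B0" "YY \<le> B0" by (auto simp: B0_def)
  have up: "b * m1 z / norm z ^ n \<le> B0 * m1 z / norm z ^ n" if "b \<le> B0" for b z n
    using that m1_pos[of z] by (intro divide_right_mono mult_right_mono) auto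
  have line: "\<bar>fst h * p + snd h * q\<bar> \<le> 2 * T * norm h" if "\<bar>p\<bar> \<le> T" "\<bar>q\<bar> \<le> T" for p q T and h :: "real \<times> real"
  proof -
    have "\<bar>fst h * p + snd h * q\<bar> \<le> \<bar>fst h\<bar> * \<bar>p\<bar> + \<bar>snd h\<bar> * \<bar>q\<bar>"
      using abs_triangle_ineq[of "fst h * p" "snd h * q"] by (simp add: abs_mult)
    also have "\<dots> \<le> norm h * T + norm h * T"
      using that by (intro add_mono mult_mono abs_coord_le) auto
    finally show ?thesis by simp
  qed
  show ?thesis
  \<comment> \<open>A factor 2 for each of the two sums over coordinates, as |h_1| + |h_2| <=
    2|h|.\<close>
  proof (rule that[of "4 * B0"])
    fix z h :: "real \<times> real" assume z: "z \<noteq> 0"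
    have n: "0 \<le> B0 * m1 z / norm z" using B0 m1_pos[of z] by simp
    have "\<bar>line_deriv m1 z h\<bar> \<le> 2 * (B0 * m1 z / norm z) * norm h"
      unfolding line_deriv_def using X[OF z] Y[OF z] up[OF B0(2), of z 1] up[OF B0(3), of z 1] by (intro line) auto
    also have "\<dots> \<le> 4 * (B0 * m1 z / norm z) * norm h" using n by (intro mult_right_mono) auto
    finally show "\<bar>line_deriv m1 z h\<bar> \<le> 4 * B0 * m1 z / norm z * norm h" by (simp add: mult_ac)
    fix k :: "real \<times> real"
    have x: "\<bar>line_deriv (dir_deriv ?x m1) z k\<bar> \<le> 2 * (B0 * m1 z / (norm z)\<^sup>2) * norm k"
      unfolding line_deriv_def using XX[OF z] XY[OF z] up[OF B0(4), of z 2] up[OF B0(5), of z 2] by (intro line) auto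
    have y: "\<bar>line_deriv (dir_deriv ?y m1) z k\<bar> \<le> 2 * (B0 * m1 z / (norm z)\<^sup>2) * norm k"
      unfolding line_deriv_def using YX[OF z] YY[OF z] up[OF B0(6), of z 2] up[OF B0(7), of z 2] by (intro line) auto
    have "\<bar>fst h * line_deriv (dir_deriv ?x m1) z k + snd h * line_deriv (dir_deriv ?y m1) z k\<bar>
        \<le> 2 * (2 * (B0 * m1 z / (norm z)\<^sup>2) * norm k) * norm h" by (rule line[OF x y])
    then show "\<bar>fst h * line_deriv (dir_deriv ?x m1) z k + snd h * line_deriv (dir_deriv ?y m1) z k\<bar>
        \<le> 4 * B0 * m1 z / (norm z)\<^sup>2 * norm h * norm k" by (simp add: mult_ac)
  qed (use B0 in auto)
qed

text \<open>At scale N the symbol m^2 |\<xi>|^2 equals N^2 times \<open>G\<close> at \<xi>/N, so the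
  numerator of \<open>Lambda4\<close> can be estimated for N = 1.\<close>

definition G :: "real \<times> real \<Rightarrow> real" where "G z = (m1 z)\<^sup>2 * (z \<bullet> z)"

text \<open>\<open>DG\<close> and \<open>DDG\<close> are the first and second directional
  derivatives of \<open>G\<close>, written out by the product rule.\<close>

definition DG :: "real \<times> real \<Rightarrow> real \<times> real \<Rightarrow> real" where
  "DG z h = 2 * m1 z * line_deriv m1 z h * (z \<bullet> z) + (m1 z)\<^sup>2 * (2 * (z \<bullet> h))"

definition D2 :: "real \<times> real \<Rightarrow> real \<times> real \<Rightarrow> real \<times> real \<Rightarrow> real" where
  "D2 z h k = fst h * line_deriv (dir_deriv (1, 0) m1) z k + snd h * line_deriv (dir_deriv (0, 1) m1) z k"

definition DDG :: "real \<times> real \<Rightarrow> real \<times> real \<Rightarrow> real \<times> real \<Rightarrow> real" where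
  "DDG z h k = 2 * line_deriv m1 z k * line_deriv m1 z h * (z \<bullet> z) + 2 * m1 z * D2 z h k * (z \<bullet> z)
     + 2 * m1 z * line_deriv m1 z h * (2 * (z \<bullet> k)) + 2 * m1 z * line_deriv m1 z k * (2 * (z \<bullet> h)) + (m1 z)\<^sup>2 * (2 * (k \<bullet> h))"

lemma G_line: "((\<lambda>t. G (a + t *\<^sub>R h)) has_real_derivative DG (a + t *\<^sub>R h) h) (at t)"
  unfolding G_def DG_def
  by (auto intro!: derivative_eq_intros line_deriv_has_derivative[OF m1_differentiable] inner_line_derivatives)

lemma DG_line: "((\<lambda>t. DG (a + t *\<^sub>R k) h) has_real_derivative DDG (a + t *\<^sub>R k) h k) (at t)"
proof -
  have "((\<lambda>t. line_deriv m1 (a + t *\<^sub>R k) h) has_real_derivative D2 (a + t *\<^sub>R k) h k) (at t)"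
    unfolding D2_def line_deriv_def[of m1]
    by (auto intro!: derivative_eq_intros line_deriv_has_derivative[OF dm1_differentiable] Basis_2)
  then show ?thesis
    unfolding DG_def DDG_def
    by (auto intro!: derivative_eq_intros line_deriv_has_derivative[OF m1_differentiable] inner_line_derivatives simp: algebra_simps power2_eq_square inner_commute)
qed

text \<open>Each derivative of m1 costs a factor 1/|z|, which the factors z provide. The first bound
  includes z = 0, where the term with the derivative of m1 carries the factor
  \<open>z \<bullet> z\<close>.\<close>

lemma G_derivative_bounds:
  obtains C where "0 \<le> C" "\<And>z h. \<bar>DG z h\<bar> \<le> C * ((m1 z)\<^sup>2 * norm z) * norm h"
    "\<And>z h k. z \<noteq> 0 \<Longrightarrow> \<bar>DDG z h k\<bar> \<le> C * (m1 z)\<^sup>2 * norm h * norm k"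
proof -
  obtain B where B: "0 \<le> B"
    "\<And>z h. z \<noteq> 0 \<Longrightarrow> \<bar>line_deriv m1 z h\<bar> \<le> B * m1 z / norm z * norm h"
    "\<And>z h k. z \<noteq> 0 \<Longrightarrow> \<bar>D2 z h k\<bar> \<le> B * m1 z / (norm z)\<^sup>2 * norm h * norm k"
    unfolding D2_def using symbol_bounds by metis
  \<comment> \<open>Sum of the constants of the five terms of \<open>DDG\<close>: 2 B^2, 2 B, 4 B, 4
    B and 2. It also exceeds the constant 2 B + 2 for \<open>DG\<close>.\<close>
  let ?C = "2 * B\<^sup>2 + 10 * B + 2"
  have CS: "\<bar>z \<bullet> h\<bar> \<le> norm z * norm h" for z h :: "real \<times> real" by (rule Cauchy_Schwarz_ineq2)
  have zz: "z \<bullet> z = (norm z)\<^sup>2" for z :: "real \<times> real" by (simp add: power2_norm_eq_inner)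
  show ?thesis
  proof (rule that[of ?C])
    show "0 \<le> ?C" using B(1) by simp
    fix z h :: "real \<times> real"
    have mp: "0 < m1 z" by (rule m1_pos)
    have t2: "\<bar>(m1 z)\<^sup>2 * (2 * (z \<bullet> h))\<bar> \<le> 2 * ((m1 z)\<^sup>2 * norm z * norm h)"
      using mult_left_mono[OF CS[of z h], of "(m1 z)\<^sup>2"] by (simp add: abs_mult mult_ac)
    have "\<bar>2 * m1 z * line_deriv m1 z h * (z \<bullet> z)\<bar> \<le> 2 * B * ((m1 z)\<^sup>2 * norm z * norm h)"
    proof (cases "z = 0")
      case False
      have "\<bar>2 * m1 z * line_deriv m1 z h * (z \<bullet> z)\<bar> = 2 * m1 z * \<bar>line_deriv m1 z h\<bar> * (norm z)\<^sup>2"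
        using mp by (simp add: zz abs_mult)
      also have "\<dots> \<le> 2 * m1 z * (B * m1 z / norm z * norm h) * (norm z)\<^sup>2"
        using mp by (intro mult_right_mono mult_left_mono B(2)[OF False]) auto
      also have "\<dots> = 2 * B * ((m1 z)\<^sup>2 * norm z * norm h)" using False by (simp add: power2_eq_square field_simps)
      finally show ?thesis .
    qed simp
    then have "\<bar>DG z h\<bar> \<le> 2 * B * ((m1 z)\<^sup>2 * norm z * norm h) + 2 * ((m1 z)\<^sup>2 * norm z * norm h)"
      unfolding DG_def using t2 by linarith
    also have "\<dots> = (2 * B + 2) * ((m1 z)\<^sup>2 * norm z * norm h)" by (simp add: algebra_simps)
    also have "\<dots> \<le> ?C * ((m1 z)\<^sup>2 * norm z * norm h)" using B(1) by (intro mult_right_mono) auto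
    finally show "\<bar>DG z h\<bar> \<le> ?C * ((m1 z)\<^sup>2 * norm z) * norm h" by (simp add: mult_ac)
    fix k :: "real \<times> real" assume z: "z \<noteq> 0"
    let ?T = "(m1 z)\<^sup>2 * norm h * norm k"
    have l: "\<bar>line_deriv m1 z h\<bar> * norm z \<le> B * m1 z * norm h" for h
      using mult_right_mono[OF B(2)[OF z, of h], of "norm z"] z by (simp add: field_simps)
    have "\<bar>2 * line_deriv m1 z k * line_deriv m1 z h * (z \<bullet> z)\<bar> = 2 * ((\<bar>line_deriv m1 z k\<bar> * norm z) * (\<bar>line_deriv m1 z h\<bar> * norm z))"
      by (simp add: zz abs_mult power2_eq_square)
    also have "\<dots> \<le> 2 * ((B * m1 z * norm k) * (B * m1 z * norm h))"
      using B(1) mp by (intro mult_left_mono mult_mono l) auto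
    finally have s1: "\<bar>2 * line_deriv m1 z k * line_deriv m1 z h * (z \<bullet> z)\<bar> \<le> 2 * B\<^sup>2 * ?T"
      by (simp add: power2_eq_square mult_ac)
    have "\<bar>2 * m1 z * D2 z h k * (z \<bullet> z)\<bar> = 2 * m1 z * \<bar>D2 z h k\<bar> * (norm z)\<^sup>2"
      using mp by (simp add: zz abs_mult)
    also have "\<dots> \<le> 2 * m1 z * (B * m1 z / (norm z)\<^sup>2 * norm h * norm k) * (norm z)\<^sup>2"
      using mp by (intro mult_right_mono mult_left_mono B(3)[OF z]) auto
    also have "\<dots> = 2 * B * ?T" using z by (simp add: power2_eq_square field_simps)
    finally have s2: "\<bar>2 * m1 z * D2 z h k * (z \<bullet> z)\<bar> \<le> 2 * B * ?T" .
    have cross: "\<bar>2 * m1 z * line_deriv m1 z h * (2 * (z \<bullet> k))\<bar> \<le> 4 * B * ((m1 z)\<^sup>2 * norm h * norm k)" for h k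
    proof -
      have "\<bar>2 * m1 z * line_deriv m1 z h * (2 * (z \<bullet> k))\<bar> = 4 * m1 z * (\<bar>line_deriv m1 z h\<bar> * \<bar>z \<bullet> k\<bar>)"
        using mp by (simp add: abs_mult)
      also have "\<dots> \<le> 4 * m1 z * (\<bar>line_deriv m1 z h\<bar> * (norm z * norm k))"
        using mp by (intro mult_left_mono CS) auto
      also have "\<dots> = 4 * m1 z * norm k * (\<bar>line_deriv m1 z h\<bar> * norm z)" by simp
      also have "\<dots> \<le> 4 * m1 z * norm k * (B * m1 z * norm h)"
        using mp by (intro mult_left_mono l) auto
      finally show ?thesis by (simp add: power2_eq_square mult_ac)
    qed
    have s5: "\<bar>(m1 z)\<^sup>2 * (2 * (k \<bullet> h))\<bar> \<le> 2 * ?T"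
      using mult_left_mono[OF CS[of k h], of "(m1 z)\<^sup>2"] by (simp add: abs_mult mult_ac)
    have "\<bar>DDG z h k\<bar> \<le> 2 * B\<^sup>2 * ?T + 2 * B * ?T + 4 * B * ?T + 4 * B * ?T + 2 * ?T"
      unfolding DDG_def using s1 s2 cross[of h k] cross[of k h] s5
      by (simp only: mult.assoc mult.commute[of "norm k" "norm h"])
    also have "\<dots> = ?C * ?T" by (simp add: algebra_simps)
    finally show "\<bar>DDG z h k\<bar> \<le> ?C * (m1 z)\<^sup>2 * norm h * norm k" by (simp only: mult.assoc)
  qed
qed

text \<open>Evenness turns the arguments z_2 and z_4 into -z_2 and -z_4, which form a parallelogram
  with z_1 and z_3.\<close>

lemma G_minus: "G (- z) = G z"
  using m1_cong[of "- z" z] by (simp add: G_def)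

text \<open>
  The expression is a second difference of the even function \<open>G\<close> with steps \<open>z\<^sub>1 + z\<^sub>2\<close> and \<open>z\<^sub>1 + z\<^sub>4\<close>. If one of the
  steps is at least \<open>R/8\<close>, the first-order mean value theorem suffices. Otherwise the parallelogram
  stays away from \<open>0\<close>, where the second derivative is controlled.
\<close>

lemma G_numerator_bound:
  obtains C where "0 \<le> C"
    "\<And>z1 z2 z3 z4 R. z1 + z2 + z3 + z4 = 0 \<Longrightarrow> R = Max {norm z1, norm z2, norm z3, norm z4} \<Longrightarrow>
       \<bar>G z1 - G z2 + G z3 - G z4\<bar> \<le> C * (M R)\<^sup>2 * (norm (z1 + z2) * norm (z1 + z4))"
proof -
  obtain C where C: "0 \<le> C" "\<And>z h. \<bar>DG z h\<bar> \<le> C * ((m1 z)\<^sup>2 * norm z) * norm h"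
    "\<And>z h k. z \<noteq> 0 \<Longrightarrow> \<bar>DDG z h k\<bar> \<le> C * (m1 z)\<^sup>2 * norm h * norm k"
    using G_derivative_bounds by metis
  \<comment> \<open>The segment from a to -b stays in the ball of radius R; 4 is the square of the
    factor between m1 and \<open>M\<close>.\<close>
  have first: "\<bar>G a - G b\<bar> \<le> 4 * C * (R * (M R)\<^sup>2) * norm (a + b)" if ab: "norm a \<le> R" "norm b \<le> R" for a b R
  proof -
    let ?h = "- b - a"
    obtain t where t: "0 < t" "t < 1" "G (a + 1 *\<^sub>R ?h) - G (a + 0 *\<^sub>R ?h) = (1 - 0) * DG (a + t *\<^sub>R ?h) ?h"
      using MVT2[of 0 1 "\<lambda>t. G (a + t *\<^sub>R ?h)" "\<lambda>t. DG (a + t *\<^sub>R ?h) ?h"] G_line by auto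
    let ?z = "a + t *\<^sub>R ?h"
    have "?z = (1 - t) *\<^sub>R a + t *\<^sub>R (- b)" by (simp add: algebra_simps)
    also have "norm \<dots> \<le> (1 - t) * norm a + t * norm b"
      using norm_triangle_ineq[of "(1 - t) *\<^sub>R a" "t *\<^sub>R (- b)"] t by simp
    also have "\<dots> \<le> (1 - t) * R + t * R" using t ab by (intro add_mono mult_left_mono) auto
    finally have zR: "norm ?z \<le> R" by (simp add: algebra_simps)
    have "(m1 ?z)\<^sup>2 * norm ?z \<le> (2 * M (norm ?z))\<^sup>2 * norm ?z"
      using m1_le_M[of ?z] m1_pos[of ?z] by (intro mult_right_mono power_mono) auto
    also have "\<dots> = 4 * (norm ?z * (M (norm ?z))\<^sup>2)" by (simp add: power_mult_distrib)
    also have "\<dots> \<le> 4 * (R * (M R)\<^sup>2)" using zR by (intro mult_left_mono mult_M_mono) auto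
    finally have k: "(m1 ?z)\<^sup>2 * norm ?z \<le> 4 * (R * (M R)\<^sup>2)" .
    have "\<bar>G a - G b\<bar> = \<bar>DG ?z ?h\<bar>" using t(3) by (simp add: G_minus)
    also have "\<dots> \<le> C * ((m1 ?z)\<^sup>2 * norm ?z) * norm ?h" by (rule C(2))
    also have "\<dots> \<le> C * (4 * (R * (M R)\<^sup>2)) * norm ?h"
      using C(1) k by (intro mult_right_mono mult_left_mono) auto
    also have "norm ?h = norm (a + b)" by (metis add_uminus_conv_diff minus_add norm_minus_cancel)
    finally show ?thesis by simp
  qed
  \<comment> \<open>Here 16 is 4^2, with one factor 2 from comparing m1 with \<open>M\<close> and
    one from M (R/2) <= 2 M R.\<close>
  have second: "\<bar>G a - G (a + h) + G (a + h + k) - G (a + k)\<bar> \<le> 16 * C * (M R)\<^sup>2 * norm h * norm k"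
    if R: "0 < R" and far: "\<And>\<sigma> \<tau>. 0 \<le> \<sigma> \<Longrightarrow> \<sigma> \<le> 1 \<Longrightarrow> 0 \<le> \<tau> \<Longrightarrow> \<tau> \<le> 1 \<Longrightarrow> R / 2 \<le> norm (a + \<sigma> *\<^sub>R h + \<tau> *\<^sub>R k)" for a h k R
  proof -
    obtain t where t: "0 < t" "t < 1" "(G (a + 1 *\<^sub>R h) - G ((a + k) + 1 *\<^sub>R h)) - (G (a + 0 *\<^sub>R h) - G ((a + k) + 0 *\<^sub>R h))
        = (1 - 0) * (DG (a + t *\<^sub>R h) h - DG ((a + k) + t *\<^sub>R h) h)"
      using MVT2[of 0 1 "\<lambda>t. G (a + t *\<^sub>R h) - G ((a + k) + t *\<^sub>R h)" "\<lambda>t. DG (a + t *\<^sub>R h) h - DG ((a + k) + t *\<^sub>R h) h"]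
        DERIV_diff[OF G_line G_line] by auto
    let ?b = "a + t *\<^sub>R h"
    obtain u where u: "0 < u" "u < 1" "DG (?b + 1 *\<^sub>R k) h - DG (?b + 0 *\<^sub>R k) h = (1 - 0) * DDG (?b + u *\<^sub>R k) h k"
      using MVT2[of 0 1 "\<lambda>t. DG (?b + t *\<^sub>R k) h" "\<lambda>t. DDG (?b + t *\<^sub>R k) h k"] DG_line by auto
    let ?z = "?b + u *\<^sub>R k"
    have zR: "R / 2 \<le> norm ?z" using t u by (intro far) auto
    then have z0: "?z \<noteq> 0" using R by auto
    have "m1 ?z \<le> 2 * M (norm ?z)" by (rule m1_le_M)
    also have "\<dots> \<le> 2 * M (R / 2)" using M_antimono[OF zR] by simp
    also have "\<dots> \<le> 4 * M R" using M_divide[of 2 R] by simp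
    finally have "(m1 ?z)\<^sup>2 \<le> (4 * M R)\<^sup>2" using m1_pos[of ?z] by (intro power_mono) auto
    then have mm: "(m1 ?z)\<^sup>2 \<le> 16 * (M R)\<^sup>2" by (simp add: power_mult_distrib)
    have "G a - G (a + h) + G (a + h + k) - G (a + k) = DDG ?z h k"
    proof -
      have e: "?b + k = (a + k) + t *\<^sub>R h" "a + h + k = a + k + h" by (simp_all add: algebra_simps)
      have "G (a + h) - G (a + k + h) - (G a - G (a + k)) = DG ?b h - DG ((a + k) + t *\<^sub>R h) h" using t(3) by simp
      moreover have "DG ((a + k) + t *\<^sub>R h) h - DG ?b h = DDG ?z h k" using u(3) unfolding e(1)[symmetric] by simp
      ultimately show ?thesis unfolding e(2) by linarith
    qed
    also have "\<bar>DDG ?z h k\<bar> \<le> C * (m1 ?z)\<^sup>2 * norm h * norm k" by (rule C(3)[OF z0])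
    also have "\<dots> \<le> C * (16 * (M R)\<^sup>2) * norm h * norm k"
      using C(1) mm by (intro mult_right_mono mult_left_mono) auto
    finally show ?thesis by (simp add: mult_ac)
  qed
  show ?thesis
  \<comment> \<open>Two first-order terms give 8 C R, and R <= 8|k| or R <= 8|h| turns this into 64
    C.\<close>
  proof (rule that[of "64 * C"])
    show "0 \<le> 64 * C" using C(1) by simp
    fix z1 z2 z3 z4 :: "real \<times> real" and R
    assume sum: "z1 + z2 + z3 + z4 = 0" and R: "R = Max {norm z1, norm z2, norm z3, norm z4}"
    let ?h = "z1 + z2" and ?k = "z1 + z4"
    have le: "norm z1 \<le> R" "norm z2 \<le> R" "norm z3 \<le> R" "norm z4 \<le> R" by (auto simp: R)
    have R0: "0 \<le> R" using le(1) norm_ge_zero order_trans by blast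
    have h': "norm (z3 + z4) = norm ?h"
    proof -
      have "z3 + z4 = - ?h" using sum by (metis add.assoc add_eq_0_iff)
      then show ?thesis by (simp only: norm_minus_cancel)
    qed
    have k': "norm (z3 + z2) = norm ?k"
    proof -
      have "(z3 + z2) + ?k = 0" using sum by (simp add: add_ac)
      then have "z3 + z2 = - ?k" by (simp only: eq_neg_iff_add_eq_0)
      then show ?thesis by (simp only: norm_minus_cancel)
    qed
    consider "R / 8 \<le> norm ?k" | "R / 8 \<le> norm ?h" | "norm ?h < R / 8" "norm ?k < R / 8" by linarith
    then show "\<bar>G z1 - G z2 + G z3 - G z4\<bar> \<le> 64 * C * (M R)\<^sup>2 * (norm ?h * norm ?k)"
    proof cases
      case 1
      have "\<bar>G z1 - G z2 + G z3 - G z4\<bar> \<le> \<bar>G z1 - G z2\<bar> + \<bar>G z3 - G z4\<bar>" by linarith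
      also have "\<dots> \<le> 4 * C * (R * (M R)\<^sup>2) * norm ?h + 4 * C * (R * (M R)\<^sup>2) * norm ?h"
        using first[OF le(1,2)] first[OF le(3,4)] by (simp only: h')
      also have "\<dots> = 64 * C * (M R)\<^sup>2 * (norm ?h * (R / 8))" by simp
      also have "\<dots> \<le> 64 * C * (M R)\<^sup>2 * (norm ?h * norm ?k)"
        using 1 C(1) by (intro mult_left_mono) auto
      finally show ?thesis .
    next
      case 2
      have "\<bar>G z1 - G z2 + G z3 - G z4\<bar> \<le> \<bar>G z1 - G z4\<bar> + \<bar>G z3 - G z2\<bar>" by linarith
      also have "\<dots> \<le> 4 * C * (R * (M R)\<^sup>2) * norm ?k + 4 * C * (R * (M R)\<^sup>2) * norm ?k"
        using first[OF le(1,4)] first[OF le(3,2)] by (simp only: k')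
      also have "\<dots> = 64 * C * (M R)\<^sup>2 * ((R / 8) * norm ?k)" by simp
      also have "\<dots> \<le> 64 * C * (M R)\<^sup>2 * (norm ?h * norm ?k)"
        using 2 C(1) by (intro mult_left_mono mult_right_mono) auto
      finally show ?thesis .
    next
      case 3
      have Rp: "0 < R" using 3 norm_ge_zero[of ?h] by linarith
      have "z3 - (z1 - ?h - ?k) = z1 + z2 + z3 + z4" by (simp add: algebra_simps)
      then have z3: "z3 = z1 - ?h - ?k" unfolding sum by simp
      have close: "norm w - R / 4 \<le> norm p" if "norm (w - p) \<le> norm ?h + norm ?k" for w p :: "real \<times> real"
        using norm_triangle_ineq2[of w p] that 3 by linarith
      have sc: "norm (\<alpha> *\<^sub>R ?h + \<beta> *\<^sub>R ?k) \<le> norm ?h + norm ?k" if "\<bar>\<alpha>\<bar> \<le> 1" "\<bar>\<beta>\<bar> \<le> 1" for \<alpha> \<beta>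
      proof -
        have "norm (\<alpha> *\<^sub>R ?h + \<beta> *\<^sub>R ?k) \<le> \<bar>\<alpha>\<bar> * norm ?h + \<bar>\<beta>\<bar> * norm ?k"
          using norm_triangle_ineq[of "\<alpha> *\<^sub>R ?h" "\<beta> *\<^sub>R ?k"] by simp
        also have "\<dots> \<le> 1 * norm ?h + 1 * norm ?k" using that by (intro add_mono mult_right_mono) auto
        finally show ?thesis by simp
      qed
      \<comment> \<open>Every point of the parallelogram is within |h| + |k| < R/4 of each of its
        vertices z_1, -z_2, -z_4, z_3, one of which has norm R.\<close>
      have far: "R / 2 \<le> norm (z1 + \<sigma> *\<^sub>R (- ?h) + \<tau> *\<^sub>R (- ?k))" (is "_ \<le> norm ?p")
        if st: "0 \<le> \<sigma>" "\<sigma> \<le> 1" "0 \<le> \<tau>" "\<tau> \<le> 1" for \<sigma> \<tau>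
      proof -
        have "norm z1 - R / 4 \<le> norm ?p"
        proof (rule close)
          have "z1 - ?p = \<sigma> *\<^sub>R ?h + \<tau> *\<^sub>R ?k" by (simp add: algebra_simps)
          then show "norm (z1 - ?p) \<le> norm ?h + norm ?k" using sc[of \<sigma> \<tau>] st by simp
        qed
        moreover have "norm (- z2) - R / 4 \<le> norm ?p"
        proof (rule close)
          have "- z2 - ?p = (\<sigma> - 1) *\<^sub>R ?h + \<tau> *\<^sub>R ?k" by (simp add: algebra_simps)
          then show "norm (- z2 - ?p) \<le> norm ?h + norm ?k" using sc[of "\<sigma> - 1" \<tau>] st by simp
        qed
        moreover have "norm (- z4) - R / 4 \<le> norm ?p"
        proof (rule close)
          have "- z4 - ?p = \<sigma> *\<^sub>R ?h + (\<tau> - 1) *\<^sub>R ?k" by (simp add: algebra_simps)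
          then show "norm (- z4 - ?p) \<le> norm ?h + norm ?k" using sc[of \<sigma> "\<tau> - 1"] st by simp
        qed
        moreover have "norm z3 - R / 4 \<le> norm ?p"
        proof (rule close)
          have "z3 - ?p = (\<sigma> - 1) *\<^sub>R ?h + (\<tau> - 1) *\<^sub>R ?k" unfolding z3 by (simp add: algebra_simps)
          then show "norm (z3 - ?p) \<le> norm ?h + norm ?k" using sc[of "\<sigma> - 1" "\<tau> - 1"] st by simp
        qed
        moreover have "R = norm z1 \<or> R = norm z2 \<or> R = norm z3 \<or> R = norm z4"
          using Max_in[of "{norm z1, norm z2, norm z3, norm z4}"] by (auto simp: R[symmetric])
        ultimately show ?thesis using Rp unfolding norm_minus_cancel by (elim disjE; linarith)
      qed
      have "\<bar>G z1 - G (z1 + - ?h) + G (z1 + - ?h + - ?k) - G (z1 + - ?k)\<bar> \<le> 16 * C * (M R)\<^sup>2 * norm (- ?h) * norm (- ?k)"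
        by (rule second[OF Rp far])
      moreover have "z1 + - ?h = - z2" "z1 + - ?k = - z4" "z1 + - ?h + - ?k = z3" unfolding z3 by simp_all
      ultimately have "\<bar>G z1 - G z2 + G z3 - G z4\<bar> \<le> 16 * C * (M R)\<^sup>2 * (norm ?h * norm ?k)"
        by (simp only: G_minus norm_minus_cancel mult.assoc)
      also have "\<dots> \<le> 64 * C * (M R)\<^sup>2 * (norm ?h * norm ?k)"
        using C(1) by (intro mult_right_mono) auto
      finally show ?thesis .
    qed
  qed
qed

end

section \<open>The kernel bound\<close>

definition bracket :: "real \<times> real \<Rightarrow> real" where "bracket \<xi> = sqrt (1 + (norm \<xi>)\<^sup>2)"

lemma bracket_ge_1: "1 \<le> bracket \<xi>" by (simp add: bracket_def)

lemma bracket_pos: "0 < bracket \<xi>" using bracket_ge_1[of \<xi>] by linarith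

lemma norm_le_bracket: "norm \<xi> \<le> bracket \<xi>"
  unfolding bracket_def by (rule real_le_rsqrt) simp

lemma bracket_le: "bracket \<xi> \<le> 1 + norm \<xi>"
  unfolding bracket_def by (rule real_le_lsqrt) (auto simp: power2_sum)

lemma bracket_minus: "bracket (- \<xi>) = bracket \<xi>" by (simp add: bracket_def)

lemma bracket_borel [measurable]: "bracket \<in> borel_measurable borel"
  unfolding bracket_def[abs_def] by measurable

text \<open>For e > 0 the exponent is just beyond -1, the borderline for square-integrability in two
  dimensions.\<close>

definition weight :: "real \<Rightarrow> real \<times> real \<Rightarrow> real" where "weight e \<xi> = bracket \<xi> powr (- 1 - e)"

lemma weight_nonneg: "0 \<le> weight e \<xi>" by (simp add: weight_def)

lemma weight_borel [measurable]: "weight e \<in> borel_measurable borel"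
  unfolding weight_def[abs_def] by measurable

lemma bracket_weight: "bracket \<xi> * weight e \<xi> = bracket \<xi> powr (- e)"
proof -
  have "bracket \<xi> * weight e \<xi> = bracket \<xi> powr 1 * bracket \<xi> powr (- 1 - e)" using bracket_pos[of \<xi>] by (simp add: weight_def)
  also have "\<dots> = bracket \<xi> powr (- e)" by (simp only: powr_add[symmetric]) simp
  finally show ?thesis .
qed

text \<open>
  In \<open>kernel_bound\<close> the weights fall on the two frequencies other than a pair of large ones; summing over all
  pairs makes the bound independent of which pair is large.
\<close>

definition pair_weights :: "real \<Rightarrow> real \<times> real \<Rightarrow> real \<times> real \<Rightarrow> real \<times> real \<Rightarrow> real \<times> real \<Rightarrow> real" where
  "pair_weights e z1 z2 z3 z4 = weight e z1 * weight e z2 + weight e z1 * weight e z3 + weight e z1 * weight e z4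
     + weight e z2 * weight e z3 + weight e z2 * weight e z4 + weight e z3 * weight e z4"

text \<open>By symmetry a half line suffices; there (1 + x)^2 <= 2 (1 + x^2) reduces the integrand
  to (1 + x)^(-1-e), which has an explicit primitive.\<close>

lemma nn_integral_bracket_finite:
  assumes e: "0 < e"
  shows "(\<integral>\<^sup>+x. ennreal ((1 + x\<^sup>2) powr (- ((1 + e) / 2))) \<partial>lborel) < \<infinity>"
proof -
  let ?p = "(1 + e) / 2"
  let ?g = "\<lambda>x::real. ennreal ((1 + x\<^sup>2) powr (- ?p))"
  have "(\<integral>\<^sup>+x. ennreal ((1 + x) powr (- 1 - e)) * indicator {0..} x \<partial>lborel) = ennreal (0 - (- ((1 + 0) powr (- e)) / e))"
  proof (rule nn_integral_FTC_atLeast)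
    show "DERIV (\<lambda>x. - ((1 + x) powr (- e)) / e) x :> (1 + x) powr (- 1 - e)" if "0 \<le> x" for x
      using that e by (auto intro!: derivative_eq_intros simp: minus_diff_commute)
    have "((\<lambda>x. (1 + x) powr (- e)) \<longlongrightarrow> 0) at_top"
      using e by (intro tendsto_neg_powr filterlim_tendsto_add_at_top[OF tendsto_const filterlim_ident]) auto
    from tendsto_divide[OF tendsto_minus[OF this] tendsto_const[of e]]
    show "((\<lambda>x. - ((1 + x) powr (- e)) / e) \<longlongrightarrow> 0) at_top" using e by simp
  qed auto
  then have half: "(\<integral>\<^sup>+x. ennreal ((1 + x) powr (- 1 - e)) * indicator {0..} x \<partial>lborel) < \<infinity>" by simp
  have pt: "(1 + x\<^sup>2) powr (- ?p) \<le> 2 powr ?p * (1 + x) powr (- 1 - e)" if x: "0 \<le> x" for x :: real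
  proof -
    have "(1 + x)\<^sup>2 \<le> 2 * (1 + x\<^sup>2)" using sum_squares_bound[of 1 x] by (simp add: power2_sum)
    then have "(2 * (1 + x\<^sup>2)) powr (- ?p) \<le> ((1 + x)\<^sup>2) powr (- ?p)"
      using x e by (intro powr_mono2') auto
    also have "((1 + x)\<^sup>2) powr (- ?p) = (1 + x) powr (- 1 - e)"
    proof -
      have "((1 + x)\<^sup>2) powr (- ?p) = ((1 + x) powr 2) powr (- ?p)" using x by simp
      also have "\<dots> = (1 + x) powr (2 * (- ?p))" by (rule powr_powr)
      also have "2 * (- ?p) = - 1 - e" by (simp add: field_simps)
      finally show ?thesis .
    qed
    also have "(2 * (1 + x\<^sup>2)) powr (- ?p) = 2 powr (- ?p) * (1 + x\<^sup>2) powr (- ?p)"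
      by (rule powr_mult)
    finally have "2 powr ?p * (2 powr (- ?p) * (1 + x\<^sup>2) powr (- ?p)) \<le> 2 powr ?p * (1 + x) powr (- 1 - e)"
      by (rule mult_left_mono) simp
    then show ?thesis by (simp add: powr_minus field_simps)
  qed
  have pos: "(\<integral>\<^sup>+x. ?g x * indicator {0..} x \<partial>lborel) < \<infinity>"
  proof -
    have "(\<integral>\<^sup>+x. ?g x * indicator {0..} x \<partial>lborel) \<le> (\<integral>\<^sup>+x. ennreal (2 powr ?p) * (ennreal ((1 + x) powr (- 1 - e)) * indicator {0..} x) \<partial>lborel)"
      using pt by (intro nn_integral_mono) (auto simp: indicator_def ennreal_mult[symmetric] intro!: ennreal_leI)
    also have "\<dots> = ennreal (2 powr ?p) * (\<integral>\<^sup>+x. ennreal ((1 + x) powr (- 1 - e)) * indicator {0..} x \<partial>lborel)"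
      by (rule nn_integral_cmult) measurable
    also have "\<dots> < \<infinity>" using half by (simp add: ennreal_mult_less_top)
    finally show ?thesis .
  qed
  have neg: "(\<integral>\<^sup>+x. ?g x * indicator {..0} x \<partial>lborel) < \<infinity>"
  proof -
    have "(\<integral>\<^sup>+x. ?g x * indicator {..0} x \<partial>lborel) = (\<integral>\<^sup>+x. ?g x * indicator {0..} x \<partial>lborel)"
      by (subst nn_integral_real_affine[of _ "-1" 0]) (auto simp: indicator_def intro!: nn_integral_cong)
    then show ?thesis using pos by simp
  qed
  have "(\<integral>\<^sup>+x. ?g x \<partial>lborel) \<le> (\<integral>\<^sup>+x. ?g x * indicator {0..} x + ?g x * indicator {..0} x \<partial>lborel)"
    by (intro nn_integral_mono) (auto simp: indicator_def)
  also have "\<dots> = (\<integral>\<^sup>+x. ?g x * indicator {0..} x \<partial>lborel) + (\<integral>\<^sup>+x. ?g x * indicator {..0} x \<partial>lborel)"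
    by (rule nn_integral_add) auto
  also have "\<dots> < \<infinity>" using pos neg by simp
  finally show ?thesis .
qed

text \<open>The sample at y = k/\<lambda> is compared with the values at \<theta> + y for 0 <=
  \<theta> < 1/\<lambda> <= 1: as 1 + (\<theta> + y)^2 <= 3 (1 + y^2), the loss is a fixed power of
  3. Integrating over \<theta> and periodising gives the integral, uniformly in \<lambda> >=
  1.\<close>

lemma riemann_sum_bracket_le:
  assumes e: "0 < e" and lam: "1 \<le> lam"
  shows "ennreal (1 / lam) * (\<integral>\<^sup>+k. ennreal ((1 + (of_int k / lam)\<^sup>2) powr (- ((1 + e) / 2))) \<partial>count_space (UNIV :: int set))
    \<le> ennreal (3 powr ((1 + e) / 2)) * (\<integral>\<^sup>+x. ennreal ((1 + x\<^sup>2) powr (- ((1 + e) / 2))) \<partial>lborel)"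
proof -
  let ?p = "(1 + e) / 2"
  let ?g = "\<lambda>x::real. ennreal ((1 + x\<^sup>2) powr (- ?p))"
  have pt: "?g y \<le> ennreal (3 powr ?p) * ?g (t + y)" if t: "0 \<le> t" "t < 1" for t y
  proof -
    have "2 * (t * y) \<le> t\<^sup>2 + y\<^sup>2" using sum_squares_bound[of t y] by simp
    moreover have "t\<^sup>2 \<le> 1" using t by (simp add: power_le_one)
    ultimately have "1 + (t + y)\<^sup>2 \<le> 3 * (1 + y\<^sup>2)" using zero_le_power2[of y] unfolding power2_sum mult.assoc by argo
    then have "(3 * (1 + y\<^sup>2)) powr (- ?p) \<le> (1 + (t + y)\<^sup>2) powr (- ?p)"
      using e by (intro powr_mono2') (auto simp: add_pos_nonneg)
    moreover have "(3 * (1 + y\<^sup>2)) powr (- ?p) = 3 powr (- ?p) * (1 + y\<^sup>2) powr (- ?p)" by (rule powr_mult)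
    ultimately have "3 powr ?p * (3 powr (- ?p) * (1 + y\<^sup>2) powr (- ?p)) \<le> 3 powr ?p * (1 + (t + y)\<^sup>2) powr (- ?p)"
      by (intro mult_left_mono) auto
    then have "(1 + y\<^sup>2) powr (- ?p) \<le> 3 powr ?p * (1 + (t + y)\<^sup>2) powr (- ?p)" by (simp add: powr_minus field_simps)
    then show ?thesis by (simp add: ennreal_mult[symmetric] ennreal_leI)
  qed
  have "ennreal (1 / lam) * (\<integral>\<^sup>+k. ?g (of_int k / lam) \<partial>count_space (UNIV :: int set))
      = (\<integral>\<^sup>+\<theta>. (\<integral>\<^sup>+k. ?g (of_int k / lam) \<partial>count_space (UNIV :: int set)) * indicator {0..<1 / lam} \<theta> \<partial>lborel)"
    using lam by (subst nn_integral_cmult) (auto simp: mult.commute)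
  also have "\<dots> \<le> (\<integral>\<^sup>+\<theta>. (\<integral>\<^sup>+k. ennreal (3 powr ?p) * ?g (\<theta> + of_int k * (1 / lam)) \<partial>count_space (UNIV :: int set)) * indicator {0..<1 / lam} \<theta> \<partial>lborel)"
  proof (rule nn_integral_mono)
    fix \<theta>
    show "(\<integral>\<^sup>+k. ?g (of_int k / lam) \<partial>count_space (UNIV :: int set)) * indicator {0..<1 / lam} \<theta>
        \<le> (\<integral>\<^sup>+k. ennreal (3 powr ?p) * ?g (\<theta> + of_int k * (1 / lam)) \<partial>count_space (UNIV :: int set)) * indicator {0..<1 / lam} \<theta>"
    proof (cases "\<theta> \<in> {0..<1 / lam}")
      case True
      have "1 / lam \<le> 1" using lam by simp
      then have "0 \<le> \<theta>" "\<theta> < 1" using True by auto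
      then have "?g (of_int k / lam) \<le> ennreal (3 powr ?p) * ?g (\<theta> + of_int k * (1 / lam))" for k :: int
        using pt[of \<theta> "of_int k / lam"] by simp
      then show ?thesis by (intro mult_right_mono nn_integral_mono) auto
    qed simp
  qed
  also have "\<dots> = (\<integral>\<^sup>+x. ennreal (3 powr ?p) * ?g x \<partial>lborel)"
    by (rule nn_integral_periodize[symmetric]) (use lam in auto)
  also have "\<dots> = ennreal (3 powr ?p) * (\<integral>\<^sup>+x. ?g x \<partial>lborel)"
    by (rule nn_integral_cmult) measurable
  finally show ?thesis .
qed

text \<open>The squared weight (1 + x^2 + y^2)^(-1-e) spends half of its decay on each variable,
  which leaves a product of two integrable functions. The sum over the grid in y is bounded by the
  integral with a constant free of \<lambda>.\<close>

lemma weight_square_bound: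
  assumes e: "0 < e"
  obtains W where "0 \<le> W" "\<And>lam. 1 \<le> lam \<Longrightarrow> (\<integral>\<^sup>+\<xi>. (ennreal (weight e \<xi>))\<^sup>2 \<partial>dxi lam) \<le> ennreal (W\<^sup>2)"
proof -
  let ?p = "(1 + e) / 2"
  let ?g = "\<lambda>x::real. ennreal ((1 + x\<^sup>2) powr (- ?p))"
  let ?I = "\<integral>\<^sup>+x. ?g x \<partial>lborel"
  have "?I * (ennreal (3 powr ?p) * ?I) < \<infinity>" using nn_integral_bracket_finite[OF e] by (simp add: ennreal_mult_less_top)
  then obtain V where V: "0 \<le> V" "?I * (ennreal (3 powr ?p) * ?I) = ennreal V"
    by (cases "?I * (ennreal (3 powr ?p) * ?I)") auto
  show ?thesis
  proof (rule that[of "sqrt V"])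
    show "0 \<le> sqrt V" using V(1) by simp
    fix lam :: real assume lam: "1 \<le> lam"
    interpret cylinder lam by standard (use lam in simp)
    have pt: "(ennreal (weight e (x, y)))\<^sup>2 \<le> ?g x * ?g y" for x y
    proof -
      have n: "(norm (x, y))\<^sup>2 = x\<^sup>2 + y\<^sup>2" by (simp add: norm_Pair)
      have "(weight e (x, y))\<^sup>2 = (1 + (x\<^sup>2 + y\<^sup>2)) powr (- 1 - e)"
      proof -
        have "0 < weight e (x, y)" using bracket_pos[of "(x, y)"] by (simp add: weight_def)
        then have "(weight e (x, y))\<^sup>2 = weight e (x, y) powr 2" by simp
        also have "\<dots> = ((1 + (x\<^sup>2 + y\<^sup>2)) powr (1 / 2)) powr ((- 1 - e) * 2)"
          unfolding weight_def bracket_def n by (subst powr_half_sqrt[symmetric]) (auto simp: powr_powr)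
        also have "\<dots> = (1 + (x\<^sup>2 + y\<^sup>2)) powr (1 / 2 * ((- 1 - e) * 2))" by (rule powr_powr)
        also have "1 / 2 * ((- 1 - e) * 2) = - 1 - e" by simp
        finally show ?thesis .
      qed
      also have "\<dots> = (1 + (x\<^sup>2 + y\<^sup>2)) powr (- ?p) * (1 + (x\<^sup>2 + y\<^sup>2)) powr (- ?p)"
      proof -
        have "- ?p + - ?p = - 1 - e" by (simp add: field_simps)
        then show ?thesis by (simp only: powr_add[symmetric])
      qed
      also have "\<dots> \<le> (1 + x\<^sup>2) powr (- ?p) * (1 + y\<^sup>2) powr (- ?p)"
        using e by (intro mult_mono powr_mono2') (auto simp: add_pos_nonneg)
      finally show ?thesis by (simp add: ennreal_power weight_nonneg ennreal_mult[symmetric] ennreal_leI)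
    qed
    have "(\<integral>\<^sup>+\<xi>. (ennreal (weight e \<xi>))\<^sup>2 \<partial>dxi lam) \<le> (\<integral>\<^sup>+\<xi>. ?g (fst \<xi>) * ?g (snd \<xi>) \<partial>dxi lam)"
      using pt by (intro nn_integral_mono) (auto split: prod.split)
    also have "\<dots> = (\<integral>\<^sup>+\<mu>. ennreal (1 / lam) * (\<integral>\<^sup>+k. ?g \<mu> * ?g (of_int k / lam) \<partial>count_space (UNIV :: int set)) \<partial>lborel)"
      by (subst nn_integral_dxi) auto
    also have "\<dots> = (\<integral>\<^sup>+\<mu>. ?g \<mu> * (ennreal (1 / lam) * (\<integral>\<^sup>+k. ?g (of_int k / lam) \<partial>count_space (UNIV :: int set))) \<partial>lborel)"
      by (simp add: nn_integral_cmult mult_ac)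
    also have "\<dots> = ?I * (ennreal (1 / lam) * (\<integral>\<^sup>+k. ?g (of_int k / lam) \<partial>count_space (UNIV :: int set)))"
      by (rule nn_integral_multc) measurable
    also have "\<dots> \<le> ?I * (ennreal (3 powr ?p) * ?I)"
      by (intro mult_left_mono riemann_sum_bracket_le e lam) auto
    also have "\<dots> = ennreal ((sqrt V)\<^sup>2)" using V by simp
    finally show "(\<integral>\<^sup>+\<xi>. (ennreal (weight e \<xi>))\<^sup>2 \<partial>dxi lam) \<le> ennreal ((sqrt V)\<^sup>2)" .
  qed
qed

text \<open>The largest vector is minus the sum of the other three, so one of those has at least a
  third of its norm.\<close>

lemma two_large:
  fixes z1 z2 z3 z4 :: "'a :: real_normed_vector"
  assumes sum: "z1 + z2 + z3 + z4 = 0" and R: "R = Max {norm z1, norm z2, norm z3, norm z4}"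
  shows "(R / 3 \<le> norm z1 \<and> R / 3 \<le> norm z2) \<or> (R / 3 \<le> norm z1 \<and> R / 3 \<le> norm z3) \<or> (R / 3 \<le> norm z1 \<and> R / 3 \<le> norm z4)
    \<or> (R / 3 \<le> norm z2 \<and> R / 3 \<le> norm z3) \<or> (R / 3 \<le> norm z2 \<and> R / 3 \<le> norm z4) \<or> (R / 3 \<le> norm z3 \<and> R / 3 \<le> norm z4)"
proof -
  have tri: "norm a \<le> norm b + norm c + norm d" if "a + b + c + d = 0" for a b c d :: 'a
  proof -
    have "a + (b + c + d) = 0" using that by (simp only: add.assoc)
    then have "a = - (b + c + d)" by (simp only: eq_neg_iff_add_eq_0)
    then have "norm a = norm (b + c + d)" by (simp only: norm_minus_cancel)
    also have "\<dots> \<le> norm (b + c) + norm d" by (rule norm_triangle_ineq)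
    also have "\<dots> \<le> norm b + norm c + norm d" using norm_triangle_ineq[of b c] by simp
    finally show ?thesis .
  qed
  have 1: "norm z1 \<le> norm z2 + norm z3 + norm z4" using sum by (rule tri)
  have 2: "norm z2 \<le> norm z1 + norm z3 + norm z4" by (rule tri) (use sum in \<open>simp add: add_ac\<close>)
  have 3: "norm z3 \<le> norm z1 + norm z2 + norm z4" by (rule tri) (use sum in \<open>simp add: add_ac\<close>)
  have 4: "norm z4 \<le> norm z1 + norm z2 + norm z3" by (rule tri) (use sum in \<open>simp add: add_ac\<close>)
  have le: "norm z1 \<le> R" "norm z2 \<le> R" "norm z3 \<le> R" "norm z4 \<le> R" by (auto simp: R)
  have "R = norm z1 \<or> R = norm z2 \<or> R = norm z3 \<or> R = norm z4"
    using Max_in[of "{norm z1, norm z2, norm z3, norm z4}"] by (auto simp: R[symmetric])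
  moreover have "0 \<le> R" using le(1) norm_ge_zero[of z1] by linarith
  ultimately show ?thesis using 1 2 3 4 le by (elim disjE; linarith)
qed

text \<open>Take the least power of two that is at least |\<xi>|. The preceding power is below
  |\<xi>|, and K >= 2 absorbs the quotient; for the power 1 \<open>freq_size\<close> asks for no
  lower bound.\<close>

lemma dyadic_size_exists:
  assumes K: "2 \<le> K"
  shows "\<exists>n\<in>dyadic. freq_size K \<xi> n"
proof -
  define k where "k = (LEAST k. norm \<xi> \<le> 2 ^ k)"
  have ex: "\<exists>k. norm \<xi> \<le> 2 ^ k"
  proof -
    obtain n where "norm \<xi> < 2 ^ n" using real_arch_pow[of 2 "norm \<xi>"] by auto
    then show ?thesis by (intro exI[of _ n]) simp
  qed
  have le: "norm \<xi> \<le> 2 ^ k" unfolding k_def using ex by (rule LeastI_ex)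
  have K1: "(2 ^ k :: real) \<le> K * 2 ^ k" using K by simp
  have "freq_size K \<xi> (2 ^ k)"
    unfolding freq_size_def
  proof (intro conjI impI)
    show "norm \<xi> \<le> K * 2 ^ k" using le K1 by linarith
    assume "(2 ^ k :: real) \<noteq> 1"
    then obtain j where j: "k = Suc j" by (cases k) auto
    then have "\<not> norm \<xi> \<le> 2 ^ j" using not_less_Least[of j "\<lambda>k. norm \<xi> \<le> 2 ^ k"] by (simp add: k_def)
    moreover have "2 ^ k / K \<le> (2 :: real) ^ j" using K j by (simp add: field_simps)
    ultimately show "2 ^ k / K \<le> norm \<xi>" by linarith
  qed
  then show ?thesis by (auto simp: dyadic_def)
qed

text \<open>The resonance function factorises on the hyperplane, through the two vectors whose angle
  enters \<open>S_set\<close>.\<close>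

lemma parallelogram_identity:
  fixes z1 z2 z3 z4 :: "real \<times> real"
  assumes "z1 + z2 + z3 + z4 = 0"
  shows "(norm z1)\<^sup>2 - (norm z2)\<^sup>2 + (norm z3)\<^sup>2 - (norm z4)\<^sup>2 = 2 * ((z1 + z2) \<bullet> (z1 + z4))"
proof -
  have "z3 - (- z1 - z2 - z4) = z1 + z2 + z3 + z4" by (simp add: algebra_simps)
  then have "z3 = - z1 - z2 - z4" using assms by simp
  then show ?thesis
    unfolding power2_norm_eq_inner by (simp add: inner_add_left inner_add_right inner_diff_left inner_diff_right inner_commute)
qed

text \<open>Multiplies out the division in \<open>cos_angle\<close>; if a vector vanishes, the left
  side is 0.\<close>

lemma cos_angle_lower:
  assumes "1 / n \<le> \<bar>cos_angle a b\<bar>" "0 < n"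
  shows "norm a * norm b \<le> n * \<bar>a \<bullet> b\<bar>"
proof (cases "norm a * norm b = 0")
  case False
  then have p: "0 < norm a * norm b" by simp
  have "1 / n \<le> \<bar>a \<bullet> b\<bar> / (norm a * norm b)"
    using assms(1) by (simp add: cos_angle_def abs_mult)
  then show ?thesis using p assms(2) by (simp add: field_simps)
next
  case True
  then show ?thesis using assms(2) by (simp only:) simp
qed

section \<open>Bounds for the difference of the quartic symbols\<close>

context profile
begin

abbreviation mN :: "real \<Rightarrow> real \<times> real \<Rightarrow> real" where "mN N \<equiv> I_symbol m1 N"

lemma mN_pos: "0 < mN N \<xi>" by (simp add: I_symbol_def m1_pos)

lemma mN_le_1: "mN N \<xi> \<le> 1" by (simp add: I_symbol_def m1_le_1)

lemma mN_minus: "mN N (- \<xi>) = mN N \<xi>"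
  unfolding I_symbol_def by (rule m1_cong) simp

lemma mN_borel [measurable]: "mN N \<in> borel_measurable borel"
  unfolding I_symbol_def[abs_def] by measurable

lemma M_le_mN: "0 < N \<Longrightarrow> norm \<xi> \<le> R \<Longrightarrow> M (R / N) \<le> 2 * mN N \<xi>"
  using M_le_m1[of "\<xi> /\<^sub>R N"] M_antimono[of "norm \<xi> / N" "R / N"]
  by (simp add: I_symbol_def divide_right_mono divide_inverse mult.commute)

lemma mN_le_M: "0 < N \<Longrightarrow> R / 3 \<le> norm \<xi> \<Longrightarrow> mN N \<xi> \<le> 6 * M (R / N)"
proof -
  assume N: "0 < N" and R: "R / 3 \<le> norm \<xi>"
  have "mN N \<xi> \<le> 2 * M (norm \<xi> / N)" using m1_le_M[of "\<xi> /\<^sub>R N"] N by (simp add: I_symbol_def divide_inverse mult.commute)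
  also have "\<dots> \<le> 2 * M ((R / N) / 3)" using M_antimono[of "(R / N) / 3" "norm \<xi> / N"] R N by (simp add: field_simps)
  also have "\<dots> \<le> 2 * (3 * M (R / N))" by (intro mult_left_mono M_divide) auto
  finally show ?thesis by simp
qed

text \<open>If R <= cN, the tuple belongs to \<open>S_set\<close> through its second alternative and
  both symbols are 1. Otherwise \<open>Lambda4\<close> and the product are bounded
  separately.\<close>

lemma Lambda4_diff_bound:
  assumes c: "0 < c" "c < 1" and K: "2 \<le> K"
  obtains C where "0 \<le> C"
    "\<And>lam N z1 z2 z3 z4 R. 1 \<le> N \<Longrightarrow> (z1, z2, z3, z4) \<in> Sigma4 lam \<Longrightarrow> R = Max {norm z1, norm z2, norm z3, norm z4} \<Longrightarrow>
       R \<le> c * N \<Longrightarrow> Lambda4 lam K c N (mN N) (z1, z2, z3, z4) - mN N z1 * mN N z2 * mN N z3 * mN N z4 = 0"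
    "\<And>lam N z1 z2 z3 z4 R. 1 \<le> N \<Longrightarrow> (z1, z2, z3, z4) \<in> Sigma4 lam \<Longrightarrow> R = Max {norm z1, norm z2, norm z3, norm z4} \<Longrightarrow>
       c * N < R \<Longrightarrow> \<bar>Lambda4 lam K c N (mN N) (z1, z2, z3, z4) - mN N z1 * mN N z2 * mN N z3 * mN N z4\<bar> \<le> C * (M (R / N))\<^sup>2 * R"
proof -
  obtain C0 where C0: "0 \<le> C0"
    "\<And>z1 z2 z3 z4 R. z1 + z2 + z3 + z4 = 0 \<Longrightarrow> R = Max {norm z1, norm z2, norm z3, norm z4} \<Longrightarrow>
       \<bar>G z1 - G z2 + G z3 - G z4\<bar> \<le> C0 * (M R)\<^sup>2 * (norm (z1 + z2) * norm (z1 + z4))"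
    by (rule G_numerator_bound) blast
  \<comment> \<open>1/c covers the range cN < R <= N, where \<open>Lambda4\<close> is at most 1 in
    modulus; C0 (K + 1/c) covers the quotient; 36/c covers the product, two of whose factors are at
    most 6 \<open>M (R / N)\<close>.\<close>
  let ?C = "1 / c + C0 * (K + 1 / c) + 36 / c"
  show ?thesis
  proof (rule that[of ?C])
    show "0 \<le> ?C" using c C0 K by simp
    fix lam N :: real and z1 z2 z3 z4 :: "real \<times> real" and R
    assume N: "1 \<le> N" and Sig: "(z1, z2, z3, z4) \<in> Sigma4 lam" and R: "R = Max {norm z1, norm z2, norm z3, norm z4}"
    let ?z = "(z1, z2, z3, z4)"
    have sum: "z1 + z2 + z3 + z4 = 0" using Sig by (simp add: Sigma4_def)
    have le: "norm z1 \<le> R" "norm z2 \<le> R" "norm z3 \<le> R" "norm z4 \<le> R" by (auto simp: R)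
    have N0: "0 < N" using N by simp
    let ?P = "mN N z1 * mN N z2 * mN N z3 * mN N z4"
    {
      assume small: "R \<le> c * N"
      have cN: "c * N \<le> N" using c N by simp
      have leN: "norm z1 \<le> N" "norm z2 \<le> N" "norm z3 \<le> N" "norm z4 \<le> N" using le small cN by linarith+
      have one: "mN N z = 1" if "norm z \<le> N" for z
        unfolding I_symbol_def using that N0 by (intro m1_small) (simp add: field_simps)
      obtain n1 n2 n3 n4 where n: "n1 \<in> dyadic" "freq_size K z1 n1" "n2 \<in> dyadic" "freq_size K z2 n2"
        "n3 \<in> dyadic" "freq_size K z3 n3" "n4 \<in> dyadic" "freq_size K z4 n4"
        using dyadic_size_exists[OF K] by metis
      have "?z \<in> S_dyadic lam K c N n1 n2 n3 n4"
        unfolding S_dyadic_def using Sig n small by (simp add: R)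
      then have "?z \<in> S_set lam K c N" unfolding S_set_def using n by blast
      then show "Lambda4 lam K c N (mN N) ?z - ?P = 0"
        using leN by (simp add: Lambda4_def one)
    }
    {
      assume big: "c * N < R"
      have cR: "1 \<le> R / c"
      proof -
        have "c * 1 \<le> c * N" using N c by (intro mult_left_mono) auto
        then have "c \<le> R" using big by linarith
        then show ?thesis using c by (simp add: field_simps)
      qed
      have R0: "0 < R" using cR c by (cases "0 < R") (auto simp: field_simps)
      let ?M = "M (R / N)"
      have M0: "0 \<le> ?M" using M_pos[of "R / N"] by simp
      have P: "?P \<le> 36 / c * ?M\<^sup>2 * R"
      proof -
        have mm: "mN N a * mN N b * (mN N p * mN N q) \<le> 36 * ?M\<^sup>2" if "R / 3 \<le> norm a" "R / 3 \<le> norm b" for a b p q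
        proof -
          have "mN N a * mN N b * (mN N p * mN N q) \<le> (6 * ?M) * (6 * ?M) * (1 * 1)"
            using mN_le_M[OF N0 that(1)] mN_le_M[OF N0 that(2)] mN_le_1[of N p] mN_le_1[of N q] mN_pos[of N a] mN_pos[of N b] mN_pos[of N p] mN_pos[of N q] M0
            by (intro mult_mono mult_nonneg_nonneg) auto
          then show ?thesis by (simp add: power2_eq_square)
        qed
        have "?P \<le> 36 * ?M\<^sup>2"
          using two_large[OF sum R] mm[of z1 z2 z3 z4] mm[of z1 z3 z2 z4] mm[of z1 z4 z2 z3] mm[of z2 z3 z1 z4] mm[of z2 z4 z1 z3] mm[of z3 z4 z1 z2]
          by (elim disjE) (auto simp: mult_ac)
        also have "\<dots> \<le> 36 * ?M\<^sup>2 * (R / c)" using mult_left_mono[OF cR, of "36 * ?M\<^sup>2"] by simp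
        finally show ?thesis by (simp add: field_simps)
      qed
      have P0: "0 \<le> ?P" using mN_pos by (intro mult_nonneg_nonneg less_imp_le)
      have L: "\<bar>Lambda4 lam K c N (mN N) ?z\<bar> \<le> (1 / c + C0 * (K + 1 / c)) * ?M\<^sup>2 * R"
      proof (cases "norm z1 \<le> N \<and> norm z2 \<le> N \<and> norm z3 \<le> N \<and> norm z4 \<le> N")
        case True
        have "\<bar>Lambda4 lam K c N (mN N) ?z\<bar> \<le> 1" using True by (simp add: Lambda4_def indicator_def)
        also have "1 \<le> 1 / c * ?M\<^sup>2 * R"
        proof -
          have "R \<le> N" using True by (simp add: R)
          then have "?M = 1" using N0 by (simp add: M_def max_def)
          then show ?thesis using cR by simp
        qed
        also have "\<dots> \<le> (1 / c + C0 * (K + 1 / c)) * ?M\<^sup>2 * R"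
          using R0 C0 K c by (intro mult_right_mono) auto
        finally show ?thesis .
      next
        case False
        let ?num = "(mN N z1)\<^sup>2 * (norm z1)\<^sup>2 - (mN N z2)\<^sup>2 * (norm z2)\<^sup>2 + (mN N z3)\<^sup>2 * (norm z3)\<^sup>2 - (mN N z4)\<^sup>2 * (norm z4)\<^sup>2"
        let ?den = "(norm z1)\<^sup>2 - (norm z2)\<^sup>2 + (norm z3)\<^sup>2 - (norm z4)\<^sup>2"
        have Leq: "Lambda4 lam K c N (mN N) ?z = ?num / ?den * indicator (S_set lam K c N) ?z"
          using False unfolding Lambda4_def by (simp only: prod.case if_False)
        show ?thesis
        proof (cases "?z \<in> S_set lam K c N")
          case False
          then show ?thesis using R0 C0 K c by (simp add: Leq)
        next
          case True
          then obtain n1 n2 n3 n4 where n: "n1 \<in> dyadic" "n2 \<in> dyadic" "n3 \<in> dyadic" "n4 \<in> dyadic" "?z \<in> S_dyadic lam K c N n1 n2 n3 n4"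
            unfolding S_set_def by blast
          let ?n = "Max {n1, n2, n3, n4}"
          \<comment> \<open>As R > cN, membership in \<open>S_set\<close> can only come from the
            cosine condition.\<close>
          have fs: "freq_size K z1 n1" "freq_size K z2 n2" "freq_size K z3 n3" "freq_size K z4 n4"
            and cos: "1 / ?n \<le> \<bar>cos_angle (z1 + z2) (z1 + z4)\<bar>"
            using n(5) big unfolding S_dyadic_def R by auto
          have npos: "0 < n1" using n(1) by (auto simp: dyadic_def)
          have n0: "0 < ?n" using npos by (simp add: less_max_iff_disj)
          \<comment> \<open>A dyadic size other than 1 is at most K R. The size 1 says nothing about
            |z| from below and is handled by R >= c.\<close>
          have nb: "nj \<le> (K + 1 / c) * R" if "freq_size K z nj" "norm z \<le> R" for z nj
          proof (cases "nj = 1")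
            case True
            have "1 \<le> 1 / c * R" using cR by simp
            also have "\<dots> \<le> (K + 1 / c) * R" using R0 K by (intro mult_right_mono) auto
            finally show ?thesis using True by simp
          next
            case False
            then have "nj / K \<le> norm z" using that(1) by (simp add: freq_size_def)
            then have "nj \<le> K * R" using that(2) K by (simp add: field_simps) (meson mult_left_mono order_trans zero_le_numeral)
            also have "\<dots> \<le> (K + 1 / c) * R" using R0 c by (intro mult_right_mono) auto
            finally show ?thesis .
          qed
          have nR: "?n \<le> (K + 1 / c) * R" using nb[OF fs(1) le(1)] nb[OF fs(2) le(2)] nb[OF fs(3) le(3)] nb[OF fs(4) le(4)] by simp
          let ?a = "z1 + z2" and ?b = "z1 + z4"
          \<comment> \<open>Scaling to N = 1; the factor N^2 is used up by the two step lengths,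
            each divided by N.\<close>
          have Gs: "(mN N z)\<^sup>2 * (norm z)\<^sup>2 = N\<^sup>2 * G (z /\<^sub>R N)" for z
          proof -
            have "(z /\<^sub>R N) \<bullet> (z /\<^sub>R N) = (norm z)\<^sup>2 / N\<^sup>2"
              unfolding dot_square_norm using N0 by (simp add: power_mult_distrib divide_inverse power_inverse mult.commute)
            then show ?thesis unfolding G_def I_symbol_def using N0 by simp
          qed
          have "?num = N\<^sup>2 * (G (z1 /\<^sub>R N) - G (z2 /\<^sub>R N) + G (z3 /\<^sub>R N) - G (z4 /\<^sub>R N))"
            unfolding Gs by (simp add: algebra_simps)
          also have "\<bar>\<dots>\<bar> \<le> N\<^sup>2 * (C0 * ?M\<^sup>2 * (norm (z1 /\<^sub>R N + z2 /\<^sub>R N) * norm (z1 /\<^sub>R N + z4 /\<^sub>R N)))"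
            unfolding abs_mult abs_power2
          proof (intro mult_left_mono C0(2))
            show "z1 /\<^sub>R N + z2 /\<^sub>R N + z3 /\<^sub>R N + z4 /\<^sub>R N = 0"
              using sum by (simp add: scaleR_add_right[symmetric] del: scaleR_add_right)
            have "mono (\<lambda>x. x / N)" using N0 by (auto simp: mono_def divide_right_mono)
            have nz: "norm (z /\<^sub>R N) = norm z / N" for z :: "real \<times> real"
              using N0 by (simp add: divide_inverse mult.commute)
            have "Max {norm z1, norm z2, norm z3, norm z4} / N = Max ((\<lambda>x. x / N) ` {norm z1, norm z2, norm z3, norm z4})"
              by (rule mono_Max_commute[OF \<open>mono (\<lambda>x. x / N)\<close>]) simp_all
            then show "R / N = Max {norm (z1 /\<^sub>R N), norm (z2 /\<^sub>R N), norm (z3 /\<^sub>R N), norm (z4 /\<^sub>R N)}"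
              unfolding R nz image_insert image_empty .
          qed simp
          also have "\<dots> = C0 * ?M\<^sup>2 * (norm ?a * norm ?b)"
          proof -
            have sc: "norm (x /\<^sub>R N + y /\<^sub>R N) = norm (x + y) / N" for x y :: "real \<times> real"
              unfolding scaleR_add_right[symmetric] norm_scaleR using N0 by (simp add: divide_inverse mult.commute)
            show ?thesis unfolding sc using N0 by (simp add: power2_eq_square)
          qed
          finally have num: "\<bar>?num\<bar> \<le> C0 * ?M\<^sup>2 * (norm ?a * norm ?b)" .
          have ab: "norm ?a * norm ?b \<le> ?n * \<bar>?a \<bullet> ?b\<bar>" by (rule cos_angle_lower[OF cos n0])
          have "\<bar>?num\<bar> \<le> C0 * ?M\<^sup>2 * (?n * \<bar>?a \<bullet> ?b\<bar>)"
            using num mult_left_mono[OF ab, of "C0 * ?M\<^sup>2"] C0(1) by simp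
          also have "\<dots> \<le> C0 * ?M\<^sup>2 * ((K + 1 / c) * R * \<bar>?a \<bullet> ?b\<bar>)"
            using nR C0(1) by (intro mult_left_mono mult_right_mono) auto
          finally have num2: "\<bar>?num\<bar> \<le> (C0 * (K + 1 / c) * ?M\<^sup>2 * R) * \<bar>?a \<bullet> ?b\<bar>" by (simp add: mult_ac)
          have B0: "0 \<le> C0 * (K + 1 / c) * ?M\<^sup>2 * R" using C0(1) K c R0 by simp
          have half_le: "x / 2 \<le> x" if "0 \<le> x" for x :: real using that by simp
          have "\<bar>?num / ?den\<bar> \<le> C0 * (K + 1 / c) * ?M\<^sup>2 * R"
          \<comment> \<open>Division by zero yields 0, so a vanishing denominator is
            harmless.\<close>
          proof (cases "?a \<bullet> ?b = 0")
            case True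
            then show ?thesis unfolding parallelogram_identity[OF sum] using B0 by simp
          next
            case False
            then have p: "0 < \<bar>?a \<bullet> ?b\<bar>" by simp
            have "\<bar>?num / ?den\<bar> = \<bar>?num\<bar> / (2 * \<bar>?a \<bullet> ?b\<bar>)"
              unfolding parallelogram_identity[OF sum] by (simp add: abs_mult)
            also have "\<dots> \<le> ((C0 * (K + 1 / c) * ?M\<^sup>2 * R) * \<bar>?a \<bullet> ?b\<bar>) / (2 * \<bar>?a \<bullet> ?b\<bar>)"
              using num2 p by (intro divide_right_mono) auto
            also have "\<dots> = (C0 * (K + 1 / c) * ?M\<^sup>2 * R) / 2" using p by simp
            also have "\<dots> \<le> C0 * (K + 1 / c) * ?M\<^sup>2 * R" by (rule half_le[OF B0])
            finally show ?thesis .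
          qed
          also have "\<dots> \<le> (1 / c + C0 * (K + 1 / c)) * ?M\<^sup>2 * R"
            using R0 c by (intro mult_right_mono) auto
          finally show ?thesis using True by (simp add: Leq)
        qed
      qed
      have "\<bar>Lambda4 lam K c N (mN N) ?z - ?P\<bar> \<le> \<bar>Lambda4 lam K c N (mN N) ?z\<bar> + ?P" using P0 by linarith
      also have "\<dots> \<le> (1 / c + C0 * (K + 1 / c)) * ?M\<^sup>2 * R + 36 / c * ?M\<^sup>2 * R" using L P by linarith
      also have "\<dots> = ?C * ?M\<^sup>2 * R" by (simp add: algebra_simps)
      finally show "\<bar>Lambda4 lam K c N (mN N) ?z - ?P\<bar> \<le> ?C * ?M\<^sup>2 * R" .
    }
  qed
qed

text \<open>With r = R/N the right-hand side is N^(\<epsilon>-2e) M(r)^2 r^(1-2e). For r >= 1 the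
  last two factors are r^(2s-1-2e) >= 1; for c < r < 1 they are r^(1-2e) >= r > c.\<close>

lemma M_square_growth:
  assumes c: "0 < c" "c < 1" and e: "0 < e" "e \<le> s - 1 / 2" "2 * e \<le> \<epsilon>" and N: "1 \<le> N" and R: "c * N < R"
  shows "c \<le> N powr (\<epsilon> - 1) * (M (R / N))\<^sup>2 * R powr (1 - 2 * e)"
proof -
  let ?r = "R / N"
  have r: "c < ?r" using R N by (simp add: field_simps)
  have R0: "0 < R" using R c N by (smt (verit) mult_pos_pos)
  have key: "c \<le> (M ?r)\<^sup>2 * ?r powr (1 - 2 * e)"
  proof (cases "1 \<le> ?r")
    case True
    have "(M ?r)\<^sup>2 * ?r powr (1 - 2 * e) = ?r powr (s - 1) * ?r powr (s - 1) * ?r powr (1 - 2 * e)"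
      using True by (simp add: M_def max_def power2_eq_square)
    also have "\<dots> = ?r powr (2 * s - 1 - 2 * e)" by (simp only: powr_add[symmetric]) (simp add: algebra_simps)
    also have "1 \<le> \<dots>" using True e by (intro ge_one_powr_ge_zero) auto
    finally show ?thesis using c by linarith
  next
    case False
    then have "M ?r = 1" by (simp add: M_def max_def)
    moreover have "?r powr 1 \<le> ?r powr (1 - 2 * e)"
      using False r c e by (intro powr_mono') auto
    moreover have "?r powr 1 = ?r" by (rule powr_one) (use r c in linarith)
    ultimately show ?thesis using r by simp
  qed
  have "N powr (\<epsilon> - 1) * (M ?r)\<^sup>2 * R powr (1 - 2 * e) = N powr (\<epsilon> - 1) * N powr (1 - 2 * e) * ((M ?r)\<^sup>2 * ?r powr (1 - 2 * e))"
    using N R0 by (simp add: powr_divide)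
  also have "N powr (\<epsilon> - 1) * N powr (1 - 2 * e) = N powr (\<epsilon> - 2 * e)" by (simp only: powr_add[symmetric]) simp
  finally have eq: "N powr (\<epsilon> - 1) * (M ?r)\<^sup>2 * R powr (1 - 2 * e) = N powr (\<epsilon> - 2 * e) * ((M ?r)\<^sup>2 * ?r powr (1 - 2 * e))" .
  have "1 * c \<le> N powr (\<epsilon> - 2 * e) * ((M ?r)\<^sup>2 * ?r powr (1 - 2 * e))"
    using key N e c by (intro mult_mono ge_one_powr_ge_zero) auto
  then show ?thesis unfolding eq by simp
qed

text \<open>The large pair gives brackets of product at least R^2/9, the four symbols give M^4/16,
  whence 144, and bracket times weight is bracket^(-e), at least ((1 + 1/c) R)^(-e), for p and q.
  The gap to M^2 R on the left is M^2 R^(1-2e) N^(\<epsilon>-1), bounded below by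
  \<open>M_square_growth\<close>.\<close>

lemma kernel_pair_bound:
  assumes c: "0 < c" "c < 1" and e: "0 < e" "e \<le> s - 1 / 2" "2 * e \<le> \<epsilon>" and N: "1 \<le> N" and R: "c * N < R"
    and a: "R / 3 \<le> norm a" "norm a \<le> R" and b: "R / 3 \<le> norm b" "norm b \<le> R" and p: "norm p \<le> R" and q: "norm q \<le> R"
  shows "(M (R / N))\<^sup>2 * R \<le> (144 * (1 + 1 / c) powr (2 * e) / c) * N powr (\<epsilon> - 1)
    * ((mN N a * bracket a) * (mN N b * bracket b) * (mN N p * bracket p) * (mN N q * bracket q)) * (weight e p * weight e q)"
proof -
  let ?M = "M (R / N)" and ?k = "1 + 1 / c"
  have N0: "0 < N" using N by simp
  have M0: "0 < ?M" by (rule M_pos)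
  have cN: "c * 1 \<le> c * N" using N c by (intro mult_left_mono) auto
  have R0: "0 < R" using R c cN by linarith
  have "c \<le> R" using cN R by linarith
  then have cR: "1 \<le> R / c" using c by (simp add: field_simps)
  have jbR: "bracket z powr (- e) \<ge> (?k * R) powr (- e)" if "norm z \<le> R" for z
  proof -
    have "bracket z \<le> 1 + norm z" by (rule bracket_le)
    also have "\<dots> \<le> R / c + R" using cR that by linarith
    also have "\<dots> = ?k * R" by (simp add: field_simps)
    finally show ?thesis using e bracket_pos[of z] by (intro powr_mono2') auto
  qed
  have kR: "(?k * R) powr (- e) * (?k * R) powr (- e) = ?k powr (- (2 * e)) * R powr (- (2 * e))"
  proof -
    have "(?k * R) powr (- e) * (?k * R) powr (- e) = (?k * R) powr (- (2 * e))" by (simp add: powr_add[symmetric])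
    also have "\<dots> = ?k powr (- (2 * e)) * R powr (- (2 * e))" by (rule powr_mult)
    finally show ?thesis .
  qed
  have pq: "?k powr (- (2 * e)) * R powr (- (2 * e)) \<le> (bracket p * weight e p) * (bracket q * weight e q)"
    unfolding bracket_weight kR[symmetric] by (intro mult_mono jbR p q) auto
  have jj: "R\<^sup>2 / 9 \<le> bracket a * bracket b"
  proof -
    have "(R / 3) * (R / 3) \<le> bracket a * bracket b"
      using a b norm_le_bracket[of a] norm_le_bracket[of b] R0 by (intro mult_mono) auto
    then show ?thesis by (simp add: power2_eq_square)
  qed
  have mm: "?M / 2 \<le> mN N z" if "norm z \<le> R" for z using M_le_mN[OF N0 that] by simp
  have m4: "?M ^ 4 / 16 \<le> mN N a * mN N b * (mN N p * mN N q)"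
  proof -
    have "(?M / 2) * (?M / 2) * ((?M / 2) * (?M / 2)) \<le> mN N a * mN N b * (mN N p * mN N q)"
      using M0 mN_pos by (intro mult_mono mm a b p q mult_nonneg_nonneg less_imp_le) auto
    then show ?thesis by (simp add: power4_eq_xxxx)
  qed
  have Rp: "R * R powr (1 - 2 * e) = R\<^sup>2 * R powr (- (2 * e))"
  proof -
    have "R * R powr (1 - 2 * e) = R * (R powr 1 * R powr (- (2 * e)))" by (simp only: powr_add[symmetric]) simp
    then show ?thesis using R0 by (simp add: power2_eq_square)
  qed
  have "?M\<^sup>2 * R * c \<le> ?M\<^sup>2 * R * (N powr (\<epsilon> - 1) * ?M\<^sup>2 * R powr (1 - 2 * e))"
    using R0 by (intro mult_left_mono M_square_growth[OF c e N R]) auto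
  also have "\<dots> = N powr (\<epsilon> - 1) * ?M ^ 4 * (R * R powr (1 - 2 * e))"
    by (simp add: power2_eq_square power4_eq_xxxx)
  also have "\<dots> = (144 * ?k powr (2 * e)) * N powr (\<epsilon> - 1) * ((?M ^ 4 / 16) * (R\<^sup>2 / 9) * (?k powr (- (2 * e)) * R powr (- (2 * e))))"
  proof -
    have "0 < ?k" using c by (simp add: add_pos_pos)
    then have "?k powr (2 * e) * ?k powr (- (2 * e)) = 1" by (simp add: powr_minus)
    then show ?thesis unfolding Rp by (simp add: field_simps)
  qed
  also have "\<dots> \<le> (144 * ?k powr (2 * e)) * N powr (\<epsilon> - 1) * ((mN N a * mN N b * (mN N p * mN N q)) * (bracket a * bracket b) * ((bracket p * weight e p) * (bracket q * weight e q)))"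
    using M0 by (intro mult_left_mono mult_mono m4 jj pq mult_nonneg_nonneg less_imp_le[OF mN_pos] less_imp_le[OF bracket_pos] weight_nonneg) auto
  finally have "?M\<^sup>2 * R * c \<le> (144 * ?k powr (2 * e)) * N powr (\<epsilon> - 1) * ((mN N a * mN N b * (mN N p * mN N q)) * (bracket a * bracket b) * ((bracket p * weight e p) * (bracket q * weight e q)))" .
  then have "?M\<^sup>2 * R \<le> ((144 * ?k powr (2 * e)) * N powr (\<epsilon> - 1) * ((mN N a * mN N b * (mN N p * mN N q)) * (bracket a * bracket b) * ((bracket p * weight e p) * (bracket q * weight e q)))) / c"
    using c by (simp add: pos_le_divide_eq)
  then show ?thesis by (simp add: mult_ac)
qed

lemma kernel_bound:
  assumes c: "0 < c" "c < 1" and K: "2 \<le> K" and e: "0 < e" "e \<le> s - 1 / 2" "2 * e \<le> \<epsilon>"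
  obtains C where "0 \<le> C"
    "\<And>lam N z1 z2 z3 z4. 1 \<le> N \<Longrightarrow> (z1, z2, z3, z4) \<in> Sigma4 lam \<Longrightarrow>
       \<bar>Lambda4 lam K c N (mN N) (z1, z2, z3, z4) - mN N z1 * mN N z2 * mN N z3 * mN N z4\<bar>
       \<le> C * N powr (\<epsilon> - 1) * ((mN N z1 * bracket z1) * (mN N z2 * bracket z2) * (mN N z3 * bracket z3) * (mN N z4 * bracket z4)) * pair_weights e z1 z2 z3 z4"
proof -
  obtain C0 where C0: "0 \<le> C0"
    "\<And>lam N z1 z2 z3 z4 R. 1 \<le> N \<Longrightarrow> (z1, z2, z3, z4) \<in> Sigma4 lam \<Longrightarrow> R = Max {norm z1, norm z2, norm z3, norm z4} \<Longrightarrow>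
       R \<le> c * N \<Longrightarrow> Lambda4 lam K c N (mN N) (z1, z2, z3, z4) - mN N z1 * mN N z2 * mN N z3 * mN N z4 = 0"
    "\<And>lam N z1 z2 z3 z4 R. 1 \<le> N \<Longrightarrow> (z1, z2, z3, z4) \<in> Sigma4 lam \<Longrightarrow> R = Max {norm z1, norm z2, norm z3, norm z4} \<Longrightarrow>
       c * N < R \<Longrightarrow> \<bar>Lambda4 lam K c N (mN N) (z1, z2, z3, z4) - mN N z1 * mN N z2 * mN N z3 * mN N z4\<bar> \<le> C0 * (M (R / N))\<^sup>2 * R"
    by (rule Lambda4_diff_bound[OF c K]) blast
  let ?D = "144 * (1 + 1 / c) powr (2 * e) / c"
  have D0: "0 \<le> ?D" using c by simp
  show ?thesis
  proof (rule that[of "C0 * ?D"])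
    show "0 \<le> C0 * ?D" by (rule mult_nonneg_nonneg[OF C0(1) D0])
    fix lam N :: real and z1 z2 z3 z4 :: "real \<times> real"
    assume N: "1 \<le> N" and Sig: "(z1, z2, z3, z4) \<in> Sigma4 lam"
    define R where R: "R = Max {norm z1, norm z2, norm z3, norm z4}"
    have sum: "z1 + z2 + z3 + z4 = 0" using Sig by (simp add: Sigma4_def)
    have le: "norm z1 \<le> R" "norm z2 \<le> R" "norm z3 \<le> R" "norm z4 \<le> R" by (auto simp: R)
    let ?J = "(mN N z1 * bracket z1) * (mN N z2 * bracket z2) * (mN N z3 * bracket z3) * (mN N z4 * bracket z4)"
    let ?L = "Lambda4 lam K c N (mN N) (z1, z2, z3, z4) - mN N z1 * mN N z2 * mN N z3 * mN N z4"
    have J0: "0 \<le> ?J" by (intro mult_nonneg_nonneg less_imp_le[OF mN_pos] less_imp_le[OF bracket_pos])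
    have ww: "0 \<le> weight e x * weight e y" for x y by (intro mult_nonneg_nonneg weight_nonneg)
    show "\<bar>?L\<bar> \<le> C0 * ?D * N powr (\<epsilon> - 1) * ?J * pair_weights e z1 z2 z3 z4"
    proof (cases "R \<le> c * N")
      case True
      have "?L = 0" by (rule C0(2)[OF N Sig R True])
      have "0 \<le> pair_weights e z1 z2 z3 z4" unfolding pair_weights_def by (intro add_nonneg_nonneg ww)
      from mult_nonneg_nonneg[OF mult_nonneg_nonneg[OF mult_nonneg_nonneg[OF mult_nonneg_nonneg[OF C0(1) D0] powr_ge_zero] J0] this]
      show ?thesis unfolding \<open>?L = 0\<close> abs_zero .
    next
      case False
      then have big: "c * N < R" by simp
      have pair: "(M (R / N))\<^sup>2 * R \<le> ?D * N powr (\<epsilon> - 1) * ?J * pair_weights e z1 z2 z3 z4"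
        if "(M (R / N))\<^sup>2 * R \<le> ?D * N powr (\<epsilon> - 1) * ?J * (weight e x * weight e y)" "weight e x * weight e y \<le> pair_weights e z1 z2 z3 z4" for x y
        by (rule order_trans[OF that(1) mult_left_mono[OF that(2)]])
           (rule mult_nonneg_nonneg[OF mult_nonneg_nonneg[OF D0 powr_ge_zero] J0])
      note kp = kernel_pair_bound[OF c e N big]
      have pw: "weight e z1 * weight e z2 \<le> pair_weights e z1 z2 z3 z4" "weight e z1 * weight e z3 \<le> pair_weights e z1 z2 z3 z4"
        "weight e z1 * weight e z4 \<le> pair_weights e z1 z2 z3 z4" "weight e z2 * weight e z3 \<le> pair_weights e z1 z2 z3 z4"
        "weight e z2 * weight e z4 \<le> pair_weights e z1 z2 z3 z4" "weight e z3 * weight e z4 \<le> pair_weights e z1 z2 z3 z4"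
        unfolding pair_weights_def using ww[of z1 z2] ww[of z1 z3] ww[of z1 z4] ww[of z2 z3] ww[of z2 z4] ww[of z3 z4] by linarith+
      have "(M (R / N))\<^sup>2 * R \<le> ?D * N powr (\<epsilon> - 1) * ?J * pair_weights e z1 z2 z3 z4"
        using two_large[OF sum R]
      proof (elim disjE conjE)
        assume "R / 3 \<le> norm z1" "R / 3 \<le> norm z2"
        from kp[OF this(1) le(1) this(2) le(2) le(3) le(4)] show ?thesis by (intro pair[OF _ pw(6)]) (simp add: mult_ac)
      next
        assume "R / 3 \<le> norm z1" "R / 3 \<le> norm z3"
        from kp[OF this(1) le(1) this(2) le(3) le(2) le(4)] show ?thesis by (intro pair[OF _ pw(5)]) (simp add: mult_ac)
      next
        assume "R / 3 \<le> norm z1" "R / 3 \<le> norm z4"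
        from kp[OF this(1) le(1) this(2) le(4) le(2) le(3)] show ?thesis by (intro pair[OF _ pw(4)]) (simp add: mult_ac)
      next
        assume "R / 3 \<le> norm z2" "R / 3 \<le> norm z3"
        from kp[OF this(1) le(2) this(2) le(3) le(1) le(4)] show ?thesis by (intro pair[OF _ pw(3)]) (simp add: mult_ac)
      next
        assume "R / 3 \<le> norm z2" "R / 3 \<le> norm z4"
        from kp[OF this(1) le(2) this(2) le(4) le(1) le(3)] show ?thesis by (intro pair[OF _ pw(2)]) (simp add: mult_ac)
      next
        assume "R / 3 \<le> norm z3" "R / 3 \<le> norm z4"
        from kp[OF this(1) le(3) this(2) le(4) le(1) le(2)] show ?thesis by (intro pair[OF _ pw(1)]) (simp add: mult_ac)
      qed
      from mult_left_mono[OF this C0(1)] C0(3)[OF N Sig R big] show ?thesis by (simp add: mult_ac)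
    qed
  qed
qed

end

section \<open>Comparison of the energies\<close>

lemma Sigma4_borel [measurable]: "Sigma4 lam \<in> sets borel"
proof -
  have "Sigma4 lam = {x. fst x \<in> frequencies lam \<and> fst (snd x) \<in> frequencies lam \<and> fst (snd (snd x)) \<in> frequencies lam
      \<and> snd (snd (snd x)) \<in> frequencies lam \<and> fst x + fst (snd x) + fst (snd (snd x)) + snd (snd (snd x)) = 0}"
    by (auto simp: Sigma4_def)
  also have "\<dots> \<in> sets borel" by measurable
  finally show ?thesis .
qed

lemma S_set_borel [measurable]: "S_set lam K c N \<in> sets borel"
proof -
  have "S_dyadic lam K c N n1 n2 n3 n4 \<in> sets borel" for n1 n2 n3 n4
  proof -
    have mx: "Max {a, b, c, d} \<le> r \<longleftrightarrow> a \<le> r \<and> b \<le> r \<and> c \<le> r \<and> d \<le> r" for a b c d r :: real by simp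
    have "S_dyadic lam K c N n1 n2 n3 n4 = {x. x \<in> Sigma4 lam \<and>
        (norm (fst x) \<le> K * n1 \<and> (n1 \<noteq> 1 \<longrightarrow> n1 / K \<le> norm (fst x))) \<and>
        (norm (fst (snd x)) \<le> K * n2 \<and> (n2 \<noteq> 1 \<longrightarrow> n2 / K \<le> norm (fst (snd x)))) \<and>
        (norm (fst (snd (snd x))) \<le> K * n3 \<and> (n3 \<noteq> 1 \<longrightarrow> n3 / K \<le> norm (fst (snd (snd x))))) \<and>
        (norm (snd (snd (snd x))) \<le> K * n4 \<and> (n4 \<noteq> 1 \<longrightarrow> n4 / K \<le> norm (snd (snd (snd x))))) \<and>
        (1 / Max {n1, n2, n3, n4} \<le> \<bar>((fst x + fst (snd x)) \<bullet> (fst x + snd (snd (snd x)))) / (norm (fst x + fst (snd x)) * norm (fst x + snd (snd (snd x))))\<bar> \<or>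
         norm (fst x) \<le> c * N \<and> norm (fst (snd x)) \<le> c * N \<and> norm (fst (snd (snd x))) \<le> c * N \<and> norm (snd (snd (snd x))) \<le> c * N)}"
      unfolding S_dyadic_def freq_size_def cos_angle_def mx by (simp add: set_eq_iff split_beta')
    also have "\<dots> \<in> sets borel" by measurable
    finally show ?thesis .
  qed
  then show ?thesis unfolding S_set_def
    by (intro sets.countable_UN'' countable_image countableI_type) (auto simp: dyadic_def)
qed

lemma Lambda4_measurable:
  assumes [measurable]: "m \<in> borel_measurable borel"
  shows "Lambda4 lam K c N m \<in> borel_measurable borel"
proof -
  have eq: "Lambda4 lam K c N m = (\<lambda>x.
     (if norm (fst x) \<le> N \<and> norm (fst (snd x)) \<le> N \<and> norm (fst (snd (snd x))) \<le> N \<and> norm (snd (snd (snd x))) \<le> N then 1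
      else ((m (fst x))\<^sup>2 * (norm (fst x))\<^sup>2 - (m (fst (snd x)))\<^sup>2 * (norm (fst (snd x)))\<^sup>2
              + (m (fst (snd (snd x))))\<^sup>2 * (norm (fst (snd (snd x))))\<^sup>2 - (m (snd (snd (snd x))))\<^sup>2 * (norm (snd (snd (snd x))))\<^sup>2)
           / ((norm (fst x))\<^sup>2 - (norm (fst (snd x)))\<^sup>2 + (norm (fst (snd (snd x))))\<^sup>2 - (norm (snd (snd (snd x))))\<^sup>2))
     * indicator (S_set lam K c N) x)"
    by (simp add: Lambda4_def fun_eq_iff)
  show ?thesis unfolding eq by measurable
qed

text \<open>Dominates the quadrilinear form of an \<open>H\<^sup>1\<close> function, without kernel, by its weighted form.\<close>

lemma one_le_weights:
  fixes e :: real
  assumes e: "0 < e" "e \<le> 1"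
  shows "1 \<le> bracket z1 * bracket z2 * bracket z3 * bracket z4 * pair_weights e z1 z2 z3 z4"
proof -
  have key: "1 \<le> p powr (- e) * q" if "1 \<le> p" "p \<le> q" for p q :: real
  proof -
    have "p powr e \<le> q powr e" using that e by (intro powr_mono2) auto
    also have "\<dots> \<le> q powr 1" using that e by (intro powr_mono) auto
    finally have "p powr e \<le> q" using that by simp
    then have "p powr (- e) * p powr e \<le> p powr (- e) * q" by (intro mult_left_mono) auto
    moreover have "p powr (- e) * p powr e = 1" using that by (simp add: powr_add[symmetric])
    ultimately show ?thesis by simp
  qed
  have ww: "0 \<le> weight e x * weight e y" for x y by (intro mult_nonneg_nonneg weight_nonneg)
  have j: "0 \<le> bracket x" for x using bracket_pos[of x] by simp
  have ge: "1 \<le> bracket x * bracket y" for x y using mult_mono[OF bracket_ge_1 bracket_ge_1, of x y] j by simp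
  have pw: "weight e z1 * weight e z2 + weight e z3 * weight e z4 \<le> pair_weights e z1 z2 z3 z4"
    unfolding pair_weights_def using ww[of z1 z3] ww[of z1 z4] ww[of z2 z3] ww[of z2 z4] by linarith
  have jw: "(bracket x * bracket y) * (weight e x * weight e y) = (bracket x * bracket y) powr (- e)" for x y
  proof -
    have "(bracket x * bracket y) * (weight e x * weight e y) = (bracket x * weight e x) * (bracket y * weight e y)" by (simp add: mult_ac)
    then show ?thesis by (simp add: bracket_weight powr_mult)
  qed
  have "1 \<le> (bracket z1 * bracket z2) powr (- e) * (bracket z3 * bracket z4) + (bracket z3 * bracket z4) powr (- e) * (bracket z1 * bracket z2)"
  proof (cases "bracket z1 * bracket z2 \<le> bracket z3 * bracket z4")
    case True
    have "0 \<le> (bracket z3 * bracket z4) powr (- e) * (bracket z1 * bracket z2)" using j by simp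
    then show ?thesis using key[OF ge True] by linarith
  next
    case False
    then have "bracket z3 * bracket z4 \<le> bracket z1 * bracket z2" by simp
    moreover have "0 \<le> (bracket z1 * bracket z2) powr (- e) * (bracket z3 * bracket z4)" using j by simp
    ultimately show ?thesis using key[OF ge, of z3 z4 "bracket z1 * bracket z2"] by linarith
  qed
  also have "\<dots> = bracket z1 * bracket z2 * bracket z3 * bracket z4 * (weight e z1 * weight e z2 + weight e z3 * weight e z4)"
    unfolding jw[symmetric] by (simp add: algebra_simps)
  also have "\<dots> \<le> bracket z1 * bracket z2 * bracket z3 * bracket z4 * pair_weights e z1 z2 z3 z4"
    using j by (intro mult_left_mono pw) auto
  finally show ?thesis .
qed

section \<open>Weighted quadrilinear forms on the hyperplane\<close>

context cylinder
begin

lemma AE_Sigma4_support: "AE x in Sigma4_measure lam. x \<in> Sigma4 lam"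
proof -
  have "AE x in Sigma4_measure lam. fst x + fst (snd x) + fst (snd (snd x)) + snd (snd (snd x)) = 0"
    unfolding Sigma4_measure_eq
    by (subst AE_distr_iff[OF param4_measurable]) (measurable, simp add: param4_def split_beta')
  with AE_Sigma4[OF AE_dxi_frequencies] show ?thesis
    by eventually_elim (auto simp: Sigma4_def)
qed

text \<open>By Cauchy-Schwarz a weight turns an L^2 factor into an integrable one, as
  \<open>form4_bound\<close> requires in its first two slots.\<close>

lemma form4_weighted:
  assumes [measurable]: "q1 \<in> borel_measurable borel" "q2 \<in> borel_measurable borel" "q3 \<in> borel_measurable borel" "q4 \<in> borel_measurable borel" "w \<in> borel_measurable borel"
    and q: "(\<integral>\<^sup>+\<xi>. (q1 \<xi>)\<^sup>2 \<partial>dxi') \<le> ennreal (h\<^sup>2)" "(\<integral>\<^sup>+\<xi>. (q2 \<xi>)\<^sup>2 \<partial>dxi') \<le> ennreal (h\<^sup>2)"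
      "(\<integral>\<^sup>+\<xi>. (q3 \<xi>)\<^sup>2 \<partial>dxi') \<le> ennreal (h\<^sup>2)" "(\<integral>\<^sup>+\<xi>. (q4 \<xi>)\<^sup>2 \<partial>dxi') \<le> ennreal (h\<^sup>2)"
    and w: "(\<integral>\<^sup>+\<xi>. (w \<xi>)\<^sup>2 \<partial>dxi') \<le> ennreal (W\<^sup>2)" and h: "0 \<le> h" and W: "0 \<le> W"
  shows "form4 (\<lambda>\<xi>. q1 \<xi> * w \<xi>) (\<lambda>\<xi>. q2 \<xi> * w \<xi>) q3 q4 \<le> ennreal (W\<^sup>2 * h ^ 4)"
proof -
  have L1: "(\<integral>\<^sup>+\<xi>. q \<xi> * w \<xi> \<partial>dxi') \<le> ennreal (h * W)"
    if [measurable]: "q \<in> borel_measurable borel" and q: "(\<integral>\<^sup>+\<xi>. (q \<xi>)\<^sup>2 \<partial>dxi') \<le> ennreal (h\<^sup>2)" for q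
  proof (rule ennreal_power2_le_imp)
    have "(\<integral>\<^sup>+\<xi>. q \<xi> * w \<xi> \<partial>dxi')\<^sup>2 \<le> (\<integral>\<^sup>+\<xi>. (q \<xi>)\<^sup>2 \<partial>dxi') * (\<integral>\<^sup>+\<xi>. (w \<xi>)\<^sup>2 \<partial>dxi')"
      by (rule Cauchy_Schwarz_nn_integral) measurable
    also have "\<dots> \<le> ennreal (h\<^sup>2) * ennreal (W\<^sup>2)" by (intro mult_mono q w) auto
    also have "\<dots> = (ennreal (h * W))\<^sup>2"
      using h W by (simp add: ennreal_power ennreal_mult[symmetric] power_mult_distrib)
    finally show "(\<integral>\<^sup>+\<xi>. q \<xi> * w \<xi> \<partial>dxi')\<^sup>2 \<le> (ennreal (h * W))\<^sup>2" .
  qed (use h W in simp)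
  have "form4 (\<lambda>\<xi>. q1 \<xi> * w \<xi>) (\<lambda>\<xi>. q2 \<xi> * w \<xi>) q3 q4 \<le> ennreal (h * W) * ennreal (h * W) * ennreal (h * h)"
    by (rule form4_bound) (use q h in \<open>auto intro: L1\<close>)
  also have "\<dots> = ennreal (W\<^sup>2 * h ^ 4)"
    using h W by (simp add: ennreal_mult[symmetric]) (simp add: power2_eq_square power4_eq_xxxx mult_ac)
  finally show ?thesis .
qed

text \<open>For each of the six pairs the permutation symmetries move the two weighted factors into
  the first two slots, whence the factor 6.\<close>

lemma form4_pair_weights:
  assumes [measurable]: "q1 \<in> borel_measurable borel" "q2 \<in> borel_measurable borel" "q3 \<in> borel_measurable borel" "q4 \<in> borel_measurable borel" "w \<in> borel_measurable borel"
    and q: "(\<integral>\<^sup>+\<xi>. (q1 \<xi>)\<^sup>2 \<partial>dxi') \<le> ennreal (h\<^sup>2)" "(\<integral>\<^sup>+\<xi>. (q2 \<xi>)\<^sup>2 \<partial>dxi') \<le> ennreal (h\<^sup>2)"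
      "(\<integral>\<^sup>+\<xi>. (q3 \<xi>)\<^sup>2 \<partial>dxi') \<le> ennreal (h\<^sup>2)" "(\<integral>\<^sup>+\<xi>. (q4 \<xi>)\<^sup>2 \<partial>dxi') \<le> ennreal (h\<^sup>2)"
    and w: "(\<integral>\<^sup>+\<xi>. (w \<xi>)\<^sup>2 \<partial>dxi') \<le> ennreal (W\<^sup>2)" and h: "0 \<le> h" and W: "0 \<le> W"
  shows "(\<integral>\<^sup>+(\<xi>\<^sub>1, \<xi>\<^sub>2, \<xi>\<^sub>3, \<xi>\<^sub>4). q1 \<xi>\<^sub>1 * q2 \<xi>\<^sub>2 * q3 \<xi>\<^sub>3 * q4 \<xi>\<^sub>4 *
      (w \<xi>\<^sub>1 * w \<xi>\<^sub>2 + w \<xi>\<^sub>1 * w \<xi>\<^sub>3 + w \<xi>\<^sub>1 * w \<xi>\<^sub>4 + w \<xi>\<^sub>2 * w \<xi>\<^sub>3 + w \<xi>\<^sub>2 * w \<xi>\<^sub>4 + w \<xi>\<^sub>3 * w \<xi>\<^sub>4) \<partial>Sigma4_measure lam)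
    \<le> ennreal (6 * W\<^sup>2 * h ^ 4)"
proof -
  define p1 p2 p3 p4 where "p1 \<xi> = q1 \<xi> * w \<xi>" "p2 \<xi> = q2 \<xi> * w \<xi>" "p3 \<xi> = q3 \<xi> * w \<xi>" "p4 \<xi> = q4 \<xi> * w \<xi>" for \<xi>
  note p = this
  have [measurable]: "p1 \<in> borel_measurable borel" "p2 \<in> borel_measurable borel" "p3 \<in> borel_measurable borel" "p4 \<in> borel_measurable borel"
    unfolding p[abs_def] by measurable
  let ?B = "ennreal (W\<^sup>2 * h ^ 4)"
  note b = form4_weighted[OF _ _ _ _ _ _ _ _ _ w h W, folded p]
  have b12: "form4 p1 p2 q3 q4 \<le> ?B" unfolding p[abs_def] by (rule b) (use q in auto)
  have b13: "form4 p1 q2 p3 q4 \<le> ?B"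
    unfolding p[abs_def] by (subst form4_swap23) (measurable, rule b, use q in auto)
  have b14: "form4 p1 q2 q3 p4 \<le> ?B"
    unfolding p[abs_def] by (subst form4_swap34, measurable, subst form4_swap23) (measurable, rule b, use q in auto)
  have b23: "form4 q1 p2 p3 q4 \<le> ?B"
    unfolding p[abs_def] by (subst form4_swap12, measurable, subst form4_swap23) (measurable, rule b, use q in auto)
  have b24: "form4 q1 p2 q3 p4 \<le> ?B"
    unfolding p[abs_def] by (subst form4_swap12, measurable, subst form4_swap34, measurable, subst form4_swap23) (measurable, rule b, use q in auto)
  have b34: "form4 q1 q2 p3 p4 \<le> ?B"
    unfolding p[abs_def] by (subst form4_swap23, measurable, subst form4_swap12, measurable, subst form4_swap34, measurable, subst form4_swap23) (measurable, rule b, use q in auto)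
  let ?I = "\<lambda>f1 f2 f3 f4. (\<lambda>(\<xi>\<^sub>1, \<xi>\<^sub>2, \<xi>\<^sub>3, \<xi>\<^sub>4). f1 \<xi>\<^sub>1 * f2 \<xi>\<^sub>2 * f3 \<xi>\<^sub>3 * f4 \<xi>\<^sub>4 :: ennreal)"
  have m: "?I f1 f2 f3 f4 \<in> borel_measurable (Sigma4_measure lam)"
    if "f1 \<in> borel_measurable borel" "f2 \<in> borel_measurable borel" "f3 \<in> borel_measurable borel" "f4 \<in> borel_measurable borel" for f1 f2 f3 f4
    using form4_integrand_measurable[OF that] by simp
  have "(\<integral>\<^sup>+(\<xi>\<^sub>1, \<xi>\<^sub>2, \<xi>\<^sub>3, \<xi>\<^sub>4). q1 \<xi>\<^sub>1 * q2 \<xi>\<^sub>2 * q3 \<xi>\<^sub>3 * q4 \<xi>\<^sub>4 *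
      (w \<xi>\<^sub>1 * w \<xi>\<^sub>2 + w \<xi>\<^sub>1 * w \<xi>\<^sub>3 + w \<xi>\<^sub>1 * w \<xi>\<^sub>4 + w \<xi>\<^sub>2 * w \<xi>\<^sub>3 + w \<xi>\<^sub>2 * w \<xi>\<^sub>4 + w \<xi>\<^sub>3 * w \<xi>\<^sub>4) \<partial>Sigma4_measure lam)
    = (\<integral>\<^sup>+x. ?I p1 p2 q3 q4 x + ?I p1 q2 p3 q4 x + ?I p1 q2 q3 p4 x + ?I q1 p2 p3 q4 x + ?I q1 p2 q3 p4 x + ?I q1 q2 p3 p4 x \<partial>Sigma4_measure lam)"
    by (intro nn_integral_cong) (simp add: p split_beta' distrib_left mult_ac)
  also have "\<dots> = form4 p1 p2 q3 q4 + form4 p1 q2 p3 q4 + form4 p1 q2 q3 p4 + form4 q1 p2 p3 q4 + form4 q1 p2 q3 p4 + form4 q1 q2 p3 p4"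
    unfolding form4_def by (simp add: nn_integral_add m)
  also have "\<dots> \<le> ?B + ?B + ?B + ?B + ?B + ?B" by (intro add_mono b12 b13 b14 b23 b24 b34)
  also have "\<dots> = ennreal (6 * W\<^sup>2 * h ^ 4)" using h by (simp add: ennreal_plus[symmetric] del: ennreal_plus)
  finally show ?thesis .
qed

lemma quartic_weight_bound:
  assumes [measurable]: "F \<in> borel_measurable borel" and F0: "\<And>\<xi>. 0 \<le> F \<xi>"
    and F: "(\<integral>\<^sup>+\<xi>. (ennreal (F \<xi>))\<^sup>2 \<partial>dxi') \<le> ennreal (h\<^sup>2)"
    and w: "(\<integral>\<^sup>+\<xi>. (ennreal (weight e \<xi>))\<^sup>2 \<partial>dxi') \<le> ennreal (W\<^sup>2)" and h: "0 \<le> h" and W: "0 \<le> W"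
  shows "(\<integral>\<^sup>+(\<xi>\<^sub>1, \<xi>\<^sub>2, \<xi>\<^sub>3, \<xi>\<^sub>4). ennreal (F \<xi>\<^sub>1 * F (- \<xi>\<^sub>2) * F \<xi>\<^sub>3 * F (- \<xi>\<^sub>4) * pair_weights e \<xi>\<^sub>1 \<xi>\<^sub>2 \<xi>\<^sub>3 \<xi>\<^sub>4) \<partial>Sigma4_measure lam)
    \<le> ennreal (6 * W\<^sup>2 * h ^ 4)"
proof -
  have F': "(\<integral>\<^sup>+\<xi>. (ennreal (F (- \<xi>)))\<^sup>2 \<partial>dxi') \<le> ennreal (h\<^sup>2)"
    using F nn_integral_dxi_reflect[OF _ zero_frequency, of "\<lambda>\<xi>. (ennreal (F \<xi>))\<^sup>2"] by simp
  have eq: "ennreal (F a * F b * F c * F d * pair_weights e \<xi>\<^sub>1 \<xi>\<^sub>2 \<xi>\<^sub>3 \<xi>\<^sub>4) = ennreal (F a) * ennreal (F b) * ennreal (F c) * ennreal (F d) *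
    (ennreal (weight e \<xi>\<^sub>1) * ennreal (weight e \<xi>\<^sub>2) + ennreal (weight e \<xi>\<^sub>1) * ennreal (weight e \<xi>\<^sub>3) + ennreal (weight e \<xi>\<^sub>1) * ennreal (weight e \<xi>\<^sub>4)
     + ennreal (weight e \<xi>\<^sub>2) * ennreal (weight e \<xi>\<^sub>3) + ennreal (weight e \<xi>\<^sub>2) * ennreal (weight e \<xi>\<^sub>4) + ennreal (weight e \<xi>\<^sub>3) * ennreal (weight e \<xi>\<^sub>4))" for a b c d \<xi>\<^sub>1 \<xi>\<^sub>2 \<xi>\<^sub>3 \<xi>\<^sub>4
    unfolding pair_weights_def using F0 weight_nonneg by (simp add: ennreal_mult ennreal_plus)
  show ?thesis unfolding eq
    by (rule form4_pair_weights[OF _ _ _ _ _ F F' F F' w h W]) measurable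
qed

end

section \<open>The energies expressed by the transform of v\<close>

lemma norm_power2_Basis: "(norm \<xi>)\<^sup>2 = (\<Sum>e\<in>Basis. (\<xi> \<bullet> e)\<^sup>2)" for \<xi> :: "'a :: euclidean_space"
  unfolding dot_square_norm[symmetric] by (subst euclidean_inner) (simp add: power2_eq_square)

context cylinder
begin

lemma H1_gradient_integrable:
  assumes "H1 lam v"
  shows "integrable dxi' (\<lambda>\<xi>. (norm \<xi>)\<^sup>2 * (cmod (fourier lam v \<xi>))\<^sup>2)"
proof -
  have "L2z v" using assms L2_imp_L2z by (simp add: H1_def)
  note [measurable] = fourier_measurable[OF this]
  have "integrable dxi' (\<lambda>\<xi>. (1 + (norm \<xi>)\<^sup>2) * (cmod (fourier lam v \<xi>))\<^sup>2)" using assms by (simp add: H1_def)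
  then show ?thesis
    by (rule Bochner_Integration.integrable_bound) (measurable, simp add: abs_mult mult_right_mono)
qed

text \<open>\<open>energy\<close> is one Bochner integral of a sum; integrability of |v|^4 allows it
  to be split. The gradient part is Plancherel for each \<open>sobolev_partial\<close>.\<close>

lemma energy_eq:
  assumes v: "H1 lam v" and q: "integrable dz' (\<lambda>z. (cmod (v z)) ^ 4)"
  shows "energy lam v = 1 / 2 * (\<integral>\<xi>. (norm \<xi>)\<^sup>2 * (cmod (fourier lam v \<xi>))\<^sup>2 \<partial>dxi') + 1 / 4 * (\<integral>z. (cmod (v z)) ^ 4 \<partial>dz')"
proof -
  let ?V = "fourier lam v" and ?D = "\<lambda>e. sobolev_partial lam e v"
  have vz: "L2z v" using v L2_imp_L2z by (simp add: H1_def)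
  note [measurable] = fourier_measurable[OF vz]
  note gi = H1_gradient_integrable[OF v]
  have part: "integrable dz' (\<lambda>z. (cmod (?D e z))\<^sup>2)" "integrable dxi' (\<lambda>\<xi>. (\<xi> \<bullet> e)\<^sup>2 * (cmod (?V \<xi>))\<^sup>2)"
    "(\<integral>z. (cmod (?D e z))\<^sup>2 \<partial>dz') = (\<integral>\<xi>. (\<xi> \<bullet> e)\<^sup>2 * (cmod (?V \<xi>))\<^sup>2 \<partial>dxi')" if e: "e \<in> Basis" for e
  proof -
    let ?a = "\<lambda>\<xi>. \<i> * complex_of_real (\<xi> \<bullet> e)"
    show i: "integrable dxi' (\<lambda>\<xi>. (\<xi> \<bullet> e)\<^sup>2 * (cmod (?V \<xi>))\<^sup>2)"
    proof (rule Bochner_Integration.integrable_bound[OF gi])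
      have "(\<xi> \<bullet> e)\<^sup>2 \<le> (norm \<xi>)\<^sup>2" for \<xi> using Basis_le_norm[OF e, of \<xi>] by (simp add: abs_le_square_iff[symmetric])
      then show "AE \<xi> in dxi'. norm ((\<xi> \<bullet> e)\<^sup>2 * (cmod (?V \<xi>))\<^sup>2) \<le> norm ((norm \<xi>)\<^sup>2 * (cmod (?V \<xi>))\<^sup>2)"
        by (simp add: abs_mult mult_right_mono)
    qed measurable
    have cm: "(cmod (?a \<xi> * ?V \<xi>))\<^sup>2 = (\<xi> \<bullet> e)\<^sup>2 * (cmod (?V \<xi>))\<^sup>2" for \<xi>
      by (simp add: norm_mult power_mult_distrib)
    have sq: "sq_integrable dxi' (\<lambda>\<xi>. ?a \<xi> * ?V \<xi>)"
      unfolding sq_integrable_def cm using i by simp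
    have L2: "L2 lam (?D e)" and AE: "AE \<xi> in dxi'. fourier lam (?D e) \<xi> = ?a \<xi> * ?V \<xi>"
      unfolding sobolev_partial_def by (rule multiplier_L2[OF sq])+
    have Dz: "L2z (?D e)" by (rule L2_imp_L2z[OF L2])
    show "integrable dz' (\<lambda>z. (cmod (?D e z))\<^sup>2)" using L2z_sq[OF Dz] by (simp add: sq_integrable_def)
    have "(\<integral>z. (cmod (?D e z))\<^sup>2 \<partial>dz') = (L2_norm dz' (?D e))\<^sup>2" by (simp add: L2_norm_def)
    also have "\<dots> = (L2_norm dxi' (fourier lam (?D e)))\<^sup>2" by (simp add: L2_norm_fourier[OF Dz])
    also have "\<dots> = (\<integral>\<xi>. (cmod (fourier lam (?D e) \<xi>))\<^sup>2 \<partial>dxi')" by (simp add: L2_norm_def)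
    also have "\<dots> = (\<integral>\<xi>. (\<xi> \<bullet> e)\<^sup>2 * (cmod (?V \<xi>))\<^sup>2 \<partial>dxi')"
    proof (rule integral_cong_AE)
      show "(\<lambda>\<xi>. (cmod (fourier lam (?D e) \<xi>))\<^sup>2) \<in> borel_measurable dxi'"
        using fourier_measurable[OF Dz] by simp
      show "AE \<xi> in dxi'. (cmod (fourier lam (?D e) \<xi>))\<^sup>2 = (\<xi> \<bullet> e)\<^sup>2 * (cmod (?V \<xi>))\<^sup>2"
        using AE by eventually_elim (simp only: cm)
    qed measurable
    finally show "(\<integral>z. (cmod (?D e z))\<^sup>2 \<partial>dz') = (\<integral>\<xi>. (\<xi> \<bullet> e)\<^sup>2 * (cmod (?V \<xi>))\<^sup>2 \<partial>dxi')" .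
  qed
  have "energy lam v = 1 / 2 * (\<Sum>e\<in>Basis. \<integral>z. (cmod (?D e z))\<^sup>2 \<partial>dz') + 1 / 4 * (\<integral>z. (cmod (v z)) ^ 4 \<partial>dz')"
    unfolding energy_def
    by (subst Bochner_Integration.integral_add)
       (use part(1) q in \<open>auto simp: Bochner_Integration.integral_sum\<close>)
  also have "(\<Sum>e\<in>Basis. \<integral>z. (cmod (?D e z))\<^sup>2 \<partial>dz') = (\<Sum>e\<in>Basis. \<integral>\<xi>. (\<xi> \<bullet> e)\<^sup>2 * (cmod (?V \<xi>))\<^sup>2 \<partial>dxi')"
    by (rule sum.cong[OF refl part(3)])
  also have "\<dots> = (\<integral>\<xi>. (\<Sum>e\<in>Basis. (\<xi> \<bullet> e)\<^sup>2 * (cmod (?V \<xi>))\<^sup>2) \<partial>dxi')"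
    by (rule Bochner_Integration.integral_sum[OF part(2), symmetric])
  also have "\<dots> = (\<integral>\<xi>. (norm \<xi>)\<^sup>2 * (cmod (?V \<xi>))\<^sup>2 \<partial>dxi')"
    by (simp only: norm_power2_Basis sum_distrib_right)
  finally show ?thesis .
qed

lemma H1_norm_nn_integral:
  assumes v: "H1 lam v"
  shows "(\<integral>\<^sup>+\<xi>. (ennreal (bracket \<xi> * cmod (fourier lam v \<xi>)))\<^sup>2 \<partial>dxi') = ennreal ((H1_norm lam v)\<^sup>2)"
proof -
  have "(ennreal (bracket \<xi> * cmod (fourier lam v \<xi>)))\<^sup>2 = ennreal ((1 + (norm \<xi>)\<^sup>2) * (cmod (fourier lam v \<xi>))\<^sup>2)" for \<xi>
    using bracket_pos[of \<xi>] by (simp add: ennreal_power power_mult_distrib) (simp add: bracket_def)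
  then show ?thesis
    using v by (simp add: H1_def H1_norm_def nn_integral_eq_integral)
qed

text \<open>The majorant T does double duty: multiplied by B it bounds the error L - X, and through
  \<open>one_le_weights\<close> it bounds the form X itself, without which the quartic part of the
  energy could not be handled.\<close>

lemma modified_energy_diff:
  fixes m :: "real \<times> real \<Rightarrow> real"
  assumes m [measurable]: "m \<in> borel_measurable borel" and m0: "\<And>\<xi>. 0 \<le> m \<xi>" and m1: "\<And>\<xi>. m \<xi> \<le> 1" and m_minus: "\<And>\<xi>. m (- \<xi>) = m \<xi>"
    and e: "0 < e" "e \<le> 1" and B: "0 \<le> B"
    and kernel: "\<And>z1 z2 z3 z4. (z1, z2, z3, z4) \<in> Sigma4 lam \<Longrightarrow>
       \<bar>Lambda4 lam K c N m (z1, z2, z3, z4) - m z1 * m z2 * m z3 * m z4\<bar>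
       \<le> B * ((m z1 * bracket z1) * (m z2 * bracket z2) * (m z3 * bracket z3) * (m z4 * bracket z4)) * pair_weights e z1 z2 z3 z4"
    and w: "(\<integral>\<^sup>+\<xi>. (ennreal (weight e \<xi>))\<^sup>2 \<partial>dxi') \<le> ennreal (W\<^sup>2)" and W: "0 \<le> W"
    and u: "L2 lam u" and v: "H1 lam (I_op lam m u)"
  shows "cmod (modified_energy lam K c N m u - complex_of_real (energy lam (I_op lam m u)))
    \<le> B * (6 * W\<^sup>2) * (H1_norm lam (I_op lam m u)) ^ 4"
proof -
  define v where "v = I_op lam m u"
  define U V ub where "U = fourier lam u" "V = fourier lam v" "ub = fourier lam (\<lambda>z. cnj (u z))"
  note UV = this
  let ?h = "H1_norm lam v"
  have H1: "H1 lam v" using \<open>H1 lam (I_op lam m u)\<close> by (simp add: v_def)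
  have uz: "L2z u" and vz: "L2z v" using u H1 L2_imp_L2z by (auto simp: H1_def)
  have [measurable]: "U \<in> borel_measurable borel" "V \<in> borel_measurable borel" "ub \<in> borel_measurable borel"
    unfolding UV by (rule fourier_measurable uz vz L2z_cnj)+
  have h: "0 \<le> ?h" by (simp add: H1_norm_def)
  have VU: "AE \<xi> in dxi'. V \<xi> = complex_of_real (m \<xi>) * U \<xi>"
  proof -
    have "sq_integrable dxi' (\<lambda>\<xi>. complex_of_real (m \<xi>) * U \<xi>)"
      unfolding sq_integrable_def
    proof
      have "integrable dxi' (\<lambda>\<xi>. (cmod (U \<xi>))\<^sup>2)" using fourier_sq[OF uz] by (simp add: UV sq_integrable_def)
      then show "integrable dxi' (\<lambda>\<xi>. (cmod (complex_of_real (m \<xi>) * U \<xi>))\<^sup>2)"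
        by (rule Bochner_Integration.integrable_bound)
           (measurable, simp add: norm_mult power_mult_distrib m0 m1 mult_left_le_one_le power_le_one)
    qed measurable
    from multiplier_L2(2)[OF this[unfolded UV]] show ?thesis by (simp add: UV v_def I_op_def)
  qed
  have ubU: "AE \<xi> in dxi'. ub \<xi> = cnj (U (- \<xi>))" unfolding UV by (rule fourier_cnj[OF uz])
  note neg = AE_dxi_reflect[OF zero_frequency, unfolded diff_0]
  \<comment> \<open>Collected into one a.e. statement, so that a single use of
    \<open>AE_Sigma4\<close> gives all relations at all four frequencies.\<close>
  let ?E = "\<lambda>\<xi>. V \<xi> = complex_of_real (m \<xi>) * U \<xi> \<and> V (- \<xi>) = complex_of_real (m \<xi>) * U (- \<xi>) \<and> ub \<xi> = cnj (U (- \<xi>))"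
  have E: "AE \<xi> in dxi'. ?E \<xi>"
    using VU neg[OF VU] ubU by eventually_elim (simp add: m_minus)

  define F where "F \<xi> = bracket \<xi> * cmod (V \<xi>)" for \<xi>
  define T :: "freq4 \<Rightarrow> real" where "T = (\<lambda>(\<xi>\<^sub>1, \<xi>\<^sub>2, \<xi>\<^sub>3, \<xi>\<^sub>4). F \<xi>\<^sub>1 * F (- \<xi>\<^sub>2) * F \<xi>\<^sub>3 * F (- \<xi>\<^sub>4) * pair_weights e \<xi>\<^sub>1 \<xi>\<^sub>2 \<xi>\<^sub>3 \<xi>\<^sub>4)"
  define X where "X = quad V V V V"
  define L where "L = (\<lambda>(\<xi>\<^sub>1, \<xi>\<^sub>2, \<xi>\<^sub>3, \<xi>\<^sub>4). complex_of_real (Lambda4 lam K c N m (\<xi>\<^sub>1, \<xi>\<^sub>2, \<xi>\<^sub>3, \<xi>\<^sub>4)) * U \<xi>\<^sub>1 * ub \<xi>\<^sub>2 * U \<xi>\<^sub>3 * ub \<xi>\<^sub>4)"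
  have F_meas [measurable]: "F \<in> borel_measurable borel" unfolding F_def[abs_def] by measurable
  have F0: "0 \<le> F \<xi>" for \<xi> using bracket_pos[of \<xi>] by (simp add: F_def)
  have T_int: "(\<integral>\<^sup>+x. ennreal (T x) \<partial>Sigma4_measure lam) \<le> ennreal (6 * W\<^sup>2 * ?h ^ 4)"
  proof -
    have "(\<integral>\<^sup>+\<xi>. (ennreal (F \<xi>))\<^sup>2 \<partial>dxi') \<le> ennreal (?h\<^sup>2)"
      using H1_norm_nn_integral[OF H1] by (simp add: F_def UV)
    from quartic_weight_bound[OF F_meas F0 this w h W] show ?thesis by (simp add: T_def split_beta')
  qed
  have X_T: "cmod (X x) \<le> T x" for x
  proof -
    obtain z1 z2 z3 z4 where x: "x = (z1, z2, z3, z4)" by (metis prod.exhaust)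
    let ?v = "cmod (V z1) * cmod (V (- z2)) * cmod (V z3) * cmod (V (- z4))"
    have "?v * 1 \<le> ?v * (bracket z1 * bracket z2 * bracket z3 * bracket z4 * pair_weights e z1 z2 z3 z4)"
      by (intro mult_left_mono one_le_weights e) auto
    then show ?thesis by (simp add: x X_def quad_def T_def F_def norm_mult bracket_minus mult_ac)
  qed
  have X_meas: "X \<in> borel_measurable borel" unfolding X_def by (rule quad_measurable) measurable
  \<comment> \<open>This has to precede any use of the energy: by \<open>quartic_identity\<close> it
    makes |v|^4 integrable.\<close>
  have X_int: "integrable (Sigma4_measure lam) X"
    unfolding integrable_Sigma4_iff[OF X_meas]
    by (rule le_less_trans[OF order_trans[OF nn_integral_mono T_int]]) (auto intro: ennreal_leI X_T)
  have quartic: "integrable dz' (\<lambda>z. (cmod (v z)) ^ 4)"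
    "complex_of_real (\<integral>z. (cmod (v z)) ^ 4 \<partial>dz') = complex_of_real (1 / (2 * pi)\<^sup>2) * (\<integral>x. X x \<partial>Sigma4_measure lam)"
    using quartic_identity[OF vz] X_int unfolding X_def UV by auto
  have L_meas: "L \<in> borel_measurable borel"
  proof -
    have [measurable]: "Lambda4 lam K c N m \<in> borel_measurable borel" by (rule Lambda4_measurable[OF m])
    have "L = (\<lambda>x. complex_of_real (Lambda4 lam K c N m x) * U (fst x) * ub (fst (snd x)) * U (fst (snd (snd x))) * ub (snd (snd (snd x))))"
      by (simp add: L_def fun_eq_iff)
    then show ?thesis by simp
  qed
  \<comment> \<open>Almost everywhere the values of U are common factors of L and X; what remains is
    the difference of the symbols, which \<open>kernel\<close> bounds.\<close>
  have LX: "AE x in Sigma4_measure lam. cmod (L x - X x) \<le> B * T x"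
    using AE_Sigma4[OF E] AE_Sigma4_support
  proof eventually_elim
    case (elim x)
    obtain z1 z2 z3 z4 where x: "x = (z1, z2, z3, z4)" by (metis prod.exhaust)
    let ?Y = "U z1 * cnj (U (- z2)) * U z3 * cnj (U (- z4))" and ?P = "m z1 * m z2 * m z3 * m z4"
    have "L x = complex_of_real (Lambda4 lam K c N m (z1, z2, z3, z4)) * ?Y" "X x = complex_of_real ?P * ?Y"
      using elim(1) by (simp_all add: x L_def X_def quad_def mult_ac)
    then have "cmod (L x - X x) = \<bar>Lambda4 lam K c N m (z1, z2, z3, z4) - ?P\<bar> * cmod ?Y"
      by (simp only: left_diff_distrib[symmetric] of_real_diff[symmetric] norm_mult norm_of_real)
    also have "\<dots> \<le> (B * ((m z1 * bracket z1) * (m z2 * bracket z2) * (m z3 * bracket z3) * (m z4 * bracket z4)) * pair_weights e z1 z2 z3 z4) * cmod ?Y"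
      using elim(2) by (intro mult_right_mono kernel) (auto simp: x)
    also have "\<dots> = B * T x"
      using elim(1) m0 by (simp add: x T_def F_def norm_mult bracket_minus mult_ac)
    finally show ?case .
  qed
  have D_nn: "(\<integral>\<^sup>+x. ennreal (cmod (L x - X x)) \<partial>Sigma4_measure lam) \<le> ennreal (B * (6 * W\<^sup>2 * ?h ^ 4))"
  proof -
    have T_meas: "T \<in> borel_measurable borel" unfolding T_def split_beta' pair_weights_def by measurable
    have "(\<integral>\<^sup>+x. ennreal (cmod (L x - X x)) \<partial>Sigma4_measure lam) \<le> (\<integral>\<^sup>+x. ennreal B * ennreal (T x) \<partial>Sigma4_measure lam)"
      using LX by (intro nn_integral_mono_AE) (auto elim!: eventually_mono simp: ennreal_mult'[OF B, symmetric] intro: ennreal_leI)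
    also have "\<dots> = ennreal B * (\<integral>\<^sup>+x. ennreal (T x) \<partial>Sigma4_measure lam)"
      using T_meas by (intro nn_integral_cmult) simp
    also have "\<dots> \<le> ennreal B * ennreal (6 * W\<^sup>2 * ?h ^ 4)" by (intro mult_left_mono T_int) simp
    finally show ?thesis using B by (simp add: ennreal_mult')
  qed
  have D_int: "integrable (Sigma4_measure lam) (\<lambda>x. L x - X x)"
    using L_meas X_meas D_nn by (subst integrable_Sigma4_iff) (auto intro: le_less_trans)
  \<comment> \<open>L is not dominated directly; it is the sum of X and the controlled
    difference.\<close>
  have L_int: "integrable (Sigma4_measure lam) L"
    using Bochner_Integration.integrable_add[OF D_int X_int] by simp
  have "ennreal (cmod (\<integral>x. L x - X x \<partial>Sigma4_measure lam)) \<le> ennreal (B * (6 * W\<^sup>2 * ?h ^ 4))"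
    by (rule order_trans[OF integral_norm_bound_ennreal[OF D_int] D_nn])
  then have D: "cmod ((\<integral>x. L x \<partial>Sigma4_measure lam) - (\<integral>x. X x \<partial>Sigma4_measure lam)) \<le> B * (6 * W\<^sup>2 * ?h ^ 4)"
    using B h by (simp add: Bochner_Integration.integral_diff[OF L_int X_int])

  \<comment> \<open>\<open>Sigma2_measure\<close> puts \<xi>_2 = -\<xi>_1, where \<open>ub\<close>
    becomes the conjugate of U, and the two factors m turn U into V.\<close>
  have quadratic: "(\<integral>(\<xi>\<^sub>1, \<xi>\<^sub>2). complex_of_real (norm \<xi>\<^sub>1 * norm \<xi>\<^sub>2 * m \<xi>\<^sub>1 * m \<xi>\<^sub>2) * U \<xi>\<^sub>1 * ub \<xi>\<^sub>2 \<partial>Sigma2_measure lam)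
    = complex_of_real (\<integral>\<xi>. (norm \<xi>)\<^sup>2 * (cmod (V \<xi>))\<^sup>2 \<partial>dxi')"
  proof -
    have "(\<integral>(\<xi>\<^sub>1, \<xi>\<^sub>2). complex_of_real (norm \<xi>\<^sub>1 * norm \<xi>\<^sub>2 * m \<xi>\<^sub>1 * m \<xi>\<^sub>2) * U \<xi>\<^sub>1 * ub \<xi>\<^sub>2 \<partial>Sigma2_measure lam)
      = (\<integral>\<xi>. complex_of_real (norm \<xi> * norm \<xi> * m \<xi> * m \<xi>) * U \<xi> * ub (- \<xi>) \<partial>dxi')"
      unfolding Sigma2_measure_def split_beta' by (subst integral_distr) (measurable, simp add: m_minus)
    also have "\<dots> = (\<integral>\<xi>. complex_of_real ((norm \<xi>)\<^sup>2 * (cmod (V \<xi>))\<^sup>2) \<partial>dxi')"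
    proof (rule integral_cong_AE)
      show "AE \<xi> in dxi'. complex_of_real (norm \<xi> * norm \<xi> * m \<xi> * m \<xi>) * U \<xi> * ub (- \<xi>) = complex_of_real ((norm \<xi>)\<^sup>2 * (cmod (V \<xi>))\<^sup>2)"
        using E neg[OF E]
      proof eventually_elim
        case (elim \<xi>)
        have "complex_of_real ((cmod (V \<xi>))\<^sup>2) = V \<xi> * cnj (V \<xi>)" by (simp only: complex_norm_square)
        then show ?case using elim by (simp add: power2_eq_square mult_ac)
      qed
    qed measurable
    finally show ?thesis by (simp del: of_real_mult of_real_power)
  qed
  let ?k = "complex_of_real (1 / (4 * (2 * pi)\<^sup>2))"
  have E0: "modified_energy lam K c N m u = 1 / 2 * complex_of_real (\<integral>\<xi>. (norm \<xi>)\<^sup>2 * (cmod (V \<xi>))\<^sup>2 \<partial>dxi') + ?k * (\<integral>x. L x \<partial>Sigma4_measure lam)"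
    unfolding quadratic[symmetric] by (simp only: modified_energy_def Let_def L_def UV)
  have k: "1 / 4 * complex_of_real (1 / (2 * pi)\<^sup>2) = ?k" by simp
  have E1: "complex_of_real (energy lam v) = 1 / 2 * complex_of_real (\<integral>\<xi>. (norm \<xi>)\<^sup>2 * (cmod (V \<xi>))\<^sup>2 \<partial>dxi') + ?k * (\<integral>x. X x \<partial>Sigma4_measure lam)"
  proof -
    have "complex_of_real (energy lam v) = 1 / 2 * complex_of_real (\<integral>\<xi>. (norm \<xi>)\<^sup>2 * (cmod (V \<xi>))\<^sup>2 \<partial>dxi') + 1 / 4 * complex_of_real (\<integral>z. (cmod (v z)) ^ 4 \<partial>dz')"
      unfolding energy_eq[OF H1 quartic(1)] UV by simp
    then show ?thesis unfolding quartic(2) k[symmetric] by (simp only: mult.assoc)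
  qed
  have kk: "cmod ?k = 1 / (4 * (2 * pi)\<^sup>2)" by (simp only: norm_of_real) simp
  have "modified_energy lam K c N m u - complex_of_real (energy lam v) = ?k * ((\<integral>x. L x \<partial>Sigma4_measure lam) - (\<integral>x. X x \<partial>Sigma4_measure lam))"
    unfolding E0 E1 by (simp only: add_diff_cancel_left right_diff_distrib)
  then have "cmod (modified_energy lam K c N m u - complex_of_real (energy lam v)) \<le> (1 / (4 * (2 * pi)\<^sup>2)) * (B * (6 * W\<^sup>2 * ?h ^ 4))"
    by (simp only: norm_mult kk) (rule mult_left_mono[OF D], simp)
  \<comment> \<open>The prefactor of the quartic form is below 1 and is dropped.\<close>
  also have "\<dots> \<le> 1 * (B * (6 * W\<^sup>2 * ?h ^ 4))"
  proof (rule mult_right_mono)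
    have "1 \<le> 2 * pi" using pi_gt3 by linarith
    then have "1 \<le> (2 * pi)\<^sup>2" by (rule one_le_power)
    then show "1 / (4 * (2 * pi)\<^sup>2) \<le> 1" by (simp add: field_simps)
  qed (use B h in simp)
  finally show ?thesis by (simp add: v_def mult_ac)
qed

end

theorem proposition1p3:
  fixes s \<epsilon> c K :: real and m\<^sub>1 :: "real \<times> real \<Rightarrow> real"
  assumes "1 / 2 < s" "s < 1" and "\<epsilon> > 0"
    and "I_profile s m\<^sub>1" and "0 < c" "c < 1" and "2 \<le> K"
  shows "\<exists>C>0. \<forall>lam\<ge>1. \<forall>N\<in>dyadic. \<forall>\<delta>>0.
    \<forall>(u :: real \<Rightarrow> real \<times> real \<Rightarrow> complex) (u\<^sub>0 :: real \<times> real \<Rightarrow> complex).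
      let m = I_symbol m\<^sub>1 N; I = I_op lam m in
        L2 lam u\<^sub>0 \<and> L2_norm (dz lam) u\<^sub>0 \<le> 1 \<and> H1 lam (I u\<^sub>0) \<and> energy lam (I u\<^sub>0) \<le> 1 \<and>
        (\<forall>t\<in>{0..\<delta>}. L2 lam (u t)) \<and>
        solves_schroedinger lam \<delta> u (\<lambda>t. cubic (u t)) \<and>
        (AE z in dz lam. u 0 z = u\<^sub>0 z) \<and>
        continuous_in_H1 lam \<delta> (\<lambda>t. I (u t)) \<and>
        solves_schroedinger lam \<delta> (\<lambda>t. I (u t)) (\<lambda>t. I (cubic (u t))) \<and>
        (AE z in dz lam. I (u 0) z = I u\<^sub>0 z)
        \<longrightarrow> (\<forall>t\<in>{0..\<delta>}.
              cmod (modified_energy lam K c N m (u t) - complex_of_real (energy lam (I (u t))))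
                \<le> C * N powr (- 1 + \<epsilon>) * H1_norm lam (I (u t)) ^ 4)"
proof -
  interpret profile s m\<^sub>1 using assms by unfold_locales
  \<comment> \<open>The largest exponent that \<open>M_square_growth\<close> admits: one bound comes
    from the growth of m(R)^2 R^(1-2e), the other from the loss N^\<epsilon>.\<close>
  define e where "e = min (s - 1 / 2) (\<epsilon> / 2)"
  have e: "0 < e" "e \<le> s - 1 / 2" "2 * e \<le> \<epsilon>" "e \<le> 1" using assms by (auto simp: e_def min_def)
  obtain C where C: "0 \<le> C" "\<And>lam N z1 z2 z3 z4. 1 \<le> N \<Longrightarrow> (z1, z2, z3, z4) \<in> Sigma4 lam \<Longrightarrow>
       \<bar>Lambda4 lam K c N (mN N) (z1, z2, z3, z4) - mN N z1 * mN N z2 * mN N z3 * mN N z4\<bar>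
       \<le> C * N powr (\<epsilon> - 1) * ((mN N z1 * bracket z1) * (mN N z2 * bracket z2) * (mN N z3 * bracket z3) * (mN N z4 * bracket z4)) * pair_weights e z1 z2 z3 z4"
    by (rule kernel_bound[OF assms(5-7) e(1-3)]) blast
  obtain W where W: "0 \<le> W" "\<And>lam. 1 \<le> lam \<Longrightarrow> (\<integral>\<^sup>+\<xi>. (ennreal (weight e \<xi>))\<^sup>2 \<partial>dxi lam) \<le> ennreal (W\<^sup>2)"
    by (rule weight_square_bound[OF e(1)]) blast
  have main: "cmod (modified_energy lam K c N (mN N) u - complex_of_real (energy lam (I_op lam (mN N) u)))
      \<le> (C * (6 * W\<^sup>2) + 1) * N powr (- 1 + \<epsilon>) * H1_norm lam (I_op lam (mN N) u) ^ 4"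
    if lam: "1 \<le> lam" and N: "N \<in> dyadic" and u: "L2 lam u" "H1 lam (I_op lam (mN N) u)" for lam N u
  proof -
    interpret cylinder lam using lam by unfold_locales simp
    have N1: "1 \<le> N" using N by (auto simp: dyadic_def)
    have "cmod (modified_energy lam K c N (mN N) u - complex_of_real (energy lam (I_op lam (mN N) u)))
        \<le> (C * N powr (\<epsilon> - 1)) * (6 * W\<^sup>2) * H1_norm lam (I_op lam (mN N) u) ^ 4"
      by (rule modified_energy_diff[OF mN_borel less_imp_le[OF mN_pos] mN_le_1 mN_minus e(1,4) _ C(2)[OF N1] W(2)[OF lam] W(1) u])
         (simp add: C(1))
    also have "\<dots> = (C * (6 * W\<^sup>2)) * N powr (- 1 + \<epsilon>) * H1_norm lam (I_op lam (mN N) u) ^ 4" by (simp add: mult_ac)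
    \<comment> \<open>The added 1 makes the final constant positive even if C or W is 0.\<close>
    also have "\<dots> \<le> (C * (6 * W\<^sup>2) + 1) * N powr (- 1 + \<epsilon>) * H1_norm lam (I_op lam (mN N) u) ^ 4"
      by (intro mult_right_mono) (auto simp: H1_norm_def)
    finally show ?thesis .
  qed
  have "0 < C * (6 * W\<^sup>2) + 1" using C(1) by (simp add: add_nonneg_pos)
  then show ?thesis unfolding Let_def continuous_in_H1_def
    by (intro exI[of _ "C * (6 * W\<^sup>2) + 1"] conjI allI impI ballI main) auto
qed

end
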